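(* Define $$\mathscr{F}_{\mathrm{deep}} = \{ \mathbf{p} \in \mathcal{E}_{\mathrm{w}} : \mathbf{p} \text{ is a deep degree}\},$$ $$\mathscr{F}_{\mathrm{pseudo}} = \{ \mathbf{p} \in \mathcal{E}_{\mathrm{w}} : \mathbf{p} = \inf \mathcal{C} \text{ for some } \mathcal{C} \subseteq \mathscr{F}_{\mathrm{deep}}\},$$ $$\mathscr{F}_{\mathrm{diff}} = \{ \mathbf{p} \in \mathcal{E}_{\mathrm{w}} : \forall P \in \mathbf{p}\ \forall X \in \mathrm{MLR}\ \bigl( \exists Y \in P\, (Y \leq_{\mathrm{T}} X) \to 0' \leq_{\mathrm{T}} X\bigr)\}.$$ Then $\mathscr{F}_{\mathrm{pseudo}}$ is a principal filter in $\langle\mathcal{E}_{\mathrm{w}},\leq\rangle$, while $\mathscr{F}_{\mathrm{deep}}$ and $\mathscr{F}_{\mathrm{diff}}$ are nonprincipal filters in $\langle\mathcal{E}_{\mathrm{w}},\leq\rangle$. Consequently, $\mathscr{F}_{\mathrm{deep}} \subsetneq \mathscr{F}_{\mathrm{pseudo}} \subsetneq \mathscr{F}_{\mathrm{diff}}$.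
   Context: For $P,Q\subseteq\mathbb{N}^{\mathbb{N}}$, $P\leq_{\mathrm{w}}Q$ means every $Y\in Q$ Turing-computes some $X\in P$; $P\equiv_{\mathrm{w}}Q$ means both reductions hold. The weak degree $\deg_{\mathrm{w}}(P)$ is the $\equiv_{\mathrm{w}}$-class of $P$, and $\leq_{\mathrm{w}}$ induces a partial order $\leq$ on the set $\mathcal{D}_{\mathrm{w}}$ of weak degrees. $\mathcal{D}_{\mathrm{w}}$ is a complete lattice in which the infimum of $\{\deg_{\mathrm{w}}(P):P\in\mathcal{Q}\}$ is $\deg_{\mathrm{w}}(\bigcup\mathcal{Q})$; infima above are taken in $\mathcal{D}_{\mathrm{w}}$. $\mathcal{E}_{\mathrm{w}}=\{\deg_{\mathrm{w}}(P) : P\subseteq\{0,1\}^{\mathbb{N}}\text{ nonempty }\Pi^0_1\}$, a sublattice of $\mathcal{D}_{\mathrm{w}}$. A filter in $\mathcal{E}_{\mathrm{w}}$ is a (nonempty) subset that is upward closed in $\mathcal{E}_{\mathrm{w}}$ and closed under binary infima; it is principal if it has a least element. Depth: a continuous semimeasure on $\{0,1\}^*$ is $\nu\colon\{0,1\}^*\to[0,1]$ with $\nu(\langle\rangle)=1$ and $\nu(\sigma)\geq\nu(\sigma^\frown 0)+\nu(\sigma^\frown 1)$. Fix a universal left r.e. continuous semimeasure $\mathbf{M}$, i.e. $\mathbf{M}$ is left r.e. (uniformly approximable from below) and for each left r.e. continuous semimeasure $\nu$ there is $c\in\mathbb{N}$ with $\nu(\sigma)\leq c\,\mathbf{M}(\sigma)$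 for all $\sigma$. A $\Pi^0_1$ set $P\subseteq\{0,1\}^{\mathbb{N}}$ is deep if there is a computable nondecreasing unbounded $r\colon\mathbb{N}\to\mathbb{N}$ with $\sum_{\sigma\in P\upharpoonright r(n)}\mathbf{M}(\sigma)\leq 2^{-n}$ for all $n$, where $P\upharpoonright m=\{X\upharpoonright m : X\in P\}$. A degree $\mathbf{p}\in\mathcal{E}_{\mathrm{w}}$ is a deep degree if $\mathbf{p}=\deg_{\mathrm{w}}(P)$ for some deep nonempty $\Pi^0_1$ set $P\subseteq\{0,1\}^{\mathbb{N}}$. $\mathrm{MLR}$ is the set of Martin-Löf random sequences in $\{0,1\}^{\mathbb{N}}$; $0'$ is the halting problem; $\leq_{\mathrm{T}}$ is Turing reducibility. *)

theory Defs
  imports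
    "HOL-Probability.Probability"
    "HOL-Algebra.Complete_Lattice"
    "HOL-Library.Nat_Bijection"
    "HOL-Library.Countable"
begin

section \<open>Oracle computation\<close>

text \<open>
  Programs for the unary partial functions on \<open>\<nat>\<close> that are partial recursive in an oracle: the
  closure of zero, successor, the two projections of the Cantor pairing and the oracle under
  pairing, composition, primitive recursion and minimization. Several arguments are passed by
  pairing.
\<close>

datatype prog =
    PZero | PSucc | PFst | PSnd | POracle
  | PPair prog prog | PComp prog prog | PPrec prog prog | PMu prog

primrec run :: "prog \<Rightarrow> (nat \<Rightarrow> nat) \<Rightarrow> nat \<Rightarrow> nat option" where
  "run PZero A = (\<lambda>x. Some 0)"
| "run PSucc A = (\<lambda>x. Some (Suc x))"
| "run PFst A = (\<lambda>x. Some (fst (prod_decode x)))"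
| "run PSnd A = (\<lambda>x. Some (snd (prod_decode x)))"
| "run POracle A = (\<lambda>x. Some (A x))"
| "run (PPair p q) A =
     (\<lambda>x. Option.bind (run p A x) (\<lambda>y. Option.bind (run q A x) (\<lambda>z. Some (prod_encode (y, z)))))"
| "run (PComp p q) A = (\<lambda>x. Option.bind (run q A x) (run p A))"
| "run (PPrec p q) A =
     (\<lambda>x. rec_nat (run p A (fst (prod_decode x)))
        (\<lambda>i r. Option.bind r
           (\<lambda>y. run q A (prod_encode (fst (prod_decode x), prod_encode (i, y)))))
        (snd (prod_decode x)))"
| "run (PMu p) A =
     (\<lambda>x. let zero_at = (\<lambda>n. run p A (prod_encode (x, n)) = Some 0 \<and>
              (\<forall>m<n. \<exists>y. run p A (prod_encode (x, m)) = Some (Suc y)))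
          in if \<exists>n. zero_at n then Some (THE n. zero_at n) else None)"

definition turing_le :: "(nat \<Rightarrow> nat) \<Rightarrow> (nat \<Rightarrow> nat) \<Rightarrow> bool" (infix \<open>\<le>\<^sub>T\<close> 50) where
  "X \<le>\<^sub>T Y \<longleftrightarrow> (\<exists>e. \<forall>n. run e Y n = Some (X n))"

text \<open>Computability without an oracle is computability with the constantly zero oracle.\<close>

abbreviation run0 :: "prog \<Rightarrow> nat \<Rightarrow> nat option" where
  "run0 e \<equiv> run e (\<lambda>_. 0)"

definition computable :: "(nat \<Rightarrow> nat) \<Rightarrow> bool" where
  "computable f \<longleftrightarrow> (\<exists>e. \<forall>n. run0 e n = Some (f n))"

definition ce :: "nat set \<Rightarrow> bool" where
  "ce W \<longleftrightarrow> (\<exists>e. W = {n. run0 e n \<noteq> None})"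

primrec prog_encode :: "prog \<Rightarrow> nat" where
  "prog_encode PZero = 0"
| "prog_encode PSucc = 1"
| "prog_encode PFst = 2"
| "prog_encode PSnd = 3"
| "prog_encode POracle = 4"
| "prog_encode (PPair p q) = 5 + 4 * prod_encode (prog_encode p, prog_encode q)"
| "prog_encode (PComp p q) = 6 + 4 * prod_encode (prog_encode p, prog_encode q)"
| "prog_encode (PPrec p q) = 7 + 4 * prod_encode (prog_encode p, prog_encode q)"
| "prog_encode (PMu p) = 8 + 4 * prog_encode p"

definition seq_of :: "(nat \<Rightarrow> bool) \<Rightarrow> nat \<Rightarrow> nat" where
  "seq_of X n = of_bool (X n)"

definition halting_problem :: "nat \<Rightarrow> bool" where
  "halting_problem n \<longleftrightarrow> (\<exists>e. n = prog_encode e \<and> run0 e n \<noteq> None)"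


section \<open>Weak degrees\<close>

definition weak_le :: "(nat \<Rightarrow> nat) set \<Rightarrow> (nat \<Rightarrow> nat) set \<Rightarrow> bool" (infix \<open>\<le>\<^sub>w\<close> 50) where
  "P \<le>\<^sub>w Q \<longleftrightarrow> (\<forall>Y\<in>Q. \<exists>X\<in>P. X \<le>\<^sub>T Y)"

definition weak_equiv :: "(nat \<Rightarrow> nat) set \<Rightarrow> (nat \<Rightarrow> nat) set \<Rightarrow> bool" (infix \<open>\<equiv>\<^sub>w\<close> 50) where
  "P \<equiv>\<^sub>w Q \<longleftrightarrow> P \<le>\<^sub>w Q \<and> Q \<le>\<^sub>w P"

type_synonym wdeg = "(nat \<Rightarrow> nat) set set"

definition deg\<^sub>w :: "(nat \<Rightarrow> nat) set \<Rightarrow> wdeg" where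
  "deg\<^sub>w P = {Q. P \<equiv>\<^sub>w Q}"

definition wdeg_le :: "wdeg \<Rightarrow> wdeg \<Rightarrow> bool" where
  "wdeg_le p q \<longleftrightarrow> (\<exists>P\<in>p. \<exists>Q\<in>q. P \<le>\<^sub>w Q)"

definition D\<^sub>w :: "wdeg gorder" where
  "D\<^sub>w = \<lparr>carrier = range deg\<^sub>w, eq = (=), le = wdeg_le\<rparr>"


section \<open>Cantor space\<close>

text \<open>Elements of \<open>{0,1}\<^sup>*\<close> are Boolean lists, and \<open>X \<restriction> n\<close> is \<open>restr X n\<close>.\<close>

definition restr :: "(nat \<Rightarrow> bool) \<Rightarrow> nat \<Rightarrow> bool list" where
  "restr X n = map X [0..<n]"

definition str_encode :: "bool list \<Rightarrow> nat" where
  "str_encode \<sigma> = list_encode (map of_bool \<sigma>)"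

definition Pi01 :: "(nat \<Rightarrow> bool) set \<Rightarrow> bool" where
  "Pi01 P \<longleftrightarrow> (\<exists>W. ce W \<and> P = {X. \<forall>n. str_encode (restr X n) \<notin> W})"

definition E\<^sub>w :: "wdeg gorder" where
  "E\<^sub>w = D\<^sub>w\<lparr>carrier := {deg\<^sub>w (seq_of ` P) | P. P \<noteq> {} \<and> Pi01 P}\<rparr>"

text \<open>The fair coin measure on \<open>{0,1}\<^sup>\<nat>\<close>.\<close>

definition coin_measure :: "(nat \<Rightarrow> bool) measure" where
  "coin_measure = (\<Pi>\<^sub>M _\<in>(UNIV :: nat set). measure_pmf (bernoulli_pmf (1/2)))"

definition mltest :: "(nat \<Rightarrow> (nat \<Rightarrow> bool) set) \<Rightarrow> bool" where
  "mltest U \<longleftrightarrow>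
     (\<exists>W. ce W \<and> (\<forall>i. U i = {X. \<exists>n. prod_encode (i, str_encode (restr X n)) \<in> W})) \<and>
     (\<forall>i. measure coin_measure (U i) \<le> (1/2) ^ i)"

definition MLR :: "(nat \<Rightarrow> bool) set" where
  "MLR = {X. \<forall>U. mltest U \<longrightarrow> X \<notin> (\<Inter>i. U i)}"


section \<open>Semimeasures and depth\<close>

definition semimeasure :: "(bool list \<Rightarrow> real) \<Rightarrow> bool" where
  "semimeasure \<nu> \<longleftrightarrow> (\<forall>\<sigma>. 0 \<le> \<nu> \<sigma> \<and> \<nu> \<sigma> \<le> 1) \<and> \<nu> [] = 1 \<and>
     (\<forall>\<sigma>. \<nu> \<sigma> \<ge> \<nu> (\<sigma> @ [False]) + \<nu> (\<sigma> @ [True]))"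

text \<open>
  \<^const>\<open>nat_to_rat_surj\<close> is an effective numbering of the rationals (numerator and denominator
  are decoded from a pair).
\<close>

definition left_re :: "(bool list \<Rightarrow> real) \<Rightarrow> bool" where
  "left_re \<nu> \<longleftrightarrow> (\<exists>f. computable f \<and>
     (\<forall>\<sigma>. let q = (\<lambda>s. real_of_rat (nat_to_rat_surj (f (prod_encode (s, str_encode \<sigma>)))))
          in incseq q \<and> q \<longlonglongrightarrow> \<nu> \<sigma>))"

definition universal_semimeasure :: "(bool list \<Rightarrow> real) \<Rightarrow> bool" where
  "universal_semimeasure M \<longleftrightarrow> semimeasure M \<and> left_re M \<and>
     (\<forall>\<nu>. semimeasure \<nu> \<and> left_re \<nu> \<longrightarrow> (\<exists>c::nat. \<forall>\<sigma>. \<nu> \<sigma> \<le> real c * M \<sigma>))"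

definition deep :: "(bool list \<Rightarrow> real) \<Rightarrow> (nat \<Rightarrow> bool) set \<Rightarrow> bool" where
  "deep M P \<longleftrightarrow> (\<exists>r. computable r \<and> mono r \<and> (\<forall>k. \<exists>n. k \<le> r n) \<and>
     (\<forall>n. (\<Sum>\<sigma>\<in>(\<lambda>X. restr X (r n)) ` P. M \<sigma>) \<le> (1/2) ^ n))"

definition deep_degree :: "(bool list \<Rightarrow> real) \<Rightarrow> wdeg \<Rightarrow> bool" where
  "deep_degree M p \<longleftrightarrow> (\<exists>P. P \<noteq> {} \<and> Pi01 P \<and> deep M P \<and> p = deg\<^sub>w (seq_of ` P))"


section \<open>Filters\<close>

definition order_filter :: "('a, 'b) gorder_scheme \<Rightarrow> 'a set \<Rightarrow> bool" where
  "order_filter L F \<longleftrightarrow> F \<subseteq> carrier L \<and> F \<noteq> {} \<and>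
     (\<forall>x\<in>F. \<forall>y\<in>carrier L. x \<sqsubseteq>\<^bsub>L\<^esub> y \<longrightarrow> y \<in> F) \<and>
     (\<forall>x\<in>F. \<forall>y\<in>F. x \<sqinter>\<^bsub>L\<^esub> y \<in> F)"

definition principal_filter :: "('a, 'b) gorder_scheme \<Rightarrow> 'a set \<Rightarrow> bool" where
  "principal_filter L F \<longleftrightarrow> order_filter L F \<and> (\<exists>l. least L l F)"

definition nonprincipal_filter :: "('a, 'b) gorder_scheme \<Rightarrow> 'a set \<Rightarrow> bool" where
  "nonprincipal_filter L F \<longleftrightarrow> order_filter L F \<and> \<not> (\<exists>l. least L l F)"

definition F_deep :: "(bool list \<Rightarrow> real) \<Rightarrow> wdeg set" where
  "F_deep M = {p \<in> carrier E\<^sub>w. deep_degree M p}"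

definition F_pseudo :: "(bool list \<Rightarrow> real) \<Rightarrow> wdeg set" where
  "F_pseudo M = {p \<in> carrier E\<^sub>w. \<exists>C \<subseteq> F_deep M. p = \<Sqinter>\<^bsub>D\<^sub>w\<^esub> C}"

definition F_diff :: "wdeg set" where
  "F_diff = {p \<in> carrier E\<^sub>w. \<forall>P\<in>p. \<forall>X\<in>MLR.
     (\<exists>Y\<in>P. Y \<le>\<^sub>T seq_of X) \<longrightarrow> seq_of halting_problem \<le>\<^sub>T seq_of X}"


section \<open>Basic properties\<close>

lemma bij_prog_encode: "bij prog_encode"
proof (rule bijI)
  have "prog_encode p = prog_encode q \<Longrightarrow> p = q" for p q
  proof (induction p arbitrary: q)
    case (PPair p1 p2) then show ?case by (cases q) (simp_all, presburger+)
  next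
    case (PComp p1 p2) then show ?case by (cases q) (simp_all, presburger+)
  next
    case (PPrec p1 p2) then show ?case by (cases q) (simp_all, presburger+)
  next
    case (PMu p) then show ?case by (cases q) (simp_all, presburger+)
  qed (case_tac [!] q, simp_all)
  then show "inj prog_encode" by (auto simp: inj_def)
next
  have "\<exists>p. prog_encode p = n" for n
  proof (induction n rule: less_induct)
    case (less n)
    show ?case
    proof (cases "n < 5")
      case True
      then have "n = 0 \<or> n = 1 \<or> n = 2 \<or> n = 3 \<or> n = 4" by linarith
      then show ?thesis
        by (metis prog_encode.simps(1-5))
    next
      case False
      define m where "m = (n - 5) div 4"
      have n: "n = 5 + 4 * m \<or> n = 6 + 4 * m \<or> n = 7 + 4 * m \<or> n = 8 + 4 * m"
        using False unfolding m_def by presburger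
      obtain a b where ab: "m = prod_encode (a, b)"
        by (metis prod_decode_inverse surj_pair)
      have "a \<le> m" "b \<le> m"
        unfolding ab by (rule le_prod_encode_1, rule le_prod_encode_2)
      moreover have "m < n" using n by linarith
      ultimately obtain p q r where "prog_encode p = a" "prog_encode q = b" "prog_encode r = m"
        using less by (metis le_less_trans)
      then have "prog_encode (PPair p q) = 5 + 4 * m" "prog_encode (PComp p q) = 6 + 4 * m"
        "prog_encode (PPrec p q) = 7 + 4 * m" "prog_encode (PMu r) = 8 + 4 * m"
        by (simp_all add: ab)
      with n show ?thesis by metis
    qed
  qed
  then show "surj prog_encode" by (metis surjI)
qed

lemma turing_le_refl: "X \<le>\<^sub>T X"
  unfolding turing_le_def by (rule exI[of _ POracle]) simp

primrec subst_oracle :: "prog \<Rightarrow> prog \<Rightarrow> prog" where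
  "subst_oracle d PZero = PZero"
| "subst_oracle d PSucc = PSucc"
| "subst_oracle d PFst = PFst"
| "subst_oracle d PSnd = PSnd"
| "subst_oracle d POracle = d"
| "subst_oracle d (PPair p q) = PPair (subst_oracle d p) (subst_oracle d q)"
| "subst_oracle d (PComp p q) = PComp (subst_oracle d p) (subst_oracle d q)"
| "subst_oracle d (PPrec p q) = PPrec (subst_oracle d p) (subst_oracle d q)"
| "subst_oracle d (PMu p) = PMu (subst_oracle d p)"

lemma run_subst_oracle:
  assumes "\<forall>n. run d B n = Some (A n)"
  shows "run (subst_oracle d e) B = run e A"
  using assms by (induction e) auto

lemma turing_le_trans: "X \<le>\<^sub>T Y \<Longrightarrow> Y \<le>\<^sub>T Z \<Longrightarrow> X \<le>\<^sub>T Z"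
  unfolding turing_le_def by (metis run_subst_oracle)

lemma weak_le_refl: "P \<le>\<^sub>w P"
  unfolding weak_le_def using turing_le_refl by blast

lemma weak_le_trans: "P \<le>\<^sub>w Q \<Longrightarrow> Q \<le>\<^sub>w R \<Longrightarrow> P \<le>\<^sub>w R"
  unfolding weak_le_def by (meson turing_le_trans)

lemma wdeg_le_deg: "wdeg_le (deg\<^sub>w P) (deg\<^sub>w Q) \<longleftrightarrow> P \<le>\<^sub>w Q"
  unfolding wdeg_le_def deg\<^sub>w_def weak_equiv_def
  using weak_le_refl weak_le_trans by blast

lemma deg_eq_iff: "deg\<^sub>w P = deg\<^sub>w Q \<longleftrightarrow> P \<equiv>\<^sub>w Q"
  unfolding deg\<^sub>w_def weak_equiv_def set_eq_iff mem_Collect_eq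
  using weak_le_refl weak_le_trans by blast

lemma carrier_D: "carrier D\<^sub>w = range deg\<^sub>w"
  and carrier_E: "carrier E\<^sub>w = {deg\<^sub>w (seq_of ` P) | P. P \<noteq> {} \<and> Pi01 P}"
  by (simp_all add: D\<^sub>w_def E\<^sub>w_def)

lemma deg_antisym: "P \<le>\<^sub>w Q \<Longrightarrow> Q \<le>\<^sub>w P \<Longrightarrow> deg\<^sub>w P = deg\<^sub>w Q"
  by (simp add: deg_eq_iff weak_equiv_def)

lemma partial_order_D: "partial_order D\<^sub>w"
proof unfold_locales
qed (auto 0 3 simp: D\<^sub>w_def wdeg_le_deg weak_le_refl
      intro: weak_le_trans deg_antisym[THEN equalityD1, THEN subsetD]
        deg_antisym[THEN equalityD2, THEN subsetD])

lemma partial_order_E: "partial_order E\<^sub>w"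
proof unfold_locales
qed (auto 0 3 simp: D\<^sub>w_def E\<^sub>w_def wdeg_le_deg weak_le_refl
      intro: weak_le_trans deg_antisym[THEN equalityD1, THEN subsetD]
        deg_antisym[THEN equalityD2, THEN subsetD])

lemma greatest_Lower_D:
  "greatest D\<^sub>w (deg\<^sub>w (\<Union>\<Q>)) (Lower D\<^sub>w (deg\<^sub>w ` \<Q>))"
proof -
  have lower: "deg\<^sub>w R \<in> Lower D\<^sub>w (deg\<^sub>w ` \<Q>) \<longleftrightarrow> (\<forall>P\<in>\<Q>. R \<le>\<^sub>w P)" for R
    by (auto simp: Lower_def D\<^sub>w_def wdeg_le_deg)
  have "deg\<^sub>w (\<Union>\<Q>) \<in> Lower D\<^sub>w (deg\<^sub>w ` \<Q>)"
    unfolding lower weak_le_def by (meson UnionI turing_le_refl)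
  moreover have "x \<sqsubseteq>\<^bsub>D\<^sub>w\<^esub> deg\<^sub>w (\<Union>\<Q>)" if x_Lower: "x \<in> Lower D\<^sub>w (deg\<^sub>w ` \<Q>)" for x
  proof -
    obtain R where x: "x = deg\<^sub>w R"
      using x_Lower unfolding Lower_def carrier_D by blast
    have "R \<le>\<^sub>w \<Union>\<Q>"
      using x_Lower unfolding x lower weak_le_def by blast
    then show ?thesis by (simp add: x D\<^sub>w_def wdeg_le_deg)
  qed
  ultimately show ?thesis
    by (auto simp: greatest_def Lower_def)
qed

lemma inf_D: "\<Sqinter>\<^bsub>D\<^sub>w\<^esub> (deg\<^sub>w ` \<Q>) = deg\<^sub>w (\<Union>\<Q>)"
  unfolding Lattice.inf_def
  using greatest_Lower_D partial_order.greatest_unique[OF partial_order_D]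
  by (metis (mono_tags, lifting) someI_ex)

lemma complete_lattice_D: "complete_lattice D\<^sub>w"
proof -
  interpret partial_order D\<^sub>w by (rule partial_order_D)
  have inf: "\<exists>i. greatest D\<^sub>w i (Lower D\<^sub>w A)" if "A \<subseteq> carrier D\<^sub>w" for A
  proof -
    obtain \<Q> where "A = deg\<^sub>w ` \<Q>"
      using \<open>A \<subseteq> carrier D\<^sub>w\<close> unfolding carrier_D by (meson subset_imageE)
    then show ?thesis using greatest_Lower_D by blast
  qed
  show ?thesis
  proof (rule complete_latticeI)
    fix A assume A: "A \<subseteq> carrier D\<^sub>w"
    obtain i where i: "greatest D\<^sub>w i (Lower D\<^sub>w (Upper D\<^sub>w A))"
      using inf[of "Upper D\<^sub>w A"] by auto
    then have "least D\<^sub>w i (Upper D\<^sub>w A)"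
      using A unfolding greatest_def least_def Lower_def Upper_def by blast
    then show "\<exists>s. least D\<^sub>w s (Upper D\<^sub>w A)" by blast
  qed (rule inf)
qed

end

theory Submission
  imports Defs
begin

text \<open>
  The product \<open>P \<times> Q\<close> is deep whenever \<open>P\<close> is, because projecting strings to their even part pushes
  \<open>M\<close> forward to a left c.e. semimeasure; hence deep degrees are upward closed. Deep classes are
  built by diagonalizing against \<open>M\<close> in consecutive blocks. If the blocks are wide relative to the
  rate of a given deep class \<open>P\<close>, bushy tree forcing produces a member of the new class computing no
  member of \<open>P\<close>, so there is no least deep degree.

  The union of all deep classes is \<open>\<Sigma>\<^sup>0\<^sub>3\<close>, so by Simpson's embedding the infimum of all deep
  degrees lies in \<open>\<E>\<^sub>w\<close>; by distributivity every degree above it is the infimum of its joins with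
  deep degrees. A random sequence computing a member of a deep class computes \<open>0'\<close>: otherwise, as
  numbers enter \<open>0'\<close>, small sets of oracles containing it would form a Solovay test.

  Suppose finally that \<open>P\<close> represents a least element of the third filter. A Sacks splitting yields
  c.e. sets \<open>A\<^sub>0\<close>, \<open>A\<^sub>1\<close> computing no member of \<open>P\<close> such that, for any two functionals, at infinitely
  many lengths the oracles computing \<open>A\<^sub>0\<close> or those computing \<open>A\<^sub>1\<close> have small measure. An
  incomplete random sequence computing \<open>A\<^sub>i\<close> would be random relative to \<open>A\<^sub>i\<close>, so for one \<open>i\<close> there is
  none, and the degree of \<open>{A\<^sub>i} \<union> P\<close> lies in the filter without being above that of \<open>P\<close>.
\<close>

section \<open>Computability of functions between encoded types\<close>

text \<open>Information about \<open>M\<close> comes mainly from its universality. A computable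
  machine that reads random bits and prints strings has output probabilities at most a constant
  times \<open>M\<close>. Hence a string found by a search with a small code is heavy, and the
  oracles computing a member of a deep class have small measure. The former drives the forcing: an
  output produced by a whole bushy tree can be found by search and is then too heavy to be a prefix
  of a member of the given class. If no output is produced so often, divergence is forced instead,
  which multiplies the branching needed by the number of possible outputs; this is why the widths
  must outgrow the given rate. A single c.e. set would face opposite demands: shrinking the set of
  oracles that compute it calls for enumerating numbers, computing no member of \<open>P\<close>
  calls for preserving computations. With two sets, each number can go to the side that respects the
  stronger preservation demand. The price is that the proof does not tell which of the two sets ends
  up without incomplete random sequences above it.\<close>

text \<open>\<open>dec\<close> is total, so a search over an encoded type can run through all natural numbers.\<close>

class enc =
  fixes enc :: "'a \<Rightarrow> nat" and dec :: "nat \<Rightarrow> 'a"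
  assumes dec_enc [simp]: "dec (enc x) = x"
    and enc_dec_le: "(\<lambda>n. enc (dec n)) \<le>\<^sub>T A"

lemma enc_inject [simp]: "enc x = enc y \<longleftrightarrow> x = y"
  by (metis dec_enc)

lemma tle_id: "(\<lambda>n. n) \<le>\<^sub>T A"
  unfolding turing_le_def by (rule exI[of _ "PPair PFst PSnd"]) simp

lemma tle_comp: "g \<le>\<^sub>T A \<Longrightarrow> f \<le>\<^sub>T A \<Longrightarrow> (\<lambda>n. g (f n)) \<le>\<^sub>T A"
  unfolding turing_le_def
proof (elim exE)
  fix p q assume "\<forall>n. run p A n = Some (g n)" "\<forall>n. run q A n = Some (f n)"
  then show "\<exists>e. \<forall>n. run e A n = Some (g (f n))"
    by (intro exI[of _ "PComp p q"]) simp
qed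

lemma tle_pair: "f \<le>\<^sub>T A \<Longrightarrow> g \<le>\<^sub>T A \<Longrightarrow> (\<lambda>n. prod_encode (f n, g n)) \<le>\<^sub>T A"
  unfolding turing_le_def
proof (elim exE)
  fix p q assume "\<forall>n. run p A n = Some (f n)" "\<forall>n. run q A n = Some (g n)"
  then show "\<exists>e. \<forall>n. run e A n = Some (prod_encode (f n, g n))"
    by (intro exI[of _ "PPair p q"]) simp
qed

lemma tle_fst: "(\<lambda>n. fst (prod_decode n)) \<le>\<^sub>T A"
  unfolding turing_le_def by (rule exI[of _ PFst]) simp

lemma tle_snd: "(\<lambda>n. snd (prod_decode n)) \<le>\<^sub>T A"
  unfolding turing_le_def by (rule exI[of _ PSnd]) simp

lemma tle_const: "(\<lambda>n. c) \<le>\<^sub>T A"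
proof -
  have "\<exists>e. \<forall>n. run e A n = Some c"
  proof (induction c)
    case 0 then show ?case by (intro exI[of _ PZero]) simp
  next
    case (Suc c)
    then obtain e where "\<forall>n. run e A n = Some c" by blast
    then show ?case by (intro exI[of _ "PComp PSucc e"]) simp
  qed
  then show ?thesis by (simp add: turing_le_def)
qed

lemma tle_prec:
  assumes "f \<le>\<^sub>T A" "g \<le>\<^sub>T A"
  shows "(\<lambda>n. rec_nat (f (fst (prod_decode n)))
           (\<lambda>i r. g (prod_encode (fst (prod_decode n), prod_encode (i, r)))) (snd (prod_decode n))) \<le>\<^sub>T A"
proof -
  obtain p q where p: "\<And>n. run p A n = Some (f n)" and q: "\<And>n. run q A n = Some (g n)"
    using assms unfolding turing_le_def by blast
  have "rec_nat (Some (f a)) (\<lambda>i r. Option.bind r (\<lambda>y. Some (g (prod_encode (a, prod_encode (i, y)))))) k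
     = Some (rec_nat (f a) (\<lambda>i r. g (prod_encode (a, prod_encode (i, r)))) k)" for a k
    by (induction k) auto
  then show ?thesis
    unfolding turing_le_def by (intro exI[of _ "PPrec p q"]) (simp add: p q)
qed

instantiation nat :: enc
begin
definition enc_nat :: "nat \<Rightarrow> nat" where "enc_nat n = n"
definition dec_nat :: "nat \<Rightarrow> nat" where "dec_nat n = n"
instance by standard (simp_all add: enc_nat_def dec_nat_def tle_id)
end

instantiation prod :: (enc, enc) enc
begin
definition enc_prod :: "'a \<times> 'b \<Rightarrow> nat" where "enc_prod p = prod_encode (enc (fst p), enc (snd p))"
definition dec_prod :: "nat \<Rightarrow> 'a \<times> 'b" where "dec_prod n = (dec (fst (prod_decode n)), dec (snd (prod_decode n)))"
instance
proof
  fix x :: "'a \<times> 'b" and A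
  show "dec (enc x) = x" by (simp add: enc_prod_def dec_prod_def)
  show "(\<lambda>n. enc (dec n :: 'a \<times> 'b)) \<le>\<^sub>T A"
    by (simp add: enc_prod_def dec_prod_def)
      (intro tle_pair tle_comp[OF enc_dec_le tle_fst] tle_comp[OF enc_dec_le tle_snd])
qed
end

instantiation bool :: enc
begin
definition enc_bool :: "bool \<Rightarrow> nat" where "enc_bool b = of_bool b"
definition dec_bool :: "nat \<Rightarrow> bool" where "dec_bool n = (n \<noteq> 0)"
instance
proof
  fix x :: bool and A
  show "dec (enc x) = x" by (simp add: enc_bool_def dec_bool_def)
  have "(\<lambda>n. enc (dec n :: bool)) = (\<lambda>n. rec_nat 0 (\<lambda>i r. 1) (snd (prod_decode (prod_encode (0, n)))))"
    by (rule ext, rename_tac n, case_tac n) (auto simp: enc_bool_def dec_bool_def)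
  moreover have "\<dots> \<le>\<^sub>T A"
    using tle_comp[OF tle_prec[OF tle_const[of 0] tle_const[of 1]] tle_pair[OF tle_const[of 0] tle_id]]
    by simp
  ultimately show "(\<lambda>n. enc (dec n :: bool)) \<le>\<^sub>T A" by simp
qed
end

text \<open>The program has to be right on codes. Since \<open>enc_dec_le\<close> makes it
  computable to normalise an arbitrary number, this agrees with \<open>\<le>\<^sub>T\<close> for the
  induced function on numbers.\<close>

definition cmp :: "(nat \<Rightarrow> nat) \<Rightarrow> ('a::enc \<Rightarrow> 'b::enc) \<Rightarrow> bool" where
  "cmp A f \<longleftrightarrow> (\<exists>e. \<forall>x. run e A (enc x) = Some (enc (f x)))"

named_theorems cmp_intros

lemma cmp_iff_tle: "cmp A f \<longleftrightarrow> (\<lambda>n. enc (f (dec n))) \<le>\<^sub>T A"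
proof
  assume "cmp A f"
  then obtain e where e: "\<And>x. run e A (enc x) = Some (enc (f x))" unfolding cmp_def by blast
  obtain d where d: "\<And>n. run d A n = Some (enc (dec n :: 'a))"
    using enc_dec_le[where 'a='a] unfolding turing_le_def by blast
  show "(\<lambda>n. enc (f (dec n))) \<le>\<^sub>T A"
    unfolding turing_le_def by (rule exI[of _ "PComp e d"]) (simp add: d e)
next
  assume "(\<lambda>n. enc (f (dec n))) \<le>\<^sub>T A"
  then show "cmp A f" unfolding cmp_def turing_le_def by (metis dec_enc)
qed

lemma cmp_nat_iff: "cmp A f \<longleftrightarrow> f \<le>\<^sub>T A" for f :: "nat \<Rightarrow> nat"
  by (simp add: cmp_iff_tle enc_nat_def dec_nat_def)

lemma computable_iff_cmp: "computable f \<longleftrightarrow> cmp (\<lambda>_. 0) f"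
  by (simp add: cmp_def computable_def enc_nat_def)

lemma cmp_mono: assumes "cmp A f" "A \<le>\<^sub>T B" shows "cmp B f"
  using assms cmp_iff_tle turing_le_trans by metis

lemma zero_tle: "(\<lambda>_. 0) \<le>\<^sub>T A" by (rule tle_const)

lemma cmp0: "cmp (\<lambda>_. 0) f \<Longrightarrow> cmp A f"
  using cmp_mono zero_tle by blast

lemma cmp_comp: "cmp A g \<Longrightarrow> cmp A f \<Longrightarrow> cmp A (\<lambda>x. g (f x))"
  unfolding cmp_def
proof (elim exE)
  fix p q assume "\<forall>x. run p A (enc x) = Some (enc (g x))" "\<forall>x. run q A (enc x) = Some (enc (f x))"
  then show "\<exists>e. \<forall>x. run e A (enc x) = Some (enc (g (f x)))"
    by (intro exI[of _ "PComp p q"]) simp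
qed

lemma cmp_cong: "(\<And>x. f x = g x) \<Longrightarrow> cmp A g \<Longrightarrow> cmp A f"
  by (simp add: cmp_def)

lemma cmp_id [cmp_intros]: "cmp A (\<lambda>x. x)"
  unfolding cmp_def by (rule exI[of _ "PPair PFst PSnd"]) simp

lemma cmp_const [cmp_intros]: "cmp A (\<lambda>x. c)"
  unfolding cmp_iff_tle by (rule tle_const)

lemma cmp_oracle: "cmp A (\<lambda>n::nat. A n)"
  using turing_le_refl cmp_nat_iff by blast

lemma cmp_Pair [cmp_intros]: "cmp A f \<Longrightarrow> cmp A g \<Longrightarrow> cmp A (\<lambda>x. (f x, g x))"
  unfolding cmp_iff_tle by (simp add: enc_prod_def tle_pair)

lemma cmp_fst [cmp_intros]: "cmp A f \<Longrightarrow> cmp A (\<lambda>x. fst (f x))"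
  unfolding cmp_iff_tle using tle_comp[OF tle_fst] by (force simp: enc_prod_def)

lemma cmp_snd [cmp_intros]: "cmp A f \<Longrightarrow> cmp A (\<lambda>x. snd (f x))"
  unfolding cmp_iff_tle using tle_comp[OF tle_snd] by (force simp: enc_prod_def)

lemma cmp_Suc [cmp_intros]: "cmp A f \<Longrightarrow> cmp A (\<lambda>x. Suc (f x))"
proof -
  have "cmp A Suc" unfolding cmp_def by (rule exI[of _ PSucc]) (simp add: enc_nat_def)
  then show "cmp A f \<Longrightarrow> cmp A (\<lambda>x. Suc (f x))" by (rule cmp_comp)
qed

lemma cmp_enc [cmp_intros]: "cmp A f \<Longrightarrow> cmp A (\<lambda>x. enc (f x))"
  unfolding cmp_def by (simp add: enc_nat_def)

lemma cmp_dec [cmp_intros]: "cmp A f \<Longrightarrow> cmp A (\<lambda>x. dec (f x))"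
  by (rule cmp_comp[of A dec]) (simp_all add: cmp_iff_tle dec_nat_def enc_dec_le)

text \<open>\<open>cmp\<close> is a predicate on unary functions. A curried function is handled by
  one proof on tuples, into which computable arguments are substituted afterwards.\<close>

lemma cmp_app2:
  assumes h: "cmp A (\<lambda>p. h (fst p) (snd p))" and f: "cmp A f" "cmp A g"
  shows "cmp A (\<lambda>x. h (f x) (g x))"
  using cmp_comp[OF h cmp_Pair[OF f]] by simp

lemma cmp_app3:
  assumes h: "cmp A (\<lambda>p. h (fst p) (fst (snd p)) (snd (snd p)))" and f: "cmp A f" "cmp A g" "cmp A k"
  shows "cmp A (\<lambda>x. h (f x) (g x) (k x))"
  using cmp_comp[OF h cmp_Pair[OF f(1) cmp_Pair[OF f(2,3)]]] by simp

lemma cmp_app4: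
  assumes h: "cmp A (\<lambda>p. h (fst p) (fst (snd p)) (fst (snd (snd p))) (snd (snd (snd p))))"
    and f: "cmp A f" "cmp A g" "cmp A k" "cmp A l"
  shows "cmp A (\<lambda>x. h (f x) (g x) (k x) (l x))"
  using cmp_comp[OF h cmp_Pair[OF f(1) cmp_Pair[OF f(2) cmp_Pair[OF f(3,4)]]]] by simp

lemma cmp_Let [cmp_intros]:
  "cmp A (\<lambda>p. g (fst p) (snd p)) \<Longrightarrow> cmp A f \<Longrightarrow> cmp A (\<lambda>x. let y = f x in g x y)"
  unfolding Let_def by (rule cmp_app2[OF _ cmp_id])

lemma cmp_rec [cmp_intros]:
  assumes "cmp A a" "cmp A (\<lambda>p. g (fst p) (fst (snd p)) (snd (snd p)))" "cmp A n"
  shows "cmp A (\<lambda>x. rec_nat (a x) (\<lambda>i r. g x i r) (n x))"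
proof -
  obtain p q k where p: "\<And>x. run p A (enc x) = Some (enc (a x))"
    and q: "\<And>y. run q A (enc y) = Some (enc (g (fst y) (fst (snd y)) (snd (snd y))))"
    and k: "\<And>x. run k A (enc x) = Some (n x)"
    using assms unfolding cmp_def enc_nat_def by blast
  have q': "run q A (prod_encode (enc x, prod_encode (i, enc y))) = Some (enc (g x i y))" for x i y
    using q[of "(x, i, y)"] by (simp add: enc_prod_def enc_nat_def)
  obtain d where d: "\<And>n. run d A n = Some n"
    using tle_id unfolding turing_le_def by blast
  have "rec_nat (Some (enc (a x))) (\<lambda>i r. Option.bind r (\<lambda>y. run q A (prod_encode (enc x, prod_encode (i, y))))) m
      = Some (enc (rec_nat (a x) (g x) m))" for x m
    by (induction m) (auto simp: q')
  then show ?thesis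
    unfolding cmp_def by (intro exI[of _ "PComp (PPrec p q) (PPair d k)"]) (simp add: p d k)
qed

lemma cmp_funpow [cmp_intros]:
  fixes g :: "'a::enc \<Rightarrow> 'b::enc \<Rightarrow> 'b"
  assumes "cmp A (\<lambda>p. g (fst p) (snd p))" "cmp A n" "cmp A a"
  shows "cmp A (\<lambda>x. (g x ^^ n x) (a x))"
proof -
  have eq: "(g x ^^ k) y = rec_nat y (\<lambda>i r. g x r) k" for x k and y :: 'b
    by (induction k) auto
  show ?thesis
    by (rule cmp_cong[OF eq]) (intro cmp_intros cmp_app2[OF assms(1)] cmp_comp[OF assms(2)] cmp_comp[OF assms(3)])
qed

section \<open>Arithmetic, logic, bounded quantifiers and search\<close>

lemma cmp_plus [cmp_intros]: "cmp A f \<Longrightarrow> cmp A g \<Longrightarrow> cmp A (\<lambda>x. f x + g x :: nat)"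
proof -
  assume *: "cmp A f" "cmp A g"
  have eq: "a + b = rec_nat a (\<lambda>i r. Suc r) b" for a b :: nat by (induction b) auto
  show ?thesis by (rule cmp_cong[OF eq]) (intro cmp_intros cmp_comp[OF *(1)] cmp_comp[OF *(2)])
qed

lemma cmp_pred: "cmp A f \<Longrightarrow> cmp A (\<lambda>x. f x - Suc 0)"
proof -
  assume *: "cmp A f"
  have eq: "a - Suc 0 = rec_nat 0 (\<lambda>i r. i) a" for a :: nat by (induction a) auto
  show ?thesis by (rule cmp_cong[OF eq]) (intro cmp_intros cmp_comp[OF *])
qed

lemma cmp_minus [cmp_intros]: "cmp A f \<Longrightarrow> cmp A g \<Longrightarrow> cmp A (\<lambda>x. f x - g x :: nat)"
proof -
  assume *: "cmp A f" "cmp A g"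
  have eq: "a - b = rec_nat a (\<lambda>i r. r - Suc 0) b" for a b :: nat by (induction b) auto
  show ?thesis by (rule cmp_cong[OF eq]) (intro cmp_intros cmp_pred cmp_comp[OF *(1)] cmp_comp[OF *(2)])
qed

lemma cmp_times [cmp_intros]: "cmp A f \<Longrightarrow> cmp A g \<Longrightarrow> cmp A (\<lambda>x. f x * g x :: nat)"
proof -
  assume *: "cmp A f" "cmp A g"
  have eq: "a * b = rec_nat 0 (\<lambda>i r. r + a) b" for a b :: nat by (induction b) auto
  show ?thesis by (rule cmp_cong[OF eq]) (intro cmp_intros cmp_comp[OF *(1)] cmp_comp[OF *(2)])
qed

lemma cmp_power [cmp_intros]: "cmp A f \<Longrightarrow> cmp A g \<Longrightarrow> cmp A (\<lambda>x. f x ^ g x :: nat)"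
proof -
  assume *: "cmp A f" "cmp A g"
  have eq: "a ^ b = rec_nat 1 (\<lambda>i r. r * a) b" for a b :: nat by (induction b) auto
  show ?thesis by (rule cmp_cong[OF eq]) (intro cmp_intros cmp_comp[OF *(1)] cmp_comp[OF *(2)])
qed

lemma cmp_of_bool [cmp_intros]: "cmp A c \<Longrightarrow> cmp A (\<lambda>x. of_bool (c x) :: nat)"
  unfolding cmp_def by (simp add: enc_nat_def enc_bool_def)

lemma cmp_If [cmp_intros]: "cmp A c \<Longrightarrow> cmp A t \<Longrightarrow> cmp A e \<Longrightarrow> cmp A (\<lambda>x. if c x then t x else e x)"
proof -
  assume *: "cmp A c" "cmp A t" "cmp A e"
  have eq: "(if c x then t x else e x) = rec_nat (e x) (\<lambda>i r. t x) (of_bool (c x))" for x by simp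
  show ?thesis by (rule cmp_cong[OF eq]) (intro cmp_intros cmp_comp[OF *(1)] cmp_comp[OF *(2)] cmp_comp[OF *(3)])
qed

lemma cmp_not [cmp_intros]: "cmp A c \<Longrightarrow> cmp A (\<lambda>x. \<not> c x)"
proof -
  assume *: "cmp A c"
  have eq: "(\<not> c x) = (if c x then False else True)" for x by simp
  show ?thesis by (rule cmp_cong[OF eq]) (intro cmp_intros cmp_comp[OF *])
qed

lemma cmp_conj [cmp_intros]: "cmp A c \<Longrightarrow> cmp A d \<Longrightarrow> cmp A (\<lambda>x. c x \<and> d x)"
proof -
  assume *: "cmp A c" "cmp A d"
  have eq: "(c x \<and> d x) = (if c x then d x else False)" for x by simp
  show ?thesis by (rule cmp_cong[OF eq]) (intro cmp_intros cmp_comp[OF *(1)] cmp_comp[OF *(2)])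
qed

lemma cmp_disj [cmp_intros]: "cmp A c \<Longrightarrow> cmp A d \<Longrightarrow> cmp A (\<lambda>x. c x \<or> d x)"
proof -
  assume *: "cmp A c" "cmp A d"
  have eq: "(c x \<or> d x) = (if c x then True else d x)" for x by simp
  show ?thesis by (rule cmp_cong[OF eq]) (intro cmp_intros cmp_comp[OF *(1)] cmp_comp[OF *(2)])
qed

lemma cmp_imp [cmp_intros]: "cmp A c \<Longrightarrow> cmp A d \<Longrightarrow> cmp A (\<lambda>x. c x \<longrightarrow> d x)"
proof -
  assume *: "cmp A c" "cmp A d"
  have eq: "(c x \<longrightarrow> d x) = (if c x then d x else True)" for x by simp
  show ?thesis by (rule cmp_cong[OF eq]) (intro cmp_intros cmp_comp[OF *(1)] cmp_comp[OF *(2)])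
qed

lemma cmp_eq0: "cmp A f \<Longrightarrow> cmp A (\<lambda>x. f x = (0::nat))"
proof -
  assume *: "cmp A f"
  have eq: "(a = 0) = rec_nat True (\<lambda>i r. False) a" for a :: nat by (cases a) auto
  show ?thesis by (rule cmp_cong[OF eq]) (intro cmp_intros cmp_comp[OF *])
qed

lemma cmp_le [cmp_intros]: "cmp A f \<Longrightarrow> cmp A g \<Longrightarrow> cmp A (\<lambda>x. f x \<le> (g x :: nat))"
proof -
  assume *: "cmp A f" "cmp A g"
  have eq: "(a \<le> b) = (a - b = 0)" for a b :: nat by auto
  show ?thesis by (rule cmp_cong[OF eq]) (intro cmp_intros cmp_eq0 cmp_comp[OF *(1)] cmp_comp[OF *(2)])
qed

lemma cmp_less [cmp_intros]: "cmp A f \<Longrightarrow> cmp A g \<Longrightarrow> cmp A (\<lambda>x. f x < (g x :: nat))"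
proof -
  assume *: "cmp A f" "cmp A g"
  have eq: "(a < b) = (Suc a \<le> b)" for a b :: nat by auto
  show ?thesis by (rule cmp_cong[OF eq]) (intro cmp_intros cmp_comp[OF *(1)] cmp_comp[OF *(2)])
qed

lemma cmp_eq [cmp_intros]: "cmp A f \<Longrightarrow> cmp A g \<Longrightarrow> cmp A (\<lambda>x. f x = g x)"
proof -
  assume *: "cmp A f" "cmp A g"
  have eq: "(f x = g x) = (enc (f x) \<le> enc (g x) \<and> enc (g x) \<le> enc (f x))" for x
    by (metis enc_inject order_antisym order_refl)
  show ?thesis by (rule cmp_cong[OF eq]) (intro cmp_intros cmp_comp[OF *(1)] cmp_comp[OF *(2)])
qed

lemma cmp_all_less [cmp_intros]:
  "cmp A (\<lambda>p. Q (fst p) (snd p)) \<Longrightarrow> cmp A b \<Longrightarrow> cmp A (\<lambda>x. \<forall>i<b x. Q x (i::nat))"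
proof -
  assume *: "cmp A (\<lambda>p. Q (fst p) (snd p))" "cmp A b"
  have eq: "(\<forall>i<n. Q x i) = rec_nat True (\<lambda>i r. r \<and> Q x i) n" for n x
    by (induction n) (auto simp: less_Suc_eq)
  show ?thesis by (rule cmp_cong[OF eq]) (intro cmp_intros cmp_app2[OF *(1)] cmp_comp[OF *(2)])
qed

lemma cmp_ex_less [cmp_intros]:
  "cmp A (\<lambda>p. Q (fst p) (snd p)) \<Longrightarrow> cmp A b \<Longrightarrow> cmp A (\<lambda>x. \<exists>i<b x. Q x (i::nat))"
proof -
  assume *: "cmp A (\<lambda>p. Q (fst p) (snd p))" "cmp A b"
  have eq: "(\<exists>i<n. Q x i) = (\<not> (\<forall>i<n. \<not> Q x i))" for n x by blast
  show ?thesis by (rule cmp_cong[OF eq]) (intro cmp_intros cmp_app2[OF *(1)] cmp_comp[OF *(2)])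
qed

lemma cmp_all_le [cmp_intros]:
  "cmp A (\<lambda>p. Q (fst p) (snd p)) \<Longrightarrow> cmp A b \<Longrightarrow> cmp A (\<lambda>x. \<forall>i\<le>b x. Q x (i::nat))"
  using cmp_all_less[of A Q "\<lambda>x. Suc (b x)"] cmp_Suc[of A b] by (simp add: less_Suc_eq_le)

lemma cmp_ex_le [cmp_intros]:
  "cmp A (\<lambda>p. Q (fst p) (snd p)) \<Longrightarrow> cmp A b \<Longrightarrow> cmp A (\<lambda>x. \<exists>i\<le>b x. Q x (i::nat))"
  using cmp_ex_less[of A Q "\<lambda>x. Suc (b x)"] cmp_Suc[of A b] by (simp add: less_Suc_eq_le)

lemma cmp_sum [cmp_intros]:
  "cmp A (\<lambda>p. f (fst p) (snd p)) \<Longrightarrow> cmp A b \<Longrightarrow> cmp A (\<lambda>x. \<Sum>i<b x::nat. f x i :: nat)"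
proof -
  assume *: "cmp A (\<lambda>p. f (fst p) (snd p))" "cmp A b"
  have eq: "(\<Sum>i<n. f x i) = rec_nat 0 (\<lambda>i r. r + f x i) n" for n :: nat and x
    by (induction n) auto
  show ?thesis by (rule cmp_cong[OF eq]) (intro cmp_intros cmp_app2[OF *(1)] cmp_comp[OF *(2)])
qed

lemma cmp_Least [cmp_intros]:
  assumes c: "cmp A (\<lambda>p. P (fst p) (snd p))" and ex: "\<And>x. \<exists>n. P x n"
  shows "cmp A (\<lambda>x. LEAST n. P x (n::nat))"
proof -
  have "cmp A (\<lambda>p. of_bool (\<not> P (fst p) (snd p)) :: nat)" by (intro cmp_intros c)
  then obtain e where e: "\<And>p. run e A (enc p) = Some (of_bool (\<not> P (fst p) (snd p)))"
    unfolding cmp_def enc_nat_def by blast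
  have e': "run e A (prod_encode (enc x, n)) = Some (of_bool (\<not> P x n))" for x n
    using e[of "(x, n)"] by (simp add: enc_prod_def enc_nat_def)
  have "run (PMu e) A (enc x) = Some (LEAST n. P x n)" for x
  proof -
    define z where "z n \<longleftrightarrow> run e A (prod_encode (enc x, n)) = Some 0 \<and>
              (\<forall>m<n. \<exists>y. run e A (prod_encode (enc x, m)) = Some (Suc y))" for n
    have z: "z n \<longleftrightarrow> P x n \<and> (\<forall>m<n. \<not> P x m)" for n
      by (auto simp: z_def e')
    have zl: "z (LEAST n. P x n)"
      unfolding z using LeastI_ex[OF ex[of x]] not_less_Least[where P = "P x"] by blast
    moreover have "n = (LEAST n. P x n)" if "z n" for n
    proof (rule Least_equality[symmetric])
      show "P x n" using that z by blast
      fix m assume "P x m"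
      with that z have "\<not> m < n" by blast
      then show "n \<le> m" by simp
    qed
    ultimately have "(THE n. z n) = (LEAST n. P x n)" by (rule the_equality)
    moreover have "run (PMu e) A (enc x) = (if \<exists>n. z n then Some (THE n. z n) else None)"
      by (simp only: run.simps Let_def z_def)
    ultimately show ?thesis using zl by metis
  qed
  then show ?thesis unfolding cmp_def enc_nat_def by blast
qed

lemma cmp_div [cmp_intros]: "cmp A f \<Longrightarrow> cmp A g \<Longrightarrow> cmp A (\<lambda>x. f x div g x :: nat)"
proof -
  assume *: "cmp A f" "cmp A g"
  \<comment> \<open>The disjunct \<open>b = 0\<close> ends the search at 0, the value of division by
    zero in HOL.\<close>
  have "a div b = (LEAST q. b = 0 \<or> a < Suc q * b)" for a b :: nat
  proof (cases "b = 0")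
    case False
    then have "a < Suc (a div b) * b" by (metis dividend_less_div_times mult_Suc add.commute gr0I)
    moreover have "a div b \<le> q" if "a < Suc q * b" for q
      using that by (metis less_Suc_eq_le less_mult_imp_div_less)
    ultimately show ?thesis using False by (intro Least_equality[symmetric]) auto
  qed (simp add: Least_eq_0)
  moreover have ex: "\<exists>q. b = 0 \<or> a < Suc q * b" for a b :: nat
  proof (cases "b = 0")
    case False
    then have "Suc a * 1 \<le> Suc a * b" by (intro mult_le_mono2) simp
    then show ?thesis by (intro exI[of _ a]) auto
  qed simp
  moreover have "cmp A (\<lambda>x. LEAST q. g x = 0 \<or> f x < Suc q * g x)"
    by (rule cmp_Least) (intro cmp_intros cmp_comp[OF *(1)] cmp_comp[OF *(2)], rule ex)
  ultimately show ?thesis by simp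
qed

lemma cmp_mod [cmp_intros]: "cmp A f \<Longrightarrow> cmp A g \<Longrightarrow> cmp A (\<lambda>x. f x mod g x :: nat)"
proof -
  assume *: "cmp A f" "cmp A g"
  have eq: "a mod b = a - a div b * b" for a b :: nat by (simp add: minus_div_mult_eq_mod)
  show ?thesis by (rule cmp_cong[OF eq]) (intro cmp_intros cmp_comp[OF *(1)] cmp_comp[OF *(2)])
qed

lemma cmp_even [cmp_intros]: "cmp A f \<Longrightarrow> cmp A (\<lambda>x. even (f x :: nat))"
  unfolding even_iff_mod_2_eq_zero by (intro cmp_intros)

subsection \<open>Lists\<close>

text \<open>One step of a left fold along a list code, which is 0 for the empty list and
  \<open>Suc (prod_encode (x, c))\<close> otherwise. The code 0 is a fixed point, so extra
  iterations are harmless, and the code itself bounds the length of the list.\<close>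

definition lstep :: "('b \<Rightarrow> nat \<Rightarrow> 'b) \<Rightarrow> nat \<times> 'b \<Rightarrow> nat \<times> 'b" where
  "lstep g p = (if fst p = 0 then p
     else (snd (prod_decode (fst p - 1)), g (snd p) (fst (prod_decode (fst p - 1)))))"

lemma lstep_iter: "length xs \<le> k \<Longrightarrow> (lstep g ^^ k) (list_encode xs, a) = (0, foldl g a xs)"
proof (induction xs arbitrary: a k)
  case Nil
  have "(lstep g ^^ k) (0, a) = (0, a)" by (induction k) (auto simp: lstep_def)
  then show ?case by simp
next
  case (Cons x xs)
  then obtain k' where k: "k = Suc k'" "length xs \<le> k'" by (cases k) auto
  have "(lstep g ^^ k) (list_encode (x # xs), a) = (lstep g ^^ k') (lstep g (list_encode (x # xs), a))"
    unfolding k by (simp add: funpow_swap1)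
  also have "lstep g (list_encode (x # xs), a) = (list_encode xs, g a x)"
    by (simp add: lstep_def)
  finally show ?case using Cons.IH[OF k(2)] by simp
qed

lemma length_le_list_encode: "length xs \<le> list_encode xs"
proof (induction xs)
  case (Cons x xs)
  then show ?case using le_prod_encode_2[of "list_encode xs" x] by simp
qed simp

lemma foldl_code: "foldl g a xs = snd ((lstep g ^^ list_encode xs) (list_encode xs, a))"
  by (simp add: lstep_iter length_le_list_encode)

lemma cmp_pdecode: "cmp A f \<Longrightarrow> cmp A (\<lambda>x. prod_decode (f x))"
  using cmp_dec[of A f, where ?'b = "nat \<times> nat"] by (simp add: dec_prod_def dec_nat_def)

lemma cmp_pencode: "cmp A f \<Longrightarrow> cmp A (\<lambda>x. prod_encode (f x))"
  using cmp_enc[of A f] by (simp add: enc_prod_def enc_nat_def)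

lemma cmp_foldl_code:
  assumes "cmp A a" "cmp A l" "cmp A (\<lambda>p. g (fst p) (fst (snd p)) (snd (snd p)))"
  shows "cmp A (\<lambda>x. foldl (g x) (a x) (list_decode (l x)))"
proof -
  have eq: "foldl (g x) (a x) (list_decode (l x)) = snd ((lstep (g x) ^^ l x) (l x, a x))" for x
    by (subst foldl_code) simp
  show ?thesis unfolding eq lstep_def
    by (intro cmp_intros cmp_pdecode cmp_app3[OF assms(3)] cmp_comp[OF assms(1)] cmp_comp[OF assms(2)])
qed

text \<open>A fold builds the image list back to front; a second pass with the identity restores the
  order.\<close>

definition lcode_rev_map :: "(nat \<Rightarrow> nat) \<Rightarrow> nat \<Rightarrow> nat" where
  "lcode_rev_map h n = foldl (\<lambda>a y. Suc (prod_encode (h y, a))) 0 (list_decode n)"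

lemma lcode_rev_map_eq: "lcode_rev_map h n = list_encode (rev (map h (list_decode n)))"
proof -
  have "foldl (\<lambda>a y. Suc (prod_encode (h y, a))) (list_encode zs) ys = list_encode (rev (map h ys) @ zs)" for ys zs
  proof (induction ys arbitrary: zs)
    case (Cons y ys)
    show ?case using Cons[of "h y # zs"] by simp
  qed simp
  from this[of "[]"] show ?thesis unfolding lcode_rev_map_def by simp
qed

lemma cmp_lcode_map:
  assumes "h \<le>\<^sub>T A" shows "(\<lambda>n. list_encode (map h (list_decode n))) \<le>\<^sub>T A"
proof -
  have h: "cmp A h" using assms by (simp add: cmp_nat_iff)
  have "list_encode (map h (list_decode n)) = lcode_rev_map (\<lambda>x. x) (lcode_rev_map h n)" for n
    by (simp add: lcode_rev_map_eq rev_map)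
  then show ?thesis
    unfolding cmp_nat_iff[symmetric] lcode_rev_map_def
    by (simp only:) (intro cmp_intros cmp_foldl_code cmp_pencode cmp_comp[OF h])
qed

instantiation list :: (enc) enc
begin
definition enc_list :: "'a list \<Rightarrow> nat" where "enc_list xs = list_encode (map enc xs)"
definition dec_list :: "nat \<Rightarrow> 'a list" where "dec_list n = map dec (list_decode n)"
instance
proof
  fix x :: "'a list" and A
  show "dec (enc x) = x" by (simp add: enc_list_def dec_list_def comp_def)
  show "(\<lambda>n. enc (dec n :: 'a list)) \<le>\<^sub>T A"
    using cmp_lcode_map[OF enc_dec_le] by (simp add: enc_list_def dec_list_def comp_def)
qed
end

lemma cmp_Cons [cmp_intros]: "cmp A f \<Longrightarrow> cmp A g \<Longrightarrow> cmp A (\<lambda>x. f x # g x)"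
proof -
  assume *: "cmp A f" "cmp A g"
  have eq: "f x # g x = dec (Suc (prod_encode (enc (f x), enc (g x))))" for x
    using dec_enc[of "f x # g x"] by (simp add: enc_list_def)
  show ?thesis by (rule cmp_cong[OF eq]) (intro cmp_intros cmp_pencode cmp_comp[OF *(1)] cmp_comp[OF *(2)])
qed

lemma foldl_map_dec: "foldl g a (map f xs) = foldl (\<lambda>a y. g a (f y)) a xs"
  by (induction xs arbitrary: a) auto

lemma cmp_foldl [cmp_intros]:
  assumes "cmp A (\<lambda>p. g (fst p) (fst (snd p)) (snd (snd p)))" "cmp A a" "cmp A l"
  shows "cmp A (\<lambda>x. foldl (\<lambda>b y. g x b y) (a x) (l x))"
proof -
  have eq: "foldl (g x) (a x) (l x) = foldl (\<lambda>b y. g x b (dec y)) (a x) (list_decode (enc (l x)))" for x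
    using foldl_map_dec[of "g x" "a x" dec "map enc (l x)"] by (simp add: enc_list_def comp_def)
  show ?thesis unfolding eq
    by (intro cmp_intros cmp_foldl_code cmp_app3[OF assms(1)] cmp_comp[OF assms(2)] cmp_comp[OF assms(3)])
qed

lemma cmp_rev [cmp_intros]: "cmp A l \<Longrightarrow> cmp A (\<lambda>x. rev (l x))"
proof -
  assume *: "cmp A l"
  have "foldl (\<lambda>a y. y # a) zs xs = rev xs @ zs" for xs zs :: "'b list"
    by (induction xs arbitrary: zs) auto
  from this[of "[]"] have eq: "rev xs = foldl (\<lambda>a y. y # a) [] xs" for xs :: "'b list" by simp
  show ?thesis by (rule cmp_cong[OF eq]) (intro cmp_intros cmp_comp[OF *])
qed

lemma cmp_append [cmp_intros]: "cmp A k \<Longrightarrow> cmp A l \<Longrightarrow> cmp A (\<lambda>x. k x @ l x)"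
proof -
  assume *: "cmp A k" "cmp A l"
  have "foldl (\<lambda>a y. y # a) zs xs = rev xs @ zs" for xs zs :: "'b list"
    by (induction xs arbitrary: zs) auto
  from this[of _ "rev _"] have eq: "xs @ zs = foldl (\<lambda>a y. y # a) zs (rev xs)" for xs zs :: "'b list" by simp
  show ?thesis by (rule cmp_cong[OF eq]) (intro cmp_intros cmp_comp[OF *(1)] cmp_comp[OF *(2)])
qed

lemma cmp_map [cmp_intros]:
  assumes "cmp A (\<lambda>p. g (fst p) (snd p))" "cmp A l"
  shows "cmp A (\<lambda>x. map (\<lambda>y. g x y) (l x))"
proof -
  have "foldl (\<lambda>a y. g x y # a) zs xs = rev (map (g x) xs) @ zs" for x xs zs
    by (induction xs arbitrary: zs) auto
  from this[of _ "[]"] have eq: "map (g x) xs = rev (foldl (\<lambda>a y. g x y # a) [] xs)" for x xs by simp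
  show ?thesis by (rule cmp_cong[OF eq]) (intro cmp_intros cmp_app2[OF assms(1)] cmp_comp[OF assms(2)])
qed

lemma cmp_length [cmp_intros]: "cmp A l \<Longrightarrow> cmp A (\<lambda>x. length (l x))"
proof -
  assume *: "cmp A l"
  have "foldl (\<lambda>a y. Suc a) n xs = n + length xs" for n and xs :: "'b list"
    by (induction xs arbitrary: n) auto
  from this[of 0] have eq: "length xs = foldl (\<lambda>a y. Suc a) 0 xs" for xs :: "'b list" by simp
  show ?thesis by (rule cmp_cong[OF eq]) (intro cmp_intros cmp_comp[OF *])
qed

text \<open>List access with a default value, so that indices out of range have a known and hence
  computable value.\<close>

definition nthd :: "'a \<Rightarrow> 'a list \<Rightarrow> nat \<Rightarrow> 'a" where
  "nthd d xs i = (if i < length xs then xs ! i else d)"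

lemma nthd_nth [simp]: "i < length xs \<Longrightarrow> nthd d xs i = xs ! i"
  and nthd_ge [simp]: "length xs \<le> i \<Longrightarrow> nthd d xs i = d"
  by (auto simp: nthd_def)

lemma nthd_foldl:
  "nthd d xs i = snd (foldl (\<lambda>p y. (Suc (fst p), if fst p = i then y else snd p)) (0, d) xs)"
proof -
  have "foldl (\<lambda>p y. (Suc (fst p), if fst p = i then y else snd p)) (0, d) xs = (length xs, nthd d xs i)"
  proof (induction xs rule: rev_induct)
    case (snoc x xs)
    then show ?case by (auto simp: nthd_def nth_append)
  qed simp
  then show ?thesis by simp
qed

lemma cmp_nthd [cmp_intros]: "cmp A d \<Longrightarrow> cmp A l \<Longrightarrow> cmp A i \<Longrightarrow> cmp A (\<lambda>x. nthd (d x) (l x) (i x))"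
  unfolding nthd_foldl by (intro cmp_intros; (rule cmp_comp, assumption)?; intro cmp_intros)

lemma cmp_upt [cmp_intros]: "cmp A f \<Longrightarrow> cmp A g \<Longrightarrow> cmp A (\<lambda>x. [f x..<g x])"
proof -
  assume *: "cmp A f" "cmp A g"
  have eq: "[a..<b] = rec_nat [] (\<lambda>i r. if a \<le> i then r @ [i] else r) b" for a b
    by (induction b) auto
  show ?thesis by (rule cmp_cong[OF eq]) (intro cmp_intros cmp_comp[OF *(1)] cmp_comp[OF *(2)])
qed

lemma cmp_take [cmp_intros]: "cmp A n \<Longrightarrow> cmp A l \<Longrightarrow> cmp A (\<lambda>x. take (n x) (l x))"
proof -
  assume *: "cmp A n" "cmp A l"
  have eq: "take n xs = snd (foldl (\<lambda>p y. (Suc (fst p), if fst p < n then snd p @ [y] else snd p)) (0, []) xs)"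
    for n and xs :: "'b list"
  proof -
    have "foldl (\<lambda>p y. (Suc (fst p), if fst p < n then snd p @ [y] else snd p)) (0, []) xs = (length xs, take n xs)"
      by (induction xs rule: rev_induct) auto
    then show ?thesis by simp
  qed
  show ?thesis by (rule cmp_cong[OF eq]) (intro cmp_intros cmp_comp[OF *(1)] cmp_comp[OF *(2)])
qed

lemma cmp_drop [cmp_intros]: "cmp A n \<Longrightarrow> cmp A l \<Longrightarrow> cmp A (\<lambda>x. drop (n x) (l x))"
proof -
  assume *: "cmp A n" "cmp A l"
  have eq: "drop n xs = rev (take (length xs - n) (rev xs))" for n and xs :: "'b list"
    by (cases "n \<le> length xs") (simp_all add: take_rev)
  show ?thesis by (rule cmp_cong[OF eq]) (intro cmp_intros cmp_comp[OF *(1)] cmp_comp[OF *(2)])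
qed

lemma cmp_list_ex [cmp_intros]:
  assumes "cmp A (\<lambda>p. Q (fst p) (snd p))" "cmp A l"
  shows "cmp A (\<lambda>x. \<exists>y\<in>set (l x). Q x y)"
proof -
  have "foldl (\<lambda>a y. a \<or> Q x y) b xs = (b \<or> (\<exists>y\<in>set xs. Q x y))" for x xs b
    by (induction xs arbitrary: b) auto
  from this[of _ False] have eq: "(\<exists>y\<in>set xs. Q x y) = foldl (\<lambda>a y. a \<or> Q x y) False xs" for x xs by simp
  show ?thesis by (rule cmp_cong[OF eq]) (intro cmp_intros cmp_app2[OF assms(1)] cmp_comp[OF assms(2)])
qed

lemma cmp_mem [cmp_intros]: "cmp A f \<Longrightarrow> cmp A l \<Longrightarrow> cmp A (\<lambda>x. f x \<in> set (l x))"
proof -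
  assume *: "cmp A f" "cmp A l"
  have eq: "(a \<in> set xs) = (\<exists>y\<in>set xs. y = a)" for a :: 'b and xs by blast
  show ?thesis by (rule cmp_cong[OF eq]) (intro cmp_intros cmp_comp[OF *(1)] cmp_comp[OF *(2)])
qed

lemma cmp_replicate [cmp_intros]: "cmp A n \<Longrightarrow> cmp A a \<Longrightarrow> cmp A (\<lambda>x. replicate (n x) (a x))"
proof -
  assume *: "cmp A n" "cmp A a"
  have eq: "replicate k y = map (\<lambda>i. y) [0..<k]" for k and y :: 'b by (simp add: map_replicate_const)
  show ?thesis by (rule cmp_cong[OF eq]) (intro cmp_intros cmp_comp[OF *(1)] cmp_comp[OF *(2)])
qed

subsection \<open>Options\<close>

instantiation option :: (enc) enc
begin
definition enc_option :: "'a option \<Rightarrow> nat" where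
  "enc_option z = (case z of None \<Rightarrow> 0 | Some x \<Rightarrow> Suc (enc x))"
definition dec_option :: "nat \<Rightarrow> 'a option" where
  "dec_option n = (if n = 0 then None else Some (dec (n - 1)))"
instance
proof
  fix x :: "'a option" and A
  show "dec (enc x) = x" by (cases x) (auto simp: enc_option_def dec_option_def)
  have "cmp A (\<lambda>n. if n = 0 then 0 else Suc (enc (dec (n - 1) :: 'a)))" by (intro cmp_intros)
  moreover have "enc (dec n :: 'a option) = (if n = 0 then 0 else Suc (enc (dec (n - 1) :: 'a)))" for n
    by (auto simp: enc_option_def dec_option_def)
  ultimately show "(\<lambda>n. enc (dec n :: 'a option)) \<le>\<^sub>T A" by (simp add: cmp_nat_iff)
qed
end

lemma cmp_Some [cmp_intros]: "cmp A f \<Longrightarrow> cmp A (\<lambda>x. Some (f x))"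
proof -
  assume *: "cmp A f"
  have eq: "Some y = dec (Suc (enc y))" for y :: 'b by (simp add: dec_option_def)
  show ?thesis by (rule cmp_cong[OF eq]) (intro cmp_intros cmp_comp[OF *])
qed

subsection \<open>Binary strings\<close>

text \<open>Binary digits, the least significant one on the left. For \<open>i < 2 ^ m\<close> this
  lists the strings of length \<open>m\<close>, which turns sums and quantifiers over strings into
  bounded ones over numbers.\<close>

definition bits :: "nat \<Rightarrow> nat \<Rightarrow> bool list" where
  "bits m i = map (\<lambda>j. odd (i div 2 ^ j)) [0..<m]"

lemma length_bits [simp]: "length (bits m i) = m"
  by (simp add: bits_def)

lemma cmp_bits [cmp_intros]: "cmp A f \<Longrightarrow> cmp A g \<Longrightarrow> cmp A (\<lambda>x. bits (f x) (g x))"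
proof -
  assume *: "cmp A f" "cmp A g"
  show ?thesis unfolding bits_def by (intro cmp_intros cmp_comp[OF *(1)] cmp_comp[OF *(2)])
qed

lemma bits_Suc: "bits (Suc m) i = odd i # bits m (i div 2)"
proof -
  have "bits (Suc m) i = map (\<lambda>j. odd (i div 2 ^ j)) (0 # map Suc [0..<m])"
    by (simp add: bits_def map_Suc_upt upt_conv_Cons del: upt_Suc)
  also have "\<dots> = odd i # bits m (i div 2)"
    by (simp add: bits_def comp_def div_mult2_eq)
  finally show ?thesis .
qed

lemma bij_bits: "bij_betw (bits m) {..<2 ^ m} {\<sigma>. length \<sigma> = m}"
proof (induction m)
  case 0
  then show ?case by (auto simp: bij_betw_def bits_def inj_on_def)
next
  case (Suc m)
  have inj: "inj_on (bits (Suc m)) {..<2 ^ Suc m}"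
  proof (rule inj_onI)
    fix x y :: nat assume xy: "x \<in> {..<2 ^ Suc m}" "y \<in> {..<2 ^ Suc m}" "bits (Suc m) x = bits (Suc m) y"
    then have "bits m (x div 2) = bits m (y div 2)" and o: "odd x = odd y" by (auto simp: bits_Suc)
    moreover have "x div 2 \<in> {..<2 ^ m}" "y div 2 \<in> {..<2 ^ m}" using xy by auto
    ultimately have "x div 2 = y div 2" using Suc by (auto simp: bij_betw_def inj_on_def)
    with o show "x = y" by (metis even_two_times_div_two odd_two_times_div_two_succ)
  qed
  moreover have "bits (Suc m) ` {..<2 ^ Suc m} = {\<sigma>. length \<sigma> = Suc m}"
  proof (rule card_subset_eq)
    have eq: "{\<sigma>::bool list. length \<sigma> = Suc m} = {\<sigma>. set \<sigma> \<subseteq> UNIV \<and> length \<sigma> = Suc m}" by auto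
    show "finite {\<sigma>::bool list. length \<sigma> = Suc m}" unfolding eq by (rule finite_lists_length_eq) simp
    show "card (bits (Suc m) ` {..<2 ^ Suc m}) = card {\<sigma>::bool list. length \<sigma> = Suc m}"
      unfolding eq using card_lists_length_eq[of "UNIV :: bool set" "Suc m"] card_image[OF inj] by simp
  qed auto
  ultimately show ?case by (simp add: bij_betw_def)
qed

lemma finite_strings [simp]: "finite {\<sigma>::bool list. length \<sigma> = m}"
  using bij_betw_finite[OF bij_bits[of m]] by simp

lemma card_strings [simp]: "card {\<sigma>::bool list. length \<sigma> = m} = 2 ^ m"
  using bij_betw_same_card[OF bij_bits[of m]] by simp

lemma finite_strings_conj [simp]: "finite {\<sigma>::bool list. length \<sigma> = m \<and> P \<sigma>}"
  by (rule finite_subset[OF _ finite_strings[of m]]) auto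

lemma sum_strings: "(\<Sum>\<sigma> | length \<sigma> = m. f \<sigma>) = (\<Sum>i<2 ^ m. f (bits m i))"
  by (rule sum.reindex_bij_betw[OF bij_bits, symmetric])

lemma cmp_sum_strings [cmp_intros]:
  assumes "cmp A (\<lambda>p. f (fst p) (snd p))" "cmp A m"
  shows "cmp A (\<lambda>x. \<Sum>\<sigma>::bool list | length \<sigma> = m x. f x \<sigma> :: nat)"
  unfolding sum_strings by (intro cmp_intros cmp_app2[OF assms(1)] cmp_comp[OF assms(2)])

lemma card_strings_conj: "card {\<sigma>::bool list. length \<sigma> = m \<and> P \<sigma>} = (\<Sum>\<sigma> | length \<sigma> = m. of_bool (P \<sigma>))"
proof -
  have "(\<Sum>\<sigma> | length \<sigma> = m. of_bool (P \<sigma>) :: nat) = (\<Sum>\<sigma> \<in> {\<sigma>. length \<sigma> = m \<and> P \<sigma>}. 1)"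
    by (rule sum.mono_neutral_cong_right) auto
  then show ?thesis by simp
qed

lemma cmp_card_strings [cmp_intros]:
  assumes "cmp A (\<lambda>p. P (fst p) (snd p))" "cmp A m"
  shows "cmp A (\<lambda>x. card {\<sigma>::bool list. length \<sigma> = m x \<and> P x \<sigma>})"
  unfolding card_strings_conj by (intro cmp_intros cmp_app2[OF assms(1)] cmp_comp[OF assms(2)])

lemma ex_strings: "(\<exists>\<sigma>. length \<sigma> = m \<and> P \<sigma>) \<longleftrightarrow> (\<exists>i<2 ^ m. P (bits m i))"
proof -
  have "{\<sigma>. length \<sigma> = m} = bits m ` {..<2 ^ m}" using bij_bits[of m] by (simp add: bij_betw_def)
  then show ?thesis by (auto simp: set_eq_iff image_iff)
qed

lemma cmp_ex_strings [cmp_intros]: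
  assumes "cmp A (\<lambda>p. P (fst p) (snd p))" "cmp A m"
  shows "cmp A (\<lambda>x. \<exists>\<sigma>::bool list. length \<sigma> = m x \<and> P x \<sigma>)"
  unfolding ex_strings by (intro cmp_intros cmp_app2[OF assms(1)] cmp_comp[OF assms(2)])

lemma str_encode_eq: "str_encode \<sigma> = enc \<sigma>"
  by (simp add: str_encode_def enc_list_def enc_bool_def[abs_def])

lemma length_restr [simp]: "length (restr X n) = n"
  by (simp add: restr_def)

lemma nth_restr [simp]: "i < n \<Longrightarrow> restr X n ! i = X i"
  by (simp add: restr_def)

lemma take_restr [simp]: "take m (restr X n) = restr X (min m n)"
  by (simp add: restr_def take_map take_upt min_def)

lemma restr_Suc: "restr X (Suc n) = restr X n @ [X n]"
  by (simp add: restr_def)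

lemma cmp_restr:
  assumes "cmp A X" "cmp A f" shows "cmp A (\<lambda>x. restr X (f x))"
  unfolding restr_def by (intro cmp_intros cmp_comp[OF assms(1)] cmp_comp[OF assms(2)])

lemma seq_of_tle_iff: "seq_of X \<le>\<^sub>T A \<longleftrightarrow> cmp A X"
  unfolding cmp_nat_iff[symmetric] unfolding cmp_def by (simp add: seq_of_def enc_nat_def enc_bool_def)

section \<open>Derivations of oracle computations\<close>

text \<open>
  A derivation lists triples \<open>(e, x, y)\<close> (program code, input, output), each justified by
  earlier ones, reading only a finite binary string of oracle answers. Checking one is decidable,
  which yields the use principle, a universal machine and computation stages at once.
\<close>

definition dstep :: "bool list \<Rightarrow> (nat \<times> nat \<times> nat) list \<Rightarrow> nat \<times> nat \<times> nat \<Rightarrow> bool" where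
  "dstep t D w = (let e = fst w; x = fst (snd w); y = snd (snd w) in
     if e = 0 then y = 0
     else if e = 1 then y = Suc x
     else if e = 2 then y = fst (prod_decode x)
     else if e = 3 then y = snd (prod_decode x)
     else if e = 4 then x < length t \<and> y = of_bool (nthd False t x)
     else let k = (e - 5) mod 4; c = (e - 5) div 4; a = fst (prod_decode c); b = snd (prod_decode c) in
       if k = 0 then (a, x, fst (prod_decode y)) \<in> set D \<and> (b, x, snd (prod_decode y)) \<in> set D
       else if k = 1 then \<exists>u\<in>set D. fst u = b \<and> fst (snd u) = x \<and> (a, snd (snd u), y) \<in> set D
       else if k = 2 then let x1 = fst (prod_decode x); x2 = snd (prod_decode x) in
         if x2 = 0 then (a, x1, y) \<in> set D
         else \<exists>u\<in>set D. fst u = e \<and> fst (snd u) = prod_encode (x1, x2 - 1) \<and>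
                (b, prod_encode (x1, prod_encode (x2 - 1, snd (snd u))), y) \<in> set D
       else (c, prod_encode (x, y), 0) \<in> set D \<and>
         (\<forall>m<y. \<exists>u\<in>set D. fst u = c \<and> fst (snd u) = prod_encode (x, m) \<and> snd (snd u) \<noteq> 0))"

definition der :: "bool list \<Rightarrow> (nat \<times> nat \<times> nat) list \<Rightarrow> bool" where
  "der t D \<longleftrightarrow> (\<forall>i<length D. dstep t (take i D) (nthd (0, 0, 0) D i))"

lemma cmp_dstep [cmp_intros]:
  assumes "cmp A t" "cmp A D" "cmp A w"
  shows "cmp A (\<lambda>x. dstep (t x) (D x) (w x))"
proof -
  have "cmp A (\<lambda>p. dstep (fst p) (fst (snd p)) (snd (snd p)))"
    unfolding dstep_def by (intro cmp_intros cmp_pdecode cmp_pencode)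
  from cmp_app3[OF this assms] show ?thesis .
qed

lemma cmp_der [cmp_intros]:
  assumes "cmp A t" "cmp A D"
  shows "cmp A (\<lambda>x. der (t x) (D x))"
  unfolding der_def by (intro cmp_intros cmp_comp[OF assms(1)] cmp_comp[OF assms(2)])

lemma if_mono:
  "(c \<Longrightarrow> P \<Longrightarrow> P') \<Longrightarrow> (\<not> c \<Longrightarrow> Q \<Longrightarrow> Q') \<Longrightarrow> (if c then P else Q) \<Longrightarrow> (if c then P' else Q')"
  by (auto split: if_splits)

lemma dstep_mono_D: "dstep t D w \<Longrightarrow> set D \<subseteq> set D' \<Longrightarrow> dstep t D' w"
  \<comment> \<open>\<open>D\<close> occurs only positively, so monotonicity is checked branch by
    branch.\<close>
  unfolding dstep_def Let_def
  apply (erule if_mono[rotated 2], assumption)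
  apply (erule if_mono[rotated 2], assumption)
  apply (erule if_mono[rotated 2], assumption)
  apply (erule if_mono[rotated 2], assumption)
  apply (erule if_mono[rotated 2], assumption)
  apply (erule if_mono[rotated 2], blast)
  apply (erule if_mono[rotated 2], blast)
  apply (erule if_mono[rotated 2])
   apply (erule if_mono[rotated 2], blast)
   apply blast
  apply blast
  done

lemma dstep_mono_t: "dstep t D w \<Longrightarrow> dstep (t @ t') D w"
proof (cases "fst w = 4")
  case True
  then show "dstep t D w \<Longrightarrow> dstep (t @ t') D w" by (auto simp: dstep_def Let_def nthd_def nth_append)
next
  case False
  then show "dstep t D w \<Longrightarrow> dstep (t @ t') D w" unfolding dstep_def Let_def by (simp only: if_False)
qed

lemma der_mono_t: "der t D \<Longrightarrow> der (t @ t') D"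
  unfolding der_def using dstep_mono_t by blast

lemma der_append: "der t D \<Longrightarrow> der t D' \<Longrightarrow> der t (D @ D')"
  unfolding der_def
proof (intro allI impI)
  fix i assume *: "\<forall>i<length D. dstep t (take i D) (nthd (0, 0, 0) D i)"
    "\<forall>i<length D'. dstep t (take i D') (nthd (0, 0, 0) D' i)" "i < length (D @ D')"
  show "dstep t (take i (D @ D')) (nthd (0, 0, 0) (D @ D') i)"
  proof (cases "i < length D")
    case True
    then show ?thesis using *(1) by (simp add: nth_append)
  next
    case False
    then have "dstep t (take (i - length D) D') (nthd (0, 0, 0) D' (i - length D))"
      using *(2,3) by auto
    then have "dstep t (take i (D @ D')) (nthd (0, 0, 0) D' (i - length D))"
      by (rule dstep_mono_D) auto
    then show ?thesis using False *(3) by (simp add: nth_append)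
  qed
qed

lemma der_snoc: "der t D \<Longrightarrow> dstep t D w \<Longrightarrow> der t (D @ [w])"
  unfolding der_def by (auto simp: less_Suc_eq nth_append)

text \<open>Codes from 5 on have the form \<open>5 + k + 4 * c\<close>, where \<open>k\<close> names
  the constructor and \<open>c\<close> codes its arguments.\<close>

lemma dstep_code:
  assumes "e = 5 + k + 4 * c" "k < 4"
  shows "dstep t D (e, x, y) \<longleftrightarrow> (let a = fst (prod_decode c); b = snd (prod_decode c) in
       if k = 0 then (a, x, fst (prod_decode y)) \<in> set D \<and> (b, x, snd (prod_decode y)) \<in> set D
       else if k = 1 then \<exists>u\<in>set D. fst u = b \<and> fst (snd u) = x \<and> (a, snd (snd u), y) \<in> set D
       else if k = 2 then let x1 = fst (prod_decode x); x2 = snd (prod_decode x) in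
         if x2 = 0 then (a, x1, y) \<in> set D
         else \<exists>u\<in>set D. fst u = e \<and> fst (snd u) = prod_encode (x1, x2 - 1) \<and>
                (b, prod_encode (x1, prod_encode (x2 - 1, snd (snd u))), y) \<in> set D
       else (c, prod_encode (x, y), 0) \<in> set D \<and>
         (\<forall>m<y. \<exists>u\<in>set D. fst u = c \<and> fst (snd u) = prod_encode (x, m) \<and> snd (snd u) \<noteq> 0))"
proof -
  have "e - 5 = k + c * 4" using assms by simp
  then have "(e - 5) mod 4 = k" "(e - 5) div 4 = c" using assms(2) by simp_all
  moreover have "e \<noteq> 0" "e \<noteq> 1" "e \<noteq> 2" "e \<noteq> 3" "e \<noteq> 4" using assms by simp_all
  ultimately show ?thesis unfolding dstep_def by (simp only: Let_def fst_conv snd_conv if_False)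
qed

lemma bex_triple: "(\<exists>u\<in>S. fst u = b \<and> fst (snd u) = x \<and> Q (snd (snd u))) \<longleftrightarrow> (\<exists>z. (b, x, z) \<in> S \<and> Q z)"
  by (metis fst_conv snd_conv prod.collapse)

lemma dstep_PPair: "dstep t D (prog_encode (PPair p q), x, y) \<longleftrightarrow>
    (prog_encode p, x, fst (prod_decode y)) \<in> set D \<and> (prog_encode q, x, snd (prod_decode y)) \<in> set D"
  by (subst dstep_code[of _ 0 "prod_encode (prog_encode p, prog_encode q)"]) simp_all

lemma dstep_PComp: "dstep t D (prog_encode (PComp p q), x, y) \<longleftrightarrow>
    (\<exists>u. (prog_encode q, x, u) \<in> set D \<and> (prog_encode p, u, y) \<in> set D)"
  by (subst dstep_code[of _ 1 "prod_encode (prog_encode p, prog_encode q)"]) (simp_all, rule bex_triple)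

lemma dstep_PPrec_0: "dstep t D (prog_encode (PPrec p q), prod_encode (a, 0), y) \<longleftrightarrow> (prog_encode p, a, y) \<in> set D"
  by (subst dstep_code[of _ 2 "prod_encode (prog_encode p, prog_encode q)"]) simp_all

lemma dstep_PPrec_Suc: "dstep t D (prog_encode (PPrec p q), prod_encode (a, Suc k), y) \<longleftrightarrow>
    (\<exists>u. (prog_encode (PPrec p q), prod_encode (a, k), u) \<in> set D \<and>
         (prog_encode q, prod_encode (a, prod_encode (k, u)), y) \<in> set D)"
  by (subst dstep_code[of _ 2 "prod_encode (prog_encode p, prog_encode q)"]) (simp_all, rule bex_triple)

lemma dstep_PMu: "dstep t D (prog_encode (PMu p), x, y) \<longleftrightarrow> (prog_encode p, prod_encode (x, y), 0) \<in> set D \<and>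
    (\<forall>m<y. \<exists>z. (prog_encode p, prod_encode (x, m), Suc z) \<in> set D)"
proof -
  have eq: "(\<exists>u\<in>set D. fst u = prog_encode p \<and> fst (snd u) = v \<and> snd (snd u) \<noteq> 0) \<longleftrightarrow>
      (\<exists>z. (prog_encode p, v, Suc z) \<in> set D)" for v
    unfolding bex_triple[where Q = "\<lambda>z. z \<noteq> 0"] by (metis not0_implies_Suc nat.distinct(1))
  have "dstep t D (prog_encode (PMu p), x, y) \<longleftrightarrow> (prog_encode p, prod_encode (x, y), 0) \<in> set D \<and>
    (\<forall>m<y. \<exists>u\<in>set D. fst u = prog_encode p \<and> fst (snd u) = prod_encode (x, m) \<and> snd (snd u) \<noteq> 0)"
    by (subst dstep_code[of _ 3 "prog_encode p"]) (simp_all add: Let_def)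
  then show ?thesis unfolding eq .
qed

lemma run_PPrec_Suc: "run (PPrec p q) A (prod_encode (a, Suc n)) =
   Option.bind (run (PPrec p q) A (prod_encode (a, n))) (\<lambda>y. run q A (prod_encode (a, prod_encode (n, y))))"
  by simp

lemma run_PMu_iff: "run (PMu p) A x = Some y \<longleftrightarrow> run p A (prod_encode (x, y)) = Some 0 \<and>
   (\<forall>m<y. \<exists>z. run p A (prod_encode (x, m)) = Some (Suc z))"
proof -
  define z where "z n \<longleftrightarrow> run p A (prod_encode (x, n)) = Some 0 \<and>
      (\<forall>m<n. \<exists>y. run p A (prod_encode (x, m)) = Some (Suc y))" for n
  have r: "run (PMu p) A x = (if \<exists>n. z n then Some (THE n. z n) else None)"
    by (simp only: run.simps Let_def z_def)
  have uniq: "m = n" if "z m" "z n" for m n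
  proof (rule ccontr)
    assume "m \<noteq> n"
    then consider "m < n" | "n < m" by linarith
    then show False by cases (use that in \<open>auto simp: z_def\<close>)
  qed
  have "run (PMu p) A x = Some y \<longleftrightarrow> z y"
  proof
    assume "run (PMu p) A x = Some y"
    then obtain n where "z n" "y = (THE n. z n)" unfolding r by (auto split: if_splits)
    then show "z y" using uniq by (metis the_equality)
  next
    assume "z y"
    then have "(THE n. z n) = y" using uniq by (intro the_equality) auto
    then show "run (PMu p) A x = Some y" unfolding r using \<open>z y\<close> by auto
  qed
  then show ?thesis by (simp add: z_def)
qed

lemma dstep_sound:
  assumes w: "dstep (restr X n) D (prog_encode p, x, y)"
    and D: "\<And>q x y. (prog_encode q, x, y) \<in> set D \<Longrightarrow> run q (seq_of X) x = Some y"
  shows "run p (seq_of X) x = Some y"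
proof (cases p)
  case (PPair p q)
  then have "(prog_encode p, x, fst (prod_decode y)) \<in> set D" "(prog_encode q, x, snd (prod_decode y)) \<in> set D"
    using w unfolding PPair dstep_PPair by auto
  from this[THEN D] show ?thesis by (simp add: PPair)
next
  case (PComp p q)
  then obtain u where "(prog_encode q, x, u) \<in> set D" "(prog_encode p, u, y) \<in> set D"
    using w unfolding PComp dstep_PComp by auto
  from this[THEN D] show ?thesis by (simp add: PComp)
next
  case (PPrec p q)
  obtain a k where x: "x = prod_encode (a, k)" by (metis prod_decode_inverse surj_pair)
  show ?thesis
  proof (cases k)
    case 0
    then have "(prog_encode p, a, y) \<in> set D" using w unfolding PPrec x dstep_PPrec_0 by (simp add: dstep_PPrec_0 del: prog_encode.simps)
    from this[THEN D] show ?thesis by (simp add: PPrec x 0)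
  next
    case (Suc k')
    then obtain z where z: "(prog_encode (PPrec p q), prod_encode (a, k'), z) \<in> set D"
      "(prog_encode q, prod_encode (a, prod_encode (k', z)), y) \<in> set D"
      using w unfolding PPrec x Suc dstep_PPrec_Suc by auto
    show ?thesis using D[OF z(1)] D[OF z(2)] unfolding PPrec x Suc run_PPrec_Suc by simp
  qed
next
  case (PMu p)
  show ?thesis unfolding PMu run_PMu_iff
    using w unfolding PMu dstep_PMu by (meson D)
qed (use w in \<open>auto simp: dstep_def Let_def seq_of_def\<close>)

lemma der_sound:
  assumes "der (restr X n) D" "(prog_encode p, x, y) \<in> set D"
  shows "run p (seq_of X) x = Some y"
proof -
  have "i \<le> length D \<Longrightarrow> \<forall>p x y. (prog_encode p, x, y) \<in> set (take i D) \<longrightarrow> run p (seq_of X) x = Some y" for i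
  proof (induction i)
    case (Suc i)
    then have IH: "\<And>p x y. (prog_encode p, x, y) \<in> set (take i D) \<Longrightarrow> run p (seq_of X) x = Some y" by simp
    have "dstep (restr X n) (take i D) (D ! i)"
      using assms(1) Suc.prems by (force simp: der_def)
    moreover have "set (take (Suc i) D) = insert (D ! i) (set (take i D))"
      using Suc.prems by (simp add: take_Suc_conv_app_nth)
    ultimately show ?case using dstep_sound IH by (metis insertE)
  qed simp
  from this[of "length D"] assms(2) show ?thesis by simp
qed

text \<open>Derivability from some initial segment of \<open>X\<close>. Finitely many derivable
  triples fit into one derivation, which is what the induction for completeness needs, in particular
  for the values below a minimum.\<close>

definition dv :: "(nat \<Rightarrow> bool) \<Rightarrow> nat \<times> nat \<times> nat \<Rightarrow> bool" where
  "dv X w \<longleftrightarrow> (\<exists>n D. der (restr X n) D \<and> w \<in> set D)"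

lemma restr_extend: "m \<le> n \<Longrightarrow> \<exists>t. restr X n = restr X m @ t"
  by (metis append_take_drop_id min.absorb1 take_restr)

lemma der_restr_mono: "der (restr X m) D \<Longrightarrow> m \<le> n \<Longrightarrow> der (restr X n) D"
  using restr_extend der_mono_t by metis

lemma dv_finite:
  assumes "finite S" "\<And>w. w \<in> S \<Longrightarrow> dv X w"
  shows "\<exists>n D. der (restr X n) D \<and> S \<subseteq> set D"
  using assms
proof (induction S rule: finite_induct)
  case empty
  then show ?case by (intro exI[of _ 0] exI[of _ "[]"]) (simp add: der_def)
next
  case (insert w S)
  then obtain n D m D' where 1: "der (restr X n) D" "S \<subseteq> set D" "der (restr X m) D'" "w \<in> set D'"
    unfolding dv_def by (metis insertCI)
  then have "der (restr X (max m n)) (D @ D')"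
    by (meson der_append der_restr_mono max.cobounded1 max.cobounded2)
  with 1 show ?case by (intro exI[of _ "max m n"] exI[of _ "D @ D'"]) auto
qed

lemma dv_step:
  assumes "finite S" "\<And>w. w \<in> S \<Longrightarrow> dv X w" "\<And>t D. S \<subseteq> set D \<Longrightarrow> dstep t D w"
  shows "dv X w"
proof -
  obtain n D where "der (restr X n) D" "S \<subseteq> set D" using dv_finite[OF assms(1,2)] by blast
  then have "der (restr X n) (D @ [w])" using der_snoc assms(3) by blast
  then show ?thesis unfolding dv_def by (metis in_set_conv_decomp)
qed

lemma dv_complete: "run p (seq_of X) x = Some y \<Longrightarrow> dv X (prog_encode p, x, y)"
proof (induction p arbitrary: x y)
  case POracle
  have "der (restr X (Suc x)) [(4, x, y)]"
    using POracle by (simp add: der_def dstep_def Let_def nthd_def seq_of_def)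
  then show ?case unfolding dv_def by fastforce
next
  case (PPair p q)
  then obtain u v where uv: "run p (seq_of X) x = Some u" "run q (seq_of X) x = Some v" "y = prod_encode (u, v)"
    by (auto split: Option.bind_splits)
  show ?case
    by (rule dv_step[where S = "{(prog_encode p, x, u), (prog_encode q, x, v)}"])
      (use uv(3) PPair.IH(1)[OF uv(1)] PPair.IH(2)[OF uv(2)] in \<open>auto simp: dstep_PPair simp del: prog_encode.simps\<close>)
next
  case (PComp p q)
  then obtain u where u: "run q (seq_of X) x = Some u" "run p (seq_of X) u = Some y"
    by (auto split: Option.bind_splits)
  show ?case
    by (rule dv_step[where S = "{(prog_encode q, x, u), (prog_encode p, u, y)}"])
      (use PComp.IH(2)[OF u(1)] PComp.IH(1)[OF u(2)] in \<open>auto simp: dstep_PComp simp del: prog_encode.simps\<close>)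
next
  case (PPrec p q)
  have "run (PPrec p q) (seq_of X) (prod_encode (a, k)) = Some y \<Longrightarrow> dv X (prog_encode (PPrec p q), prod_encode (a, k), y)" for a k y
  proof (induction k arbitrary: y)
    case 0
    then have "run p (seq_of X) a = Some y" by simp
    from PPrec.IH(1)[OF this] have "dv X (prog_encode p, a, y)" .
    then show ?case
      by (rule_tac dv_step[where S = "{(prog_encode p, a, y)}"]) (simp_all only: dstep_PPrec_0 finite.intros, simp_all)
  next
    case (Suc k)
    then obtain z where z: "run (PPrec p q) (seq_of X) (prod_encode (a, k)) = Some z"
      "run q (seq_of X) (prod_encode (a, prod_encode (k, z))) = Some y"
      unfolding run_PPrec_Suc by (auto split: Option.bind_splits)
    show ?case
      by (rule dv_step[where S = "{(prog_encode (PPrec p q), prod_encode (a, k), z),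
            (prog_encode q, prod_encode (a, prod_encode (k, z)), y)}"])
        (use Suc.IH[OF z(1)] PPrec.IH(2)[OF z(2)] in
          \<open>auto simp: dstep_PPrec_Suc simp del: prog_encode.simps\<close>)
  qed
  then show ?case using PPrec.prems by (metis prod_decode_inverse surj_pair)
next
  case (PMu p)
  then have r: "run p (seq_of X) (prod_encode (x, y)) = Some 0"
    "\<forall>m<y. \<exists>z. run p (seq_of X) (prod_encode (x, m)) = Some (Suc z)"
    unfolding run_PMu_iff by auto
  then obtain z where z: "\<And>m. m < y \<Longrightarrow> run p (seq_of X) (prod_encode (x, m)) = Some (Suc (z m))" by metis
  let ?S = "insert (prog_encode p, prod_encode (x, y), 0) ((\<lambda>m. (prog_encode p, prod_encode (x, m), Suc (z m))) ` {..<y})"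
  show ?case
  proof (rule dv_step[where S = ?S])
    fix t D assume S: "?S \<subseteq> set D"
    then show "dstep t D (prog_encode (PMu p), x, y)"
      unfolding dstep_PMu by blast
  qed (use r(1) z PMu.IH in auto)
qed (rule dv_step[where S = "{}"], auto simp: dstep_def Let_def)+

text \<open>The stage \<open>s\<close> bounds the code of a derivation instead of a running time.
  The relation is decidable and persists when the stage or the oracle string grows.\<close>

definition evb :: "nat \<Rightarrow> bool list \<Rightarrow> nat \<Rightarrow> nat \<Rightarrow> nat \<Rightarrow> bool" where
  "evb s t e x y \<longleftrightarrow> (\<exists>c<s. der t (dec c) \<and> (e, x, y) \<in> set (dec c))"

lemma cmp_evb [cmp_intros]:
  assumes "cmp A s" "cmp A t" "cmp A e" "cmp A x" "cmp A y"
  shows "cmp A (\<lambda>z. evb (s z) (t z) (e z) (x z) (y z))"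
  unfolding evb_def
  by (intro cmp_intros cmp_comp[OF assms(1)] cmp_comp[OF assms(2)] cmp_comp[OF assms(3)]
      cmp_comp[OF assms(4)] cmp_comp[OF assms(5)])

lemma evb_mono: "evb s t e x y \<Longrightarrow> s \<le> s' \<Longrightarrow> evb s' (t @ t') e x y"
  unfolding evb_def using der_mono_t by (meson less_le_trans)

lemma evb_restr_mono: "evb s (restr X n) e x y \<Longrightarrow> s \<le> s' \<Longrightarrow> n \<le> n' \<Longrightarrow> evb s' (restr X n') e x y"
  using evb_mono restr_extend by metis

lemma evb_sound: "evb s (restr X n) (prog_encode e) x y \<Longrightarrow> run e (seq_of X) x = Some y"
  unfolding evb_def using der_sound by blast

lemma evb_complete:
  assumes "run e (seq_of X) x = Some y"
  shows "\<exists>n. \<forall>s\<ge>n. evb s (restr X s) (prog_encode e) x y"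
proof -
  obtain n D where nD: "der (restr X n) D" "(prog_encode e, x, y) \<in> set D"
    using dv_complete[OF assms] unfolding dv_def by blast
  have "evb (Suc (enc D)) (restr X n) (prog_encode e) x y"
    unfolding evb_def by (intro exI[of _ "enc D"]) (use nD in simp)
  then show ?thesis
    using evb_restr_mono by (intro exI[of _ "max n (Suc (enc D))"]) fastforce
qed

lemma restr_of_string: "restr (\<lambda>i. nthd False t i) (length t) = t"
  by (rule nth_equalityI) auto

text \<open>By soundness, since both values are correct for the sequence that continues the longer
  string with zeros.\<close>

lemma evb_fun:
  assumes "evb s t e x y" "evb s' (t @ t') e x y'"
  shows "y = y'"
proof -
  obtain p where p: "e = prog_encode p" using bij_prog_encode by (metis bij_pointE)
  let ?X = "nthd False (t @ t')"
  have "evb s (t @ t') e x y" using evb_mono[OF assms(1) order_refl] .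
  then show ?thesis
    using assms(2) evb_sound[of _ ?X "length (t @ t')" p x] unfolding p restr_of_string
    by (metis option.inject)
qed

lemma seq_of_False: "seq_of (\<lambda>_. False) = (\<lambda>_. 0)"
  by (simp add: seq_of_def fun_eq_iff)

lemma restr_False: "restr (\<lambda>_. False) n = replicate n False"
  by (simp add: restr_def map_replicate_const)

section \<open>Semidecidable predicates\<close>

definition sd :: "('a::enc \<Rightarrow> bool) \<Rightarrow> bool" where
  "sd P \<longleftrightarrow> (\<exists>R :: nat \<Rightarrow> 'a \<Rightarrow> bool. cmp (\<lambda>_. 0) (\<lambda>p. R (fst p) (snd p)) \<and> (\<forall>x. P x \<longleftrightarrow> (\<exists>s. R s x)))"

lemma sdI:
  fixes R :: "'b::enc \<Rightarrow> 'a::enc \<Rightarrow> bool"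
  assumes "cmp (\<lambda>_. 0) (\<lambda>p. R (fst p) (snd p))" "\<And>x. P x \<longleftrightarrow> (\<exists>s. R s x)"
  shows "sd P"
  unfolding sd_def
proof (intro exI conjI allI)
  show "cmp (\<lambda>_. 0) (\<lambda>p. R (dec (fst p)) (snd p) :: bool)" by (intro cmp_app2[OF assms(1)] cmp_intros)
  show "P x \<longleftrightarrow> (\<exists>s. R (dec s) x)" for x
    using assms(2) by (metis dec_enc)
qed

text \<open>The search rejects numbers that are not codes by the test
  \<open>enc (dec n) = n\<close>; otherwise every number decoding to an element would be
  enumerated.\<close>

lemma ce_of_sd:
  assumes "sd P" shows "ce {enc x | x. P x}"
proof -
  obtain R where R: "cmp (\<lambda>_. 0) (\<lambda>p. R (fst p) (snd p))" "\<And>x. P x \<longleftrightarrow> (\<exists>s::nat. R s x)"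
    using assms unfolding sd_def by blast
  have "cmp (\<lambda>_. 0) (\<lambda>p. of_bool (\<not> (enc (dec (fst p) :: 'a) = fst p \<and> R (snd p) (dec (fst p)))) :: nat)"
    by (intro cmp_intros cmp_app2[OF R(1)])
  then obtain e where "\<And>p::nat\<times>nat. run0 e (enc p) = Some (enc (of_bool (\<not> (enc (dec (fst p) :: 'a) = fst p \<and> R (snd p) (dec (fst p)))) :: nat))"
    unfolding cmp_def by blast
  from this[of "(_, _)"] have e: "run0 e (prod_encode (n, s)) = Some (of_bool (\<not> (enc (dec n :: 'a) = n \<and> R s (dec n))))" for n s
    by (simp add: enc_prod_def enc_nat_def)
  have 1: "run0 (PMu e) n \<noteq> None \<longleftrightarrow> (\<exists>y. run0 (PMu e) n = Some y)" for n by blast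
  have 2: "(\<exists>y. run0 (PMu e) n = Some y) \<longleftrightarrow> (\<exists>s. enc (dec n :: 'a) = n \<and> R s (dec n))" for n
  proof
    assume ex: "\<exists>s. enc (dec n :: 'a) = n \<and> R s (dec n)"
    define Q where "Q s \<longleftrightarrow> enc (dec n :: 'a) = n \<and> R s (dec n)" for s
    have e': "run0 e (prod_encode (n, s)) = Some (of_bool (\<not> Q s))" for s
      unfolding Q_def by (rule e)
    have "\<exists>s. Q s" using ex unfolding Q_def .
    then have "Q (LEAST s. Q s)" by (rule LeastI_ex)
    moreover have "\<not> Q m" if "m < (LEAST s. Q s)" for m
      using not_less_Least[OF that] .
    ultimately have "run0 (PMu e) n = Some (LEAST s. Q s)"
      unfolding run_PMu_iff e' by (metis of_bool_eq(1,2) One_nat_def)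
    then show "\<exists>y. run0 (PMu e) n = Some y" by blast
  next
    assume "\<exists>y. run0 (PMu e) n = Some y"
    then obtain y where "run0 (PMu e) n = Some y" ..
    then have "of_bool (\<not> (enc (dec n :: 'a) = n \<and> R y (dec n))) = (0::nat)"
      unfolding run_PMu_iff e by simp
    then show "\<exists>s. enc (dec n :: 'a) = n \<and> R s (dec n)" by auto
  qed
  have 3: "(\<exists>s. enc (dec n :: 'a) = n \<and> R s (dec n)) \<longleftrightarrow> n \<in> {enc x | x. P x}" for n
    using R(2) by (auto; metis dec_enc)
  have "{enc x | x. P x} = {n. run0 (PMu e) n \<noteq> None}"
    unfolding 1 2 3 by (simp only: Collect_mem_eq)
  then show ?thesis unfolding ce_def by (rule exI)
qed

lemma ce_iff_sd: "ce W \<longleftrightarrow> sd (\<lambda>n. n \<in> W)"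
proof
  assume "ce W"
  then obtain e where W: "W = {n. run0 e n \<noteq> None}" unfolding ce_def by blast
  show "sd (\<lambda>n. n \<in> W)"
  proof (rule sdI[where R = "\<lambda>p n. evb (fst p) (replicate (fst p) False) (prog_encode e) n (snd p)"])
    show "cmp (\<lambda>_. 0) (\<lambda>p. evb (fst (fst p)) (replicate (fst (fst p)) False) (prog_encode e) (snd p) (snd (fst p)))"
      by (intro cmp_intros)
    show "(n \<in> W) = (\<exists>p. evb (fst p) (replicate (fst p) False) (prog_encode e) n (snd p))" for n
      unfolding W restr_False[symmetric]
      using evb_sound[of _ "\<lambda>_. False" _ e n] evb_complete[of e "\<lambda>_. False" n] unfolding seq_of_False
      by fastforce
  qed
next
  assume "sd (\<lambda>n. n \<in> W)"
  from ce_of_sd[OF this] show "ce W" by (simp add: enc_nat_def)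
qed

lemma ce_strings_iff: "ce W \<Longrightarrow> sd (\<lambda>x. enc x \<in> W)"
proof -
  assume "ce W"
  then obtain R where R: "cmp (\<lambda>_. 0) (\<lambda>p. R (fst p) (snd p))" "\<And>x. x \<in> W \<longleftrightarrow> (\<exists>s::nat. R s x)"
    unfolding ce_iff_sd sd_def by blast
  show ?thesis
    by (rule sdI[where R = "\<lambda>s x. R s (enc x)"]) (auto simp: R(2) intro!: cmp_app2[OF R(1)] cmp_intros)
qed

subsection \<open>Effectively closed classes as paths through computable trees\<close>

definition dtree :: "(bool list \<Rightarrow> bool) \<Rightarrow> bool" where
  "dtree T \<longleftrightarrow> cmp (\<lambda>_. 0) T \<and> (\<forall>\<sigma> n. T \<sigma> \<longrightarrow> T (take n \<sigma>))"

definition paths :: "(bool list \<Rightarrow> bool) \<Rightarrow> (nat \<Rightarrow> bool) set" where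
  "paths T = {X. \<forall>n. T (restr X n)}"

lemma Pi01I:
  fixes R :: "'b::enc \<Rightarrow> bool list \<Rightarrow> bool"
  assumes "cmp (\<lambda>_. 0) (\<lambda>p. R (fst p) (snd p))" "\<And>X. X \<in> P \<longleftrightarrow> (\<forall>s n. R s (restr X n))"
  shows "Pi01 P"
proof -
  have "sd (\<lambda>\<sigma>. \<exists>s. \<not> R s \<sigma>)"
    by (rule sdI[where R = "\<lambda>s \<sigma>. \<not> R s \<sigma>"]) (auto intro!: cmp_intros cmp_app2[OF assms(1)])
  then have "ce {enc \<sigma> | \<sigma>. \<exists>s. \<not> R s \<sigma>}" by (rule ce_of_sd)
  then show ?thesis unfolding Pi01_def str_encode_eq
    by (intro exI[of _ "{enc \<sigma> | \<sigma>. \<exists>s. \<not> R s \<sigma>}"] conjI) (use assms(2) in auto)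
qed

text \<open>A string is dropped when some prefix of it is seen to be enumerated at a stage not
  beyond its length. This makes the tree decidable and closed under prefixes, and a sequence outside
  the class still leaves it at some later length.\<close>

lemma Pi01_iff_tree: "Pi01 P \<longleftrightarrow> (\<exists>T. dtree T \<and> P = paths T)"
proof
  assume "Pi01 P"
  then obtain W where W: "ce W" "P = {X. \<forall>n. enc (restr X n) \<notin> W}" unfolding Pi01_def str_encode_eq by blast
  obtain R where R: "cmp (\<lambda>_. 0) (\<lambda>p. R (fst p) (snd p))" "\<And>\<sigma>::bool list. enc \<sigma> \<in> W \<longleftrightarrow> (\<exists>s::nat. R s \<sigma>)"
    using ce_strings_iff[OF W(1)] unfolding sd_def by blast
  define T where "T \<sigma> \<longleftrightarrow> (\<forall>n\<le>length \<sigma>. \<forall>s\<le>length \<sigma>. \<not> R s (take n \<sigma>))" for \<sigma>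
  have "cmp (\<lambda>_. 0) T"
    unfolding T_def[abs_def] by (intro cmp_intros cmp_app2[OF R(1)])
  moreover have "T (take n \<sigma>)" if "T \<sigma>" for n \<sigma>
    using that by (simp add: T_def min_def)
  moreover have "X \<in> P \<longleftrightarrow> X \<in> paths T" for X
  proof
    assume "X \<in> paths T"
    then have T1: "T (restr X (max n s))" for n s by (simp add: paths_def)
    have "\<not> R s (restr X n)" for n s
    proof -
      have "n \<le> length (restr X (max n s))" "s \<le> length (restr X (max n s))" by simp_all
      then have "\<not> R s (take n (restr X (max n s)))" using T1[of n s] unfolding T_def by blast
      moreover have "min n (max n s) = n" by simp
      ultimately show ?thesis by (metis take_restr)
    qed
    then show "X \<in> P" by (simp add: W(2) R(2))
  qed (auto simp: W(2) R(2) paths_def T_def)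
  ultimately show "\<exists>T. dtree T \<and> P = paths T" unfolding dtree_def by blast
next
  assume "\<exists>T. dtree T \<and> P = paths T"
  then obtain T where T: "cmp (\<lambda>_. 0) T" "P = paths T" unfolding dtree_def by blast
  show "Pi01 P"
    by (rule Pi01I[where R = "\<lambda>s::nat. T"]) (auto simp: T(2) paths_def intro!: cmp_comp[OF T(1)] cmp_intros)
qed

text \<open>The step of Koenig's lemma: if both one-bit extensions failed, each at some length, an
  extension of \<sigma> at the larger of these lengths would refute one failure after
  truncation.\<close>

lemma konig_step:
  assumes "\<And>n. n \<ge> length \<sigma> \<Longrightarrow> \<exists>\<tau>. length \<tau> = n \<and> take (length \<sigma>) \<tau> = \<sigma> \<and> T \<tau>"
    and T: "\<And>\<sigma> n. T \<sigma> \<Longrightarrow> T (take n \<sigma>)"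
  shows "\<exists>b::bool. \<forall>n\<ge>length (\<sigma> @ [b]). \<exists>\<tau>. length \<tau> = n \<and> take (length (\<sigma> @ [b])) \<tau> = \<sigma> @ [b] \<and> T \<tau>"
proof (rule ccontr)
  assume "\<not> ?thesis"
  then have *: "\<exists>n\<ge>length \<sigma> + 1. \<not> (\<exists>\<tau>. length \<tau> = n \<and> take (length \<sigma> + 1) \<tau> = \<sigma> @ [b] \<and> T \<tau>)" for b
    by auto
  obtain n where n: "n \<ge> length \<sigma> + 1" "\<not> (\<exists>\<tau>. length \<tau> = n \<and> take (length \<sigma> + 1) \<tau> = \<sigma> @ [True] \<and> T \<tau>)"
    using *[of True] by blast
  obtain m where m: "m \<ge> length \<sigma> + 1" "\<not> (\<exists>\<tau>. length \<tau> = m \<and> take (length \<sigma> + 1) \<tau> = \<sigma> @ [False] \<and> T \<tau>)"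
    using *[of False] by blast
  obtain \<tau> where \<tau>: "length \<tau> = max m n" "take (length \<sigma>) \<tau> = \<sigma>" "T \<tau>"
    using assms(1)[of "max m n"] n(1) by (meson add_leE le_max_iff_disj)
  have *: "take (length \<sigma> + 1) \<tau> = \<sigma> @ [\<tau> ! length \<sigma>]"
    using \<tau> n(1) by (simp add: take_Suc_conv_app_nth max_def)
  show False
  proof (cases "\<tau> ! length \<sigma>")
    case True
    have "length (take n \<tau>) = n" "take (length \<sigma> + 1) (take n \<tau>) = \<sigma> @ [True]" "T (take n \<tau>)"
      using \<tau> n(1) * True T by (auto simp: min_def)
    then show False using n(2) by blast
  next
    case False
    have "length (take m \<tau>) = m" "take (length \<sigma> + 1) (take m \<tau>) = \<sigma> @ [False]" "T (take m \<tau>)"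
      using \<tau> m(1) * False T by (auto simp: min_def)
    then show False using m(2) by blast
  qed
qed

lemma konig:
  assumes ext: "\<And>n. n \<ge> length \<sigma> \<Longrightarrow> \<exists>\<tau>. length \<tau> = n \<and> take (length \<sigma>) \<tau> = \<sigma> \<and> T \<tau>"
    and T: "\<And>\<sigma> n. T \<sigma> \<Longrightarrow> T (take n \<sigma>)"
  shows "\<exists>X\<in>paths T. restr X (length \<sigma>) = \<sigma>"
proof -
  define E where "E \<rho> \<longleftrightarrow> (\<forall>n\<ge>length \<rho>. \<exists>\<tau>. length \<tau> = n \<and> take (length \<rho>) \<tau> = \<rho> \<and> T \<tau>)" for \<rho> :: "bool list"
  have step: "\<exists>b. E (\<rho> @ [b])" if "E \<rho>" for \<rho>
    using konig_step[of \<rho> T] that T unfolding E_def by blast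
  define f where "f = rec_nat \<sigma> (\<lambda>i \<rho>. \<rho> @ [SOME b. E (\<rho> @ [b])])"
  have fS: "f (Suc i) = f i @ [SOME b. E (f i @ [b])]" and f0: "f 0 = \<sigma>" for i by (simp_all add: f_def)
  have E: "E (f i)" for i
  proof (induction i)
    case 0
    then show ?case using ext by (simp add: E_def f0)
  next
    case (Suc i)
    show ?case unfolding fS using someI_ex[OF step[OF Suc]] .
  qed
  have len: "length (f i) = length \<sigma> + i" for i by (induction i) (simp_all add: f0 fS)
  have pre: "take (length (f i)) (f (i + j)) = f i" for i j
    by (induction j) (simp_all add: fS len)
  define X where "X n = f (Suc n) ! n" for n
  have X: "X n = f j ! n" if "n < length \<sigma> + j" for n j
  proof (cases "j \<le> Suc n")
    case True
    have "f j = take (length (f j)) (f (Suc n))" using pre[of j "Suc n - j"] True by simp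
    then have "f j ! n = take (length (f j)) (f (Suc n)) ! n" by simp
    then show ?thesis using that by (simp add: X_def len)
  next
    case False
    have "f (Suc n) = take (length (f (Suc n))) (f j)" using pre[of "Suc n" "j - Suc n"] False by simp
    then have "f (Suc n) ! n = take (length (f (Suc n))) (f j) ! n" by simp
    then show ?thesis using that by (simp add: X_def len)
  qed
  have r: "restr X (length \<sigma> + j) = f j" for j
    by (rule nth_equalityI) (simp_all add: len X)
  have "T (restr X n)" for n
  proof -
    have "T (f n)" using E[of n] unfolding E_def
      by (metis order_refl take_all_iff)
    then have "T (take n (f n))" by (rule T)
    then show ?thesis using r[of n] by (metis le_add2 min.absorb1 take_restr)
  qed
  then show ?thesis using r[of 0] f0 by (intro bexI[of _ X]) (auto simp: paths_def)
qed

section \<open>Left computably enumerable semimeasures\<close>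

lemma int_decode_eq: "int_decode n = (if even n then int (Suc n div 2) else - int (Suc n div 2))"
  by (auto simp: int_decode_def sum_decode_def elim!: oddE)

lemma real_of_rat_Fract: "real_of_rat (Fract a b) = real_of_int a / real_of_int b"
  by (cases "b = 0") (simp_all add: of_rat_rat rat_number_collapse)

lemma real_of_nat_to_rat_surj:
  fixes c :: nat
  defines "a \<equiv> fst (prod_decode c)" and "b \<equiv> snd (prod_decode c)"
  shows "real_of_rat (nat_to_rat_surj c) =
    (if even a = even b then 1 else -1) * (real (Suc a div 2) / real (Suc b div 2))"
proof -
  have i: "real_of_int (int_decode n) = (if even n then real (Suc n div 2) else - real (Suc n div 2))" for n
    unfolding int_decode_eq by (simp only: of_int_of_nat_eq of_int_minus split: if_split) simp
  have "real_of_rat (nat_to_rat_surj c) = real_of_int (int_decode a) / real_of_int (int_decode b)"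
    by (simp add: nat_to_rat_surj_def case_prod_beta real_of_rat_Fract a_def b_def)
  then show ?thesis unfolding i
    by (cases "even a"; cases "even b") (simp_all only: if_True if_False minus_divide_left[symmetric]
        minus_divide_right[symmetric] minus_minus mult_1_left mult_minus1 simp_thms)
qed

text \<open>The rational approximations, cut off at 0, are rounded down to multiples of
  \<open>(1/2) ^ s\<close>. These grids refine each other, so the result still increases, and the
  rounding error vanishes. Searches then concern natural numbers only.\<close>

lemma left_re_approx:
  assumes "left_re \<nu>" and pos: "\<And>\<sigma>. 0 \<le> \<nu> \<sigma>"
  obtains m :: "nat \<Rightarrow> bool list \<Rightarrow> nat" where "cmp (\<lambda>_. 0) (\<lambda>p. m (fst p) (snd p))"
    "\<And>\<sigma>. incseq (\<lambda>s. real (m s \<sigma>) / 2 ^ s)" "\<And>\<sigma>. (\<lambda>s. real (m s \<sigma>) / 2 ^ s) \<longlonglongrightarrow> \<nu> \<sigma>"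
proof -
  obtain f where f: "cmp (\<lambda>_. 0) f" and f': "\<And>\<sigma>. let q = (\<lambda>s. real_of_rat (nat_to_rat_surj (f (prod_encode (s, enc \<sigma>)))))
          in incseq q \<and> q \<longlonglongrightarrow> \<nu> \<sigma>"
    using assms(1) unfolding left_re_def computable_iff_cmp str_encode_eq by blast
  define q where "q s \<sigma> = real_of_rat (nat_to_rat_surj (f (prod_encode (s, enc \<sigma>))))" for s and \<sigma> :: "bool list"
  have q: "incseq (\<lambda>s. q s \<sigma>)" "(\<lambda>s. q s \<sigma>) \<longlonglongrightarrow> \<nu> \<sigma>" for \<sigma>
    using f'[of \<sigma>] unfolding Let_def q_def by auto
  define m where "m s \<sigma> = (let c = prod_decode (f (prod_encode (s, enc \<sigma>))) in
      if even (fst c) = even (snd c) then (2 ^ s * (Suc (fst c) div 2)) div (Suc (snd c) div 2) else 0)" for s and \<sigma> :: "bool list"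
  have m: "int (m s \<sigma>) = \<lfloor>2 ^ s * max 0 (q s \<sigma>)\<rfloor>" for s \<sigma>
  proof -
    define c where "c = prod_decode (f (prod_encode (s, enc \<sigma>)))"
    define a b where "a = Suc (fst c) div 2" and "b = Suc (snd c) div 2"
    show ?thesis
    proof (cases "even (fst c) = even (snd c)")
      case True
      have "q s \<sigma> = real a / real b"
        using True unfolding q_def real_of_nat_to_rat_surj a_def b_def c_def by simp
      then have "2 ^ s * max 0 (q s \<sigma>) = real (2 ^ s * a) / real b"
        by (simp add: max_absorb2)
      moreover have "m s \<sigma> = (2 ^ s * a) div b"
        using True by (simp add: m_def Let_def a_def b_def c_def)
      ultimately show ?thesis by (simp only: floor_divide_of_nat_eq)
    next
      case False
      have "q s \<sigma> \<le> 0"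
        using False unfolding q_def real_of_nat_to_rat_surj c_def by simp
      then have "max 0 (q s \<sigma>) = 0" by simp
      moreover have "m s \<sigma> = 0" using False by (simp add: m_def Let_def c_def)
      ultimately show ?thesis by simp
    qed
  qed
  have m_le: "real (m s \<sigma>) / 2 ^ s \<le> max 0 (q s \<sigma>)" for s \<sigma>
  proof -
    have "real (m s \<sigma>) \<le> 2 ^ s * max 0 (q s \<sigma>)"
      using m[of s \<sigma>] by (metis of_int_floor_le of_int_of_nat_eq)
    then show ?thesis by (simp add: field_simps)
  qed
  have m_ge: "real (m s \<sigma>) / 2 ^ s \<ge> max 0 (q s \<sigma>) - (1/2) ^ s" for s \<sigma>
  proof -
    have "real_of_int (int (m s \<sigma>)) > 2 ^ s * max 0 (q s \<sigma>) - 1"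
      unfolding m by linarith
    then have "(2 ^ s * max 0 (q s \<sigma>) - 1) / 2 ^ s \<le> real (m s \<sigma>) / 2 ^ s"
      by (intro divide_right_mono) auto
    then show ?thesis by (simp add: diff_divide_distrib power_one_over)
  qed
  show thesis
  proof (rule that)
    show "cmp (\<lambda>_. 0) (\<lambda>p. m (fst p) (snd p))"
      unfolding m_def by (intro cmp_intros cmp_pdecode cmp_pencode cmp_comp[OF f])
    show "incseq (\<lambda>s. real (m s \<sigma>) / 2 ^ s)" for \<sigma>
    proof (rule incseq_SucI)
      fix s
      have "real (m s \<sigma>) \<le> 2 ^ s * max 0 (q s \<sigma>)" using m_le[of s \<sigma>] by (simp add: field_simps)
      also have "\<dots> \<le> 2 ^ s * max 0 (q (Suc s) \<sigma>)"
        using q(1)[of \<sigma>] by (intro mult_left_mono) (auto simp: incseq_Suc_iff intro: max.coboundedI2)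
      finally have "real_of_int (int (2 * m s \<sigma>)) \<le> 2 ^ Suc s * max 0 (q (Suc s) \<sigma>)" by simp
      then have "int (2 * m s \<sigma>) \<le> int (m (Suc s) \<sigma>)" unfolding m le_floor_iff by simp
      then have "real (2 * m s \<sigma>) \<le> real (m (Suc s) \<sigma>)" by linarith
      then show "real (m s \<sigma>) / 2 ^ s \<le> real (m (Suc s) \<sigma>) / 2 ^ Suc s" by (simp add: field_simps)
    qed
    have *: "(\<lambda>s. max 0 (q s \<sigma>)) \<longlonglongrightarrow> \<nu> \<sigma>" for \<sigma>
      using tendsto_max[OF tendsto_const q(2), of 0 \<sigma>] pos[of \<sigma>] by (simp add: max_absorb2)
    have **: "(\<lambda>s. max 0 (q s \<sigma>) - (1/2) ^ s) \<longlonglongrightarrow> \<nu> \<sigma> - 0" for \<sigma>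
      by (intro tendsto_diff * LIMSEQ_power_zero) simp
    show "(\<lambda>s. real (m s \<sigma>) / 2 ^ s) \<longlonglongrightarrow> \<nu> \<sigma>" for \<sigma>
      using tendsto_sandwich[OF _ _ **[of \<sigma>, simplified] *[of \<sigma>]] m_le m_ge by simp
  qed
qed

lemma left_reI:
  fixes m :: "nat \<Rightarrow> bool list \<Rightarrow> nat"
  assumes m: "cmp (\<lambda>_. 0) (\<lambda>p. m (fst p) (snd p))"
    and "\<And>\<sigma>. incseq (\<lambda>s. real (m s \<sigma>) / 2 ^ s)" "\<And>\<sigma>. (\<lambda>s. real (m s \<sigma>) / 2 ^ s) \<longlonglongrightarrow> \<nu> \<sigma>"
  shows "left_re \<nu>"
  unfolding left_re_def computable_iff_cmp str_encode_eq
proof (intro exI conjI allI)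
  \<comment> \<open>An even code decodes to half of itself as an integer, hence the two factors
    2.\<close>
  let ?f = "\<lambda>n. prod_encode (2 * m (fst (prod_decode n)) (dec (snd (prod_decode n))), 2 * 2 ^ fst (prod_decode n))"
  show "cmp (\<lambda>_. 0) ?f" by (intro cmp_intros cmp_pencode cmp_pdecode cmp_app2[OF m])
  have "real_of_rat (nat_to_rat_surj (?f (prod_encode (s, enc \<sigma>)))) = real (m s \<sigma>) / 2 ^ s" for s \<sigma>
    by (simp add: real_of_nat_to_rat_surj)
  then show "let q = \<lambda>s. real_of_rat (nat_to_rat_surj (?f (prod_encode (s, enc \<sigma>))))
         in incseq q \<and> q \<longlonglongrightarrow> \<nu> \<sigma>" for \<sigma>
    using assms(2,3) by (simp add: Let_def)
qed

lemma card_strings_double: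
  assumes "\<And>\<rho> b. length \<rho> = s \<Longrightarrow> P \<rho> \<Longrightarrow> Q (\<rho> @ [b])"
  shows "2 * card {\<rho>::bool list. length \<rho> = s \<and> P \<rho>} \<le> card {\<rho>. length \<rho> = Suc s \<and> Q \<rho>}"
proof -
  let ?S = "{\<rho>::bool list. length \<rho> = s \<and> P \<rho>}"
  have "card ((\<lambda>(\<rho>, b). \<rho> @ [b]) ` (?S \<times> (UNIV :: bool set))) = card (?S \<times> (UNIV :: bool set))"
    by (rule card_image) (auto simp: inj_on_def)
  also have "\<dots> = 2 * card ?S" by (simp add: card_cartesian_product)
  finally have "2 * card ?S = card ((\<lambda>(\<rho>, b). \<rho> @ [b]) ` (?S \<times> (UNIV :: bool set)))" by simp
  also have "\<dots> \<le> card {\<rho>. length \<rho> = Suc s \<and> Q \<rho>}"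
    by (rule card_mono) (use assms in auto)
  finally show ?thesis .
qed

locale universal =
  fixes M :: "bool list \<Rightarrow> real"
  assumes universal: "universal_semimeasure M"
begin

lemma M_nonneg [simp]: "0 \<le> M \<sigma>" and M_le_1: "M \<sigma> \<le> 1" and M_Nil [simp]: "M [] = 1"
  and M_superadd: "M (\<sigma> @ [False]) + M (\<sigma> @ [True]) \<le> M \<sigma>"
  using universal unfolding universal_semimeasure_def semimeasure_def by auto

definition Ms :: "nat \<Rightarrow> bool list \<Rightarrow> nat" where
  "Ms = (SOME m. cmp (\<lambda>_. 0) (\<lambda>p. m (fst p) (snd p)) \<and>
    (\<forall>\<sigma>. incseq (\<lambda>s. real (m s \<sigma>) / 2 ^ s) \<and> (\<lambda>s. real (m s \<sigma>) / 2 ^ s) \<longlonglongrightarrow> M \<sigma>))"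

lemma Ms: "cmp (\<lambda>_. 0) (\<lambda>p. Ms (fst p) (snd p))"
    "incseq (\<lambda>s. real (Ms s \<sigma>) / 2 ^ s)" "(\<lambda>s. real (Ms s \<sigma>) / 2 ^ s) \<longlonglongrightarrow> M \<sigma>"
proof -
  have "\<exists>m. cmp (\<lambda>_. 0) (\<lambda>p. m (fst p) (snd p)) \<and>
    (\<forall>\<sigma>. incseq (\<lambda>s. real (m s \<sigma>) / 2 ^ s) \<and> (\<lambda>s. real (m s \<sigma>) / 2 ^ s) \<longlonglongrightarrow> M \<sigma>)"
  proof -
    have "left_re M" using universal unfolding universal_semimeasure_def by blast
    from left_re_approx[OF this M_nonneg] obtain m where "cmp (\<lambda>_. 0) (\<lambda>p. m (fst p) (snd p))"
      "\<And>\<sigma>. incseq (\<lambda>s. real (m s \<sigma>) / 2 ^ s)" "\<And>\<sigma>. (\<lambda>s. real (m s \<sigma>) / 2 ^ s) \<longlonglongrightarrow> M \<sigma>"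
      by blast
    then show ?thesis by (intro exI[of _ m]) simp
  qed
  from someI_ex[OF this] show "cmp (\<lambda>_. 0) (\<lambda>p. Ms (fst p) (snd p))"
    "incseq (\<lambda>s. real (Ms s \<sigma>) / 2 ^ s)" "(\<lambda>s. real (Ms s \<sigma>) / 2 ^ s) \<longlonglongrightarrow> M \<sigma>"
    unfolding Ms_def[symmetric] by blast+
qed

lemmas cmp_Ms [cmp_intros] = cmp_app2[OF cmp0[OF Ms(1)]]

lemma Ms_le_M: "real (Ms s \<sigma>) / 2 ^ s \<le> M \<sigma>"
  using incseq_le[OF Ms(2,3)] .

lemma dominates:
  fixes m :: "nat \<Rightarrow> bool list \<Rightarrow> nat"
  assumes m: "cmp (\<lambda>_. 0) (\<lambda>p. m (fst p) (snd p))"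
    and inc: "\<And>\<sigma>. incseq (\<lambda>s. real (m s \<sigma>) / 2 ^ s)" and lim: "\<And>\<sigma>. (\<lambda>s. real (m s \<sigma>) / 2 ^ s) \<longlonglongrightarrow> \<nu> \<sigma>"
    and sup: "\<And>\<sigma>. \<nu> (\<sigma> @ [False]) + \<nu> (\<sigma> @ [True]) \<le> \<nu> \<sigma>" and one: "\<nu> [] \<le> 1"
  obtains c :: nat where "c > 0" "\<And>\<sigma>. \<nu> \<sigma> \<le> real c * M \<sigma>" "\<And>s \<sigma>. real (m s \<sigma>) / 2 ^ s \<le> real c * M \<sigma>"
proof -
  have pos: "0 \<le> \<nu> \<sigma>" for \<sigma>
    by (rule LIMSEQ_le_const[OF lim]) auto
  have le1: "\<nu> \<sigma> \<le> 1" for \<sigma>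
  proof (induction \<sigma> rule: rev_induct)
    case (snoc b \<sigma>)
    then show ?case using sup[of \<sigma>] pos[of "\<sigma> @ [False]"] pos[of "\<sigma> @ [True]"] by (cases b) auto
  qed (rule one)
  \<comment> \<open>A semimeasure has value 1 at the root. Raising the value there keeps
    superadditivity.\<close>
  define m' where "m' s \<sigma> = (if \<sigma> = [] then 2 ^ s else m s \<sigma>)" for s \<sigma>
  define \<nu>' where "\<nu>' \<sigma> = (if \<sigma> = [] then 1 else \<nu> \<sigma>)" for \<sigma>
  have "left_re \<nu>'"
  proof (rule left_reI[of m'])
    show "cmp (\<lambda>_. 0) (\<lambda>p. m' (fst p) (snd p))" unfolding m'_def by (intro cmp_intros cmp_app2[OF m])
    show "incseq (\<lambda>s. real (m' s \<sigma>) / 2 ^ s)" for \<sigma> using inc by (cases "\<sigma> = []") (auto simp: m'_def)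
    show "(\<lambda>s. real (m' s \<sigma>) / 2 ^ s) \<longlonglongrightarrow> \<nu>' \<sigma>" for \<sigma> using lim by (cases "\<sigma> = []") (auto simp: m'_def \<nu>'_def)
  qed
  moreover have "semimeasure \<nu>'"
    unfolding semimeasure_def
  proof (intro conjI allI)
    show "\<nu>' \<sigma> \<ge> \<nu>' (\<sigma> @ [False]) + \<nu>' (\<sigma> @ [True])" for \<sigma>
      using sup[of \<sigma>] one by (auto simp: \<nu>'_def)
  qed (auto simp: \<nu>'_def pos le1)
  ultimately obtain c where c: "\<And>\<sigma>. \<nu>' \<sigma> \<le> real c * M \<sigma>"
    using universal unfolding universal_semimeasure_def by blast
  have "c \<noteq> 0" using c[of "[]"] by (auto simp: \<nu>'_def)
  moreover have \<nu>: "\<nu> \<sigma> \<le> real c * M \<sigma>" for \<sigma>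
    using c[of \<sigma>] one by (cases "\<sigma> = []") (auto simp: \<nu>'_def)
  moreover have "real (m s \<sigma>) / 2 ^ s \<le> real c * M \<sigma>" for s \<sigma>
    using incseq_le[OF inc lim, of s \<sigma>] \<nu>[of \<sigma>] by linarith
  ultimately show thesis using that[of c] by simp
qed

text \<open>Read \<open>G s \<rho> \<sigma>\<close> as: a monotone machine with random tape \<open>\<rho>\<close> prints an extension of \<open>\<sigma>\<close> within \<open>s\<close> steps.\<close>

lemma machine_dominated:
  fixes G :: "nat \<Rightarrow> bool list \<Rightarrow> bool list \<Rightarrow> bool"
  assumes G: "cmp (\<lambda>_. 0) (\<lambda>p. G (fst p) (fst (snd p)) (snd (snd p)))"
    and ext: "\<And>s \<rho> \<sigma> b. length \<rho> = s \<Longrightarrow> G s \<rho> \<sigma> \<Longrightarrow> G (Suc s) (\<rho> @ [b]) \<sigma>"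
    and init: "\<And>s \<rho> \<sigma> b. length \<rho> = s \<Longrightarrow> G s \<rho> (\<sigma> @ [b]) \<Longrightarrow> G s \<rho> \<sigma>"
    and cons: "\<And>s \<rho> \<sigma>. length \<rho> = s \<Longrightarrow> \<not> (G s \<rho> (\<sigma> @ [False]) \<and> G s \<rho> (\<sigma> @ [True]))"
  obtains c :: nat where "c > 0" "\<And>s \<sigma>. real (card {\<rho>. length \<rho> = s \<and> G s \<rho> \<sigma>}) / 2 ^ s \<le> real c * M \<sigma>"
proof -
  define m where "m s \<sigma> = card {\<rho>. length \<rho> = s \<and> G s \<rho> \<sigma>}" for s \<sigma>
  have inc: "incseq (\<lambda>s. real (m s \<sigma>) / 2 ^ s)" for \<sigma>
  proof (rule incseq_SucI)
    fix s
    have "2 * m s \<sigma> \<le> m (Suc s) \<sigma>"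
      unfolding m_def by (rule card_strings_double) (rule ext)
    then have "real (2 * m s \<sigma>) \<le> real (m (Suc s) \<sigma>)" by linarith
    then show "real (m s \<sigma>) / 2 ^ s \<le> real (m (Suc s) \<sigma>) / 2 ^ Suc s" by (simp add: field_simps)
  qed
  have le: "m s \<sigma> \<le> 2 ^ s" for s \<sigma>
    unfolding m_def using card_mono[OF finite_strings, of "{\<rho>. length \<rho> = s \<and> G s \<rho> \<sigma>}" s] by auto
  then have "real (m s \<sigma>) \<le> 2 ^ s" for s \<sigma>
    by (metis of_nat_le_iff of_nat_numeral of_nat_power)
  then have le1: "real (m s \<sigma>) / 2 ^ s \<le> 1" for s \<sigma> by (simp add: field_simps)
  have "\<exists>l. (\<lambda>s. real (m s \<sigma>) / 2 ^ s) \<longlonglongrightarrow> l" for \<sigma>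
    by (rule incseq_convergent[OF inc[of \<sigma>], of 1]) (use le1 in auto)
  then have "\<exists>\<nu>. \<forall>\<sigma>. (\<lambda>s. real (m s \<sigma>) / 2 ^ s) \<longlonglongrightarrow> \<nu> \<sigma>" by (intro choice allI)
  then obtain \<nu> where lim: "\<And>\<sigma>. (\<lambda>s. real (m s \<sigma>) / 2 ^ s) \<longlonglongrightarrow> \<nu> \<sigma>" by blast
  have sup: "m s (\<sigma> @ [False]) + m s (\<sigma> @ [True]) \<le> m s \<sigma>" for s \<sigma>
  proof -
    have "m s (\<sigma> @ [False]) + m s (\<sigma> @ [True]) =
      card ({\<rho>. length \<rho> = s \<and> G s \<rho> (\<sigma> @ [False])} \<union> {\<rho>. length \<rho> = s \<and> G s \<rho> (\<sigma> @ [True])})"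
      unfolding m_def by (rule card_Un_disjoint[symmetric]) (use cons in auto)
    also have "\<dots> \<le> m s \<sigma>" unfolding m_def by (rule card_mono) (use init in auto)
    finally show ?thesis .
  qed
  show thesis
  proof (rule dominates[of m \<nu>])
    show "cmp (\<lambda>_. 0) (\<lambda>p. m (fst p) (snd p))" unfolding m_def by (intro cmp_intros cmp_app3[OF G])
    show "\<nu> (\<sigma> @ [False]) + \<nu> (\<sigma> @ [True]) \<le> \<nu> \<sigma>" for \<sigma>
    proof (rule LIMSEQ_le[OF tendsto_add[OF lim lim] lim], intro exI allI impI)
      fix s
      have "real (m s (\<sigma> @ [False]) + m s (\<sigma> @ [True])) \<le> real (m s \<sigma>)" using sup by (metis of_nat_le_iff)
      then show "real (m s (\<sigma> @ [False])) / 2 ^ s + real (m s (\<sigma> @ [True])) / 2 ^ s \<le> real (m s \<sigma>) / 2 ^ s"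
        by (simp add: add_divide_distrib[symmetric] divide_right_mono)
    qed
    show "\<nu> [] \<le> 1" by (rule LIMSEQ_le_const2[OF lim]) (use le1 in auto)
  qed (use that inc lim in \<open>auto simp: m_def\<close>)
qed

end

subsection \<open>Turing functionals with binary output\<close>

definition fcomp :: "nat \<Rightarrow> nat \<Rightarrow> bool list \<Rightarrow> bool list \<Rightarrow> bool" where
  "fcomp s e t \<sigma> \<longleftrightarrow> (\<forall>i<length \<sigma>. evb s t e i (of_bool (nthd False \<sigma> i)))"

lemma cmp_fcomp [cmp_intros]:
  assumes "cmp A s" "cmp A e" "cmp A t" "cmp A \<sigma>"
  shows "cmp A (\<lambda>z. fcomp (s z) (e z) (t z) (\<sigma> z))"
  unfolding fcomp_def
  by (intro cmp_intros cmp_comp[OF assms(1)] cmp_comp[OF assms(2)] cmp_comp[OF assms(3)] cmp_comp[OF assms(4)])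

lemma fcomp_mono: "fcomp s e t \<sigma> \<Longrightarrow> s \<le> s' \<Longrightarrow> fcomp s' e (t @ t') \<sigma>"
  unfolding fcomp_def using evb_mono by blast

lemma fcomp_restr_mono: "fcomp s e (restr X n) \<sigma> \<Longrightarrow> s \<le> s' \<Longrightarrow> n \<le> n' \<Longrightarrow> fcomp s' e (restr X n') \<sigma>"
  unfolding fcomp_def using evb_restr_mono by blast

lemma fcomp_take: "fcomp s e t \<sigma> \<Longrightarrow> fcomp s e t (take n \<sigma>)"
  unfolding fcomp_def by simp

lemma fcomp_unique:
  assumes "fcomp s e t \<sigma>" "fcomp s' e (t @ t') \<sigma>'" "length \<sigma> = length \<sigma>'"
  shows "\<sigma> = \<sigma>'"
proof (rule nth_equalityI)
  fix i assume "i < length \<sigma>"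
  then have "of_bool (\<sigma> ! i) = (of_bool (\<sigma>' ! i) :: nat)"
    using assms evb_fun[of s t e i "of_bool (\<sigma> ! i)" s' t' "of_bool (\<sigma>' ! i)"] unfolding fcomp_def by simp
  then show "\<sigma> ! i = \<sigma>' ! i" by (simp only: of_bool_eq_iff)
qed (rule assms)

lemma fcomp_sound:
  assumes "fcomp s (prog_encode e) (restr X n) \<sigma>" "i < length \<sigma>"
  shows "run e (seq_of X) i = Some (of_bool (\<sigma> ! i))"
  using assms evb_sound unfolding fcomp_def by fastforce

lemma fcomp_complete:
  assumes "\<And>i. i < k \<Longrightarrow> run e (seq_of X) i = Some (seq_of Y i)"
  shows "\<exists>n. \<forall>s\<ge>n. fcomp s (prog_encode e) (restr X s) (restr Y k)"
  using assms
proof (induction k)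
  case 0
  then show ?case by (simp add: fcomp_def restr_def)
next
  case (Suc k)
  then obtain n where n: "\<forall>s\<ge>n. fcomp s (prog_encode e) (restr X s) (restr Y k)" by fastforce
  obtain n' where n': "\<forall>s\<ge>n'. evb s (restr X s) (prog_encode e) k (seq_of Y k)"
    using evb_complete[OF Suc.prems[of k]] by blast
  have "fcomp s (prog_encode e) (restr X s) (restr Y (Suc k))" if "s \<ge> max n n'" for s
    unfolding fcomp_def
  proof (intro allI impI)
    fix i assume "i < length (restr Y (Suc k))"
    then have i: "i < Suc k" by simp
    show "evb s (restr X s) (prog_encode e) i (of_bool (nthd False (restr Y (Suc k)) i))"
    proof (cases "i = k")
      case True
      then show ?thesis using n' that by (simp add: seq_of_def)
    next
      case False
      then show ?thesis using n that i unfolding fcomp_def by (auto dest!: spec[of _ s])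
    qed
  qed
  then show ?case by blast
qed

context universal
begin

text \<open>The oracle serves as the random tape of a machine, so the left-hand side is the measure
  of the oracles whose output extends \<sigma> by stage \<open>s\<close>.\<close>

lemma functional_dominated:
  obtains c :: nat where "c > 0" "\<And>s \<sigma>. real (card {\<rho>. length \<rho> = s \<and> fcomp s e \<rho> \<sigma>}) / 2 ^ s \<le> real c * M \<sigma>"
proof (rule machine_dominated[of "\<lambda>s \<rho> \<sigma>. fcomp s e \<rho> \<sigma>"])
  show "cmp (\<lambda>_. 0) (\<lambda>p. fcomp (fst p) e (fst (snd p)) (snd (snd p)))" by (intro cmp_intros)
  show "fcomp (Suc s) e (\<rho> @ [b]) \<sigma>" if "fcomp s e \<rho> \<sigma>" for s \<rho> \<sigma> b using fcomp_mono[OF that] by simp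
  show "fcomp s e \<rho> \<sigma>" if "fcomp s e \<rho> (\<sigma> @ [b])" for s \<rho> \<sigma> b using fcomp_take[OF that, of "length \<sigma>"] by simp
  show "\<not> (fcomp s e \<rho> (\<sigma> @ [False]) \<and> fcomp s e \<rho> (\<sigma> @ [True]))" for s \<rho> \<sigma>
    using fcomp_unique[of s e \<rho> "\<sigma> @ [False]" s "[]" "\<sigma> @ [True]"] by auto
qed (use that in blast)

end

section \<open>The lattice of weak degrees of effectively closed classes\<close>

lemma dtree_cmp: "dtree T \<Longrightarrow> cmp A f \<Longrightarrow> cmp A (\<lambda>x. T (f x))"
  unfolding dtree_def using cmp0 cmp_comp by blast

lemma dtree_take: "dtree T \<Longrightarrow> T \<sigma> \<Longrightarrow> T (take n \<sigma>)"
  unfolding dtree_def by blast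

abbreviation wd :: "(nat \<Rightarrow> bool) set \<Rightarrow> wdeg" where
  "wd P \<equiv> deg\<^sub>w (seq_of ` P)"

lemma carrier_E_iff: "p \<in> carrier E\<^sub>w \<longleftrightarrow> (\<exists>P. P \<noteq> {} \<and> Pi01 P \<and> p = wd P)"
  unfolding carrier_E by blast

lemma le_E: "x \<sqsubseteq>\<^bsub>E\<^sub>w\<^esub> y \<longleftrightarrow> wdeg_le x y"
  by (simp add: E\<^sub>w_def D\<^sub>w_def)

lemma Pi01_Un:
  assumes "Pi01 P" "Pi01 Q" shows "Pi01 (P \<union> Q)"
proof -
  obtain S T where S: "dtree S" "P = paths S" and T: "dtree T" "Q = paths T"
    using assms unfolding Pi01_iff_tree by blast
  show ?thesis
  proof (rule Pi01I[where R = "\<lambda>(s::nat) \<sigma>. S \<sigma> \<or> T \<sigma>"])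
    show "cmp (\<lambda>_. 0) (\<lambda>p::nat \<times> bool list. S (snd p) \<or> T (snd p))"
      by (intro cmp_intros dtree_cmp[OF S(1)] dtree_cmp[OF T(1)])
    show "(X \<in> P \<union> Q) = (\<forall>s::nat. \<forall>n. S (restr X n) \<or> T (restr X n))" for X
    proof
      assume *: "\<forall>s::nat. \<forall>n. S (restr X n) \<or> T (restr X n)"
      show "X \<in> P \<union> Q"
      proof (rule ccontr)
        assume "X \<notin> P \<union> Q"
        then obtain n m where nm: "\<not> S (restr X n)" "\<not> T (restr X m)" by (auto simp: S T paths_def)
        \<comment> \<open>Both trees are closed under prefixes, so the two failures meet at the
          larger length.\<close>
        have "restr X n = take n (restr X (max m n))" "restr X m = take m (restr X (max m n))"
          by (simp_all add: min_def max_def)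
        then show False using nm * S(1) T(1) unfolding dtree_def by metis
      qed
    qed (auto simp: S T paths_def)
  qed
qed

lemma wd_Un_le: "wdeg_le (wd (P \<union> Q)) (wd P)" "wdeg_le (wd (P \<union> Q)) (wd Q)"
  unfolding wdeg_le_deg weak_le_def image_Un using turing_le_refl by blast+

lemma wd_le_Un: "wdeg_le (wd R) (wd P) \<Longrightarrow> wdeg_le (wd R) (wd Q) \<Longrightarrow> wdeg_le (wd R) (wd (P \<union> Q))"
  unfolding wdeg_le_deg weak_le_def image_Un by blast

lemma meet_E:
  assumes "P \<noteq> {}" "Pi01 P" "Q \<noteq> {}" "Pi01 Q"
  shows "wd P \<sqinter>\<^bsub>E\<^sub>w\<^esub> wd Q = wd (P \<union> Q)"
proof -
  interpret partial_order E\<^sub>w by (rule partial_order_E)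
  have g: "greatest E\<^sub>w (wd (P \<union> Q)) (Lower E\<^sub>w {wd P, wd Q})"
    unfolding greatest_def
  proof (intro conjI ballI)
    have "wd (P \<union> Q) \<in> carrier E\<^sub>w"
      using assms Pi01_Un unfolding carrier_E_iff by blast
    then show "wd (P \<union> Q) \<in> Lower E\<^sub>w {wd P, wd Q}"
      using wd_Un_le[of P Q] unfolding Lower_def le_E by auto
    fix x assume x: "x \<in> Lower E\<^sub>w {wd P, wd Q}"
    have c: "wd P \<in> carrier E\<^sub>w" "wd Q \<in> carrier E\<^sub>w" using assms unfolding carrier_E_iff by blast+
    from x c have "x \<in> carrier E\<^sub>w" "wdeg_le x (wd P)" "wdeg_le x (wd Q)"
      unfolding Lower_def le_E by auto
    then show "x \<sqsubseteq>\<^bsub>E\<^sub>w\<^esub> wd (P \<union> Q)" unfolding le_E carrier_E_iff using wd_le_Un by metis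
  qed (auto simp: Lower_def)
  then show ?thesis unfolding meet_def Lattice.inf_def
    using greatest_unique by (metis (mono_tags, lifting) someI_ex)
qed

lemma wdeg_le_trans:
  assumes "x \<in> range deg\<^sub>w" "y \<in> range deg\<^sub>w" "z \<in> range deg\<^sub>w" "wdeg_le x y" "wdeg_le y z"
  shows "wdeg_le x z"
  using assms weak_le_trans by (auto simp: wdeg_le_deg)

definition evens :: "'a list \<Rightarrow> 'a list" where
  "evens \<sigma> = map (\<lambda>i. \<sigma> ! (2 * i)) [0..<length \<sigma> div 2]"

definition odds :: "'a list \<Rightarrow> 'a list" where
  "odds \<sigma> = map (\<lambda>i. \<sigma> ! Suc (2 * i)) [0..<length \<sigma> div 2]"

lemma evens_nthd: "evens \<sigma> = map (\<lambda>i. nthd d \<sigma> (2 * i)) [0..<length \<sigma> div 2]"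
  and odds_nthd: "odds \<sigma> = map (\<lambda>i. nthd d \<sigma> (Suc (2 * i))) [0..<length \<sigma> div 2]"
  by (auto simp: evens_def odds_def)

lemma cmp_evens [cmp_intros]:
  fixes l :: "'a::enc \<Rightarrow> bool list"
  assumes "cmp A l" shows "cmp A (\<lambda>x. evens (l x))" "cmp A (\<lambda>x. odds (l x))"
  unfolding evens_nthd[where d = False] odds_nthd[where d = False] by (intro cmp_intros cmp_comp[OF assms])+

lemma evens_restr: "evens (restr X n) = restr (\<lambda>i. X (2 * i)) (n div 2)"
  and odds_restr: "odds (restr X n) = restr (\<lambda>i. X (Suc (2 * i))) (n div 2)"
  by (auto simp: evens_def odds_def restr_def)

text \<open>A representative of the join of the two weak degrees.\<close>

definition wjoin :: "(nat \<Rightarrow> bool) set \<Rightarrow> (nat \<Rightarrow> bool) set \<Rightarrow> (nat \<Rightarrow> bool) set" where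
  "wjoin P Q = {X. (\<lambda>i. X (2 * i)) \<in> P \<and> (\<lambda>i. X (Suc (2 * i))) \<in> Q}"

definition seq_join :: "(nat \<Rightarrow> 'a) \<Rightarrow> (nat \<Rightarrow> 'a) \<Rightarrow> nat \<Rightarrow> 'a" where
  "seq_join X Y n = (if even n then X (n div 2) else Y (n div 2))"

lemma seq_join_simps [simp]: "seq_join X Y (2 * i) = X i" "seq_join X Y (Suc (2 * i)) = Y i"
  by (simp_all add: seq_join_def)

lemma seq_join_in_wjoin: "X \<in> P \<Longrightarrow> Y \<in> Q \<Longrightarrow> seq_join X Y \<in> wjoin P Q"
  by (simp add: wjoin_def)

lemma Pi01_wjoin:
  assumes "Pi01 P" "Pi01 Q" shows "Pi01 (wjoin P Q)"
proof -
  obtain S T where S: "dtree S" "P = paths S" and T: "dtree T" "Q = paths T"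
    using assms unfolding Pi01_iff_tree by blast
  show ?thesis
  proof (rule Pi01I[where R = "\<lambda>(s::nat) \<sigma>. S (evens \<sigma>) \<and> T (odds \<sigma>)"])
    show "cmp (\<lambda>_. 0) (\<lambda>p::nat \<times> bool list. S (evens (snd p)) \<and> T (odds (snd p)))"
      by (intro cmp_intros dtree_cmp[OF S(1)] dtree_cmp[OF T(1)])
    have "(\<forall>n. S (evens (restr X n)) \<and> T (odds (restr X n))) \<longleftrightarrow> X \<in> wjoin P Q" for X
    proof
      assume *: "\<forall>n. S (evens (restr X n)) \<and> T (odds (restr X n))"
      show "X \<in> wjoin P Q" unfolding wjoin_def S(2) T(2) paths_def
        using *[rule_format, of "2 * n" for n] unfolding evens_restr odds_restr by simp
    qed (auto simp: wjoin_def S T paths_def evens_restr odds_restr)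
    then show "(X \<in> wjoin P Q) = (\<forall>s::nat. \<forall>n. S (evens (restr X n)) \<and> T (odds (restr X n)))" for X by blast
  qed
qed

lemma seq_of_image_le: "seq_of ` P \<le>\<^sub>w seq_of ` Q \<longleftrightarrow> (\<forall>Y\<in>Q. \<exists>X\<in>P. cmp (seq_of Y) X)"
  unfolding weak_le_def by (auto simp: seq_of_tle_iff)

lemma cmp_seq_of: "cmp (seq_of X) X"
  using turing_le_refl seq_of_tle_iff by blast

lemma wjoin_ge: "seq_of ` P \<le>\<^sub>w seq_of ` wjoin P Q" "seq_of ` Q \<le>\<^sub>w seq_of ` wjoin P Q"
proof -
  have "cmp (seq_of X) (\<lambda>i. X (2 * i))" "cmp (seq_of X) (\<lambda>i. X (Suc (2 * i)))" for X
    by (intro cmp_comp[OF cmp_seq_of] cmp_intros)+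
  then show "seq_of ` P \<le>\<^sub>w seq_of ` wjoin P Q" "seq_of ` Q \<le>\<^sub>w seq_of ` wjoin P Q"
    unfolding seq_of_image_le wjoin_def by blast+
qed

lemma wjoin_le:
  assumes "seq_of ` P \<le>\<^sub>w seq_of ` R" "seq_of ` Q \<le>\<^sub>w seq_of ` R"
  shows "seq_of ` wjoin P Q \<le>\<^sub>w seq_of ` R"
  unfolding seq_of_image_le
proof
  fix Z assume "Z \<in> R"
  then obtain X Y where X: "X \<in> P" "cmp (seq_of Z) X" and Y: "Y \<in> Q" "cmp (seq_of Z) Y"
    using assms unfolding seq_of_image_le by blast
  have "cmp (seq_of Z) (seq_join X Y)"
    unfolding seq_join_def[abs_def] by (intro cmp_intros cmp_comp[OF X(2)] cmp_comp[OF Y(2)])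
  then show "\<exists>X\<in>wjoin P Q. cmp (seq_of Z) X" using seq_join_in_wjoin X Y by blast
qed

section \<open>Deep classes\<close>

lemma strings_Suc: "{\<sigma>::bool list. length \<sigma> = Suc n} = (\<lambda>\<sigma>. \<sigma> @ [False]) ` {\<sigma>. length \<sigma> = n} \<union> (\<lambda>\<sigma>. \<sigma> @ [True]) ` {\<sigma>. length \<sigma> = n}"
proof -
  have "\<sigma> \<in> (\<lambda>\<sigma>. \<sigma> @ [False]) ` {\<sigma>. length \<sigma> = n} \<union> (\<lambda>\<sigma>. \<sigma> @ [True]) ` {\<sigma>. length \<sigma> = n}"
    if "length \<sigma> = Suc n" for \<sigma> :: "bool list"
    using that by (cases \<sigma> rule: rev_cases; cases "last \<sigma>") auto
  then show ?thesis by auto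
qed

lemma sum_strings_Suc:
  "(\<Sum>\<sigma> | length \<sigma> = Suc n. f \<sigma>) = (\<Sum>\<sigma>::bool list | length \<sigma> = n. f (\<sigma> @ [False]) + f (\<sigma> @ [True]))"
proof -
  have "(\<Sum>\<sigma> | length \<sigma> = Suc n. f \<sigma>) =
     sum f ((\<lambda>\<sigma>. \<sigma> @ [False]) ` {\<sigma>. length \<sigma> = n}) + sum f ((\<lambda>\<sigma>. \<sigma> @ [True]) ` {\<sigma>. length \<sigma> = n})"
    unfolding strings_Suc by (rule sum.union_disjoint) auto
  also have "\<dots> = (\<Sum>\<sigma> | length \<sigma> = n. f (\<sigma> @ [False])) + (\<Sum>\<sigma> | length \<sigma> = n. f (\<sigma> @ [True]))"
    by (subst (1 2) sum.reindex) (auto simp: inj_on_def comp_def)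
  finally show ?thesis by (simp add: sum.distrib)
qed

lemma finite_restr_image [simp]: "finite ((\<lambda>X. restr X n) ` P)"
  by (rule finite_subset[OF _ finite_strings[of n]]) auto

context universal
begin

definition mass :: "(nat \<Rightarrow> bool) set \<Rightarrow> nat \<Rightarrow> real" where
  "mass P n = (\<Sum>\<sigma>\<in>(\<lambda>X. restr X n) ` P. M \<sigma>)"

lemma mass_Suc: "mass P (Suc n) \<le> mass P n"
proof -
  let ?R = "(\<lambda>X. restr X n) ` P"
  have "mass P (Suc n) \<le> sum M ((\<lambda>\<sigma>. \<sigma> @ [False]) ` ?R \<union> (\<lambda>\<sigma>. \<sigma> @ [True]) ` ?R)"
    unfolding mass_def
  proof (rule sum_mono2)
    show "(\<lambda>X. restr X (Suc n)) ` P \<subseteq> (\<lambda>\<sigma>. \<sigma> @ [False]) ` ?R \<union> (\<lambda>\<sigma>. \<sigma> @ [True]) ` ?R"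
    proof
      fix \<sigma> assume "\<sigma> \<in> (\<lambda>X. restr X (Suc n)) ` P"
      then obtain X where "X \<in> P" "\<sigma> = restr X n @ [X n]" by (auto simp: restr_Suc)
      then show "\<sigma> \<in> (\<lambda>\<sigma>. \<sigma> @ [False]) ` ?R \<union> (\<lambda>\<sigma>. \<sigma> @ [True]) ` ?R" by (cases "X n") auto
    qed
  qed auto
  also have "\<dots> = sum M ((\<lambda>\<sigma>. \<sigma> @ [False]) ` ?R) + sum M ((\<lambda>\<sigma>. \<sigma> @ [True]) ` ?R)"
    by (rule sum.union_disjoint) auto
  also have "\<dots> = (\<Sum>\<sigma>\<in>?R. M (\<sigma> @ [False]) + M (\<sigma> @ [True]))"
    by (subst (1 2) sum.reindex) (auto simp: inj_on_def comp_def sum.distrib)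
  also have "\<dots> \<le> mass P n" unfolding mass_def by (intro sum_mono M_superadd)
  finally show ?thesis .
qed

lemma mass_antimono: "m \<le> n \<Longrightarrow> mass P n \<le> mass P m"
  by (induction rule: dec_induct) (use mass_Suc order_trans in blast)+

lemma deep_iff: "deep M P \<longleftrightarrow> (\<exists>r. cmp (\<lambda>_. 0) r \<and> mono r \<and> (\<forall>k. \<exists>n. k \<le> r n) \<and> (\<forall>n. mass P (r n) \<le> (1/2) ^ n))"
  unfolding deep_def mass_def computable_iff_cmp by simp

text \<open>A shift by \<open>k\<close> with \<open>c < 2 ^ k\<close> absorbs the constant. Summing
  the values of \<open>r\<close> and adding \<open>n\<close> gives a nondecreasing unbounded rate,
  and masses only decrease with the length.\<close>

lemma deepI:
  fixes c :: nat
  assumes r: "cmp (\<lambda>_. 0) r" and mass: "\<And>n. mass P (r n) \<le> real c * (1/2) ^ n"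
  shows "deep M P"
proof -
  obtain k :: nat where k: "real c < 2 ^ k" using real_arch_pow[of 2 "real c"] by auto
  define r' where "r' n = n + (\<Sum>i<n + Suc k. r i)" for n
  have "cmp (\<lambda>_. 0) r'" unfolding r'_def[abs_def] by (intro cmp_intros cmp_comp[OF r])
  moreover have "mono r'" unfolding r'_def by (intro monoI add_mono sum_mono2) auto
  moreover have "\<exists>n. j \<le> r' n" for j by (intro exI[of _ j]) (simp add: r'_def)
  moreover have "mass P (r' n) \<le> (1/2) ^ n" for n
  proof -
    have "r (n + k) \<le> (\<Sum>i<n + Suc k. r i)" by (rule member_le_sum) auto
    then have "mass P (r' n) \<le> mass P (r (n + k))" by (intro mass_antimono) (simp add: r'_def)
    also have "\<dots> \<le> real c * (1/2) ^ (n + k)" by (rule mass)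
    also have "\<dots> \<le> 2 ^ k * (1/2) ^ (n + k)" using k by (intro mult_right_mono) auto
    also have "\<dots> = (1/2) ^ n" by (simp add: power_add power_one_over)
    finally show ?thesis .
  qed
  ultimately show ?thesis unfolding deep_iff by blast
qed

lemma deep_Un:
  assumes "deep M P" "deep M Q" shows "deep M (P \<union> Q)"
proof -
  obtain p q where p: "cmp (\<lambda>_. 0) p" "\<And>n. mass P (p n) \<le> (1/2) ^ n"
    and q: "cmp (\<lambda>_. 0) q" "\<And>n. mass Q (q n) \<le> (1/2) ^ n"
    using assms unfolding deep_iff by blast
  show ?thesis
  proof (rule deepI[of "\<lambda>n. p n + q n" _ 2])
    show "cmp (\<lambda>_. 0) (\<lambda>n. p n + q n)" by (intro cmp_intros p q)
    fix n
    have "mass (P \<union> Q) (p n + q n) \<le> mass P (p n + q n) + mass Q (p n + q n)"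
      unfolding mass_def image_Un
      by (subst sum.union_inter[symmetric]) (auto intro!: sum_nonneg)
    also have "\<dots> \<le> mass P (p n) + mass Q (q n)" by (intro add_mono mass_antimono) auto
    also have "\<dots> \<le> real 2 * (1/2) ^ n" using p(2)[of n] q(2)[of n] by simp
    finally show "mass (P \<union> Q) (p n + q n) \<le> real 2 * (1/2) ^ n" .
  qed
qed

lemma evens_snoc2: "even (length \<sigma>) \<Longrightarrow> evens (\<sigma> @ [a, b]) = evens \<sigma> @ [a]"
  by (rule nth_equalityI) (auto simp: evens_def nth_append elim!: evenE)

text \<open>Superadditivity of \<open>M\<close> enters twice: to sum out the interleaved bit, and to
  add up the two values of the appended bit.\<close>

lemma evens_dominated:
  obtains c :: nat where "\<And>\<tau>. (\<Sum>\<sigma> | length \<sigma> = 2 * length \<tau>. if evens \<sigma> = \<tau> then M \<sigma> else 0) \<le> real c * M \<tau>"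
proof -
  define \<nu> where "\<nu> \<tau> = (\<Sum>\<sigma> | length \<sigma> = 2 * length \<tau>. if evens \<sigma> = \<tau> then M \<sigma> else 0)" for \<tau>
  define m where "m s \<tau> = (\<Sum>\<sigma> | length \<sigma> = 2 * length \<tau>. if evens \<sigma> = \<tau> then Ms s \<sigma> else 0)" for s \<tau>
  have m_eq: "real (m s \<tau>) / 2 ^ s = (\<Sum>\<sigma> | length \<sigma> = 2 * length \<tau>. if evens \<sigma> = \<tau> then real (Ms s \<sigma>) / 2 ^ s else 0)" for s \<tau>
    unfolding m_def of_nat_sum sum_divide_distrib by (rule sum.cong) auto
  note result = that
  show thesis
  proof (rule dominates[of m \<nu>])
    show thesis if c: "\<And>\<tau>. \<nu> \<tau> \<le> real c * M \<tau>" for c :: nat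
      using c unfolding \<nu>_def by (rule result)
    show "cmp (\<lambda>_. 0) (\<lambda>p. m (fst p) (snd p))" unfolding m_def by (intro cmp_intros)
    show "incseq (\<lambda>s. real (m s \<tau>) / 2 ^ s)" for \<tau>
      unfolding m_eq using Ms(2) by (auto simp: incseq_def intro!: sum_mono)
    show "(\<lambda>s. real (m s \<tau>) / 2 ^ s) \<longlonglongrightarrow> \<nu> \<tau>" for \<tau>
      unfolding m_eq \<nu>_def by (intro tendsto_sum) (auto intro: Ms(3))
    show "\<nu> [] \<le> 1" by (simp add: \<nu>_def evens_def)
    have snoc: "\<nu> (\<tau> @ [c]) \<le> (\<Sum>\<sigma> | length \<sigma> = 2 * length \<tau>. if evens \<sigma> = \<tau> then M (\<sigma> @ [c]) else 0)" for \<tau> c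
    proof -
      have "\<nu> (\<tau> @ [c]) = (\<Sum>\<sigma>::bool list | length \<sigma> = 2 * length \<tau>. \<Sum>a\<in>UNIV. \<Sum>b\<in>UNIV.
          if evens (\<sigma> @ [a, b]) = \<tau> @ [c] then M (\<sigma> @ [a, b]) else 0)"
        unfolding \<nu>_def
        by (simp add: sum_strings_Suc UNIV_bool add_ac cong: if_cong)
      also have "\<dots> = (\<Sum>\<sigma>::bool list | length \<sigma> = 2 * length \<tau>. if evens \<sigma> = \<tau> then M (\<sigma> @ [c, False]) + M (\<sigma> @ [c, True]) else 0)"
        by (rule sum.cong) (auto simp: evens_snoc2 UNIV_bool)
      also have "\<dots> \<le> (\<Sum>\<sigma> | length \<sigma> = 2 * length \<tau>. if evens \<sigma> = \<tau> then M (\<sigma> @ [c]) else 0)"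
        using M_superadd[of "_ @ [c]"] by (intro sum_mono) auto
      finally show ?thesis .
    qed
    show "\<nu> (\<tau> @ [False]) + \<nu> (\<tau> @ [True]) \<le> \<nu> \<tau>" for \<tau>
    proof -
      have "\<nu> (\<tau> @ [False]) + \<nu> (\<tau> @ [True]) \<le> (\<Sum>\<sigma> | length \<sigma> = 2 * length \<tau>. (if evens \<sigma> = \<tau> then M (\<sigma> @ [False]) else 0) +
         (if evens \<sigma> = \<tau> then M (\<sigma> @ [True]) else 0))"
        unfolding sum.distrib by (intro add_mono snoc)
      also have "\<dots> \<le> \<nu> \<tau>" unfolding \<nu>_def using M_superadd by (intro sum_mono) auto
      finally show ?thesis .
    qed
  qed
qed

lemma deep_evens:
  assumes "deep M P" and Q: "\<And>X. X \<in> Q \<Longrightarrow> (\<lambda>i. X (2 * i)) \<in> P"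
  shows "deep M Q"
proof -
  obtain r where r: "cmp (\<lambda>_. 0) r" "\<And>n. mass P (r n) \<le> (1/2) ^ n"
    using assms unfolding deep_iff by blast
  obtain c :: nat where c: "\<And>\<tau>. (\<Sum>\<sigma> | length \<sigma> = 2 * length \<tau>. if evens \<sigma> = \<tau> then M \<sigma> else 0) \<le> real c * M \<tau>"
    using evens_dominated by blast
  show ?thesis
  proof (rule deepI[of "\<lambda>n. 2 * r n" _ c])
    show "cmp (\<lambda>_. 0) (\<lambda>n. 2 * r n)" by (intro cmp_intros r)
    fix n
    let ?S = "(\<lambda>X. restr X (r n)) ` P"
    \<comment> \<open>The string of a member of \<open>Q\<close> is charged to its even part, which
      is a prefix of a member of \<open>P\<close>.\<close>
    have "mass Q (2 * r n) \<le> (\<Sum>\<sigma> | length \<sigma> = 2 * r n. \<Sum>\<tau>\<in>?S. if evens \<sigma> = \<tau> then M \<sigma> else 0)"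
      unfolding mass_def
    proof (rule sum_le_included[where i = "\<lambda>\<sigma>. \<sigma>"])
      show "\<forall>\<sigma>\<in>(\<lambda>X. restr X (2 * r n)) ` Q. \<exists>\<sigma>'\<in>{\<sigma>. length \<sigma> = 2 * r n}. \<sigma>' = \<sigma> \<and>
          M \<sigma> \<le> (\<Sum>\<tau>\<in>?S. if evens \<sigma>' = \<tau> then M \<sigma>' else 0)"
      proof
        fix \<sigma> assume "\<sigma> \<in> (\<lambda>X. restr X (2 * r n)) ` Q"
        then obtain X where X: "X \<in> Q" "\<sigma> = restr X (2 * r n)" by blast
        have "evens \<sigma> \<in> ?S" using Q[OF X(1)] unfolding X(2) evens_restr by simp
        then show "\<exists>\<sigma>'\<in>{\<sigma>. length \<sigma> = 2 * r n}. \<sigma>' = \<sigma> \<and> M \<sigma> \<le> (\<Sum>\<tau>\<in>?S. if evens \<sigma>' = \<tau> then M \<sigma>' else 0)"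
          using X(2) by (intro bexI[of _ \<sigma>]) auto
      qed
    qed (auto intro!: sum_nonneg)
    also have "\<dots> = (\<Sum>\<tau>\<in>?S. \<Sum>\<sigma> | length \<sigma> = 2 * r n. if evens \<sigma> = \<tau> then M \<sigma> else 0)"
      by (rule sum.swap)
    also have "\<dots> = (\<Sum>\<tau>\<in>?S. \<Sum>\<sigma> | length \<sigma> = 2 * length \<tau>. if evens \<sigma> = \<tau> then M \<sigma> else 0)"
      by (rule sum.cong) auto
    also have "\<dots> \<le> (\<Sum>\<tau>\<in>?S. real c * M \<tau>)" by (intro sum_mono c)
    also have "\<dots> = real c * mass P (r n)" by (simp add: mass_def sum_distrib_left)
    also have "\<dots> \<le> real c * (1/2) ^ n" by (intro mult_left_mono r) auto
    finally show "mass Q (2 * r n) \<le> real c * (1/2) ^ n" .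
  qed
qed

lemma deep_wjoin: "deep M P \<Longrightarrow> deep M (wjoin P Q)"
  by (erule deep_evens) (simp add: wjoin_def)

lemma wjoin_mem_F_deep:
  assumes P: "P \<noteq> {}" "Pi01 P" "deep M P" and Q: "Q \<noteq> {}" "Pi01 Q"
  shows "wd (wjoin P Q) \<in> F_deep M"
proof -
  have "wjoin P Q \<noteq> {}" using P Q seq_join_in_wjoin by (metis all_not_in_conv)
  moreover have "Pi01 (wjoin P Q)" using Pi01_wjoin P Q by blast
  ultimately show ?thesis
    using deep_wjoin[OF P(3)] unfolding F_deep_def deep_degree_def carrier_E by blast
qed

lemma F_deep_iff: "p \<in> F_deep M \<longleftrightarrow> (\<exists>P. P \<noteq> {} \<and> Pi01 P \<and> deep M P \<and> p = wd P)"
  unfolding F_deep_def deep_degree_def carrier_E_iff by blast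

text \<open>If the deep class \<open>P\<close> lies below \<open>Q\<close>, their join has the
  degree of \<open>Q\<close>, and it is deep.\<close>

lemma F_deep_upward:
  assumes "p \<in> F_deep M" "q \<in> carrier E\<^sub>w" "wdeg_le p q"
  shows "q \<in> F_deep M"
proof -
  obtain P Q where P: "P \<noteq> {}" "Pi01 P" "deep M P" "p = wd P" and Q: "Q \<noteq> {}" "Pi01 Q" "q = wd Q"
    using assms unfolding F_deep_iff carrier_E_iff by blast
  have "seq_of ` P \<le>\<^sub>w seq_of ` Q" using assms(3) unfolding P Q wdeg_le_deg .
  then have "wd (wjoin P Q) = wd Q"
    using wjoin_ge wjoin_le weak_le_refl by (intro deg_antisym) blast+
  then show ?thesis using wjoin_mem_F_deep P Q by metis
qed

lemma F_deep_filter: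
  assumes "F_deep M \<noteq> {}" shows "order_filter E\<^sub>w (F_deep M)"
  unfolding order_filter_def le_E
proof (intro conjI ballI impI)
  show "F_deep M \<subseteq> carrier E\<^sub>w" by (auto simp: F_deep_def)
  fix p q assume "p \<in> F_deep M" "q \<in> F_deep M"
  then obtain P Q where "P \<noteq> {}" "Pi01 P" "deep M P" "p = wd P" "Q \<noteq> {}" "Pi01 Q" "deep M Q" "q = wd Q"
    unfolding F_deep_iff by blast
  then show "p \<sqinter>\<^bsub>E\<^sub>w\<^esub> q \<in> F_deep M"
    unfolding F_deep_iff using meet_E Pi01_Un deep_Un by (intro exI[of _ "P \<union> Q"]) auto
qed (use assms F_deep_upward in auto)

end

section \<open>Bushy trees\<close>

text \<open>
  The bushy trees of Kumabe and Lewis, except that successors append whole blocks of bits; \<open>wl n\<close>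
  is the width of the block starting at position \<open>n\<close>.
\<close>

inductive big :: "(nat \<Rightarrow> nat) \<Rightarrow> nat \<Rightarrow> (bool list \<Rightarrow> bool) \<Rightarrow> bool list \<Rightarrow> bool"
  for wl k B where
  leaf: "B \<sigma> \<Longrightarrow> big wl k B \<sigma>"
| node: "S \<subseteq> {v. length v = wl (length \<sigma>)} \<Longrightarrow> k \<le> card S \<Longrightarrow> (\<And>v. v \<in> S \<Longrightarrow> big wl k B (\<sigma> @ v)) \<Longrightarrow> big wl k B \<sigma>"

lemma finite_block: "S \<subseteq> {v::bool list. length v = n} \<Longrightarrow> finite S"
  using finite_subset finite_strings by blast

text \<open>By induction on the tree: among \<open>k + l\<close> children, at least \<open>k\<close>
  are big for \<open>B\<close> or at least \<open>l\<close> are big for \<open>C\<close>.\<close>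

lemma big_union:
  assumes "big wl (k + l) (\<lambda>\<tau>. B \<tau> \<or> C \<tau>) \<sigma>"
  shows "big wl k B \<sigma> \<or> big wl l C \<sigma>"
  using assms
proof (induction rule: big.induct)
  case (leaf \<sigma>)
  then show ?case by (auto intro: big.leaf)
next
  case (node S \<sigma>)
  let ?S1 = "{v \<in> S. big wl k B (\<sigma> @ v)}" and ?S2 = "{v \<in> S. big wl l C (\<sigma> @ v)}"
  have "v \<in> ?S1 \<union> ?S2" if "v \<in> S" for v using node.IH[OF that] that by blast
  then have "S = ?S1 \<union> ?S2" by blast
  then have "card S = card (?S1 \<union> ?S2)" by (rule arg_cong[where f = card])
  also have "\<dots> \<le> card ?S1 + card ?S2" by (rule card_Un_le)
  finally have "card S \<le> card ?S1 + card ?S2" .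
  then have "k \<le> card ?S1 \<or> l \<le> card ?S2" using node.hyps(2) by linarith
  then show ?case
  proof
    assume "k \<le> card ?S1"
    then have "big wl k B \<sigma>" using node.hyps(1) by (rule_tac big.node[of ?S1]) auto
    then show ?thesis ..
  next
    assume "l \<le> card ?S2"
    then have "big wl l C \<sigma>" using node.hyps(1) by (rule_tac big.node[of ?S2]) auto
    then show ?thesis ..
  qed
qed

lemma big_pigeon:
  assumes "finite I" "I \<noteq> {}" "big wl (card I * k) (\<lambda>\<tau>. \<exists>i\<in>I. A i \<tau>) \<sigma>"
  shows "\<exists>i\<in>I. big wl k (A i) \<sigma>"
  using assms
proof (induction I rule: finite_ne_induct)
  case (insert i I)
  then have "big wl (k + card I * k) (\<lambda>\<tau>. A i \<tau> \<or> (\<exists>i\<in>I. A i \<tau>)) \<sigma>" by simp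
  from big_union[OF this] insert.IH show ?case by auto
qed simp

text \<open>Climb the tree that witnesses bigness of \<open>A\<close>. Each inner node has a child
  above which \<open>B\<close> is still not big, as otherwise \<open>B\<close> would be big at the
  node; the climb ends at a leaf in \<open>A\<close>. The predicate \<open>Q\<close> will say that a
  length is a chunk boundary.\<close>

lemma big_compose:
  assumes "big wl k A \<sigma>" "\<not> big wl k B \<sigma>" "Q (length \<sigma>)" "\<And>n. Q n \<Longrightarrow> Q (n + wl n)"
  shows "\<exists>\<rho>. A (\<sigma> @ \<rho>) \<and> \<not> big wl k B (\<sigma> @ \<rho>) \<and> Q (length (\<sigma> @ \<rho>))"
  using assms
proof (induction rule: big.induct)
  case (leaf \<sigma>)
  then show ?case by (intro exI[of _ "[]"]) auto
next
  case (node S \<sigma>)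
  have "\<exists>v\<in>S. \<not> big wl k B (\<sigma> @ v)"
    using node.hyps(1,2) node.prems(1) big.node[of S wl \<sigma> k B] by blast
  then obtain v where v: "v \<in> S" "\<not> big wl k B (\<sigma> @ v)" by blast
  moreover have "Q (length (\<sigma> @ v))" using node.hyps(1) v(1) node.prems by auto
  ultimately obtain \<rho> where "A ((\<sigma> @ v) @ \<rho>)" "\<not> big wl k B ((\<sigma> @ v) @ \<rho>)" "Q (length ((\<sigma> @ v) @ \<rho>))"
    using node.IH[of v] node.prems(3) by blast
  then show ?case by (intro exI[of _ "v @ \<rho>"]) simp
qed

lemma not_big_child:
  assumes "\<not> big wl k B \<sigma>" "k \<le> 2 ^ wl (length \<sigma>)"
  shows "\<exists>v. length v = wl (length \<sigma>) \<and> \<not> big wl k B (\<sigma> @ v)"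
  using assms big.node[of "{v. length v = wl (length \<sigma>)}" wl \<sigma> k B] by auto

text \<open>Certificates for bigness: each listed string lies in \<open>B\<close> or has
  \<open>k\<close> children listed earlier. For decidable \<open>B\<close> and computable widths,
  bigness can therefore be searched for.\<close>

definition bstep :: "(nat \<Rightarrow> nat) \<Rightarrow> nat \<Rightarrow> (bool list \<Rightarrow> bool) \<Rightarrow> bool list list \<Rightarrow> bool list \<Rightarrow> bool" where
  "bstep wl k B E x \<longleftrightarrow> B x \<or> k \<le> card {v. length v = wl (length x) \<and> x @ v \<in> set E}"

definition bder :: "(nat \<Rightarrow> nat) \<Rightarrow> nat \<Rightarrow> (bool list \<Rightarrow> bool) \<Rightarrow> bool list list \<Rightarrow> bool" where
  "bder wl k B D \<longleftrightarrow> (\<forall>u<length D. bstep wl k B (take u D) (nthd [] D u))"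

lemma bstep_mono: "bstep wl k B E x \<Longrightarrow> set E \<subseteq> set E' \<Longrightarrow> bstep wl k B E' x"
proof -
  assume *: "bstep wl k B E x" "set E \<subseteq> set E'"
  have "card {v. length v = wl (length x) \<and> x @ v \<in> set E} \<le> card {v. length v = wl (length x) \<and> x @ v \<in> set E'}"
    by (rule card_mono) (use *(2) in auto)
  then show ?thesis using *(1) unfolding bstep_def by linarith
qed

lemma bder_append: "bder wl k B D \<Longrightarrow> bder wl k B D' \<Longrightarrow> bder wl k B (D @ D')"
  unfolding bder_def
proof (intro allI impI)
  fix i assume *: "\<forall>u<length D. bstep wl k B (take u D) (nthd [] D u)"
    "\<forall>u<length D'. bstep wl k B (take u D') (nthd [] D' u)" "i < length (D @ D')"
  show "bstep wl k B (take i (D @ D')) (nthd [] (D @ D') i)"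
  proof (cases "i < length D")
    case True
    then show ?thesis using *(1) by (simp add: nth_append)
  next
    case False
    then have "bstep wl k B (take (i - length D) D') (nthd [] D' (i - length D))"
      using *(2,3) by auto
    then have "bstep wl k B (take i (D @ D')) (nthd [] D' (i - length D))"
      by (rule bstep_mono) auto
    then show ?thesis using False *(3) by (simp add: nth_append)
  qed
qed

lemma bder_snoc: "bder wl k B D \<Longrightarrow> bstep wl k B D x \<Longrightarrow> bder wl k B (D @ [x])"
  unfolding bder_def by (auto simp: less_Suc_eq nth_append)

lemma bder_finite:
  assumes "finite S" "\<And>x. x \<in> S \<Longrightarrow> \<exists>D. bder wl k B D \<and> x \<in> set D"
  shows "\<exists>D. bder wl k B D \<and> S \<subseteq> set D"
  using assms
proof (induction S rule: finite_induct)
  case empty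
  then show ?case by (intro exI[of _ "[]"]) (simp add: bder_def)
next
  case (insert x S)
  then obtain D D' where "bder wl k B D" "S \<subseteq> set D" "bder wl k B D'" "x \<in> set D'"
    by (metis insertCI)
  then show ?case by (intro exI[of _ "D @ D'"]) (auto intro: bder_append)
qed

lemma bder_complete: "big wl k B \<sigma> \<Longrightarrow> \<exists>D. bder wl k B D \<and> \<sigma> \<in> set D"
proof (induction rule: big.induct)
  case (leaf \<sigma>)
  then show ?case by (intro exI[of _ "[\<sigma>]"]) (simp add: bder_def bstep_def)
next
  case (node S \<sigma>)
  have "\<exists>D. bder wl k B D \<and> (\<lambda>v. \<sigma> @ v) ` S \<subseteq> set D"
    by (rule bder_finite) (use node finite_block in auto)
  then obtain D where D: "bder wl k B D" "(\<lambda>v. \<sigma> @ v) ` S \<subseteq> set D" by blast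
  have "card S \<le> card {v. length v = wl (length \<sigma>) \<and> \<sigma> @ v \<in> set D}"
    by (rule card_mono) (use node.hyps(1) D(2) in auto)
  then have "bder wl k B (D @ [\<sigma>])"
    using node.hyps(2) by (intro bder_snoc D) (simp add: bstep_def)
  then show ?case by (intro exI[of _ "D @ [\<sigma>]"]) simp
qed

lemma bder_sound:
  assumes "bder wl k B D" "\<sigma> \<in> set D" shows "big wl k B \<sigma>"
proof -
  have "i \<le> length D \<Longrightarrow> \<forall>x\<in>set (take i D). big wl k B x" for i
  proof (induction i)
    case (Suc i)
    then have IH: "\<forall>x\<in>set (take i D). big wl k B x" by simp
    have "bstep wl k B (take i D) (D ! i)"
      using assms(1) Suc.prems by (force simp: bder_def)
    then have "big wl k B (D ! i)" unfolding bstep_def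
      using IH big.leaf big.node[of "{v. length v = wl (length (D ! i)) \<and> D ! i @ v \<in> set (take i D)}" wl "D ! i" k B] by auto
    then show ?case using IH Suc.prems by (simp add: take_Suc_conv_app_nth)
  qed simp
  from this[of "length D"] assms(2) show ?thesis by simp
qed

text \<open>The strings \<open>0^z 1\<close> form a prefix-free code, so a tape announces at most
  one \<open>z\<close>.\<close>

lemma replicate_prefix_unique:
  assumes "take (Suc z) \<rho> = replicate z False @ [True]" "take (Suc z') \<rho> = replicate z' False @ [True]"
  shows "z = z'"
proof -
  have *: "\<not> z < z'" if "take (Suc z) \<rho> = replicate z False @ [True]" "take (Suc z') \<rho> = replicate z' False @ [True]" for z z'
  proof
    assume "z < z'"
    have "length (take (Suc z') \<rho>) = Suc z'" unfolding that(2) by simp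
    then have "Suc z' \<le> length \<rho>" by simp
    have "take (Suc z') \<rho> ! z = take (Suc z) \<rho> ! z" using \<open>z < z'\<close> by simp
    then show False unfolding that using \<open>z < z'\<close> by (simp add: nth_append)
  qed
  then show ?thesis using assms by (meson linorder_neqE_nat)
qed

lemma card_extensions: "length \<tau> \<le> s \<Longrightarrow> card {\<rho>::bool list. length \<rho> = s \<and> take (length \<tau>) \<rho> = \<tau>} = 2 ^ (s - length \<tau>)"
proof -
  assume le: "length \<tau> \<le> s"
  have "\<rho> \<in> (\<lambda>v. \<tau> @ v) ` {v. length v = s - length \<tau>}" if "length \<rho> = s" "take (length \<tau>) \<rho> = \<tau>" for \<rho>
  proof
    show "\<rho> = \<tau> @ drop (length \<tau>) \<rho>" using append_take_drop_id[of "length \<tau>" \<rho>] unfolding that(2) by simp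
  qed (use that in simp)
  then have "(\<lambda>v. \<tau> @ v) ` {v. length v = s - length \<tau>} = {\<rho>. length \<rho> = s \<and> take (length \<tau>) \<rho> = \<tau>}"
    using le by auto
  then have "bij_betw (\<lambda>v. \<tau> @ v) {v. length v = s - length \<tau>} {\<rho>. length \<rho> = s \<and> take (length \<tau>) \<rho> = \<tau>}"
    by (simp add: bij_betw_def inj_on_def)
  from bij_betw_same_card[OF this] show ?thesis by simp
qed

section \<open>Strings found by search are heavy\<close>

context universal
begin

text \<open>A machine reads \<open>0^z 1\<close> from its tape, which has probability
  \<open>(1/2) ^ Suc z\<close>, and prints the string from the first success of the search for
  \<open>z\<close>. Universality bounds this probability by a multiple of the weight of the string,
  with one constant for all \<open>z\<close>.\<close>

lemma search_weight:
  fixes F :: "nat \<Rightarrow> nat \<Rightarrow> bool list \<Rightarrow> bool"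
  assumes F: "cmp (\<lambda>_. 0) (\<lambda>p. F (fst p) (fst (snd p)) (snd (snd p)))"
  obtains C :: nat where "C > 0"
    "\<And>z. \<exists>s i. F z s i \<Longrightarrow> \<exists>s i. F z s i \<and> (1/2) ^ Suc z \<le> real C * M i"
proof -
  define F' where "F' z u \<longleftrightarrow> F z (fst (dec u :: nat \<times> bool list)) (snd (dec u :: nat \<times> bool list))" for z u
  \<comment> \<open>Keeping only the first success makes the output depend on \<open>z\<close>
    alone.\<close>
  define first where "first z u \<longleftrightarrow> F' z u \<and> (\<forall>u'<u. \<not> F' z u')" for z u
  define G where "G s \<rho> \<tau> \<longleftrightarrow> (\<exists>z<s. take (Suc z) \<rho> = replicate z False @ [True] \<and>
      (\<exists>u<s. first z u \<and> take (length \<tau>) (snd (dec u :: nat \<times> bool list)) = \<tau>))" for s :: nat and \<rho> \<tau> :: "bool list"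
  have first_unique: "u = u'" if "first z u" "first z u'" for z u u'
    using that unfolding first_def by (meson linorder_neqE_nat)
  obtain C :: nat where C: "C > 0" "\<And>s \<sigma>. real (card {\<rho>. length \<rho> = s \<and> G s \<rho> \<sigma>}) / 2 ^ s \<le> real C * M \<sigma>"
  proof (rule machine_dominated[of G])
    show "cmp (\<lambda>_. 0) (\<lambda>p. G (fst p) (fst (snd p)) (snd (snd p)))"
      unfolding G_def first_def F'_def by (intro cmp_intros cmp_app3[OF F])
    show "G (Suc s) (\<rho> @ [b]) \<sigma>" if "length \<rho> = s" "G s \<rho> \<sigma>" for s \<rho> \<sigma> b
      using that unfolding G_def by (auto simp: less_Suc_eq)
    show "G s \<rho> \<sigma>" if "G s \<rho> (\<sigma> @ [b])" for s \<rho> \<sigma> b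
    proof -
      have "take (length \<sigma>) i = \<sigma>" if "take (length (\<sigma> @ [b])) i = \<sigma> @ [b]" for i
      proof -
        have "take (length \<sigma>) i = take (length \<sigma>) (take (length (\<sigma> @ [b])) i)" by simp
        then show ?thesis unfolding that by simp
      qed
      then show ?thesis using that unfolding G_def by blast
    qed
    show "\<not> (G s \<rho> (\<sigma> @ [False]) \<and> G s \<rho> (\<sigma> @ [True]))" for s \<rho> \<sigma>
    proof
      assume "G s \<rho> (\<sigma> @ [False]) \<and> G s \<rho> (\<sigma> @ [True])"
      then obtain z u z' u' where *: "take (Suc z) \<rho> = replicate z False @ [True]" "first z u"
        "take (Suc (length \<sigma>)) (snd (dec u :: nat \<times> bool list)) = \<sigma> @ [False]"
        "take (Suc z') \<rho> = replicate z' False @ [True]" "first z' u'"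
        "take (Suc (length \<sigma>)) (snd (dec u' :: nat \<times> bool list)) = \<sigma> @ [True]"
        unfolding G_def by auto
      have "z = z'" using replicate_prefix_unique *(1,4) by blast
      then have "u = u'" using first_unique * by blast
      then show False using * by simp
    qed
  qed blast
  show thesis
  proof (rule that[OF C(1)])
    fix z assume "\<exists>s i. F z s i"
    then obtain s i where "F z s i" by blast
    then have "F' z (enc (s, i))" by (simp add: F'_def)
    then have "F' z (LEAST u. F' z u)" by (rule LeastI)
    moreover define u where "u = (LEAST u. F' z u)"
    ultimately have u: "F' z u" "first z u" unfolding first_def using not_less_Least by blast+
    define i where "i = snd (dec u :: nat \<times> bool list)"
    define s where "s = Suc (max u z)"
    let ?\<tau> = "replicate z False @ [True]"
    have "2 ^ (s - Suc z) = card {\<rho>. length \<rho> = s \<and> take (length ?\<tau>) \<rho> = ?\<tau>}"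
      by (subst card_extensions) (auto simp: s_def)
    also have "\<dots> \<le> card {\<rho>. length \<rho> = s \<and> G s \<rho> i}"
    proof (rule card_mono)
      show "{\<rho>. length \<rho> = s \<and> take (length ?\<tau>) \<rho> = ?\<tau>} \<subseteq> {\<rho>. length \<rho> = s \<and> G s \<rho> i}"
      proof (intro subsetI CollectI conjI; elim CollectE conjE)
        fix \<rho> :: "bool list" assume \<rho>: "take (length ?\<tau>) \<rho> = ?\<tau>"
        have "\<exists>u<s. first z u \<and> take (length i) (snd (dec u :: nat \<times> bool list)) = i"
          using u(2) by (intro exI[of _ u]) (auto simp: s_def i_def)
        then show "G s \<rho> i" unfolding G_def using \<rho> by (intro exI[of _ z]) (auto simp: s_def)
      qed
    qed simp
    finally have "real (2 ^ (s - Suc z)) / 2 ^ s \<le> real (card {\<rho>. length \<rho> = s \<and> G s \<rho> i}) / 2 ^ s"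
      by (intro divide_right_mono) (auto simp del: of_nat_power)
    also have "\<dots> \<le> real C * M i" by (rule C(2))
    also have "real (2 ^ (s - Suc z)) / 2 ^ s = (1/2) ^ Suc z"
    proof -
      have "(2::real) ^ s = 2 ^ (s - Suc z) * 2 ^ Suc z"
        unfolding power_add[symmetric] by (simp add: s_def)
      then show ?thesis by (simp add: power_one_over)
    qed
    finally have "(1/2) ^ Suc z \<le> real C * M i" .
    moreover have "F z (fst (dec u :: nat \<times> bool list)) i" using u(1) by (simp add: F'_def i_def)
    ultimately show "\<exists>s i. F z s i \<and> (1/2) ^ Suc z \<le> real C * M i" by blast
  qed
qed

end

section \<open>A family of deep classes\<close>

text \<open>
  Positions are cut into chunks; block \<open>j\<close> consists of \<open>2 ^ j * 2 ^ w j + 1\<close> consecutive chunks of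
  \<open>w j\<close> bits each. Whenever the \<open>M\<close>-mass of the strings obeying the prohibitions issued so far in
  block \<open>j\<close> exceeds \<open>2 ^ (- j)\<close>, the heaviest value of the next chunk is prohibited. Each time a
  mass of at least \<open>2 ^ (- j - w j)\<close> is lost, so the block never runs out of chunks.
\<close>

locale blocks = universal +
  fixes w :: "nat \<Rightarrow> nat"
  assumes cmp_w: "cmp (\<lambda>_. 0) w" and w_pos: "w j \<ge> 1"
begin

text \<open>Chunks are numbered through: \<open>cs j\<close> is the first chunk of block
  \<open>j\<close>, \<open>bl c\<close> the block of chunk \<open>c\<close>, \<open>W c\<close> its
  width and \<open>pos c\<close> the position of its first bit.\<close>

definition cs :: "nat \<Rightarrow> nat" where "cs j = (\<Sum>i<j. 2 ^ i * 2 ^ w i + 1)"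
definition bl :: "nat \<Rightarrow> nat" where "bl c = (LEAST j. c < cs (Suc j))"
definition W :: "nat \<Rightarrow> nat" where "W c = w (bl c)"
definition pos :: "nat \<Rightarrow> nat" where "pos c = (\<Sum>i<c. W i)"
definition chunk :: "nat \<Rightarrow> bool list \<Rightarrow> bool list" where "chunk c \<sigma> = take (W c) (drop (pos c) \<sigma>)"

lemma cs_Suc: "cs (Suc j) = cs j + (2 ^ j * 2 ^ w j + 1)" by (simp add: cs_def)

lemma cs_mono: "i \<le> j \<Longrightarrow> cs i \<le> cs j"
  by (rule lift_Suc_mono_le[of cs]) (simp_all add: cs_Suc)

lemma cs_ge: "j \<le> cs j" by (induction j) (simp_all add: cs_Suc)

lemma bl_eq: assumes "t < 2 ^ j * 2 ^ w j + 1" shows "bl (cs j + t) = j"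
  unfolding bl_def
proof (rule Least_equality)
  show "cs j + t < cs (Suc j)" using assms by (simp add: cs_Suc)
  fix i assume "cs j + t < cs (Suc i)"
  then have "\<not> Suc i \<le> j" using cs_mono[of "Suc i" j] by linarith
  then show "j \<le> i" by simp
qed

lemma bl_props: "cs (bl c) \<le> c" "c < cs (Suc (bl c))"
proof -
  have ex: "\<exists>j. c < cs (Suc j)" using cs_ge[of "Suc c"] by (intro exI[of _ c]) linarith
  show 2: "c < cs (Suc (bl c))" unfolding bl_def by (rule LeastI_ex[OF ex])
  show "cs (bl c) \<le> c"
  proof (cases "bl c")
    case (Suc j)
    then have "\<not> c < cs (Suc j)" using not_less_Least[of j "\<lambda>j. c < cs (Suc j)"] unfolding bl_def[symmetric] by simp
    then show ?thesis by (simp add: Suc)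
  qed (simp add: cs_def)
qed

lemma bl_ge: "cs j \<le> c \<Longrightarrow> j \<le> bl c"
  using bl_props(2)[of c] cs_mono[of "Suc (bl c)" j] by (cases "j \<le> bl c") auto

lemma pos_Suc: "pos (Suc c) = pos c + W c" by (simp add: pos_def)

lemma W_pos: "W c \<ge> 1" unfolding W_def by (rule w_pos)

lemma pos_strict: "c < d \<Longrightarrow> pos c < pos d"
  by (rule lift_Suc_mono_less[of pos]) (use W_pos in \<open>simp_all add: pos_Suc Suc_le_eq\<close>)

lemma pos_less_iff: "pos c < pos d \<longleftrightarrow> c < d"
  by (metis pos_strict linorder_neqE_nat less_asym less_irrefl)

lemma pos_le_iff: "pos c \<le> pos d \<longleftrightarrow> c \<le> d"
  using pos_less_iff[of d c] by linarith

lemma pos_ge: "c \<le> pos c"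
proof (induction c)
  case (Suc c)
  then show ?case using W_pos[of c] by (simp add: pos_Suc)
qed simp

lemma cmp_cs [cmp_intros]: "cmp A f \<Longrightarrow> cmp A (\<lambda>x. cs (f x))"
proof -
  assume f: "cmp A f"
  show ?thesis unfolding cs_def by (intro cmp_intros cmp_comp[OF f] cmp_comp[OF cmp0[OF cmp_w]])
qed

lemma cmp_bl [cmp_intros]: "cmp A f \<Longrightarrow> cmp A (\<lambda>x. bl (f x))"
proof -
  assume f: "cmp A f"
  have "cmp A bl" unfolding bl_def[abs_def]
    by (rule cmp_Least) (intro cmp_intros, metis cs_ge less_le_trans lessI)
  then show ?thesis using f by (rule cmp_comp)
qed

lemma cmp_W [cmp_intros]: "cmp A f \<Longrightarrow> cmp A (\<lambda>x. W (f x))"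
proof -
  assume f: "cmp A f"
  show ?thesis unfolding W_def by (intro cmp_intros cmp_comp[OF f] cmp_comp[OF cmp0[OF cmp_w]])
qed

lemma cmp_pos [cmp_intros]: "cmp A f \<Longrightarrow> cmp A (\<lambda>x. pos (f x))"
proof -
  assume f: "cmp A f"
  show ?thesis unfolding pos_def by (intro cmp_intros cmp_comp[OF f])
qed

text \<open>The list \<open>a\<close> contains the prohibitions of block \<open>j\<close> in order,
  one per chunk. Below, \<open>massS\<close> is the approximate mass of the strings obeying them and
  \<open>massV\<close> the part of it with value \<open>v\<close> in the next chunk, both as
  numerators over \<open>2 ^ s\<close>.\<close>

definition compat :: "nat \<Rightarrow> bool list list \<Rightarrow> bool list \<Rightarrow> bool" where
  "compat j a \<sigma> \<longleftrightarrow> (\<forall>t<length a. chunk (cs j + t) \<sigma> \<noteq> nthd [] a t)"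

definition massS :: "nat \<Rightarrow> nat \<Rightarrow> bool list list \<Rightarrow> nat" where
  "massS s j a = (\<Sum>\<sigma> | length \<sigma> = pos (cs (Suc j)). if compat j a \<sigma> then Ms s \<sigma> else 0)"

definition massV :: "nat \<Rightarrow> nat \<Rightarrow> bool list list \<Rightarrow> bool list \<Rightarrow> nat" where
  "massV s j a v = (\<Sum>\<sigma> | length \<sigma> = pos (cs (Suc j)).
     if compat j a \<sigma> \<and> chunk (cs j + length a) \<sigma> = v then Ms s \<sigma> else 0)"

text \<open>The choice is the first value with at least the average share of the mass. The disjunct
  \<open>i \<ge> 2 ^ w j\<close> keeps the search total for every list \<open>a\<close>.\<close>

definition best :: "nat \<Rightarrow> nat \<Rightarrow> bool list list \<Rightarrow> bool list" where
  "best s j a = bits (w j) (LEAST i. i \<ge> 2 ^ w j \<or> massS s j a \<le> massV s j a (bits (w j) i) * 2 ^ w j)"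

definition al :: "nat \<Rightarrow> nat \<Rightarrow> bool list list" where
  "al j s = rec_nat [] (\<lambda>s a. if massS s j a * 2 ^ j > 2 ^ s then a @ [best s j a] else a) s"

lemma al_Suc: "al j (Suc s) = (if massS s j (al j s) * 2 ^ j > 2 ^ s then al j s @ [best s j (al j s)] else al j s)"
  and al_0: "al j 0 = []"
  by (simp_all add: al_def)

lemma cmp_compat [cmp_intros]: "cmp A j \<Longrightarrow> cmp A a \<Longrightarrow> cmp A \<sigma> \<Longrightarrow> cmp A (\<lambda>x. compat (j x) (a x) (\<sigma> x))"
proof -
  assume *: "cmp A j" "cmp A a" "cmp A \<sigma>"
  show ?thesis unfolding compat_def chunk_def by (intro cmp_intros cmp_comp[OF *(1)] cmp_comp[OF *(2)] cmp_comp[OF *(3)])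
qed

lemma cmp_al [cmp_intros]: "cmp A j \<Longrightarrow> cmp A s \<Longrightarrow> cmp A (\<lambda>x. al (j x) (s x))"
proof -
  assume *: "cmp A j" "cmp A s"
  have ex: "\<exists>i. i \<ge> 2 ^ w j \<or> massS s j a \<le> massV s j a (bits (w j) i) * 2 ^ w j" for s j a by blast
  have 1: "cmp A (\<lambda>p. massS (fst p) (fst (snd p)) (snd (snd p)))"
    unfolding massS_def by (intro cmp_intros)
  have 2: "cmp A (\<lambda>p. massV (fst p) (fst (snd p)) (fst (snd (snd p))) (snd (snd (snd p))))"
    unfolding massV_def chunk_def by (intro cmp_intros)
  have 3: "cmp A (\<lambda>p. best (fst p) (fst (snd p)) (snd (snd p)))"
    unfolding best_def
    by (intro cmp_intros cmp_comp[OF cmp0[OF cmp_w]] cmp_Least cmp_app3[OF 1] cmp_app4[OF 2] ex)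
  show ?thesis unfolding al_def
    by (intro cmp_intros cmp_app3[OF 1] cmp_app3[OF 3] cmp_comp[OF *(1)] cmp_comp[OF *(2)])
qed

lemma al_mono: "s \<le> s' \<Longrightarrow> \<exists>b. al j s' = al j s @ b"
proof (induction rule: dec_induct)
  case (step n)
  then show ?case by (auto simp: al_Suc)
qed simp

lemma length_chunk:
  assumes "length \<sigma> = pos (cs (Suc j))" "t < 2 ^ j * 2 ^ w j + 1"
  shows "length (chunk (cs j + t) \<sigma>) = w j"
proof -
  have "pos (Suc (cs j + t)) \<le> pos (cs (Suc j))" using assms(2) unfolding pos_le_iff by (simp add: cs_Suc)
  then show ?thesis using assms by (simp add: chunk_def pos_Suc W_def bl_eq)
qed

lemma massS_sum:
  assumes "length a < 2 ^ j * 2 ^ w j + 1"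
  shows "massS s j a = (\<Sum>i<2 ^ w j. massV s j a (bits (w j) i))"
proof -
  have "massS s j a = (\<Sum>\<sigma> | length \<sigma> = pos (cs (Suc j)). \<Sum>v::bool list | length v = w j.
     if compat j a \<sigma> \<and> chunk (cs j + length a) \<sigma> = v then Ms s \<sigma> else 0)"
    unfolding massS_def
  proof (rule sum.cong[OF refl])
    fix \<sigma> assume "\<sigma> \<in> {\<sigma>::bool list. length \<sigma> = pos (cs (Suc j))}"
    then have "length (chunk (cs j + length a) \<sigma>) = w j" using length_chunk assms by blast
    then show "(if compat j a \<sigma> then Ms s \<sigma> else 0) = (\<Sum>v::bool list | length v = w j.
       if compat j a \<sigma> \<and> chunk (cs j + length a) \<sigma> = v then Ms s \<sigma> else 0)"
      by (cases "compat j a \<sigma>") auto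
  qed
  also have "\<dots> = (\<Sum>v | length v = w j. massV s j a v)" unfolding massV_def by (rule sum.swap)
  finally show ?thesis unfolding sum_strings .
qed

text \<open>By averaging over the \<open>2 ^ w j\<close> values of the next chunk, which exists
  because of the bound on \<open>length a\<close>.\<close>

lemma best:
  assumes "length a < 2 ^ j * 2 ^ w j + 1"
  shows "massS s j a \<le> massV s j a (best s j a) * 2 ^ w j" "length (best s j a) = w j"
proof -
  have "\<exists>i<2 ^ w j. massS s j a \<le> massV s j a (bits (w j) i) * 2 ^ w j"
  proof (rule ccontr)
    assume "\<not> ?thesis"
    then have *: "massV s j a (bits (w j) i) * 2 ^ w j < massS s j a" if "i < 2 ^ w j" for i using that by (meson not_le)
    have "massS s j a * 2 ^ w j = (\<Sum>i<2 ^ w j. massV s j a (bits (w j) i) * 2 ^ w j)"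
      unfolding massS_sum[OF assms] sum_distrib_right ..
    also have "\<dots> < (\<Sum>i<(2::nat) ^ w j. massS s j a)" by (rule sum_strict_mono) (use * in \<open>auto simp: lessThan_empty_iff\<close>)
    finally show False by (simp add: mult.commute)
  qed
  then obtain i where i: "i < 2 ^ w j" "massS s j a \<le> massV s j a (bits (w j) i) * 2 ^ w j" by blast
  let ?P = "\<lambda>i. i \<ge> 2 ^ w j \<or> massS s j a \<le> massV s j a (bits (w j) i) * 2 ^ w j"
  have "(LEAST i. ?P i) \<le> i" by (rule Least_le) (use i in simp)
  moreover have "?P (LEAST i. ?P i)" by (rule LeastI[of ?P i]) (use i in simp)
  ultimately show "massS s j a \<le> massV s j a (best s j a) * 2 ^ w j" using i(1) unfolding best_def by linarith
qed (simp add: best_def)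

lemma mass_UNIV: "(\<Sum>\<sigma> | length \<sigma> = n. M \<sigma>) \<le> 1"
proof -
  have "(\<lambda>X. restr X n) ` UNIV = {\<sigma>. length \<sigma> = n}"
    using restr_of_string by (auto simp: image_iff) metis
  then have "(\<Sum>\<sigma> | length \<sigma> = n. M \<sigma>) = mass UNIV n" unfolding mass_def by simp
  also have "\<dots> \<le> mass UNIV 0" by (rule mass_antimono) simp
  also have "\<dots> = 1" by (simp add: mass_def restr_def)
  finally show ?thesis .
qed

text \<open>The claims need each other: the length bound provides a chunk for the next prohibition,
  and the mass bound together with \<open>mass_UNIV\<close> gives the next length bound. Prohibited
  mass is measured by \<open>M\<close> and not by its approximation, so the estimate stays valid at
  later stages.\<close>

lemma al_length:
  "real (length (al j s)) * (1/2) ^ (j + w j) \<le> (\<Sum>\<sigma> | length \<sigma> = pos (cs (Suc j)). if compat j (al j s) \<sigma> then 0 else M \<sigma>)"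
  "length (al j s) \<le> 2 ^ j * 2 ^ w j"
proof (induction s)
  case 0
  { case 1 then show ?case by (auto simp: al_0 intro!: sum_nonneg) }
  { case 2 then show ?case by (simp add: al_0) }
next
  case (Suc s)
  let ?a = "al j s" and ?n = "pos (cs (Suc j))"
  let ?b = "best s j ?a"
  have IH2: "length ?a < 2 ^ j * 2 ^ w j + 1" using Suc(2) by simp
  show *: "real (length (al j (Suc s))) * (1/2) ^ (j + w j) \<le>
     (\<Sum>\<sigma> | length \<sigma> = ?n. if compat j (al j (Suc s)) \<sigma> then 0 else M \<sigma>)"
  proof (cases "massS s j ?a * 2 ^ j > 2 ^ s")
    case True
    then have al: "al j (Suc s) = ?a @ [?b]" by (simp add: al_Suc)
    have cp: "compat j (?a @ [?b]) \<sigma> \<longleftrightarrow> compat j ?a \<sigma> \<and> chunk (cs j + length ?a) \<sigma> \<noteq> ?b" for \<sigma>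
      unfolding compat_def by (auto simp: less_Suc_eq nthd_def nth_append)
    have "2 ^ s < massV s j ?a ?b * 2 ^ w j * 2 ^ j"
      using True best(1)[OF IH2, of s] by (meson less_le_trans mult_le_mono1)
    then have "real (2 ^ s) < real (massV s j ?a ?b * 2 ^ w j * 2 ^ j)" unfolding of_nat_less_iff .
    then have "(1/2) ^ (j + w j) \<le> real (massV s j ?a ?b) / 2 ^ s"
      by (simp add: power_one_over power_add field_simps)
    also have "\<dots> = (\<Sum>\<sigma> | length \<sigma> = ?n. if compat j ?a \<sigma> \<and> chunk (cs j + length ?a) \<sigma> = ?b then real (Ms s \<sigma>) / 2 ^ s else 0)"
      unfolding massV_def of_nat_sum sum_divide_distrib by (rule sum.cong) auto
    also have "\<dots> \<le> (\<Sum>\<sigma> | length \<sigma> = ?n. if compat j ?a \<sigma> \<and> chunk (cs j + length ?a) \<sigma> = ?b then M \<sigma> else 0)"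
      by (intro sum_mono) (auto intro: Ms_le_M)
    finally have "real (length (al j (Suc s))) * (1/2) ^ (j + w j) \<le>
       (\<Sum>\<sigma> | length \<sigma> = ?n. if compat j ?a \<sigma> then 0 else M \<sigma>) +
       (\<Sum>\<sigma> | length \<sigma> = ?n. if compat j ?a \<sigma> \<and> chunk (cs j + length ?a) \<sigma> = ?b then M \<sigma> else 0)"
      using Suc(1) unfolding al by (simp add: distrib_right)
    also have "\<dots> = (\<Sum>\<sigma> | length \<sigma> = ?n. if compat j (al j (Suc s)) \<sigma> then 0 else M \<sigma>)"
      unfolding al cp sum.distrib[symmetric] by (rule sum.cong) auto
    finally show ?thesis .
  qed (use Suc(1) in \<open>simp add: al_Suc\<close>)
  have "\<dots> \<le> (\<Sum>\<sigma> | length \<sigma> = ?n. M \<sigma>)" by (intro sum_mono) auto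
  then have "real (length (al j (Suc s))) * (1/2) ^ (j + w j) \<le> 1" using * mass_UNIV[of ?n] by linarith
  then have "real (length (al j (Suc s))) \<le> real (2 ^ (j + w j))"
    by (simp add: power_one_over field_simps)
  then show "length (al j (Suc s)) \<le> 2 ^ j * 2 ^ w j" unfolding of_nat_le_iff power_add .
qed

text \<open>Here \<open>v\<close> is the value eventually prohibited for chunk \<open>c\<close>.
  There is at most one, but its existence is only semidecidable.\<close>

definition fb :: "nat \<Rightarrow> bool list \<Rightarrow> bool" where
  "fb c v \<longleftrightarrow> (\<exists>s. c - cs (bl c) < length (al (bl c) s) \<and> al (bl c) s ! (c - cs (bl c)) = v)"

lemma fb_unique: "fb c v \<Longrightarrow> fb c v' \<Longrightarrow> v = v'"
proof -
  have *: "v = v'" if "s \<le> s'" "t < length (al j s)" "al j s ! t = v" "al j s' ! t = v'" for s s' t j v v'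
    using al_mono[OF that(1), of j] that(2-4) by (auto simp: nth_append)
  show "fb c v \<Longrightarrow> fb c v' \<Longrightarrow> v = v'"
    unfolding fb_def by (metis * nat_le_linear)
qed

lemma pos_cs_Suc: "pos (cs (Suc j)) = pos (cs j) + (2 ^ j * 2 ^ w j + 1) * w j"
proof -
  have "t \<le> 2 ^ j * 2 ^ w j + 1 \<Longrightarrow> pos (cs j + t) = pos (cs j) + t * w j" for t
    by (induction t) (simp_all add: pos_Suc W_def bl_eq)
  from this[of "2 ^ j * 2 ^ w j + 1"] show ?thesis by (simp add: cs_Suc)
qed

definition QQ :: "(nat \<Rightarrow> bool) set" where
  "QQ = {X. \<forall>c v. fb c v \<longrightarrow> chunk c (restr X (pos (Suc c))) \<noteq> v}"

lemma chunk_restr: "pos (Suc c) \<le> n \<Longrightarrow> chunk c (restr X n) = map X [pos c..<pos (Suc c)]"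
  by (auto simp: chunk_def restr_def drop_map take_map drop_upt take_upt pos_Suc)

lemma chunk_restr_eq: "pos (Suc c) \<le> n \<Longrightarrow> chunk c (restr X n) = chunk c (restr X (pos (Suc c)))"
  by (simp add: chunk_restr)

lemma QQ_compat: "QQ = {X. \<forall>j s. compat j (al j s) (restr X (pos (cs (Suc j))))}"
proof (rule Set.set_eqI, rule iffI, rule CollectI, intro allI)
  fix X j s assume X: "X \<in> QQ"
  show "compat j (al j s) (restr X (pos (cs (Suc j))))" unfolding compat_def
  proof (intro allI impI)
    fix t assume t: "t < length (al j s)"
    then have t': "t < 2 ^ j * 2 ^ w j + 1" using al_length(2)[of j s] by linarith
    have "fb (cs j + t) (al j s ! t)" unfolding fb_def bl_eq[OF t'] using t by auto
    moreover have "pos (Suc (cs j + t)) \<le> pos (cs (Suc j))" using t' by (simp add: pos_le_iff cs_Suc)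
    ultimately show "chunk (cs j + t) (restr X (pos (cs (Suc j)))) \<noteq> nthd [] (al j s) t"
      using X t unfolding QQ_def by (subst chunk_restr_eq) auto
  qed
next
  fix X assume "X \<in> {X. \<forall>j s. compat j (al j s) (restr X (pos (cs (Suc j))))}"
  then have X: "\<forall>j s. compat j (al j s) (restr X (pos (cs (Suc j))))" by blast
  show "X \<in> QQ" unfolding QQ_def
  proof (intro CollectI allI impI)
    fix c v assume "fb c v"
    then obtain s where s: "c - cs (bl c) < length (al (bl c) s)" "al (bl c) s ! (c - cs (bl c)) = v"
      unfolding fb_def by blast
    have c: "cs (bl c) + (c - cs (bl c)) = c" using bl_props(1)[of c] by simp
    have "pos (Suc c) \<le> pos (cs (Suc (bl c)))" using bl_props(2)[of c] by (simp add: pos_le_iff)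
    moreover have "chunk c (restr X (pos (cs (Suc (bl c))))) \<noteq> nthd [] (al (bl c) s) (c - cs (bl c))"
      using X[rule_format, of "bl c" s] s(1) c unfolding compat_def by metis
    ultimately show "chunk c (restr X (pos (Suc c))) \<noteq> v" using s by (subst chunk_restr_eq[symmetric]) auto
  qed
qed

lemma Pi01_QQ: "Pi01 QQ"
proof (rule Pi01I[where R = "\<lambda>p \<sigma>. length \<sigma> = pos (cs (Suc (fst p))) \<longrightarrow> compat (fst p) (al (fst p) (snd p)) \<sigma>"])
  show "cmp (\<lambda>_. 0) (\<lambda>p. length (snd p) = pos (cs (Suc (fst (fst p)))) \<longrightarrow>
      compat (fst (fst p)) (al (fst (fst p)) (snd (fst p))) (snd p))"
    by (intro cmp_intros)
qed (auto simp: QQ_compat)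

text \<open>The list of prohibitions of block \<open>j\<close> is bounded and so stops growing. From
  then on the approximate mass of the obeying strings never exceeds \<open>(1/2) ^ j\<close>, hence
  neither does its limit.\<close>

lemma deep_QQ: "deep M QQ"
proof (rule deepI[of "\<lambda>j. pos (cs (Suc j))" _ 1])
  show "cmp (\<lambda>_. 0) (\<lambda>j. pos (cs (Suc j)))" by (intro cmp_intros)
  fix j
  let ?n = "pos (cs (Suc j))"
  define l where "l = Max (range (\<lambda>s. length (al j s)))"
  have fin: "finite (range (\<lambda>s. length (al j s)))"
    by (rule finite_subset[of _ "{..2 ^ j * 2 ^ w j}"]) (use al_length(2) in auto)
  have "l \<in> range (\<lambda>s. length (al j s))" unfolding l_def by (rule Max_in[OF fin]) auto
  then obtain s0 where s0: "length (al j s0) = l" by auto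
  have le: "length (al j s) \<le> l" for s unfolding l_def using fin by simp
  have al: "al j s = al j s0" if "s \<ge> s0" for s
    using al_mono[OF that, of j] le[of s] s0 by auto
  have S: "massS s j (al j s0) * 2 ^ j \<le> 2 ^ s" if "s \<ge> s0" for s
  proof (rule ccontr)
    assume "\<not> ?thesis"
    then have "length (al j (Suc s)) = Suc l" using al[OF that] s0 by (simp add: al_Suc)
    then show False using le[of "Suc s"] by simp
  qed
  have "mass QQ ?n \<le> (\<Sum>\<sigma> | length \<sigma> = ?n. if compat j (al j s0) \<sigma> then M \<sigma> else 0)"
    unfolding mass_def
  proof (rule sum_le_included[where i = "\<lambda>\<sigma>. \<sigma>"])
    show "\<forall>\<sigma>\<in>(\<lambda>X. restr X ?n) ` QQ. \<exists>y\<in>{\<sigma>. length \<sigma> = ?n}. y = \<sigma> \<and> M \<sigma> \<le> (if compat j (al j s0) y then M y else 0)"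
      by (auto simp: QQ_compat)
  qed auto
  also have "\<dots> \<le> (1/2) ^ j"
  proof (rule LIMSEQ_le_const2)
    show "(\<lambda>s. \<Sum>\<sigma> | length \<sigma> = ?n. if compat j (al j s0) \<sigma> then real (Ms s \<sigma>) / 2 ^ s else 0)
        \<longlonglongrightarrow> (\<Sum>\<sigma> | length \<sigma> = ?n. if compat j (al j s0) \<sigma> then M \<sigma> else 0)"
      by (intro tendsto_sum) (auto intro: Ms(3))
    have "(\<Sum>\<sigma> | length \<sigma> = ?n. if compat j (al j s0) \<sigma> then real (Ms s \<sigma>) / 2 ^ s else 0) \<le> (1/2) ^ j" if "s \<ge> s0" for s
    proof -
      have "(\<Sum>\<sigma> | length \<sigma> = ?n. if compat j (al j s0) \<sigma> then real (Ms s \<sigma>) / 2 ^ s else 0) = real (massS s j (al j s0)) / 2 ^ s"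
        unfolding massS_def of_nat_sum sum_divide_distrib by (rule sum.cong) auto
      also have "real (massS s j (al j s0) * 2 ^ j) \<le> real (2 ^ s)" using S[OF that] unfolding of_nat_le_iff .
      then have "real (massS s j (al j s0)) / 2 ^ s \<le> (1/2) ^ j" by (simp add: power_one_over field_simps)
      finally show ?thesis .
    qed
    then show "\<exists>N. \<forall>s\<ge>N. (\<Sum>\<sigma> | length \<sigma> = ?n. if compat j (al j s0) \<sigma> then real (Ms s \<sigma>) / 2 ^ s else 0) \<le> (1/2) ^ j"
      by blast
  qed
  finally show "mass QQ ?n \<le> real 1 * (1/2) ^ j" by simp
qed

subsection \<open>Bushy forcing inside the class\<close>

text \<open>Bushy trees read the width of the next step off the length of a node. The forcing keeps
  to lengths satisfying \<open>bnd\<close>, where this is the width of the next chunk.\<close>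

definition wl :: "nat \<Rightarrow> nat" where "wl n = W (LEAST c. n \<le> pos c)"

lemma wl_pos [simp]: "wl (pos c) = W c"
proof -
  have "(LEAST d. pos c \<le> pos d) = c" unfolding pos_le_iff by (rule Least_equality) auto
  then show ?thesis by (simp add: wl_def)
qed

lemma cmp_wl [cmp_intros]: "cmp A f \<Longrightarrow> cmp A (\<lambda>x. wl (f x))"
proof -
  assume f: "cmp A f"
  have "cmp A wl" unfolding wl_def[abs_def]
    by (intro cmp_intros) (metis pos_ge)
  then show ?thesis using f by (rule cmp_comp)
qed

definition bnd :: "nat \<Rightarrow> bool" where "bnd n \<longleftrightarrow> (\<exists>c. n = pos c)"

lemma bnd_step: "bnd n \<Longrightarrow> bnd (n + wl n)"
  unfolding bnd_def by (metis pos_Suc wl_pos)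

definition B0 :: "bool list \<Rightarrow> bool" where
  "B0 \<sigma> \<longleftrightarrow> (\<exists>c v. pos (Suc c) \<le> length \<sigma> \<and> fb c v \<and> chunk c \<sigma> = v)"

lemma chunk_append: "pos (Suc c) \<le> length \<sigma> \<Longrightarrow> chunk c (\<sigma> @ \<tau>) = chunk c \<sigma>"
  by (simp add: chunk_def pos_Suc)

lemma B0_append: "B0 \<sigma> \<Longrightarrow> B0 (\<sigma> @ \<tau>)"
  unfolding B0_def using chunk_append by (metis le_add1 length_append order_trans)

text \<open>At a chunk boundary, a node outside \<open>B0\<close> has at most one child in
  \<open>B0\<close>, because a chunk has at most one prohibited value. Hence a tree with two
  children per node cannot lead from outside into \<open>B0\<close>.\<close>

lemma big_B0: "big wl 2 B0 \<sigma> \<Longrightarrow> bnd (length \<sigma>) \<Longrightarrow> B0 \<sigma>"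
proof (induction rule: big.induct)
  case (node S \<sigma>)
  obtain c where c: "length \<sigma> = pos c" using node.prems unfolding bnd_def by blast
  have B: "B0 (\<sigma> @ v) \<and> length v = W c" if "v \<in> S" for v
    using node.IH[OF that] node.hyps(1) that bnd_step[OF node.prems] c by auto
  show ?case
  proof (rule ccontr)
    assume nB: "\<not> B0 \<sigma>"
    have "fb c v" if v: "v \<in> S" for v
    proof -
      obtain d where d: "pos (Suc d) \<le> length (\<sigma> @ v)" "fb d (chunk d (\<sigma> @ v))" using B[OF v] unfolding B0_def by blast
      have "\<not> pos (Suc d) \<le> length \<sigma>" using nB d chunk_append unfolding B0_def by metis
      moreover have "length (\<sigma> @ v) = pos (Suc c)" using B[OF v] c by (simp add: pos_Suc)
      ultimately have "d = c" using d(1) c by (simp only: pos_le_iff)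
      moreover have "chunk c (\<sigma> @ v) = v" using B[OF v] c by (simp add: chunk_def)
      ultimately show ?thesis using d(2) by simp
    qed
    then have S: "S \<subseteq> {v}" if "v \<in> S" for v using fb_unique that by blast
    have "card S \<le> 1"
    proof (cases "S = {}")
      case False
      then obtain v where "S \<subseteq> {v}" using S by blast
      then show ?thesis using card_mono[of "{v}" S] by simp
    qed simp
    then show False using node.hyps(2) by simp
  qed
qed

lemma not_big_extend:
  assumes "\<not> big wl k B \<sigma>" "length \<sigma> = pos c" "c \<le> d" "\<And>i. c \<le> i \<Longrightarrow> i < d \<Longrightarrow> k \<le> 2 ^ W i"
  shows "\<exists>\<rho>. length (\<sigma> @ \<rho>) = pos d \<and> \<not> big wl k B (\<sigma> @ \<rho>)"
  using assms(3,4)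
proof (induction d rule: dec_induct)
  case base
  then show ?case using assms(1,2) by (intro exI[of _ "[]"]) simp
next
  case (step d)
  then obtain \<rho> where \<rho>: "length (\<sigma> @ \<rho>) = pos d" "\<not> big wl k B (\<sigma> @ \<rho>)" by fastforce
  moreover have "k \<le> 2 ^ wl (length (\<sigma> @ \<rho>))" unfolding \<rho>(1) wl_pos using step by simp
  ultimately obtain v where "length v = W d" "\<not> big wl k B ((\<sigma> @ \<rho>) @ v)"
    using not_big_child[of wl k B "\<sigma> @ \<rho>"] unfolding \<rho>(1) wl_pos by blast
  then show ?case using \<rho>(1) by (intro exI[of _ "\<rho> @ v"]) (simp add: pos_Suc)
qed

text \<open>A chunk has at least two values, of which at most one is prohibited; allowed values are
  strung together.\<close>

lemma QQ_nonempty: "QQ \<noteq> {}"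
proof -
  have "\<exists>v. length v = n \<and> v \<noteq> u" if "n \<ge> 1" for n and u :: "bool list"
  proof (rule ccontr)
    assume "\<not> ?thesis"
    then have "replicate n True = u" "replicate n False = u" by auto
    then show False using that by (cases n) auto
  qed
  from this[OF W_pos] have ex: "\<exists>v. length v = W c \<and> v \<noteq> u" for c and u :: "bool list" .
  have "\<exists>v. length v = W c \<and> \<not> fb c v" for c
  proof (cases "\<exists>u. fb c u")
    case True
    then obtain u where "fb c u" by blast
    then show ?thesis using ex[of c u] fb_unique by blast
  qed (use ex[of c "[]"] in blast)
  then obtain V where V: "\<And>c. length (V c) = W c" "\<And>c. \<not> fb c (V c)" by metis
  define X where "X n = V (LEAST c. n < pos (Suc c)) ! (n - pos (LEAST c. n < pos (Suc c)))" for n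
  have "map X [pos c..<pos (Suc c)] = V c" for c
  proof (rule nth_equalityI)
    show "length (map X [pos c..<pos (Suc c)]) = length (V c)" by (simp add: pos_Suc V)
    fix i assume "i < length (map X [pos c..<pos (Suc c)])"
    then have i: "i < W c" by (simp add: pos_Suc)
    have "(LEAST d. pos c + i < pos (Suc d)) = c"
    proof (rule Least_equality)
      show "pos c + i < pos (Suc c)" using i by (simp add: pos_Suc)
      fix d assume "pos c + i < pos (Suc d)"
      then have "pos c < pos (Suc d)" by linarith
      then show "c \<le> d" unfolding pos_less_iff by simp
    qed
    then show "map X [pos c..<pos (Suc c)] ! i = V c ! i" using i by (simp add: X_def pos_Suc)
  qed
  then have "X \<in> QQ" unfolding QQ_def using V(2) by (auto simp add: chunk_restr)
  then show ?thesis by blast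
qed

end

context universal
begin

lemma F_deep_nonempty: "F_deep M \<noteq> {}"
proof -
  interpret blocks M "\<lambda>_. 1" by unfold_locales (auto intro: cmp_intros)
  have "wd QQ \<in> F_deep M" unfolding F_deep_iff
    by (intro exI[of _ QQ] conjI QQ_nonempty Pi01_QQ deep_QQ refl)
  then show ?thesis by auto
qed

end

section \<open>A member of the new class that computes no member of a given deep class\<close>

locale deep_target = universal +
  fixes P :: "(nat \<Rightarrow> bool) set" and r :: "nat \<Rightarrow> nat"
  assumes cmp_r: "cmp (\<lambda>_. 0) r" and mono_r: "mono r" and mass_P: "mass P (r n) \<le> (1/2) ^ n"
begin

text \<open>Summing all the codes gives a computable upper bound for them without any estimate of
  the coding.\<close>

definition Zb :: "nat \<Rightarrow> nat \<Rightarrow> nat" where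
  "Zb p b = (\<Sum>\<sigma>::bool list | length \<sigma> = p. \<Sum>k<Suc (2 ^ b). enc (\<sigma>, k::nat))"

lemma enc_le_Zb: fixes k :: nat and \<sigma> :: "bool list" assumes "length \<sigma> = p" "k \<le> 2 ^ b" shows "enc (\<sigma>, k) \<le> Zb p b"
proof -
  have "enc (\<sigma>, k) \<le> (\<Sum>k<Suc (2 ^ b). enc (\<sigma>, k))"
    by (rule member_le_sum[of k "{..<Suc (2 ^ b)}" "\<lambda>k. enc (\<sigma>, k)"]) (use assms in auto)
  also have "\<dots> \<le> Zb p b" unfolding Zb_def
    by (rule member_le_sum[of \<sigma> "{\<sigma>. length \<sigma> = p}" "\<lambda>\<sigma>. \<Sum>k<Suc (2 ^ b). enc (\<sigma>, k::nat)"]) (use assms in auto)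
  finally show ?thesis .
qed

text \<open>One recursion yields the pair of \<open>pos (cs j)\<close> and \<open>ww j\<close>,
  because the width of a block depends on where it starts: it must exceed \<open>r (2 * z)\<close>
  for every code \<open>z\<close> of a string ending there together with a number up to
  \<open>2 ^ snd pb\<close>.\<close>

definition gg :: "nat \<Rightarrow> nat \<times> nat" where
  "gg j = rec_nat (0, 1) (\<lambda>j pb. let p = fst pb + (2 ^ j * 2 ^ snd pb + 1) * snd pb in
     (p, Suc (snd pb + r (2 * Zb p (snd pb))))) j"

definition ww :: "nat \<Rightarrow> nat" where "ww j = snd (gg j)"

lemma cmp_ww: "cmp (\<lambda>_. 0) ww"
proof -
  have *: "cmp (\<lambda>_. 0) (\<lambda>p. Zb (fst p) (snd p))" unfolding Zb_def by (intro cmp_intros)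
  show ?thesis unfolding ww_def[abs_def] gg_def by (intro cmp_intros cmp_comp[OF cmp_r] cmp_app2[OF *])
qed

lemma gg_Suc: "gg (Suc j) = (fst (gg j) + (2 ^ j * 2 ^ ww j + 1) * ww j,
    Suc (ww j + r (2 * Zb (fst (gg j) + (2 ^ j * 2 ^ ww j + 1) * ww j) (ww j))))"
  and gg_0: "gg 0 = (0, 1)"
  by (simp_all add: gg_def ww_def Let_def)

sublocale blocks M ww
proof
  show "cmp (\<lambda>_. 0) ww" by (rule cmp_ww)
  show "1 \<le> ww j" for j by (cases j) (simp_all add: ww_def gg_0 gg_Suc)
qed

lemma gg_pos: "fst (gg j) = pos (cs j)"
proof (induction j)
  case 0
  then show ?case by (simp add: gg_0 cs_def pos_def)
next
  case (Suc j)
  then show ?case by (simp only: gg_Suc pos_cs_Suc fst_conv)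
qed

lemma ww_Suc: "ww (Suc j) = Suc (ww j + r (2 * Zb (pos (cs (Suc j))) (ww j)))"
  unfolding ww_def[of "Suc j"] gg_Suc pos_cs_Suc gg_pos by simp

lemma ww_mono: "i \<le> j \<Longrightarrow> ww i \<le> ww j"
  by (rule lift_Suc_mono_le[of ww]) (simp_all add: ww_Suc)

lemma W_ge: "cs j \<le> c \<Longrightarrow> 2 ^ ww j \<le> (2::nat) ^ W c"
  unfolding W_def using ww_mono[OF bl_ge] by (simp add: power_increasing)

text \<open>In a condition \<open>(j, \<sigma>, k, B)\<close>, the sequence to be built extends
  \<sigma>, which fills the blocks up to \<open>j\<close>, and avoids the bad strings in
  \<open>B\<close>. It can be continued since \<open>B\<close> is not \<open>k\<close>-big above
  \<sigma> and each later chunk has at least \<open>k\<close> values.\<close>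

type_synonym condition = "nat \<times> bool list \<times> nat \<times> (bool list \<Rightarrow> bool)"

definition good :: "condition \<Rightarrow> bool" where
  "good = (\<lambda>(j, \<sigma>, k, B). length \<sigma> = pos (cs (Suc j)) \<and> k \<le> 2 ^ ww j \<and> \<not> big wl k B \<sigma> \<and>
     (\<forall>x y. B x \<longrightarrow> B (x @ y)) \<and> (\<forall>x. B0 x \<longrightarrow> B x))"

text \<open>The last clause meets requirement \<open>e\<close>. It quantifies over the sequences
  that extend \<open>\<sigma>'\<close> and avoid \<open>B'\<close>, so that a wrong output secured
  by \<open>\<sigma>'\<close> and a divergence secured by \<open>B'\<close> are treated
  alike.\<close>

definition stronger :: "nat \<Rightarrow> condition \<Rightarrow> condition \<Rightarrow> bool" where
  "stronger e = (\<lambda>(j, \<sigma>, k, B) (j', \<sigma>', k', B'). j < j' \<and> (\<exists>\<rho>. \<sigma>' = \<sigma> @ \<rho>) \<and> (\<forall>x. B x \<longrightarrow> B' x) \<and>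
     (\<forall>Y. restr Y (length \<sigma>') = \<sigma>' \<longrightarrow> (\<forall>c. \<not> B' (restr Y (pos c))) \<longrightarrow>
        (\<forall>p. prog_encode p = e \<longrightarrow> \<not> (\<exists>X\<in>P. \<forall>i. run p (seq_of Y) i = Some (seq_of X i)))))"

lemma good_0: "\<exists>q. good q"
proof -
  have n0: "\<not> big wl 2 B0 []"
    using big_B0[of "[]"] pos_def[of 0] W_pos unfolding B0_def bnd_def
    by (force simp: pos_Suc dest: le_trans)
  have "ww 0 = 1" by (simp add: ww_def gg_0)
  then have "2 \<le> (2::nat) ^ W i" for i
    using W_ge[of 0 i] by (simp add: cs_def)
  then obtain \<rho> where "length \<rho> = pos (cs (Suc 0))" "\<not> big wl 2 B0 \<rho>"
    using not_big_extend[OF n0, of 0 "cs (Suc 0)"] by (auto simp: pos_def[of 0])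
  then have "good (0, \<rho>, 2, B0)"
    using \<open>ww 0 = 1\<close> B0_append by (simp add: good_def)
  then show ?thesis ..
qed

lemma length_le_enc: "length (xs :: bool list) \<le> enc (xs, k::nat)"
proof -
  have "length xs \<le> enc xs" using length_le_list_encode[of "map enc xs"] by (simp add: enc_list_def)
  also have "\<dots> \<le> enc (xs, k)" unfolding enc_prod_def by (simp add: le_prod_encode_1)
  finally show ?thesis .
qed

text \<open>Let \<open>z\<close> code \<open>\<sigma>1\<close> and \<open>k\<close>, and let
  \<open>R = r (2 * z)\<close>. If the strings giving an output of length \<open>R\<close> are big
  with \<open>card I * k\<close> children, one output is produced on a \<open>k\<close>-big tree,
  and a search finds such an output of weight at least \<open>(1/2) ^ Suc z / C\<close>. Prefixes of
  length \<open>R\<close> of members of \<open>P\<close> weigh at most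
  \<open>(1/2) ^ (2 * z)\<close>, so it is none of them, and some leaf of its tree keeps
  \<open>B\<close> small above it. Otherwise all strings giving an output of length \<open>R\<close>
  are declared bad, which forces divergence.\<close>

lemma stronger_ex:
  assumes "good q" shows "\<exists>q'. good q' \<and> stronger e q q'"
proof -
  obtain j \<sigma> k B where q: "q = (j, \<sigma>, k, B)" by (cases q)
  have g: "length \<sigma> = pos (cs (Suc j))" "k \<le> 2 ^ ww j" "\<not> big wl k B \<sigma>"
    and Bext: "\<And>x y. B x \<Longrightarrow> B (x @ y)" and B0: "\<And>x. B0 x \<Longrightarrow> B x"
    using assms unfolding q good_def by auto
  \<comment> \<open>The search runs over certificates \<open>s\<close> that one output
    \<open>i\<close> is produced on a big tree; \<open>z\<close> codes the root and the branching
    number.\<close>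
  define F where "F z s i \<longleftrightarrow> (let sk = dec z :: bool list \<times> nat; D = dec s :: bool list list in
     length i = r (2 * z) \<and> bder wl (snd sk) (\<lambda>x. fcomp (length x) e x i) D \<and> fst sk \<in> set D)"
    for z s :: nat and i :: "bool list"
  have "cmp (\<lambda>_. 0) (\<lambda>p. F (fst p) (fst (snd p)) (snd (snd p)))"
  proof -
    have "cmp (\<lambda>_. 0) (\<lambda>p::nat \<times> (bool list \<times> bool list list). bder wl (fst p) (\<lambda>x. fcomp (length x) e x (fst (snd p))) (snd (snd p)))"
      unfolding bder_def bstep_def by (intro cmp_intros)
    note bd = cmp_app3[OF this]
    show ?thesis unfolding F_def by (intro cmp_intros cmp_comp[OF cmp_r] bd)
  qed
  then obtain C :: nat where C: "C > 0"
    "\<And>z. \<exists>s i. F z s i \<Longrightarrow> \<exists>s i. F z s i \<and> (1/2) ^ Suc z \<le> real C * M i"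
    using search_weight by blast
  \<comment> \<open>The string will be prolonged until \<open>z \<ge> m\<close>, so that
    \<open>2 ^ z\<close> exceeds \<open>2 * C\<close> and the two weights contradict each
    other.\<close>
  obtain m :: nat where m: "real (2 * C) < 2 ^ m" using real_arch_pow[of 2 "real (2 * C)"] by auto
  define j1 where "j1 = max j m"
  have j1: "j \<le> j1" "m \<le> j1" by (simp_all add: j1_def)
  have k1: "k \<le> 2 ^ ww j1" using g(2) ww_mono[OF j1(1)] by (meson le_trans one_le_numeral power_increasing)
  have kW: "k \<le> 2 ^ W i" if "cs (Suc j) \<le> i" for i
    using g(2) W_ge[of j i] cs_mono[of j "Suc j"] that by (meson le_SucI le_refl le_trans)
  obtain \<rho> where \<rho>: "length (\<sigma> @ \<rho>) = pos (cs (Suc j1))" "\<not> big wl k B (\<sigma> @ \<rho>)"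
    using not_big_extend[OF g(3,1), of "cs (Suc j1)"] cs_mono[of "Suc j" "Suc j1"] j1(1) kW by auto
  define \<sigma>1 where "\<sigma>1 = \<sigma> @ \<rho>"
  define z where "z = enc (\<sigma>1, k)"
  have "j1 \<le> pos (cs (Suc j1))" using cs_ge[of "Suc j1"] pos_ge[of "cs (Suc j1)"] by linarith
  then have "m \<le> z" using length_le_enc[of \<sigma>1 k] \<rho>(1) j1(2) unfolding z_def \<sigma>1_def by linarith
  define R where "R = r (2 * z)"
  define A where "A i x \<longleftrightarrow> fcomp (length x) e x i" for i x
  define I where "I = {i::bool list. length i = R}"
  define AA where "AA x \<longleftrightarrow> (\<exists>i\<in>I. A i x)" for x
  have A_ext: "A i (x @ y)" if "A i x" for i x y
    using that unfolding A_def by (simp add: fcomp_mono)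
  show ?thesis
  proof (cases "big wl (card I * k) AA \<sigma>1")
    case True
    have "finite I" "I \<noteq> {}" unfolding I_def by (simp, metis (mono_tags) Collect_empty_eq length_replicate)
    from big_pigeon[OF this True[unfolded AA_def[abs_def]]] obtain i where i: "i \<in> I" "big wl k (A i) \<sigma>1" by blast
    obtain D where "bder wl k (A i) D" "\<sigma>1 \<in> set D" using bder_complete[OF i(2)] by blast
    then have "F z (enc D) i" using i(1) unfolding F_def z_def I_def R_def A_def by simp
    then obtain s' i' where F': "F z s' i'" and Mi: "(1/2) ^ Suc z \<le> real C * M i'" using C(2) by blast
    have dz: "dec z = (\<sigma>1, k)" unfolding z_def by simp
    have "bder wl k (A i') (dec s')" "\<sigma>1 \<in> set (dec s')" and len: "length i' = R"
      using F' unfolding F_def Let_def dz R_def A_def by simp_all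
    then have "big wl k (A i') \<sigma>1" by (intro bder_sound)
    moreover have "bnd (length \<sigma>1)" unfolding bnd_def \<sigma>1_def using \<rho>(1) by blast
    ultimately obtain \<rho>' where \<rho>': "A i' (\<sigma>1 @ \<rho>')" "\<not> big wl k B (\<sigma>1 @ \<rho>')" "bnd (length (\<sigma>1 @ \<rho>'))"
      using big_compose[of wl k "A i'" \<sigma>1 B bnd] \<rho>(2) bnd_step unfolding \<sigma>1_def by blast
    then obtain c where c: "length (\<sigma>1 @ \<rho>') = pos c" unfolding bnd_def by blast
    have "pos (cs (Suc j1)) \<le> pos c" using c \<rho>(1) unfolding \<sigma>1_def by simp
    then have c_ge: "cs (Suc j1) \<le> c" unfolding pos_le_iff .
    define j2 where "j2 = max c (Suc j1)"
    have "c \<le> cs (Suc j2)" using cs_ge[of "Suc j2"] unfolding j2_def by linarith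
    then obtain \<rho>'' where \<rho>'': "length ((\<sigma>1 @ \<rho>') @ \<rho>'') = pos (cs (Suc j2))" "\<not> big wl k B ((\<sigma>1 @ \<rho>') @ \<rho>'')"
      using not_big_extend[OF \<rho>'(2) c, of "cs (Suc j2)"] kW cs_mono[of "Suc j" "Suc j1"] j1(1) c_ge by auto
    define \<sigma>2 where "\<sigma>2 = (\<sigma>1 @ \<rho>') @ \<rho>''"
    have k2: "k \<le> 2 ^ ww j2"
    proof -
      have "(2::nat) ^ ww j1 \<le> 2 ^ ww j2" by (intro power_increasing ww_mono) (simp_all add: j2_def)
      then show ?thesis using k1 by linarith
    qed
    have "good (j2, \<sigma>2, k, B)"
      unfolding good_def \<sigma>2_def using \<rho>'' k2 Bext B0 by auto
    moreover have "stronger e q (j2, \<sigma>2, k, B)"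
      unfolding q stronger_def prod.case
    proof (intro conjI allI impI)
      show "j < j2" using j1 by (simp add: j2_def)
      show "\<exists>\<rho>. \<sigma>2 = \<sigma> @ \<rho>" by (simp add: \<sigma>2_def \<sigma>1_def)
      show "B x" if "B x" for x using that .
      fix Y p assume Y: "restr Y (length \<sigma>2) = \<sigma>2" and e: "prog_encode p = e"
      show "\<not> (\<exists>X\<in>P. \<forall>i. run p (seq_of Y) i = Some (seq_of X i))"
      proof
        assume "\<exists>X\<in>P. \<forall>i. run p (seq_of Y) i = Some (seq_of X i)"
        then obtain X where X: "X \<in> P" "\<And>i. run p (seq_of Y) i = Some (seq_of X i)" by blast
        have "restr Y (pos c) = take (pos c) \<sigma>2" using Y \<rho>'' c unfolding \<sigma>2_def by (metis append_eq_conv_conj length_append le_add1 min.absorb1 take_restr)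
        then have "restr Y (pos c) = \<sigma>1 @ \<rho>'" using c unfolding \<sigma>2_def by simp
        then have "fcomp (pos c) (prog_encode p) (restr Y (pos c)) i'" using \<rho>'(1) c unfolding A_def e[symmetric] by simp
        then have "run p (seq_of Y) n = Some (of_bool (i' ! n))" if "n < R" for n
          using fcomp_sound that len by blast
        then have "of_bool (i' ! n) = seq_of X n" if "n < R" for n using X(2)[of n] that by (metis option.inject)
        then have "i' ! n = X n" if "n < R" for n using that unfolding seq_of_def of_bool_eq_iff .
        then have "i' = restr X R" using len by (intro nth_equalityI) auto
        then have "M i' \<le> mass P R" unfolding mass_def using X(1) by (intro member_le_sum) auto
        also have "\<dots> \<le> (1/2) ^ (2 * z)" unfolding R_def by (rule mass_P)
        finally have "real C * M i' \<le> real C * (1/2) ^ (2 * z)" by (intro mult_left_mono) auto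
        then have "(1/2) ^ Suc z \<le> real C * (1/2) ^ (2 * z)" using Mi by linarith
        then have "2 ^ z \<le> real (2 * C)" by (simp add: power_one_over field_simps power_mult power2_eq_square)
        moreover have "(2::real) ^ m \<le> 2 ^ z" using \<open>m \<le> z\<close> by (simp add: power_increasing)
        ultimately show False using m by linarith
      qed
    qed
    ultimately show ?thesis by blast
  next
    case False
    define B' where "B' x \<longleftrightarrow> B x \<or> AA x" for x
    \<comment> \<open>Avoiding \<open>B\<close> costs \<open>k\<close> children and avoiding
      \<open>AA\<close> costs \<open>card I * k\<close>, where \<open>card I = 2 ^ R\<close>; the
      width of the next block was chosen for this sum.\<close>
    define k' where "k' = k + card I * k"
    have nb: "\<not> big wl k' B' \<sigma>1"
      using big_union[of wl k "card I * k" B AA \<sigma>1] False \<rho>(2) unfolding B'_def[abs_def] k'_def \<sigma>1_def by blast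
    have "R \<le> r (2 * Zb (pos (cs (Suc j1))) (ww j1))"
      unfolding R_def using enc_le_Zb[OF _ k1, of \<sigma>1 "pos (cs (Suc j1))"] \<rho>(1)
      by (intro monoD[OF mono_r]) (simp add: z_def \<sigma>1_def)
    then have "ww j1 + R + 1 \<le> ww (Suc j1)" by (simp add: ww_Suc)
    then have "(2::nat) ^ (ww j1 + R + 1) \<le> 2 ^ ww (Suc j1)" by (intro power_increasing) auto
    moreover have "k' \<le> 2 ^ ww j1 + 2 ^ R * 2 ^ ww j1" unfolding k'_def I_def using k1 by (intro add_mono mult_mono) auto
    moreover have "(2::nat) ^ ww j1 + 2 ^ R * 2 ^ ww j1 \<le> 2 ^ (ww j1 + R + 1)"
      by (simp add: power_add mult.commute)
    ultimately have k': "k' \<le> 2 ^ ww (Suc j1)" by linarith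
    have "k' \<le> 2 ^ W i" if "cs (Suc j1) \<le> i" for i using k' W_ge[OF that] by linarith
    then obtain \<rho>' where \<rho>': "length (\<sigma>1 @ \<rho>') = pos (cs (Suc (Suc j1)))" "\<not> big wl k' B' (\<sigma>1 @ \<rho>')"
      using not_big_extend[OF nb \<rho>(1)[folded \<sigma>1_def], of "cs (Suc (Suc j1))"] cs_mono[of "Suc j1" "Suc (Suc j1)"] by auto
    have "AA (x @ y)" if "AA x" for x y using that A_ext unfolding AA_def by blast
    then have "good (Suc j1, \<sigma>1 @ \<rho>', k', B')"
      unfolding good_def using \<rho>' k' Bext B0 unfolding B'_def by auto
    moreover have "stronger e q (Suc j1, \<sigma>1 @ \<rho>', k', B')"
      unfolding q stronger_def prod.case
    proof (intro conjI allI impI)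
      show "j < Suc j1" using j1 by simp
      show "\<exists>\<rho>. \<sigma>1 @ \<rho>' = \<sigma> @ \<rho>" by (simp add: \<sigma>1_def)
      show "B' x" if "B x" for x using that by (simp add: B'_def)
      fix Y p assume Y: "\<forall>c. \<not> B' (restr Y (pos c))" and e: "prog_encode p = e"
      show "\<not> (\<exists>X\<in>P. \<forall>i. run p (seq_of Y) i = Some (seq_of X i))"
      proof
        assume "\<exists>X\<in>P. \<forall>i. run p (seq_of Y) i = Some (seq_of X i)"
        then obtain X where X: "X \<in> P" "\<And>i. run p (seq_of Y) i = Some (seq_of X i)" by blast
        then obtain n where n: "\<And>s. s \<ge> n \<Longrightarrow> fcomp s (prog_encode p) (restr Y s) (restr X R)"
          using fcomp_complete[of R p Y X] by blast
        have "fcomp (pos n) e (restr Y (pos n)) (restr X R)" unfolding e[symmetric] by (rule n[OF pos_ge])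
        then have "AA (restr Y (pos n))" unfolding AA_def A_def I_def by (intro bexI[of _ "restr X R"]) auto
        then show False using Y unfolding B'_def by blast
      qed
    qed
    ultimately show ?thesis by blast
  qed
qed

text \<open>The requirements are met one after another, and \<open>Y\<close> is the union of the
  strings. It avoids every bad set, since these grow, are closed under extension and never contain
  the current string; as they include \<open>B0\<close>, it lies in \<open>QQ\<close>.\<close>

lemma QQ_not_above: "\<exists>Y\<in>QQ. \<forall>X\<in>P. \<not> seq_of X \<le>\<^sub>T seq_of Y"
proof -
  obtain q where q: "\<And>n. good (q n)" "\<And>n. stronger n (q n) (q (Suc n))"
    using dependent_nat_choice[of "\<lambda>n. good" "\<lambda>n. stronger n"] good_0 stronger_ex by metis
  define jj \<sigma> kk B where "jj n = fst (q n)" and "\<sigma> n = fst (snd (q n))" and "kk n = fst (snd (snd (q n)))"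
    and "B n = snd (snd (snd (q n)))" for n
  have qn: "q n = (jj n, \<sigma> n, kk n, B n)" for n by (simp add: jj_def \<sigma>_def kk_def B_def)
  have good: "length (\<sigma> n) = pos (cs (Suc (jj n)))" "\<not> B n (\<sigma> n)" "B n x \<Longrightarrow> B n (x @ y)" "B0 x \<Longrightarrow> B n x" for n x y
  proof -
    have "\<not> big wl (kk n) (B n) (\<sigma> n)" using q(1)[of n] unfolding qn[of n] good_def by auto
    then show "\<not> B n (\<sigma> n)" using big.leaf by blast
    show "length (\<sigma> n) = pos (cs (Suc (jj n)))" "B n x \<Longrightarrow> B n (x @ y)" "B0 x \<Longrightarrow> B n x"
      using q(1)[of n] unfolding qn[of n] good_def by auto
  qed
  have str: "jj n < jj (Suc n)" "\<exists>\<rho>. \<sigma> (Suc n) = \<sigma> n @ \<rho>" "B n x \<Longrightarrow> B (Suc n) x" for n x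
    using q(2)[of n] unfolding qn[of n] qn[of "Suc n"] stronger_def by auto
  have ext: "\<exists>\<rho>. \<sigma> (n + d) = \<sigma> n @ \<rho>" for n d
  proof (induction d)
    case (Suc d)
    then show ?case using str(2)[of "n + d"] by (metis add_Suc_right append_assoc)
  qed simp
  have Bmono: "B n x \<Longrightarrow> B (n + d) x" for n d x by (induction d) (use str(3) in auto)
  have "n \<le> jj n" for n by (induction n) (use str(1) in \<open>auto simp: Suc_le_eq intro: le_less_trans\<close>)
  then have len: "n < length (\<sigma> n)" for n
    using good(1)[of n] cs_ge[of "Suc (jj n)"] pos_ge[of "cs (Suc (jj n))"] by (metis Suc_le_lessD le_trans Suc_le_mono)
  define Y where "Y n = \<sigma> n ! n" for n
  have Y: "restr Y m = take m (\<sigma> n)" if "m \<le> length (\<sigma> n)" for m n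
  proof (rule nth_equalityI)
    fix i assume "i < length (restr Y m)"
    then have i: "i < m" by simp
    have "\<sigma> i ! i = \<sigma> n ! i"
    proof (cases "i \<le> n")
      case True
      then show ?thesis using ext[of i "n - i"] len[of i] by (auto simp: nth_append)
    next
      case False
      then obtain \<rho> where "\<sigma> i = \<sigma> n @ \<rho>" using ext[of n "i - n"] by auto
      then show ?thesis using i that by (simp add: nth_append)
    qed
    then show "restr Y m ! i = take m (\<sigma> n) ! i" using i by (simp add: Y_def)
  qed (use that in simp)
  have avoid: "\<not> B n (restr Y m)" for n m
  proof
    assume *: "B n (restr Y m)"
    have "m \<le> length (\<sigma> (n + m))" using len[of "n + m"] by simp
    then have "\<sigma> (n + m) = restr Y m @ drop m (\<sigma> (n + m))" using Y by simp
    moreover have "B (n + m) (restr Y m)" using Bmono[OF *] .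
    ultimately have "B (n + m) (\<sigma> (n + m))" using good(3) by metis
    then show False using good(2) by blast
  qed
  have "Y \<in> QQ" unfolding QQ_def
  proof (intro CollectI allI impI notI)
    fix c v assume "fb c v" "chunk c (restr Y (pos (Suc c))) = v"
    then have "B0 (restr Y (pos (Suc c)))" unfolding B0_def by (intro exI[of _ c]) auto
    then show False using good(4)[of "restr Y (pos (Suc c))" 0] avoid by blast
  qed
  moreover have "\<not> seq_of X \<le>\<^sub>T seq_of Y" if "X \<in> P" for X
  proof
    assume "seq_of X \<le>\<^sub>T seq_of Y"
    then obtain p where p: "\<And>i. run p (seq_of Y) i = Some (seq_of X i)" unfolding turing_le_def by blast
    let ?n = "prog_encode p"
    have "restr Y (length (\<sigma> (Suc ?n))) = \<sigma> (Suc ?n)" using Y[of _ "Suc ?n"] by simp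
    then show False using q(2)[of ?n] p that avoid unfolding qn[of ?n] qn[of "Suc ?n"] stronger_def by fast
  qed
  ultimately show ?thesis by blast
qed

end

context universal
begin

lemma F_deep_no_least: "\<not> (\<exists>l. least E\<^sub>w l (F_deep M))"
proof
  assume "\<exists>l. least E\<^sub>w l (F_deep M)"
  then obtain l where l: "l \<in> F_deep M" "\<And>q. q \<in> F_deep M \<Longrightarrow> wdeg_le l q"
    unfolding least_def le_E by blast
  then obtain P where P: "deep M P" "l = wd P" unfolding F_deep_iff by blast
  then obtain r where "cmp (\<lambda>_. 0) r" "mono r" "\<And>n. mass P (r n) \<le> (1/2) ^ n" unfolding deep_iff by blast
  then interpret deep_target M P r by unfold_locales
  have "wd QQ \<in> F_deep M" unfolding F_deep_iff
    by (intro exI[of _ QQ] conjI QQ_nonempty Pi01_QQ deep_QQ refl)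
  from l(2)[OF this] have "seq_of ` P \<le>\<^sub>w seq_of ` QQ" unfolding P(2) wdeg_le_deg .
  then show False using QQ_not_above unfolding weak_le_def by blast
qed

end

section \<open>Martin-Loef random sequences\<close>

lemma coin_cylinder: "emeasure coin_measure {X. restr X n = \<sigma>} = (if length \<sigma> = n then ennreal ((1/2) ^ n) else 0)"
proof (cases "length \<sigma> = n")
  case True
  interpret product_prob_space "\<lambda>_::nat. measure_pmf (bernoulli_pmf (1/2))" UNIV
    by unfold_locales
  have eq: "{X. restr X n = \<sigma>} = {X \<in> space (\<Pi>\<^sub>M _\<in>UNIV. measure_pmf (bernoulli_pmf (1/2))). \<forall>i\<in>{..<n}. X i \<in> {\<sigma> ! i}}"
    using True by (auto simp: space_PiM list_eq_iff_nth_eq)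
  have "emeasure coin_measure {X. restr X n = \<sigma>} = (\<Prod>i<n. emeasure (measure_pmf (bernoulli_pmf (1/2))) {\<sigma> ! i})"
    unfolding coin_measure_def eq by (rule emeasure_PiM_Collect) auto
  also have "\<dots> = (\<Prod>i<n. ennreal (1/2))"
    by (rule prod.cong) (auto simp: emeasure_pmf_single pmf_bernoulli_half)
  also have "\<dots> = ennreal ((1/2) ^ n)"
    by (simp only: prod_constant card_lessThan) (rule ennreal_power, simp)
  finally show ?thesis using True by simp
next
  case False
  then have "{X. restr X n = \<sigma>} = {}" by auto
  then show ?thesis using False by simp
qed

lemma sets_coin_cylinder [measurable]: "{X. restr X n = \<sigma>} \<in> sets coin_measure"
proof (cases "length \<sigma> = n")
  case True
  have eq: "{X. restr X n = \<sigma>} = {X \<in> space coin_measure. \<forall>i\<in>{..<n}. X i \<in> {\<sigma> ! i}}"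
    using True by (auto simp: coin_measure_def space_PiM list_eq_iff_nth_eq)
  show ?thesis unfolding eq
  proof (rule sets.sets_Collect_finite_All)
    fix i :: nat
    have "(\<lambda>X. X i) \<in> measurable coin_measure (measure_pmf (bernoulli_pmf (1/2)))"
      unfolding coin_measure_def by (rule measurable_component_singleton) simp
    from measurable_sets[OF this, of "{\<sigma> ! i}"]
    show "{X \<in> space coin_measure. X i \<in> {\<sigma> ! i}} \<in> sets coin_measure"
      by (simp add: vimage_def Int_def conj_commute)
  qed simp
next
  case False
  then have "{X. restr X n = \<sigma>} = {}" by auto
  then show ?thesis by simp
qed

interpretation coin: prob_space coin_measure
  unfolding coin_measure_def by (rule prob_space_PiM) (rule measure_pmf.prob_space_axioms)

lemma sets_coin_strings: "{X. T (restr X n)} \<in> sets coin_measure"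
proof -
  have "{X. T (restr X n)} = (\<Union>\<sigma>\<in>{\<sigma>. length \<sigma> = n \<and> T \<sigma>}. {X. restr X n = \<sigma>})" by auto
  then show ?thesis using sets_coin_cylinder by (simp only:) (rule sets.finite_UN, auto)
qed

lemma measure_coin_strings: "measure coin_measure {X. T (restr X n)} = real (card {\<sigma>. length \<sigma> = n \<and> T \<sigma>}) / 2 ^ n"
proof -
  have eq: "{X. T (restr X n)} = (\<Union>\<sigma>\<in>{\<sigma>. length \<sigma> = n \<and> T \<sigma>}. {X. restr X n = \<sigma>})" by auto
  have "measure coin_measure {X. T (restr X n)} = (\<Sum>\<sigma>\<in>{\<sigma>. length \<sigma> = n \<and> T \<sigma>}. measure coin_measure {X. restr X n = \<sigma>})"
    unfolding eq by (rule coin.finite_measure_finite_Union) (auto simp: disjoint_family_on_def)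
  also have "\<dots> = (\<Sum>\<sigma>\<in>{\<sigma>. length \<sigma> = n \<and> T \<sigma>}. (1/2) ^ n)"
    by (rule sum.cong) (auto simp: measure_def coin_cylinder)
  also have "\<dots> = real (card {\<sigma>. length \<sigma> = n \<and> T \<sigma>}) / 2 ^ n" by (simp add: power_one_over)
  finally show ?thesis .
qed

definition Kst :: "nat \<Rightarrow> nat \<Rightarrow> bool" where
  "Kst s n \<longleftrightarrow> (\<exists>y<s. evb s (replicate s False) n n y)"

lemma cmp_Kst [cmp_intros]: "cmp A s \<Longrightarrow> cmp A n \<Longrightarrow> cmp A (\<lambda>x. Kst (s x) (n x))"
proof -
  assume *: "cmp A s" "cmp A n"
  show ?thesis unfolding Kst_def by (intro cmp_intros cmp_comp[OF *(1)] cmp_comp[OF *(2)])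
qed

lemma Kst_mono: "Kst s n \<Longrightarrow> s \<le> s' \<Longrightarrow> Kst s' n"
  unfolding Kst_def restr_False[symmetric] using evb_restr_mono by (meson less_le_trans)

lemma halting_Kst: "halting_problem n \<longleftrightarrow> (\<exists>s. Kst s n)"
proof -
  obtain e where e: "n = prog_encode e" using bij_prog_encode by (metis bij_pointE)
  have "halting_problem n \<longleftrightarrow> run0 e n \<noteq> None"
    unfolding halting_problem_def e using bij_prog_encode by (auto dest: bij_is_inj injD)
  also have "\<dots> \<longleftrightarrow> (\<exists>s. Kst s n)"
  proof
    assume "run0 e n \<noteq> None"
    then obtain y where "run e (seq_of (\<lambda>_. False)) n = Some y" unfolding seq_of_False by blast
    from evb_complete[OF this] obtain m where "\<forall>s\<ge>m. evb s (restr (\<lambda>_. False) s) (prog_encode e) n y" by blast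
    then have "Kst (max m (Suc y)) n" unfolding Kst_def restr_False[symmetric] e by (intro exI[of _ y]) auto
    then show "\<exists>s. Kst s n" ..
  next
    assume "\<exists>s. Kst s n"
    then show "run0 e n \<noteq> None"
      unfolding Kst_def restr_False[symmetric] seq_of_False[symmetric] using evb_sound e by (metis option.discI)
  qed
  finally show ?thesis .
qed

text \<open>
  A random sequence lying in all the small clopen sets \<open>T k t\<close> with \<open>t \<ge> f k\<close> computes the halting
  problem from \<open>f\<close>: otherwise the sets \<open>T k t\<close>, with \<open>t\<close> the stage at which \<open>k\<close> enters the halting
  problem, form a Solovay test that it fails.
\<close>

lemma MLR_halting:
  fixes T :: "nat \<Rightarrow> nat \<Rightarrow> bool list \<Rightarrow> bool" and c :: nat
  assumes X: "X \<in> MLR"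
    and T: "cmp (\<lambda>_. 0) (\<lambda>p. T (fst p) (fst (snd p)) (snd (snd p)))"
    and small: "\<And>k t. card {\<rho>. length \<rho> = t \<and> T k t \<rho>} * 2 ^ k \<le> c * 2 ^ t"
    and f: "cmp (seq_of X) f" and mem: "\<And>k t. t \<ge> f k \<Longrightarrow> T k t (restr X t)"
  shows "seq_of halting_problem \<le>\<^sub>T seq_of X"
proof (cases "finite {k. halting_problem k \<and> \<not> Kst (f k) k}")
  case True
  then obtain F where F: "set F = {k. halting_problem k \<and> \<not> Kst (f k) k}" using finite_list by blast
  have "halting_problem k \<longleftrightarrow> Kst (f k) k \<or> k \<in> set F" for k
    unfolding F using halting_Kst by auto
  then have "halting_problem = (\<lambda>k. Kst (f k) k \<or> k \<in> set F)" by auto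
  moreover have "cmp (seq_of X) (\<lambda>k. Kst (f k) k \<or> k \<in> set F)" by (intro cmp_intros f)
  ultimately show ?thesis unfolding seq_of_tle_iff by simp
next
  case False
  \<comment> \<open>The shift by \<open>d\<close> absorbs the constant \<open>c\<close>: the sets
    with \<open>k > i + d\<close> have total measure at most \<open>(1/2) ^ i\<close>.\<close>
  obtain d :: nat where d: "c < 2 ^ d" using less_exp by blast
  \<comment> \<open>Fixing the stage to the first one lets every \<open>k\<close> contribute a
    single clopen set.\<close>
  define first where "first k t \<longleftrightarrow> Kst t k \<and> (\<forall>t'<t. \<not> Kst t' k)" for k t
  define V where "V w \<longleftrightarrow> (\<exists>k. k > fst w + d \<and> first k (length (snd w)) \<and> T k (length (snd w)) (snd w))"
    for w :: "nat \<times> bool list"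
  have "sd V"
  proof (rule sdI[where R = "\<lambda>k w. k > fst w + d \<and> first k (length (snd w)) \<and> T k (length (snd w)) (snd w)"])
    show "cmp (\<lambda>_. 0) (\<lambda>p. fst p > fst (snd p) + d \<and> first (fst p) (length (snd (snd p))) \<and>
       T (fst p) (length (snd (snd p))) (snd (snd p)))"
      unfolding first_def by (intro cmp_intros cmp_app3[OF T])
  qed (simp add: V_def)
  then have ce: "ce {enc w | w. V w}" by (rule ce_of_sd)
  define U where "U i = {X. \<exists>n. V (i, restr X n)}" for i
  have U_eq: "U i = {X. \<exists>n. prod_encode (i, str_encode (restr X n)) \<in> {enc w | w. V w}}" for i
  proof -
    have "V (i, \<rho>) \<longleftrightarrow> prod_encode (i, str_encode \<rho>) \<in> {enc w | w. V w}" for \<rho>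
    proof -
      have e: "prod_encode (i, str_encode \<rho>) = enc (i, \<rho>)" by (simp add: enc_prod_def enc_nat_def str_encode_eq)
      show ?thesis unfolding e by (auto simp del: enc_inject dest: enc_inject[THEN iffD1])
    qed
    then show ?thesis by (simp add: U_def)
  qed
  have meas: "measure coin_measure (U i) \<le> (1/2) ^ i" for i
  proof -
    define B where "B j = (if \<exists>t. first (Suc (i + d + j)) t
       then {X. T (Suc (i + d + j)) (THE t. first (Suc (i + d + j)) t) (restr X (THE t. first (Suc (i + d + j)) t))} else {})" for j
    have uniq: "t = t'" if "first k t" "first k t'" for k t t'
      using that unfolding first_def by (meson linorder_neqE_nat)
    have the: "(THE t. first k t) = t" if "first k t" for k t using that uniq by blast
    have "U i \<subseteq> (\<Union>j. B j)"
    proof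
      fix Z assume "Z \<in> U i"
      then obtain n k where k: "k > i + d" "first k n" "T k n (restr Z n)" unfolding U_def V_def by auto
      obtain j where j: "k = Suc (i + d + j)" using k(1) less_imp_Suc_add by blast
      have "Z \<in> B j" unfolding B_def using k the[of k n] unfolding j by auto
      then show "Z \<in> (\<Union>j. B j)" by blast
    qed
    moreover have sets: "B j \<in> sets coin_measure" for j
      unfolding B_def using sets_coin_strings[of "T (Suc (i + d + j)) _"] by auto
    ultimately have "measure coin_measure (U i) \<le> measure coin_measure (\<Union>j. B j)"
      by (intro coin.finite_measure_mono) auto
    have B: "measure coin_measure (B j) \<le> (1/2) ^ i * (1/2) ^ Suc j" for j
    proof (cases "\<exists>t. first (Suc (i + d + j)) t")
      case True
      then obtain t where t: "first (Suc (i + d + j)) t" by blast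
      let ?k = "Suc (i + d + j)"
      have "measure coin_measure (B j) = real (card {\<rho>. length \<rho> = t \<and> T ?k t \<rho>}) / 2 ^ t"
        using True unfolding B_def the[OF t] by (simp add: measure_coin_strings)
      also have "\<dots> \<le> real c / 2 ^ ?k"
      proof -
        have "real (card {\<rho>. length \<rho> = t \<and> T ?k t \<rho>} * 2 ^ ?k) \<le> real (c * 2 ^ t)"
          using small[of t ?k] of_nat_le_iff by blast
        then show ?thesis by (simp add: divide_simps mult.commute del: power_Suc)
      qed
      also have "\<dots> \<le> 2 ^ d / 2 ^ ?k"
      proof (rule divide_right_mono)
        show "real c \<le> 2 ^ d" using d by (metis less_imp_le of_nat_le_iff of_nat_numeral of_nat_power)
      qed simp
      also have "\<dots> = (1/2) ^ i * (1/2) ^ Suc j" by (simp add: power_add power_one_over)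
      finally show ?thesis .
    qed (simp add: B_def)
    have sums: "(\<lambda>j. (1/2) ^ i * (1/2::real) ^ Suc j) sums ((1/2) ^ i * 1)"
      by (intro sums_mult power_half_series)
    have summable: "summable (\<lambda>j. measure coin_measure (B j))"
      by (rule summable_comparison_test[OF _ sums_summable[OF sums]]) (use B in auto)
    have "measure coin_measure (\<Union>j. B j) \<le> (\<Sum>j. measure coin_measure (B j))"
      by (rule coin.finite_measure_subadditive_countably) (use sets summable in auto)
    also have "\<dots> \<le> (\<Sum>j. (1/2) ^ i * (1/2::real) ^ Suc j)"
      by (rule suminf_le) (use B summable sums_summable[OF sums] in auto)
    also have "\<dots> = (1/2) ^ i" using sums_unique[OF sums] by simp
    finally show ?thesis using \<open>measure coin_measure (U i) \<le> measure coin_measure (\<Union>j. B j)\<close> by linarith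
  qed
  have "mltest U" unfolding mltest_def using ce U_eq meas by blast
  moreover have "X \<in> U i" for i
  proof -
    obtain k where k: "k > i + d" "halting_problem k" "\<not> Kst (f k) k"
      using False unfolding infinite_nat_iff_unbounded by blast
    obtain t where "Kst t k" using k(2) halting_Kst by blast
    then have t: "first k (LEAST t. Kst t k)" unfolding first_def using LeastI not_less_Least by metis
    have "f k \<le> (LEAST t. Kst t k)"
      using t k(3) Kst_mono unfolding first_def by (meson nat_le_linear)
    then have "T k (LEAST t. Kst t k) (restr X (LEAST t. Kst t k))" by (rule mem)
    then have "V (i, restr X (LEAST t. Kst t k))" unfolding V_def using k(1) t by auto
    then show ?thesis unfolding U_def by blast
  qed
  ultimately show ?thesis using X unfolding MLR_def by blast
qed

text \<open>Compactness: a string of length \<open>m\<close> off the class has no extension on the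
  tree from some level on, and there are only finitely many such strings.\<close>

lemma tree_settle:
  assumes S: "dtree S"
  shows "\<exists>u\<ge>m. \<forall>\<sigma>. length \<sigma> = m \<longrightarrow> (\<exists>\<tau>. length \<tau> = u \<and> take m \<tau> = \<sigma> \<and> S \<tau>) \<longrightarrow> \<sigma> \<in> (\<lambda>X. restr X m) ` paths S"
proof -
  let ?PR = "(\<lambda>X. restr X m) ` paths S"
  have "\<exists>u\<ge>m. \<forall>u'\<ge>u. \<not> (\<exists>\<tau>. length \<tau> = u' \<and> take m \<tau> = \<sigma> \<and> S \<tau>)" if \<sigma>: "length \<sigma> = m" "\<sigma> \<notin> ?PR" for \<sigma>
  proof (rule ccontr)
    assume n: "\<not> ?thesis"
    have "\<exists>\<tau>. length \<tau> = u \<and> take (length \<sigma>) \<tau> = \<sigma> \<and> S \<tau>" if "u \<ge> length \<sigma>" for u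
    proof -
      have "u \<ge> m" using that \<sigma>(1) by simp
      then have "\<not> (\<forall>u'\<ge>u. \<not> (\<exists>\<tau>. length \<tau> = u' \<and> take m \<tau> = \<sigma> \<and> S \<tau>))" using n by blast
      then obtain u' \<tau> where "u' \<ge> u" "length \<tau> = u'" "take m \<tau> = \<sigma>" "S \<tau>" by blast
      then have "length (take u \<tau>) = u" "take (length \<sigma>) (take u \<tau>) = \<sigma>" "S (take u \<tau>)"
        using that \<sigma>(1) dtree_take[OF S] by (auto simp: min_def)
      then show ?thesis by blast
    qed
    from konig[of \<sigma> S, OF this dtree_take[OF S]] obtain X where X: "X \<in> paths S" "restr X (length \<sigma>) = \<sigma>" by blast
    have "restr X m \<in> ?PR" using X(1) by blast
    then show False using X(2) \<sigma> by simp
  qed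
  then obtain uu where uu: "\<And>\<sigma> u'. length \<sigma> = m \<Longrightarrow> \<sigma> \<notin> ?PR \<Longrightarrow> u' \<ge> uu \<sigma> \<Longrightarrow> \<not> (\<exists>\<tau>. length \<tau> = u' \<and> take m \<tau> = \<sigma> \<and> S \<tau>)"
    by metis
  define u where "u = m + (\<Sum>\<sigma> | length \<sigma> = m. uu \<sigma>)"
  have "\<sigma> \<in> ?PR" if "length \<sigma> = m" "\<exists>\<tau>. length \<tau> = u \<and> take m \<tau> = \<sigma> \<and> S \<tau>" for \<sigma>
  proof (rule ccontr)
    assume "\<sigma> \<notin> ?PR"
    moreover have "uu \<sigma> \<le> (\<Sum>\<sigma> | length \<sigma> = m. uu \<sigma>)" by (rule member_le_sum) (use that in auto)
    then have "uu \<sigma> \<le> u" by (simp add: u_def)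
    ultimately show False using uu that by blast
  qed
  then show ?thesis by (intro exI[of _ u]) (auto simp: u_def)
qed

context universal
begin

text \<open>For \<open>k\<close> and \<open>t\<close>, a search finds a level \<open>u k t\<close>
  of the tree such that the oracle strings of length \<open>t\<close> computing a string of length
  \<open>r k\<close> alive at that level have measure at most \<open>c * (1/2) ^ k\<close>. It
  succeeds by compactness, since deepness and \<open>functional_dominated\<close> bound the measure
  of those computing prefixes of members. The stage \<open>f k\<close> is when \<open>X\<close> has
  computed \<open>Y\<close> up to \<open>r k\<close>.\<close>

lemma deep_diff:
  assumes P: "Pi01 P" "deep M P" and X: "X \<in> MLR" and Y: "Y \<in> P" "seq_of Y \<le>\<^sub>T seq_of X"
  shows "seq_of halting_problem \<le>\<^sub>T seq_of X"
proof -
  obtain S where S: "dtree S" "P = paths S" using P(1) unfolding Pi01_iff_tree by blast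
  obtain r where r: "cmp (\<lambda>_. 0) r" "\<And>n. mass P (r n) \<le> (1/2) ^ n" using P(2) unfolding deep_iff by blast
  obtain p where p: "\<And>n. run p (seq_of X) n = Some (seq_of Y n)" using Y(2) unfolding turing_le_def by blast
  define e where "e = prog_encode p"
  obtain c :: nat where c: "c > 0" "\<And>s \<sigma>. real (card {\<rho>. length \<rho> = s \<and> fcomp s e \<rho> \<sigma>}) / 2 ^ s \<le> real c * M \<sigma>"
    using functional_dominated[of e] by blast
  define G where "G k t u \<rho> \<longleftrightarrow> (\<exists>\<sigma>. length \<sigma> = r k \<and> fcomp t e \<rho> \<sigma> \<and>
      (\<exists>\<tau>. length \<tau> = u \<and> take (r k) \<tau> = \<sigma> \<and> S \<tau>))" for k t u \<rho>
  have G: "cmp (\<lambda>_. 0) (\<lambda>p. G (fst p) (fst (snd p)) (fst (snd (snd p))) (snd (snd (snd p))))"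
    unfolding G_def by (intro cmp_intros cmp_comp[OF r(1)] dtree_cmp[OF S(1)])
  have ex: "\<exists>u. u \<ge> r k \<and> card {\<rho>. length \<rho> = t \<and> G k t u \<rho>} * 2 ^ k \<le> c * 2 ^ t" for k t
  proof -
    let ?PR = "(\<lambda>X. restr X (r k)) ` P"
    obtain u where u: "u \<ge> r k" "\<And>\<sigma>. length \<sigma> = r k \<Longrightarrow> \<exists>\<tau>. length \<tau> = u \<and> take (r k) \<tau> = \<sigma> \<and> S \<tau> \<Longrightarrow> \<sigma> \<in> ?PR"
      using tree_settle[OF S(1), of "r k"] unfolding S(2) by blast
    have "{\<rho>. length \<rho> = t \<and> G k t u \<rho>} \<subseteq> (\<Union>\<sigma>\<in>?PR. {\<rho>. length \<rho> = t \<and> fcomp t e \<rho> \<sigma>})"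
      using u(2) unfolding G_def by blast
    then have "card {\<rho>. length \<rho> = t \<and> G k t u \<rho>} \<le> card (\<Union>\<sigma>\<in>?PR. {\<rho>. length \<rho> = t \<and> fcomp t e \<rho> \<sigma>})"
      by (intro card_mono) (rule finite_subset[OF _ finite_strings[of t]], auto)
    also have "\<dots> \<le> (\<Sum>\<sigma>\<in>?PR. card {\<rho>. length \<rho> = t \<and> fcomp t e \<rho> \<sigma>})" by (rule card_UN_le) simp
    finally have "real (card {\<rho>. length \<rho> = t \<and> G k t u \<rho>}) \<le> (\<Sum>\<sigma>\<in>?PR. real (card {\<rho>. length \<rho> = t \<and> fcomp t e \<rho> \<sigma>}))"
      by (simp only: of_nat_le_iff of_nat_sum[symmetric])
    also have "\<dots> \<le> (\<Sum>\<sigma>\<in>?PR. real c * M \<sigma> * 2 ^ t)"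
      by (rule sum_mono) (use c(2)[of t] in \<open>simp add: divide_le_eq\<close>)
    also have "\<dots> = real c * 2 ^ t * mass P (r k)" by (simp add: mass_def sum_distrib_left mult_ac)
    also have "\<dots> \<le> real c * 2 ^ t * (1/2) ^ k" by (intro mult_left_mono r) auto
    finally have "real (card {\<rho>. length \<rho> = t \<and> G k t u \<rho>} * 2 ^ k) \<le> real (c * 2 ^ t)"
      by (simp add: power_one_over field_simps)
    then have "card {\<rho>. length \<rho> = t \<and> G k t u \<rho>} * 2 ^ k \<le> c * 2 ^ t" unfolding of_nat_le_iff .
    then show ?thesis using u(1) by blast
  qed
  define u where "u k t = (LEAST u. u \<ge> r k \<and> card {\<rho>. length \<rho> = t \<and> G k t u \<rho>} * 2 ^ k \<le> c * 2 ^ t)" for k t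
  have u: "u k t \<ge> r k" "card {\<rho>. length \<rho> = t \<and> G k t (u k t) \<rho>} * 2 ^ k \<le> c * 2 ^ t" for k t
    using LeastI_ex[OF ex[of k t]] unfolding u_def by auto
  have cu: "cmp (\<lambda>_. 0) (\<lambda>p. u (fst p) (snd p))"
    unfolding u_def by (intro cmp_intros cmp_app4[OF G] cmp_comp[OF r(1)] ex)
  have "\<exists>n. fcomp n e (restr X n) (restr Y (r k))" for k
    using fcomp_complete[of "r k" p X Y] p unfolding e_def by blast
  define f where "f k = (LEAST n. fcomp n e (restr X n) (restr Y (r k)))" for k
  have f: "fcomp (f k) e (restr X (f k)) (restr Y (r k))" for k
    unfolding f_def by (rule LeastI_ex) fact
  have cY: "cmp (seq_of X) Y" using Y(2) unfolding seq_of_tle_iff .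
  show ?thesis
  proof (rule MLR_halting[OF X, where T = "\<lambda>k t. G k t (u k t)" and f = f and c = c])
    show "cmp (\<lambda>_. 0) (\<lambda>p. G (fst p) (fst (snd p)) (u (fst p) (fst (snd p))) (snd (snd p)))"
      by (intro cmp_app4[OF G] cmp_app2[OF cu] cmp_intros)
    show "card {\<rho>. length \<rho> = t \<and> G k t (u k t) \<rho>} * 2 ^ k \<le> c * 2 ^ t" for k t by (rule u)
    show "cmp (seq_of X) f" unfolding f_def[abs_def]
      by (intro cmp_intros cmp_restr[OF cmp_seq_of] cmp_restr[OF cY] cmp_comp[OF cmp0[OF r(1)]]) fact
    show "G k t (u k t) (restr X t)" if "f k \<le> t" for k t
    proof -
      have "\<exists>\<tau>. length \<tau> = u k t \<and> take (r k) \<tau> = restr Y (r k) \<and> S \<tau>"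
        using Y(1) u(1)[of k t] by (intro exI[of _ "restr Y (u k t)"]) (auto simp: S(2) paths_def min_def)
      moreover have "fcomp t e (restr X t) (restr Y (r k))" using fcomp_restr_mono[OF f that that] .
      ultimately show ?thesis unfolding G_def by (intro exI[of _ "restr Y (r k)"]) simp
    qed
  qed
qed

end

subsection \<open>Random sequences above a computably enumerable set\<close>

text \<open>
  If an incomplete random sequence computes a c.e. set \<open>A\<close>, it is random relative to \<open>A\<close>
  (Hirschfeldt, Nies, Stephan), so the sets of oracles computing \<open>A\<close> up to \<open>m n\<close> cannot be small
  for infinitely many \<open>n\<close>.
\<close>

lemma MLR_above_ce:
  fixes As :: "nat \<Rightarrow> nat \<Rightarrow> bool"
  assumes X: "X \<in> MLR" and p: "\<And>i. run p (seq_of X) i = Some (seq_of A i)"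
    and As: "cmp (\<lambda>_. 0) (\<lambda>p. As (fst p) (snd p))" and As_mono: "\<And>s t x. As s x \<Longrightarrow> s \<le> t \<Longrightarrow> As t x"
    and A: "\<And>x. A x \<longleftrightarrow> (\<exists>s. As s x)" and m: "cmp (\<lambda>_. 0) m"
    and inf: "\<And>k. \<exists>n>k. \<forall>s. card {\<rho>. length \<rho> = s \<and> fcomp s (prog_encode p) \<rho> (restr A (m n))} * 2 ^ n \<le> 2 ^ s"
  shows "seq_of halting_problem \<le>\<^sub>T seq_of X"
proof -
  define e where "e = prog_encode p"
  have cAr: "cmp B (\<lambda>x. restr (As (g x)) (h x))" if "cmp B g" "cmp B h" for g h :: "'a::enc \<Rightarrow> nat" and B
    unfolding restr_def by (intro cmp_intros cmp_app2[OF cmp0[OF As]] cmp_comp[OF that(1)] cmp_comp[OF that(2)])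
  \<comment> \<open>Smallness is assumed for \<open>A\<close> itself but tested for its
    approximation at stage \<open>s\<close>.\<close>
  define ok where "ok n s \<longleftrightarrow> card {\<rho>. length \<rho> = s \<and> fcomp s e \<rho> (restr (As s) (m n))} * 2 ^ n \<le> 2 ^ s" for n s
  have c_ok: "cmp B (\<lambda>x. ok (g x) (h x))" if "cmp B g" "cmp B h" for g h :: "'a::enc \<Rightarrow> nat" and B
    unfolding ok_def by (intro cmp_intros cAr cmp_comp[OF that(1)] cmp_comp[OF that(2)] cmp_comp[OF cmp0[OF m]])
  define Q where "Q n t s \<rho> \<longleftrightarrow> restr (As s) (m n) = restr (As t) (m n) \<and> ok n s \<and> fcomp s e (take s \<rho>) (restr (As s) (m n))"
    for n t s \<rho>
  define T where "T k t \<rho> \<longleftrightarrow> (\<exists>n<t. k < n \<and> (\<exists>s\<le>t. Q n t s \<rho>))" for k t \<rho>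
  have Q_card: "card {\<rho>. length \<rho> = t \<and> (\<exists>s\<le>t. Q n t s \<rho>)} * 2 ^ n \<le> 2 ^ t" for n t
  proof (cases "\<exists>s\<le>t. restr (As s) (m n) = restr (As t) (m n) \<and> ok n s")
    case False
    then have "{\<rho>. length \<rho> = t \<and> (\<exists>s\<le>t. Q n t s \<rho>)} = {}" unfolding Q_def by auto
    then show ?thesis by (simp only: card.empty)
  next
    case True
    define s where "s = (GREATEST s. s \<le> t \<and> restr (As s) (m n) = restr (As t) (m n) \<and> ok n s)"
    have s: "s \<le> t" "restr (As s) (m n) = restr (As t) (m n)" "ok n s"
      using GreatestI_ex_nat[OF True, of t] unfolding s_def by auto
    have s_max: "s' \<le> s" if "s' \<le> t" "restr (As s') (m n) = restr (As t) (m n)" "ok n s'" for s'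
      unfolding s_def by (rule Greatest_le_nat[where b = t]) (use that in auto)
    have "{\<rho>. length \<rho> = t \<and> (\<exists>s\<le>t. Q n t s \<rho>)} \<subseteq>
       (\<Union>\<tau>\<in>{\<tau>. length \<tau> = s \<and> fcomp s e \<tau> (restr (As s) (m n))}. {\<rho>. length \<rho> = t \<and> take (length \<tau>) \<rho> = \<tau>})"
    proof
      fix \<rho> :: "bool list" assume "\<rho> \<in> {\<rho>. length \<rho> = t \<and> (\<exists>s\<le>t. Q n t s \<rho>)}"
      then obtain s' where \<rho>: "t = length \<rho>" "s' \<le> length \<rho>" "Q n (length \<rho>) s' \<rho>" by auto
      then have s': "s' \<le> s" using s_max unfolding Q_def by blast
      have "fcomp s' e (take s' \<rho>) (restr (As s) (m n))" using \<rho>(3) s(2) unfolding Q_def \<rho>(1) by metis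
      then have "fcomp s e (take s' \<rho> @ drop s' (take s \<rho>)) (restr (As s) (m n))" using fcomp_mono s' by blast
      moreover have "take s' \<rho> @ drop s' (take s \<rho>) = take s \<rho>"
        using append_take_drop_id[of s' "take s \<rho>"] s' by (simp add: min_def)
      ultimately have "fcomp s e (take s \<rho>) (restr (As s) (m n))" by simp
      then show "\<rho> \<in> (\<Union>\<tau>\<in>{\<tau>. length \<tau> = s \<and> fcomp s e \<tau> (restr (As s) (m n))}. {\<rho>. length \<rho> = t \<and> take (length \<tau>) \<rho> = \<tau>})"
        using s(1) \<rho>(1) by (intro UN_I[of "take s \<rho>"]) auto
    qed
    then have "card {\<rho>. length \<rho> = t \<and> (\<exists>s\<le>t. Q n t s \<rho>)} \<le>
       card (\<Union>\<tau>\<in>{\<tau>. length \<tau> = s \<and> fcomp s e \<tau> (restr (As s) (m n))}. {\<rho>. length \<rho> = t \<and> take (length \<tau>) \<rho> = \<tau>})"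
      by (intro card_mono) auto
    also have "\<dots> \<le> (\<Sum>\<tau>\<in>{\<tau>. length \<tau> = s \<and> fcomp s e \<tau> (restr (As s) (m n))}. card {\<rho>. length \<rho> = t \<and> take (length \<tau>) \<rho> = \<tau>})"
      by (rule card_UN_le) simp
    also have "\<dots> = (\<Sum>\<tau>\<in>{\<tau>. length \<tau> = s \<and> fcomp s e \<tau> (restr (As s) (m n))}. 2 ^ (t - s))"
      by (rule sum.cong) (use s(1) in \<open>auto simp: card_extensions\<close>)
    finally have "card {\<rho>. length \<rho> = t \<and> (\<exists>s\<le>t. Q n t s \<rho>)} * 2 ^ n \<le>
       card {\<tau>. length \<tau> = s \<and> fcomp s e \<tau> (restr (As s) (m n))} * 2 ^ n * 2 ^ (t - s)"
      by (simp add: mult_ac)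
    also have "\<dots> \<le> 2 ^ s * 2 ^ (t - s)" using s(3) unfolding ok_def by (rule mult_le_mono1)
    also have "\<dots> = 2 ^ t" using s(1) by (simp add: power_add[symmetric])
    finally show ?thesis .
  qed
  have cT: "cmp (\<lambda>_. 0) (\<lambda>p. T (fst p) (fst (snd p)) (snd (snd p)))"
    unfolding T_def Q_def by (intro cmp_intros cAr c_ok cmp_comp[OF m])
  have small: "card {\<rho>. length \<rho> = t \<and> T k t \<rho>} * 2 ^ k \<le> 1 * 2 ^ t" for k t
  proof -
    have "{\<rho>. length \<rho> = t \<and> T k t \<rho>} \<subseteq> (\<Union>n\<in>{k<..<t}. {\<rho>. length \<rho> = t \<and> (\<exists>s\<le>t. Q n t s \<rho>)})"
      unfolding T_def by auto
    then have "card {\<rho>. length \<rho> = t \<and> T k t \<rho>} \<le> card (\<Union>n\<in>{k<..<t}. {\<rho>. length \<rho> = t \<and> (\<exists>s\<le>t. Q n t s \<rho>)})"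
      by (intro card_mono) auto
    also have "\<dots> \<le> (\<Sum>n\<in>{k<..<t}. card {\<rho>. length \<rho> = t \<and> (\<exists>s\<le>t. Q n t s \<rho>)})" by (rule card_UN_le) simp
    finally have "real (card {\<rho>. length \<rho> = t \<and> T k t \<rho>}) \<le> (\<Sum>n\<in>{k<..<t}. real (card {\<rho>. length \<rho> = t \<and> (\<exists>s\<le>t. Q n t s \<rho>)}))"
      by (simp only: of_nat_le_iff of_nat_sum[symmetric])
    also have "\<dots> \<le> (\<Sum>n\<in>{k<..<t}. 2 ^ t * (1/2) ^ n)"
    proof (rule sum_mono)
      fix n
      have "real (card {\<rho>. length \<rho> = t \<and> (\<exists>s\<le>t. Q n t s \<rho>)} * 2 ^ n) \<le> real (2 ^ t)"
        using Q_card[of t n] unfolding of_nat_le_iff .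
      then show "real (card {\<rho>. length \<rho> = t \<and> (\<exists>s\<le>t. Q n t s \<rho>)}) \<le> 2 ^ t * (1/2) ^ n"
        by (simp add: power_one_over field_simps)
    qed
    also have "\<dots> \<le> 2 ^ t * (1/2) ^ k"
    proof -
      \<comment> \<open>The sharper bound with a subtracted term is what the induction on
        \<open>t\<close> carries.\<close>
      have "(\<Sum>n\<in>{k<..<t}. (1/2::real) ^ n) \<le> (1/2) ^ k - (1/2) ^ (max k (t - 1))"
      proof (induction t)
        case (Suc t)
        show ?case
        proof (cases "k < t")
          case True
          then have "{k<..<Suc t} = insert t {k<..<t}" by auto
          then have "(\<Sum>n\<in>{k<..<Suc t}. (1/2::real) ^ n) = (1/2) ^ t + (\<Sum>n\<in>{k<..<t}. (1/2::real) ^ n)" by simp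
          moreover obtain t' where "t = Suc t'" "k \<le> t'" using True by (cases t) auto
          ultimately show ?thesis using Suc by (simp add: max_def split: if_splits)
        next
          case False
          then have "{k<..<Suc t} = {}" by auto
          then show ?thesis using False by (simp add: max_def)
        qed
      qed simp
      then have "(\<Sum>n\<in>{k<..<t}. (1/2::real) ^ n) \<le> (1/2) ^ k"
        using zero_le_power[of "1/2::real" "max k (t - 1)"] by linarith
      then show ?thesis unfolding sum_distrib_left[symmetric] by (rule mult_left_mono) simp
    qed
    finally have "real (card {\<rho>. length \<rho> = t \<and> T k t \<rho>} * 2 ^ k) \<le> real (1 * 2 ^ t)"
      by (simp add: power_one_over field_simps)
    then show ?thesis unfolding of_nat_le_iff .
  qed
  \<comment> \<open>Since \<open>X\<close> computes \<open>A\<close>, it recognises a stage at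
    which, for some \<open>n > k\<close>, the approximation is correct up to \<open>m n\<close>,
    passes the test \<open>ok\<close> and is output from \<open>X\<close> by the functional.\<close>
  define D where "D k s \<longleftrightarrow> (\<exists>n<s. k < n \<and> restr (As s) (m n) = restr A (m n) \<and> ok n s \<and> fcomp s e (restr X s) (restr (As s) (m n)))" for k s
  have settle: "\<exists>s0. \<forall>s\<ge>s0. restr (As s) n = restr A n" for n
  proof (induction n)
    case (Suc n)
    then obtain s0 where s0: "\<forall>s\<ge>s0. restr (As s) n = restr A n" by blast
    obtain s1 where s1: "\<forall>s\<ge>s1. As s n = A n"
      using A As_mono by (metis nat_le_linear)
    show ?case by (rule exI[of _ "max s0 s1"]) (use s0 s1 in \<open>auto simp: restr_Suc\<close>)
  qed (simp add: restr_def)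
  have D_ex: "\<exists>s. D k s" for k
  proof -
    obtain n where n: "n > k" "\<And>s. card {\<rho>. length \<rho> = s \<and> fcomp s e \<rho> (restr A (m n))} * 2 ^ n \<le> 2 ^ s"
      using inf[of k] unfolding e_def by blast
    obtain s0 where s0: "\<forall>s\<ge>s0. restr (As s) (m n) = restr A (m n)" using settle by blast
    obtain s1 where s1: "\<forall>s\<ge>s1. fcomp s e (restr X s) (restr A (m n))"
      using fcomp_complete[of "m n" p X A] p unfolding e_def by blast
    show ?thesis unfolding D_def ok_def
      by (rule exI[of _ "max (Suc n) (max s0 s1)"], rule exI[of _ n]) (use n s0 s1 in auto)
  qed
  define f where "f k = (LEAST s. D k s)" for k
  have f: "D k (f k)" for k unfolding f_def by (rule LeastI_ex[OF D_ex])
  have cA: "cmp (seq_of X) A" using p unfolding seq_of_tle_iff[symmetric] turing_le_def by blast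
  show ?thesis
  proof (rule MLR_halting[OF X cT small])
    show "cmp (seq_of X) f" unfolding f_def[abs_def]
    proof (rule cmp_Least[OF _ D_ex])
      show "cmp (seq_of X) (\<lambda>p. D (fst p) (snd p))"
        unfolding D_def by (intro cmp_intros cAr c_ok cmp_restr[OF cA] cmp_restr[OF cmp_seq_of] cmp_comp[OF cmp0[OF m]])
    qed
    show "T k t (restr X t)" if "f k \<le> t" for k t
    proof -
      obtain n where n: "n < f k" "k < n" "restr (As (f k)) (m n) = restr A (m n)" "ok n (f k)"
          "fcomp (f k) e (restr X (f k)) (restr (As (f k)) (m n))"
        using f[of k] unfolding D_def by blast
      \<comment> \<open>A correct approximation stays correct: nothing leaves a c.e. set, and
        elements outside \<open>A\<close> never enter.\<close>
      have "As t i \<longleftrightarrow> A i" if "i < m n" for i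
      proof
        assume "A i"
        then have "restr (As (f k)) (m n) ! i" unfolding n(3) using that by simp
        then show "As t i" using that As_mono \<open>f k \<le> t\<close> by auto
      qed (use A in blast)
      then have "restr (As t) (m n) = restr A (m n)" by (intro nth_equalityI) auto
      then have "Q n t (f k) (restr X t)" unfolding Q_def using n that by (simp add: min_def)
      then show ?thesis unfolding T_def using n that by (meson less_le_trans)
    qed
  qed
qed

section \<open>Splitting a computably enumerable set\<close>

text \<open>
  The block with code \<open>(e0, e1, n)\<close> is used to make it impossible that the oracles computing
  \<open>A False\<close> by \<open>e0\<close> and those computing \<open>A True\<close> by \<open>e1\<close> both have measure above \<open>2 ^ (- n)\<close>.
  Each number enumerated goes to the side that injures the requirement of weakest priority, as in
  the Sacks splitting theorem; requirement \<open>k\<close> says that the functional \<open>k div 2\<close> with oracle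
  \<open>A (odd k)\<close> yields no path through \<open>S\<close>.
\<close>

type_synonym history = "nat \<Rightarrow> (nat \<times> bool) option"

definition enumd :: "history \<Rightarrow> nat \<Rightarrow> bool \<Rightarrow> nat \<Rightarrow> bool" where
  "enumd g t i x \<longleftrightarrow> (\<exists>u<t. g u = Some (x, i))"

text \<open>Each side receives at most \<open>2 ^ n\<close> numbers of a block with parameter
  \<open>n\<close>, so one number always remains.\<close>

definition bsz :: "nat \<Rightarrow> nat" where
  "bsz b = 2 * 2 ^ snd (snd (dec b :: nat \<times> nat \<times> nat)) + 1"

definition bst :: "nat \<Rightarrow> nat" where "bst b = (\<Sum>i<b. bsz i)"

definition bidx :: "nat \<Rightarrow> bool \<Rightarrow> nat" where
  "bidx b i = (if i then fst (snd (dec b :: nat \<times> nat \<times> nat)) else fst (dec b :: nat \<times> nat \<times> nat))"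

definition heavy :: "history \<Rightarrow> nat \<Rightarrow> nat \<Rightarrow> bool \<Rightarrow> bool" where
  "heavy g s b i \<longleftrightarrow> 2 ^ s < card {\<rho>. length \<rho> = s \<and> fcomp s (bidx b i) \<rho> (map (enumd g s i) [0..<bst (Suc b)])} *
     2 ^ snd (snd (dec b :: nat \<times> nat \<times> nat))"

text \<open>The value \<open>bst (Suc b)\<close>, just beyond the block, signals that the block is
  used up.\<close>

definition fresh :: "history \<Rightarrow> nat \<Rightarrow> nat \<Rightarrow> nat" where
  "fresh g s b = (LEAST x. x \<ge> bst (Suc b) \<or> bst b \<le> x \<and> \<not> enumd g s False x \<and> \<not> enumd g s True x)"

locale sacks =
  fixes S :: "bool list \<Rightarrow> bool"
  assumes S: "dtree S" and special: "\<And>X. X \<in> paths S \<Longrightarrow> \<not> cmp (\<lambda>_. 0) X"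
begin

definition agree :: "history \<Rightarrow> nat \<Rightarrow> nat \<Rightarrow> nat \<Rightarrow> bool" where
  "agree g t k l \<longleftrightarrow> l \<le> t \<and> (\<exists>\<sigma>. length \<sigma> = l \<and> (fcomp t (k div 2) (map (enumd g t (odd k)) [0..<t]) \<sigma> \<and> S \<sigma>))"

text \<open>The expansionary stages of requirement \<open>k\<close>, at which some length of
  agreement is attained for the first time. Agreement at stage \<open>t\<close> reads the oracle
  only below \<open>t\<close>, so \<open>restrained\<close> protects the numbers below such a
  stage.\<close>

definition expand :: "history \<Rightarrow> nat \<Rightarrow> nat \<Rightarrow> bool" where
  "expand g t k \<longleftrightarrow> (\<exists>l\<le>t. agree g t k l \<and> (\<forall>t'<t. \<not> agree g t' k l))"

definition restrained :: "history \<Rightarrow> nat \<Rightarrow> nat \<Rightarrow> nat \<Rightarrow> bool" where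
  "restrained g s k x \<longleftrightarrow> (\<exists>t\<le>s. x < t \<and> expand g t k)"

text \<open>Requirement \<open>k\<close> concerns the side \<open>odd k\<close>, so the opposite
  side \<open>even k\<close> leaves it uninjured. The least restraining \<open>k\<close> decides;
  the disjunct \<open>k \<ge> s\<close> makes the search total.\<close>

definition side :: "history \<Rightarrow> nat \<Rightarrow> nat \<Rightarrow> bool" where
  "side g s x \<longleftrightarrow> even (LEAST k. k \<ge> s \<or> restrained g s k x)"

definition entry :: "history \<Rightarrow> nat \<Rightarrow> (nat \<times> bool) option" where
  "entry g s = (let b = fst (prod_decode s); x = fresh g s b in
     if heavy g s b False \<and> heavy g s b True \<and> x < bst (Suc b) then Some (x, side g s x) else None)"

text \<open>The construction is a course-of-values recursion. The finite history is kept as a list,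
  because a function of type \<open>history\<close> has no code.\<close>

definition hist :: "nat \<Rightarrow> (nat \<times> bool) option list" where
  "hist s = rec_nat [] (\<lambda>s H. H @ [entry (nthd None H) s]) s"

definition ent :: history where "ent u = nthd None (hist (Suc u)) u"

lemma cmp_bst [cmp_intros]: "cmp A f \<Longrightarrow> cmp A (\<lambda>x. bst (f x))"
proof -
  assume f: "cmp A f"
  show ?thesis unfolding bst_def bsz_def by (intro cmp_intros cmp_comp[OF f])
qed

lemma cmp_hist: "cmp (\<lambda>_. 0) hist"
proof -
  have enumd: "cmp A (\<lambda>x. enumd (nthd None (H x)) (t x) (i x) (y x))"
    if "cmp A H" "cmp A t" "cmp A i" "cmp A y" for A t i y and H :: "'a::enc \<Rightarrow> (nat \<times> bool) option list"
    unfolding enumd_def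
    by (intro cmp_intros cmp_comp[OF that(1)] cmp_comp[OF that(2)] cmp_comp[OF that(3)] cmp_comp[OF that(4)])
  have heavy0: "cmp (\<lambda>_. 0) (\<lambda>p. heavy (nthd None (fst p)) (fst (snd p)) (fst (snd (snd p))) (snd (snd (snd p))))"
    unfolding heavy_def bidx_def by (intro cmp_intros enumd)
  note heavy = cmp_app4[where h = "\<lambda>H. heavy (nthd None H)", OF heavy0]
  have fresh0: "cmp (\<lambda>_. 0) (\<lambda>p. fresh (nthd None (fst p)) (fst (snd p)) (snd (snd p)))"
    unfolding fresh_def by (intro cmp_intros enumd) blast
  note fresh = cmp_app3[where h = "\<lambda>H. fresh (nthd None H)", OF fresh0]
  have agree0: "cmp (\<lambda>_. 0) (\<lambda>p. agree (nthd None (fst p)) (fst (snd p)) (fst (snd (snd p))) (snd (snd (snd p))))"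
    unfolding agree_def by (intro cmp_intros enumd dtree_cmp[OF S])
  note agree = cmp_app4[where h = "\<lambda>H. agree (nthd None H)", OF agree0]
  have side0: "cmp (\<lambda>_. 0) (\<lambda>p. side (nthd None (fst p)) (fst (snd p)) (snd (snd p)))"
    unfolding side_def restrained_def expand_def
    by (intro cmp_intros agree) blast
  note side = cmp_app3[where h = "\<lambda>H. side (nthd None H)", OF side0]
  have entry: "cmp (\<lambda>_. 0) (\<lambda>p. entry (nthd None (fst p)) (snd p))"
    unfolding entry_def
    by (intro cmp_intros cmp_pdecode heavy fresh side)
  show ?thesis unfolding hist_def[abs_def] by (intro cmp_intros cmp_app2[where h = "\<lambda>H. entry (nthd None H)", OF entry])
qed

lemma enumd_cong: "(\<And>u. u < t \<Longrightarrow> g u = h u) \<Longrightarrow> enumd g t = enumd h t"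
  by (auto simp: enumd_def fun_eq_iff)

lemma entry_cong:
  assumes "\<And>u. u < s \<Longrightarrow> g u = h u" shows "entry g s = entry h s"
proof -
  have e: "enumd g t = enumd h t" if "t \<le> s" for t using assms that by (intro enumd_cong) auto
  have agree: "agree g t k l = agree h t k l" if "t \<le> s" for t k l unfolding agree_def e[OF that] ..
  have expand: "expand g t k = expand h t k" if "t \<le> s" for t k
    unfolding expand_def using agree that by (meson le_trans less_imp_le)
  have restr: "restrained g s k x = restrained h s k x" for k x unfolding restrained_def using expand by blast
  show ?thesis unfolding entry_def heavy_def fresh_def side_def restr e[OF order_refl] ..
qed

lemma hist_eq: "hist s = map ent [0..<s]"
proof (induction s)
  case (Suc s)
  have "length (hist s) = s" unfolding Suc by simp
  then have "hist (Suc s) = hist s @ [ent s]" by (simp add: hist_def ent_def nthd_def nth_append)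
  then show ?case unfolding Suc by simp
qed (simp add: hist_def)

lemma ent_eq: "ent s = entry ent s"
proof -
  have "length (hist s) = s" unfolding hist_eq by simp
  then have "ent s = entry (nthd None (hist s)) s" by (simp add: hist_def ent_def nthd_def nth_append)
  also have "\<dots> = entry ent s" by (rule entry_cong) (simp add: hist_eq)
  finally show ?thesis .
qed

lemma cmp_ent [cmp_intros]: "cmp A f \<Longrightarrow> cmp A (\<lambda>x. ent (f x))"
proof -
  assume f: "cmp A f"
  show ?thesis unfolding ent_def by (intro cmp_intros cmp_comp[OF f] cmp_comp[OF cmp0[OF cmp_hist]])
qed

abbreviation As :: "bool \<Rightarrow> nat \<Rightarrow> nat \<Rightarrow> bool" where "As i s x \<equiv> enumd ent s i x"

definition Aset :: "bool \<Rightarrow> nat \<Rightarrow> bool" where "Aset i x \<longleftrightarrow> (\<exists>s. As i s x)"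

lemma cmp_As [cmp_intros]: "cmp A s \<Longrightarrow> cmp A i \<Longrightarrow> cmp A x \<Longrightarrow> cmp A (\<lambda>z. As (i z) (s z) (x z))"
proof -
  assume *: "cmp A s" "cmp A i" "cmp A x"
  show ?thesis unfolding enumd_def by (intro cmp_intros cmp_comp[OF *(1)] cmp_comp[OF *(2)] cmp_comp[OF *(3)])
qed

lemma As_mono: "As i s x \<Longrightarrow> s \<le> t \<Longrightarrow> As i t x"
  unfolding enumd_def by (meson less_le_trans)

lemma As_settle: "\<exists>s0. \<forall>s\<ge>s0. \<forall>x<n. As i s x = Aset i x"
proof (induction n)
  case (Suc n)
  then obtain s0 where s0: "\<forall>s\<ge>s0. \<forall>x<n. As i s x = Aset i x" by blast
  obtain s1 where s1: "\<forall>s\<ge>s1. As i s n = Aset i n"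
    using As_mono unfolding Aset_def by (metis nat_le_linear)
  show ?case by (rule exI[of _ "max s0 s1"]) (use s0 s1 in \<open>auto simp: less_Suc_eq\<close>)
qed simp

lemma bst_Suc: "bst (Suc b) = bst b + bsz b" by (simp add: bst_def)

lemma bst_mono: "a \<le> b \<Longrightarrow> bst a \<le> bst b"
  by (rule lift_Suc_mono_le[of bst]) (simp_all add: bst_Suc)

lemma block_unique: "bst a \<le> x \<Longrightarrow> x < bst (Suc a) \<Longrightarrow> bst b \<le> x \<Longrightarrow> x < bst (Suc b) \<Longrightarrow> a = b"
  using bst_mono[of "Suc a" b] bst_mono[of "Suc b" a] by (meson leD le_less_trans not_less_eq_eq linorder_neqE_nat Suc_leI)

lemma fresh_props:
  assumes "fresh g s b < bst (Suc b)"
  shows "bst b \<le> fresh g s b" "\<not> enumd g s i (fresh g s b)"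
proof -
  have "fresh g s b \<ge> bst (Suc b) \<or> bst b \<le> fresh g s b \<and> \<not> enumd g s False (fresh g s b) \<and> \<not> enumd g s True (fresh g s b)"
    unfolding fresh_def by (rule LeastI[of _ "bst (Suc b)"]) simp
  then show "bst b \<le> fresh g s b" "\<not> enumd g s i (fresh g s b)" using assms by (cases i; auto)+
qed

lemma fresh_less:
  assumes "bst b \<le> x" "x < bst (Suc b)" "\<not> enumd g s False x" "\<not> enumd g s True x"
  shows "fresh g s b < bst (Suc b)"
proof -
  have "fresh g s b \<le> x" unfolding fresh_def by (rule Least_le) (use assms in simp)
  then show ?thesis using assms(2) by linarith
qed

lemma ent_Some:
  assumes "ent s = Some (x, i)"
  defines "b \<equiv> fst (prod_decode s)"
  shows "x = fresh ent s b" "x < bst (Suc b)" "bst b \<le> x" "heavy ent s b j" "i = side ent s x" "\<not> As j s x"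
proof -
  have "entry ent s = Some (x, i)" using assms(1) ent_eq by simp
  then show *: "x = fresh ent s b" "x < bst (Suc b)" "heavy ent s b j" "i = side ent s x"
    unfolding entry_def b_def Let_def by (cases j; auto split: if_splits)+
  show "bst b \<le> x" "\<not> As j s x" using fresh_props[of ent s b] * by auto
qed

lemma ent_unique: "ent s = Some (x, i) \<Longrightarrow> ent s' = Some (x, i') \<Longrightarrow> s = s'"
proof -
  have "\<not> s < s'" if "ent s = Some (x, i)" "ent s' = Some (x, i')" for s s' i i'
    using ent_Some(6)[OF that(2), of i] that(1) unfolding enumd_def by blast
  then show "ent s = Some (x, i) \<Longrightarrow> ent s' = Some (x, i') \<Longrightarrow> s = s'" by (meson linorder_neqE_nat)
qed

lemma card_fcomp_mono:
  assumes "s \<le> t"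
  shows "card {\<rho>. length \<rho> = s \<and> fcomp s e \<rho> \<sigma>} * 2 ^ (t - s) \<le> card {\<rho>. length \<rho> = t \<and> fcomp t e \<rho> \<sigma>}"
  using assms
proof (induction t rule: dec_induct)
  case (step t)
  have "2 * card {\<rho>. length \<rho> = t \<and> fcomp t e \<rho> \<sigma>} \<le> card {\<rho>. length \<rho> = Suc t \<and> fcomp (Suc t) e \<rho> \<sigma>}"
    by (rule card_strings_double) (simp add: fcomp_mono)
  then show ?case using step by (simp add: Suc_diff_le)
qed simp

text \<open>Every entry into the block changes the set there for good, so the oracles that were
  heavy at different entries compute different strings of the same length and form disjoint sets.
  Each of these has measure at least \<open>2 ^ (- n)\<close>.\<close>

lemma heavy_card:
  fixes b :: nat and i :: bool
  defines "n \<equiv> snd (snd (dec b :: nat \<times> nat \<times> nat))"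
  assumes "finite F" and F: "\<And>s. s \<in> F \<Longrightarrow> \<exists>x. ent s = Some (x, i) \<and> bst b \<le> x \<and> x < bst (Suc b)"
  shows "card F \<le> 2 ^ n"
proof -
  define \<alpha> where "\<alpha> s = map (As i s) [0..<bst (Suc b)]" for s
  define t where "t = Suc (Max F)"
  have le: "s \<le> t" if "s \<in> F" for s using that assms(2) by (simp add: t_def le_SucI)
  have hv: "2 ^ s < card {\<rho>. length \<rho> = s \<and> fcomp s (bidx b i) \<rho> (\<alpha> s)} * 2 ^ n" if "s \<in> F" for s
  proof -
    obtain x where x: "ent s = Some (x, i)" "bst b \<le> x" "x < bst (Suc b)" using F \<open>s \<in> F\<close> by blast
    have "fst (prod_decode s) = b" using block_unique ent_Some(2,3)[OF x(1)] x(2,3) by blast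
    then have "heavy ent s b i" using ent_Some(4)[OF x(1)] by blast
    then show ?thesis unfolding heavy_def \<alpha>_def n_def .
  qed
  have ge: "2 ^ t \<le> card {\<rho>. length \<rho> = t \<and> fcomp t (bidx b i) \<rho> (\<alpha> s)} * 2 ^ n" if "s \<in> F" for s
  proof -
    have "(2::nat) ^ t = 2 ^ s * 2 ^ (t - s)" using le[OF that] by (simp add: power_add[symmetric])
    also have "\<dots> \<le> card {\<rho>. length \<rho> = s \<and> fcomp s (bidx b i) \<rho> (\<alpha> s)} * 2 ^ n * 2 ^ (t - s)"
      using hv[OF that] by (intro mult_le_mono1) simp
    also have "\<dots> = card {\<rho>. length \<rho> = s \<and> fcomp s (bidx b i) \<rho> (\<alpha> s)} * 2 ^ (t - s) * 2 ^ n" by simp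
    also have "\<dots> \<le> card {\<rho>. length \<rho> = t \<and> fcomp t (bidx b i) \<rho> (\<alpha> s)} * 2 ^ n"
      by (intro mult_le_mono1 card_fcomp_mono le that)
    finally show ?thesis .
  qed
  have ne: "\<alpha> s \<noteq> \<alpha> s'" if "s \<in> F" "s' \<in> F" "s < s'" for s s'
  proof -
    obtain x where x: "ent s = Some (x, i)" "x < bst (Suc b)" using F[OF \<open>s \<in> F\<close>] by blast
    have "\<not> As i s x" using ent_Some(6)[OF x(1)] .
    moreover have "As i s' x" unfolding enumd_def using x(1) that(3) by blast
    ultimately have "\<alpha> s ! x \<noteq> \<alpha> s' ! x" using x(2) by (simp add: \<alpha>_def)
    then show ?thesis by metis
  qed
  have disj: "{\<rho>. length \<rho> = t \<and> fcomp t (bidx b i) \<rho> (\<alpha> s)} \<inter> {\<rho>. length \<rho> = t \<and> fcomp t (bidx b i) \<rho> (\<alpha> s')} = {}"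
    if "s \<in> F" "s' \<in> F" "s \<noteq> s'" for s s'
  proof -
    have "\<alpha> s \<noteq> \<alpha> s'" using ne that by (metis linorder_neqE_nat)
    then show ?thesis using fcomp_unique[of t "bidx b i" _ "\<alpha> s" t "[]" "\<alpha> s'"] by (auto simp: \<alpha>_def)
  qed
  have "card F * 2 ^ t = (\<Sum>s\<in>F. 2 ^ t)" by simp
  also have "\<dots> \<le> (\<Sum>s\<in>F. card {\<rho>. length \<rho> = t \<and> fcomp t (bidx b i) \<rho> (\<alpha> s)} * 2 ^ n)" by (intro sum_mono ge)
  also have "\<dots> = card (\<Union>s\<in>F. {\<rho>. length \<rho> = t \<and> fcomp t (bidx b i) \<rho> (\<alpha> s)}) * 2 ^ n"
    unfolding sum_distrib_right[symmetric]
    by (subst card_UN_disjoint) (use assms(2) disj in auto)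
  also have "\<dots> \<le> 2 ^ t * 2 ^ n"
  proof (rule mult_le_mono1)
    have "card (\<Union>s\<in>F. {\<rho>. length \<rho> = t \<and> fcomp t (bidx b i) \<rho> (\<alpha> s)}) \<le> card {\<rho>::bool list. length \<rho> = t}"
      by (rule card_mono) auto
    then show "card (\<Union>s\<in>F. {\<rho>. length \<rho> = t \<and> fcomp t (bidx b i) \<rho> (\<alpha> s)}) \<le> 2 ^ t" by simp
  qed
  finally show ?thesis by simp
qed

lemma small_side:
  fixes e0 e1 n :: nat
  defines "b \<equiv> enc (e0, e1, n)"
  shows "\<exists>i. \<forall>s. card {\<rho>. length \<rho> = s \<and> fcomp s (if i then e1 else e0) \<rho> (restr (Aset i) (bst (Suc b)))} * 2 ^ n \<le> 2 ^ s"
proof (rule ccontr)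
  assume nt: "\<not> ?thesis"
  have bi: "bidx b i = (if i then e1 else e0)" for i by (simp add: bidx_def b_def)
  have "\<forall>i. \<exists>s. 2 ^ s < card {\<rho>. length \<rho> = s \<and> fcomp s (bidx b i) \<rho> (restr (Aset i) (bst (Suc b)))} * 2 ^ n"
    using nt unfolding bi by (meson not_le)
  then obtain ss where ss: "\<And>i. 2 ^ ss i < card {\<rho>. length \<rho> = ss i \<and> fcomp (ss i) (bidx b i) \<rho> (restr (Aset i) (bst (Suc b)))} * 2 ^ n" by metis
  have n: "snd (snd (dec b :: nat \<times> nat \<times> nat)) = n" by (simp add: b_def)
  have "\<exists>s0. \<forall>i. \<forall>s\<ge>s0. map (As i s) [0..<bst (Suc b)] = restr (Aset i) (bst (Suc b))"
  proof -
    have "\<exists>s0. \<forall>s\<ge>s0. map (As i s) [0..<bst (Suc b)] = restr (Aset i) (bst (Suc b))" for i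
    proof -
      obtain s0 where "\<And>s x. s \<ge> s0 \<Longrightarrow> x < bst (Suc b) \<Longrightarrow> As i s x = Aset i x" using As_settle by blast
      then show ?thesis unfolding restr_def by (intro exI[of _ s0]) simp
    qed
    then obtain s0 where s0: "\<And>i s. s \<ge> s0 i \<Longrightarrow> map (As i s) [0..<bst (Suc b)] = restr (Aset i) (bst (Suc b))" by metis
    have "s0 i \<le> max (s0 False) (s0 True)" for i by (cases i) auto
    then show ?thesis using s0 by (meson le_trans)
  qed
  then obtain s0 where s0: "\<And>i s. s \<ge> s0 \<Longrightarrow> map (As i s) [0..<bst (Suc b)] = restr (Aset i) (bst (Suc b))" by blast
  define s1 where "s1 = s0 + ss False + ss True"
  have heavy: "heavy ent s b i" if "s \<ge> s1" for s i
  proof -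
    have s: "s \<ge> s0" "s \<ge> ss i" using that by (cases i; simp add: s1_def)+
    have "(2::nat) ^ s = 2 ^ ss i * 2 ^ (s - ss i)" using s(2) by (simp add: power_add[symmetric])
    also have "\<dots> < card {\<rho>. length \<rho> = ss i \<and> fcomp (ss i) (bidx b i) \<rho> (restr (Aset i) (bst (Suc b)))} * 2 ^ n * 2 ^ (s - ss i)"
      using ss[of i] by (intro mult_strict_right_mono) simp_all
    also have "\<dots> = card {\<rho>. length \<rho> = ss i \<and> fcomp (ss i) (bidx b i) \<rho> (restr (Aset i) (bst (Suc b)))} * 2 ^ (s - ss i) * 2 ^ n" by simp
    also have "\<dots> \<le> card {\<rho>. length \<rho> = s \<and> fcomp s (bidx b i) \<rho> (restr (Aset i) (bst (Suc b)))} * 2 ^ n"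
      by (intro mult_le_mono1 card_fcomp_mono s)
    finally show ?thesis unfolding heavy_def n s0[OF s(1)] .
  qed
  define St where "St i = {s. \<exists>x. ent s = Some (x, i) \<and> bst b \<le> x \<and> x < bst (Suc b)}" for i
  have cardF: "card F \<le> 2 ^ n" if "finite F" "F \<subseteq> St i" for F i
    using heavy_card[OF that(1), of i b] that(2) unfolding n St_def by blast
  have fin: "finite (St i)" for i
  proof (rule ccontr)
    assume "infinite (St i)"
    then obtain F where "F \<subseteq> St i" "finite F" "card F = Suc (2 ^ n)" using infinite_arbitrarily_large by blast
    then show False using cardF[of F i] by simp
  qed
  have free: "fresh ent s b < bst (Suc b)" for s
  proof (rule ccontr)
    assume "\<not> ?thesis"
    then have used: "As False s x \<or> As True s x" if "bst b \<le> x" "x < bst (Suc b)" for x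
      using fresh_less that by blast
    have "\<exists>u. u \<in> St False \<union> St True \<and> (\<exists>i. ent u = Some (x, i))" if "x \<in> {bst b..<bst (Suc b)}" for x
      using used[of x] that unfolding enumd_def St_def by auto
    then obtain u where u: "\<And>x. x \<in> {bst b..<bst (Suc b)} \<Longrightarrow> u x \<in> St False \<union> St True \<and> (\<exists>i. ent (u x) = Some (x, i))" by metis
    have "inj_on u {bst b..<bst (Suc b)}"
    proof (rule inj_onI)
      fix x y assume "x \<in> {bst b..<bst (Suc b)}" "y \<in> {bst b..<bst (Suc b)}" "u x = u y"
      then show "x = y" using u[of x] u[of y] by auto
    qed
    moreover have "u ` {bst b..<bst (Suc b)} \<subseteq> St False \<union> St True" using u by blast
    ultimately have "card {bst b..<bst (Suc b)} \<le> card (St False \<union> St True)"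
      by (rule card_inj_on_le) (use fin in simp)
    also have "\<dots> \<le> card (St False) + card (St True)" by (rule card_Un_le)
    also have "\<dots> \<le> 2 ^ n + 2 ^ n" by (intro add_mono cardF fin) auto
    finally show False by (simp add: bst_Suc bsz_def n)
  qed
  have "prod_encode (b, t) \<in> St False \<union> St True" if "t \<ge> s1" for t
  proof -
    let ?s = "prod_encode (b, t)"
    have "?s \<ge> s1" using le_prod_encode_2[of t b] that by linarith
    then have "entry ent ?s = Some (fresh ent ?s b, side ent ?s (fresh ent ?s b))"
      unfolding entry_def using heavy free by (simp add: Let_def)
    then have "ent ?s = Some (fresh ent ?s b, side ent ?s (fresh ent ?s b))" using ent_eq by simp
    then show ?thesis unfolding St_def using free fresh_props(1)[OF free] by (cases "side ent ?s (fresh ent ?s b)") auto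
  qed
  then have "(\<lambda>t. prod_encode (b, t)) ` {s1..} \<subseteq> St False \<union> St True" by auto
  then have "finite ((\<lambda>t. prod_encode (b, t)) ` {s1..})" using fin finite_subset by blast
  then have "finite {s1..}" by (rule finite_imageD) (auto simp: inj_on_def)
  then show False using infinite_Ici by blast
qed

lemma agree_take: "agree g t k l \<Longrightarrow> l' \<le> l \<Longrightarrow> agree g t k l'"
  unfolding agree_def
proof (elim conjE exE)
  fix \<sigma> assume *: "l' \<le> l" "l \<le> t" "length \<sigma> = l" "fcomp t (k div 2) (map (enumd g t (odd k)) [0..<t]) \<sigma>" "S \<sigma>"
  show "l' \<le> t \<and> (\<exists>\<sigma>. length \<sigma> = l' \<and> (fcomp t (k div 2) (map (enumd g t (odd k)) [0..<t]) \<sigma> \<and> S \<sigma>))"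
    by (intro conjI exI[of _ "take l' \<sigma>"]) (use * fcomp_take dtree_take[OF S] in auto)
qed

lemma cmp_agree: "cmp A t \<Longrightarrow> cmp A k \<Longrightarrow> cmp A l \<Longrightarrow> cmp A (\<lambda>x. agree ent (t x) (k x) (l x))"
proof -
  assume *: "cmp A t" "cmp A k" "cmp A l"
  show ?thesis unfolding agree_def
    by (intro cmp_intros dtree_cmp[OF S] cmp_comp[OF *(1)] cmp_comp[OF *(2)] cmp_comp[OF *(3)])
qed

text \<open>Induction on priority. Once the stronger requirements have no more expansionary stages
  and no number below their bound \<open>R\<close> is enumerated any more, a number entering below
  an expansionary stage of \<open>k\<close> goes to the other side. So the oracle seen at that stage
  is final; if there were infinitely many such stages, reading off the agreeing outputs would
  compute a path through \<open>S\<close>.\<close>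

lemma finite_expand: "finite {t. expand ent t k}"
proof (induction k rule: less_induct)
  case (less k)
  have "finite (\<Union>k'<k. {t. expand ent t k'})" using less by blast
  then obtain R where R: "\<And>k' t. k' < k \<Longrightarrow> expand ent t k' \<Longrightarrow> t \<le> R"
    unfolding finite_nat_set_iff_bounded_le by auto
  define i where "i = odd k"
  have "\<exists>s1. \<forall>s\<ge>s1. \<forall>x<R. \<forall>j. ent s \<noteq> Some (x, j)"
  proof -
    have inj: "inj_on (\<lambda>s. fst (the (ent s))) {s. \<exists>x<R. \<exists>j. ent s = Some (x, j)}"
      using ent_unique by (auto simp: inj_on_def)
    have "finite {s. \<exists>x<R. \<exists>j. ent s = Some (x, j)}"
      by (rule inj_on_finite[OF inj, of "{..<R}"]) auto
    then obtain s1 where "\<forall>s\<in>{s. \<exists>x<R. \<exists>j. ent s = Some (x, j)}. s < s1"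
      unfolding finite_nat_set_iff_bounded by blast
    then show ?thesis by (intro exI[of _ s1]) (auto simp: not_less[symmetric])
  qed
  then obtain s1' where s1': "\<And>s x j. s \<ge> s1' \<Longrightarrow> x < R \<Longrightarrow> ent s \<noteq> Some (x, j)" by blast
  define s1 where "s1 = max s1' (Suc k)"
  have keep: "x \<ge> t" if t: "expand ent t k" "t \<ge> s1" and s: "s \<ge> t" "ent s = Some (x, i)" for t s x
  proof (rule ccontr)
    assume "\<not> t \<le> x"
    then have "restrained ent s k x" unfolding restrained_def using t s by (intro exI[of _ t]) auto
    moreover have "R \<le> x" using s1' t(2) s by (metis max.bounded_iff not_le order_trans s1_def)
    then have "\<not> restrained ent s k' x" if "k' < k" for k'
      unfolding restrained_def using R[OF that] by (meson le_less_trans not_le)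
    moreover have "k < s" using t(2) s(1) by (simp add: s1_def)
    ultimately have "(LEAST k. k \<ge> s \<or> restrained ent s k x) = k"
      by (intro Least_equality) (auto simp: not_le[symmetric] intro: ccontr dest: le_less_trans)
    then have "side ent s x = even k" by (simp add: side_def)
    then show False using ent_Some(5)[OF s(2)] by (simp add: i_def)
  qed
  have stable: "As i s x = As i t x" if "expand ent t k" "t \<ge> s1" "s \<ge> t" "x < t" for s t x
  proof
    assume "As i s x"
    then obtain u where u: "u < s" "ent u = Some (x, i)" unfolding enumd_def by blast
    then have "u < t" using keep[OF that(1,2), of u x] that(4) by (meson not_le)
    then show "As i t x" unfolding enumd_def using u(2) by blast
  qed (use As_mono that(3) in blast)
  show ?case
  proof (rule ccontr)
    assume inf: "infinite {t. expand ent t k}"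
    \<comment> \<open>Each expansionary stage has a length attained there for the first time; these
      lengths are distinct, hence unbounded.\<close>
    have many: "\<exists>t. s1 \<le> t \<and> expand ent t k \<and> agree ent t k l" for l
    proof (rule ccontr)
      assume no: "\<not> ?thesis"
      have "infinite {t. s1 \<le> t \<and> expand ent t k}"
      proof
        assume "finite {t. s1 \<le> t \<and> expand ent t k}"
        then have "finite ({..<s1} \<union> {t. s1 \<le> t \<and> expand ent t k})" by simp
        moreover have "{t. expand ent t k} \<subseteq> {..<s1} \<union> {t. s1 \<le> t \<and> expand ent t k}" by auto
        ultimately show False using inf finite_subset by blast
      qed
      moreover obtain L where L: "\<And>t. expand ent t k \<Longrightarrow> agree ent t k (L t) \<and> (\<forall>t'<t. \<not> agree ent t' k (L t))"
      proof -
        have "\<forall>t. \<exists>l. expand ent t k \<longrightarrow> agree ent t k l \<and> (\<forall>t'<t. \<not> agree ent t' k l)"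
          unfolding expand_def by blast
        from choice[OF this] show ?thesis using that by blast
      qed
      moreover have "L t < l" if "s1 \<le> t" "expand ent t k" for t
        using no L[OF that(2)] agree_take that by (meson not_le)
      moreover have "inj_on L {t. s1 \<le> t \<and> expand ent t k}"
      proof (rule inj_onI)
        fix t t' assume "t \<in> {t. s1 \<le> t \<and> expand ent t k}" "t' \<in> {t. s1 \<le> t \<and> expand ent t k}" "L t = L t'"
        then show "t = t'" using L[of t] L[of t'] by (metis linorder_neqE_nat mem_Collect_eq)
      qed
      moreover have "finite {t. s1 \<le> t \<and> expand ent t k}"
      proof (rule inj_on_finite)
        show "inj_on L {t. s1 \<le> t \<and> expand ent t k}" by fact
        show "L ` {t. s1 \<le> t \<and> expand ent t k} \<subseteq> {..<l}" using \<open>\<And>t. s1 \<le> t \<Longrightarrow> expand ent t k \<Longrightarrow> L t < l\<close> by blast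
      qed simp
      ultimately show False by blast
    qed
    have restrA: "map (As i t) [0..<t] = restr (Aset i) t" if "expand ent t k" "s1 \<le> t" for t
    proof (rule nth_equalityI)
      fix x assume "x < length (map (As i t) [0..<t])"
      then have x: "x < t" by simp
      have "As i t x = Aset i x" unfolding Aset_def using stable[OF that _ x] As_mono by (meson nat_le_linear)
      then show "map (As i t) [0..<t] ! x = restr (Aset i) t ! x" using x by simp
    qed simp
    obtain p where p: "k div 2 = prog_encode p" using bij_prog_encode by (metis bij_pointE)
    \<comment> \<open>After \<open>s1\<close> every expansionary stage can be trusted, so a search
      without oracle determines the bits of \<open>Y\<close>.\<close>
    define tt where "tt n = (LEAST t. s1 \<le> t \<and> expand ent t k \<and> agree ent t k (Suc n))" for n
    define Y where "Y n \<longleftrightarrow> (\<exists>\<sigma>. length \<sigma> = Suc n \<and> (fcomp (tt n) (k div 2) (map (As i (tt n)) [0..<tt n]) \<sigma> \<and> nthd False \<sigma> n))" for n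
    have tt: "s1 \<le> tt n" "expand ent (tt n) k" "agree ent (tt n) k (Suc n)" for n
      using LeastI_ex[OF many[of "Suc n"]] unfolding tt_def by auto
    have run_eq: "run p (seq_of (Aset i)) x = Some (of_bool (\<sigma> ! x))"
      if "expand ent t k" "s1 \<le> t" "fcomp t (k div 2) (map (As i t) [0..<t]) \<sigma>" "x < length \<sigma>" for t \<sigma> x
      using that(3,4) fcomp_sound unfolding restrA[OF that(1,2)] p by blast
    have runY: "run p (seq_of (Aset i)) n = Some (of_bool (Y n))" for n
    proof -
      obtain \<sigma> where \<sigma>: "length \<sigma> = Suc n" "fcomp (tt n) (k div 2) (map (As i (tt n)) [0..<tt n]) \<sigma>"
        using tt(3)[of n] unfolding agree_def i_def by blast
      have r: "run p (seq_of (Aset i)) n = Some (of_bool (\<sigma> ! n))" using run_eq[OF tt(2,1) \<sigma>(2)] \<sigma>(1) by simp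
      have "Y n \<longleftrightarrow> \<sigma> ! n"
      proof
        assume "Y n"
        then obtain \<sigma>' where "length \<sigma>' = Suc n" "fcomp (tt n) (k div 2) (map (As i (tt n)) [0..<tt n]) \<sigma>'" "nthd False \<sigma>' n"
          unfolding Y_def by blast
        moreover have "\<sigma> = \<sigma>'" using fcomp_unique[OF \<sigma>(2), of "tt n" "[]" \<sigma>'] calculation \<sigma>(1) by simp
        ultimately show "\<sigma> ! n" by simp
      next
        assume "\<sigma> ! n"
        then show "Y n" unfolding Y_def using \<sigma> by (intro exI[of _ \<sigma>]) simp
      qed
      then show ?thesis using r by simp
    qed
    have "S (restr Y l)" for l
    proof -
      obtain t where t: "s1 \<le> t" "expand ent t k" "agree ent t k l" using many by blast
      then obtain \<sigma> where \<sigma>: "length \<sigma> = l" "fcomp t (k div 2) (map (As i t) [0..<t]) \<sigma>" "S \<sigma>"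
        unfolding agree_def i_def by blast
      have "\<sigma> = restr Y l"
      proof (rule nth_equalityI)
        fix x assume x: "x < length \<sigma>"
        have "Some (of_bool (\<sigma> ! x) :: nat) = Some (of_bool (Y x))"
          using run_eq[OF t(2,1) \<sigma>(2) x] runY[of x] by simp
        then have "\<sigma> ! x = Y x" unfolding option.inject of_bool_eq_iff .
        then show "\<sigma> ! x = restr Y l ! x" using x \<sigma>(1) by simp
      qed (simp add: \<sigma>)
      then show ?thesis using \<sigma>(3) by simp
    qed
    then have "Y \<in> paths S" by (simp add: paths_def)
    moreover have "cmp (\<lambda>_. 0) Y"
    proof -
      have "cmp (\<lambda>_. 0) tt" unfolding tt_def[abs_def] expand_def
        by (rule cmp_Least) (intro cmp_intros cmp_agree, use many in \<open>simp add: expand_def\<close>)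
      then show ?thesis unfolding Y_def[abs_def] by (intro cmp_intros cmp_comp[OF \<open>cmp (\<lambda>_. 0) tt\<close>])
    qed
    ultimately show False using special by blast
  qed
qed

text \<open>A reduction would make every length agree at some stage. The first such stage is
  expansionary and at least as large as the length, so there would be infinitely many.\<close>

lemma Aset_not_above:
  assumes "X \<in> paths S" shows "\<not> seq_of X \<le>\<^sub>T seq_of (Aset i)"
proof
  assume "seq_of X \<le>\<^sub>T seq_of (Aset i)"
  then obtain p where p: "\<And>n. run p (seq_of (Aset i)) n = Some (seq_of X n)" unfolding turing_le_def by blast
  define k where "k = 2 * prog_encode p + of_bool i"
  have k: "k div 2 = prog_encode p" "odd k = i" by (simp_all add: k_def)
  have ex: "\<exists>t. agree ent t k l" for l
  proof -
    obtain n where n: "\<forall>s\<ge>n. fcomp s (prog_encode p) (restr (Aset i) s) (restr X l)"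
      using fcomp_complete[of l p "Aset i" X] p by blast
    obtain s0 where s0: "\<And>s x. s \<ge> s0 \<Longrightarrow> x < n \<Longrightarrow> As i s x = Aset i x" using As_settle by blast
    define t where "t = s0 + n + l"
    have "[0..<t] = [0..<n] @ [n..<t]" using upt_add_eq_append[of 0 n "s0 + l"] by (simp add: t_def add_ac)
    then have "map (As i t) [0..<t] = restr (Aset i) n @ map (As i t) [n..<t]"
      using s0[of t] by (simp add: restr_def t_def)
    moreover have "fcomp t (prog_encode p) (restr (Aset i) n @ map (As i t) [n..<t]) (restr X l)"
      by (rule fcomp_mono) (use n in \<open>auto simp: t_def\<close>)
    ultimately show ?thesis unfolding agree_def k
      by (intro exI[of _ t] conjI exI[of _ "restr X l"]) (use assms in \<open>auto simp: t_def paths_def\<close>)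
  qed
  have "\<exists>t. expand ent t k \<and> l \<le> t" for l
  proof -
    let ?t = "LEAST t. agree ent t k l"
    have "agree ent ?t k l" by (rule LeastI_ex[OF ex])
    moreover have "\<not> agree ent t' k l" if "t' < ?t" for t' using not_less_Least[OF that] .
    ultimately show ?thesis unfolding expand_def agree_def by blast
  qed
  then have "infinite {t. expand ent t k}" unfolding infinite_nat_iff_unbounded_le by blast
  then show False using finite_expand by blast
qed

text \<open>Given an incomplete random sequence above each side, the blocks indexed by the two
  reductions have a small side for every \<open>n\<close>. One side is thus small for infinitely
  many \<open>n\<close>, and the sequence above it computes the halting problem.\<close>

lemma ce_not_below_incomplete:
  "\<exists>i. \<forall>X\<in>MLR. seq_of (Aset i) \<le>\<^sub>T seq_of X \<longrightarrow> seq_of halting_problem \<le>\<^sub>T seq_of X"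
proof (rule ccontr)
  assume "\<not> ?thesis"
  then have "\<forall>i. \<exists>X p. X \<in> MLR \<and> (\<forall>n. run p (seq_of X) n = Some (seq_of (Aset i) n)) \<and> \<not> seq_of halting_problem \<le>\<^sub>T seq_of X"
    unfolding turing_le_def[of "seq_of (Aset _)"] by blast
  then obtain X p where X: "\<And>i. X i \<in> MLR" "\<And>i n. run (p i) (seq_of (X i)) n = Some (seq_of (Aset i) n)"
    "\<And>i. \<not> seq_of halting_problem \<le>\<^sub>T seq_of (X i)" by metis
  define m where "m n = bst (Suc (enc (prog_encode (p False), prog_encode (p True), n)))" for n :: nat
  have m: "cmp (\<lambda>_. 0) m" unfolding m_def[abs_def] by (intro cmp_intros)
  define sm where "sm i n \<longleftrightarrow> (\<forall>s. card {\<rho>. length \<rho> = s \<and> fcomp s (prog_encode (p i)) \<rho> (restr (Aset i) (m n))} * 2 ^ n \<le> 2 ^ s)" for i and n :: nat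
  have sm: "\<exists>i. sm i n" for n
  proof -
    obtain i where "\<forall>s. card {\<rho>. length \<rho> = s \<and> fcomp s (if i then prog_encode (p True) else prog_encode (p False)) \<rho> (restr (Aset i) (m n))} * 2 ^ n \<le> 2 ^ s"
      using small_side[of "prog_encode (p True)" "prog_encode (p False)" n] unfolding m_def by blast
    then show ?thesis unfolding sm_def by (intro exI[of _ i]) (cases i; simp)
  qed
  have "\<exists>i. \<forall>k. \<exists>n>k. sm i n"
  proof (rule ccontr)
    assume "\<not> ?thesis"
    then obtain k where k: "\<And>i n. n > k i \<Longrightarrow> \<not> sm i n" by metis
    obtain i where "sm i (Suc (k False + k True))" using sm by blast
    then show False using k[of i] by (cases i) auto
  qed
  then obtain i where i: "\<And>k. \<exists>n>k. sm i n" by blast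
  have "seq_of halting_problem \<le>\<^sub>T seq_of (X i)"
  proof (rule MLR_above_ce[OF X(1,2), where As = "As i" and m = m])
    show "cmp (\<lambda>_. 0) (\<lambda>p. As i (fst p) (snd p))" by (intro cmp_intros)
    show "As i t x" if "As i s x" "s \<le> t" for s t x using As_mono that .
    show "Aset i x = (\<exists>s. As i s x)" for x by (rule Aset_def)
    show "\<exists>n>k. \<forall>s. card {\<rho>. length \<rho> = s \<and> fcomp s (prog_encode (p i)) \<rho> (restr (Aset i) (m n))} * 2 ^ n \<le> 2 ^ s" for k
      using i unfolding sm_def by blast
  qed (rule m)
  then show False using X(3) by blast
qed

end

section \<open>Completeness of the halting problem and incomplete random sequences\<close>

fun const_prog :: "nat \<Rightarrow> prog" where
  "const_prog 0 = PZero"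
| "const_prog (Suc n) = PComp PSucc (const_prog n)"

lemma run_const_prog: "run (const_prog n) A x = Some n"
  by (induction n) auto

lemma cmp_const_prog: "cmp A f \<Longrightarrow> cmp A (\<lambda>x. prog_encode (const_prog (f x)))"
proof -
  assume f: "cmp A f"
  have eq: "prog_encode (const_prog n) = rec_nat 0 (\<lambda>i c. 6 + 4 * prod_encode (1, c)) n" for n
    by (induction n) auto
  show ?thesis unfolding eq by (intro cmp_intros cmp_pencode cmp_comp[OF f])
qed

text \<open>The program built for \<open>x\<close> ignores its input, so running it on its own code
  asks exactly whether \<open>p\<close> halts on the code of \<open>x\<close>.\<close>

lemma halting_complete:
  assumes "sd P" shows "cmp (seq_of halting_problem) P"
proof -
  have "ce {enc x | x. P x}" using assms by (rule ce_of_sd)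
  then obtain p where p: "{enc x | x. P x} = {n. run0 p n \<noteq> None}" unfolding ce_def by blast
  have eq: "P x \<longleftrightarrow> halting_problem (6 + 4 * prod_encode (prog_encode p, prog_encode (const_prog (enc x))))" for x
  proof -
    let ?q = "PComp p (const_prog (enc x))"
    have "halting_problem (prog_encode ?q) \<longleftrightarrow> run0 ?q (prog_encode ?q) \<noteq> None"
      unfolding halting_problem_def using bij_prog_encode by (metis bij_is_inj injD)
    also have "\<dots> \<longleftrightarrow> run0 p (enc x) \<noteq> None" by (simp add: run_const_prog)
    also have "\<dots> \<longleftrightarrow> P x" using p by (auto simp: set_eq_iff dest: enc_inject[THEN iffD1])
    finally show ?thesis by simp
  qed
  show ?thesis unfolding eq[abs_def]
    by (intro cmp_comp[OF cmp_seq_of] cmp_intros cmp_pencode cmp_const_prog)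
qed

text \<open>The leftmost path works: the halting problem decides which nodes have extensions of
  every length on the tree.\<close>

lemma halting_basis:
  assumes "Pi01 P" "P \<noteq> {}"
  shows "\<exists>X\<in>P. seq_of X \<le>\<^sub>T seq_of halting_problem"
proof -
  obtain T where T: "dtree T" "P = paths T" using assms(1) unfolding Pi01_iff_tree by blast
  define E where "E \<sigma> \<longleftrightarrow> (\<forall>n\<ge>length \<sigma>. \<exists>\<tau>. length \<tau> = n \<and> take (length \<sigma>) \<tau> = \<sigma> \<and> T \<tau>)" for \<sigma> :: "bool list"
  have "sd (\<lambda>\<sigma>. \<not> E \<sigma>)"
  proof (rule sdI[where R = "\<lambda>n \<sigma>. length \<sigma> \<le> n \<and> \<not> (\<exists>\<tau>. length \<tau> = n \<and> (take (length \<sigma>) \<tau> = \<sigma> \<and> T \<tau>))"])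
    show "cmp (\<lambda>_. 0) (\<lambda>p. length (snd p) \<le> fst p \<and>
       \<not> (\<exists>\<tau>. length \<tau> = fst p \<and> (take (length (snd p)) \<tau> = snd p \<and> T \<tau>)))"
      by (intro cmp_intros dtree_cmp[OF T(1)])
    show "(\<not> E \<sigma>) = (\<exists>n. length \<sigma> \<le> n \<and> \<not> (\<exists>\<tau>. length \<tau> = n \<and> (take (length \<sigma>) \<tau> = \<sigma> \<and> T \<tau>)))" for \<sigma>
      unfolding E_def by blast
  qed
  then have "cmp (seq_of halting_problem) (\<lambda>\<sigma>. \<not> E \<sigma>)" by (rule halting_complete)
  then have cE: "cmp (seq_of halting_problem) E" using cmp_not by force
  have step: "\<exists>b. E (\<sigma> @ [b])" if "E \<sigma>" for \<sigma>
    using konig_step[of \<sigma> T] that dtree_take[OF T(1)] unfolding E_def by blast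
  define g where "g n = rec_nat [] (\<lambda>i \<sigma>. \<sigma> @ [\<not> E (\<sigma> @ [False])]) n" for n
  have g: "g 0 = []" "g (Suc n) = g n @ [\<not> E (g n @ [False])]" for n by (simp_all add: g_def)
  have len: "length (g n) = n" for n by (induction n) (simp_all add: g)
  obtain X0 where X0: "X0 \<in> P" using assms(2) by blast
  have E: "E (g n)" for n
  proof (induction n)
    case 0
    have "\<exists>\<tau>. length \<tau> = n \<and> T \<tau>" for n
      using X0 unfolding T(2) paths_def by (intro exI[of _ "restr X0 n"]) simp
    then show ?case by (simp add: E_def g)
  next
    case (Suc n)
    then show ?case using step[of "g n"] unfolding g by (metis (full_types))
  qed
  define X where "X n = g (Suc n) ! n" for n
  have r: "restr X n = g n" for n
  proof (induction n)
    case (Suc n)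
    then show ?case by (simp add: restr_Suc X_def g nth_append len)
  qed (simp add: restr_def g)
  have "T (g n)" for n using E[of n] len[of n] unfolding E_def by (metis order_refl take_all_iff)
  then have "X \<in> P" by (simp add: T(2) paths_def r)
  moreover have "cmp (seq_of halting_problem) X"
  proof -
    have "cmp (seq_of halting_problem) g" unfolding g_def[abs_def] by (intro cmp_intros cmp_comp[OF cE])
    moreover have "X = (\<lambda>n. nthd False (g (Suc n)) n)" by (simp add: X_def len fun_eq_iff)
    ultimately show ?thesis using cmp_comp by (simp only:) (intro cmp_intros cmp_comp[OF \<open>cmp (seq_of halting_problem) g\<close>])
  qed
  ultimately show ?thesis unfolding seq_of_tle_iff by blast
qed

section \<open>Almost every sequence is random and computes no member of a deep class\<close>

lemma null_if_small:
  assumes "\<And>i. A \<subseteq> U i" "\<And>i. U i \<in> sets coin_measure" "\<And>i. measure coin_measure (U i) \<le> real c * (1/2) ^ i"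
  shows "AE X in coin_measure. X \<notin> A"
proof -
  have "(\<Inter>i. U i) \<in> null_sets coin_measure"
  proof (rule null_setsI)
    have "measure coin_measure (\<Inter>i. U i) \<le> real c * (1/2) ^ i" for i
      using coin.finite_measure_mono[of "\<Inter>i. U i" "U i"] assms(2,3)[of i] by force
    moreover have "(\<lambda>i. real c * (1/2::real) ^ i) \<longlonglongrightarrow> real c * 0"
      by (intro tendsto_mult tendsto_const LIMSEQ_power_zero) simp
    ultimately have "measure coin_measure (\<Inter>i. U i) \<le> 0"
      by (intro LIMSEQ_le_const[of "\<lambda>i. real c * (1/2) ^ i"]) auto
    then show "emeasure coin_measure (\<Inter>i. U i) = 0"
      by (simp add: coin.emeasure_eq_measure measure_le_0_iff)
    show "(\<Inter>i. U i) \<in> sets coin_measure" using assms(2) by (intro sets.countable_INT) auto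
  qed
  then have "AE X in coin_measure. X \<notin> (\<Inter>i. U i)" by (rule AE_not_in)
  then show ?thesis by eventually_elim (use assms(1) in blast)
qed

lemma AE_MLR: "AE X in coin_measure. X \<in> MLR"
proof -
  define UU where "UU p i = {X. \<exists>n. prod_encode (i, str_encode (restr X n)) \<in> {n. run0 p n \<noteq> None}}" for p i
  have sets: "UU p i \<in> sets coin_measure" for p i
  proof -
    have "UU p i = (\<Union>n. {X. prod_encode (i, str_encode (restr X n)) \<in> {n. run0 p n \<noteq> None}})" unfolding UU_def by auto
    then show ?thesis using sets_coin_strings[of "\<lambda>\<rho>. prod_encode (i, str_encode \<rho>) \<in> {n. run0 p n \<noteq> None}"]
      by (simp only:) (intro sets.countable_UN, auto)
  qed
  have "AE X in coin_measure. \<forall>n. mltest (UU (inv prog_encode n)) \<longrightarrow> X \<notin> (\<Inter>i. UU (inv prog_encode n) i)"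
    unfolding AE_all_countable
  proof
    fix n
    show "AE X in coin_measure. mltest (UU (inv prog_encode n)) \<longrightarrow> X \<notin> (\<Inter>i. UU (inv prog_encode n) i)"
    proof (cases "mltest (UU (inv prog_encode n))")
      case True
      then have "\<And>i. measure coin_measure (UU (inv prog_encode n) i) \<le> real 1 * (1/2) ^ i" by (simp add: mltest_def)
      from null_if_small[where A = "\<Inter>i. UU (inv prog_encode n) i" and U = "UU (inv prog_encode n)" and c = 1, OF _ sets this]
      show ?thesis by auto
    qed simp
  qed
  then show ?thesis
  proof eventually_elim
    fix X assume X: "\<forall>n. mltest (UU (inv prog_encode n)) \<longrightarrow> X \<notin> (\<Inter>i. UU (inv prog_encode n) i)"
    have "X \<notin> (\<Inter>i. U i)" if "mltest U" for U
    proof -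
      obtain W where W: "ce W" "\<And>i. U i = {X. \<exists>n. prod_encode (i, str_encode (restr X n)) \<in> W}"
        using \<open>mltest U\<close> unfolding mltest_def by blast
      obtain p where p: "W = {n. run0 p n \<noteq> None}" using W(1) unfolding ce_def by blast
      have "U = UU p" by (rule ext) (simp only: W(2) UU_def p)
      moreover have "inv prog_encode (prog_encode p) = p" using bij_prog_encode by (simp add: bij_is_inj)
      ultimately show ?thesis using X[rule_format, of "prog_encode p"] that by simp
    qed
    then show "X \<in> MLR" by (simp add: MLR_def)
  qed
qed

context universal
begin

text \<open>For each of the countably many functionals, the oracles that output a prefix of length
  \<open>r n\<close> of a member of \<open>P\<close> have measure at most a constant times
  \<open>(1/2) ^ n\<close>, for every \<open>n\<close>.\<close>

lemma AE_not_above_deep: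
  assumes P: "deep M P"
  shows "AE Z in coin_measure. \<not> (\<exists>X\<in>P. seq_of X \<le>\<^sub>T seq_of Z)"
proof -
  obtain r where r: "\<And>n. mass P (r n) \<le> (1/2) ^ n" using P unfolding deep_iff by blast
  define B where "B e = {Z. \<exists>X\<in>P. \<forall>n. run (inv prog_encode e) (seq_of Z) n = Some (seq_of X n)}" for e
  have "AE Z in coin_measure. Z \<notin> B e" for e
  proof -
    obtain c :: nat where "c > 0"
      and c: "\<And>s \<sigma>. real (card {\<rho>. length \<rho> = s \<and> fcomp s e \<rho> \<sigma>}) / 2 ^ s \<le> real c * M \<sigma>"
      using functional_dominated[of e] by blast
    define C where "C n t = {Z. \<exists>X\<in>P. fcomp t e (restr Z t) (restr X (r n))}" for n t
    have sets: "C n t \<in> sets coin_measure" for n t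
      unfolding C_def by (rule sets_coin_strings[of "\<lambda>\<rho>. \<exists>X\<in>P. fcomp t e \<rho> (restr X (r n))"])
    have C_small: "measure coin_measure (C n t) \<le> real c * (1/2) ^ n" for n t
    proof -
      have "measure coin_measure (C n t) = real (card {\<rho>. length \<rho> = t \<and> (\<exists>X\<in>P. fcomp t e \<rho> (restr X (r n)))}) / 2 ^ t"
        unfolding C_def by (rule measure_coin_strings)
      also have "{\<rho>. length \<rho> = t \<and> (\<exists>X\<in>P. fcomp t e \<rho> (restr X (r n)))} =
          (\<Union>\<sigma>\<in>(\<lambda>X. restr X (r n)) ` P. {\<rho>. length \<rho> = t \<and> fcomp t e \<rho> \<sigma>})" by blast
      also have "real (card \<dots>) / 2 ^ t \<le> real (\<Sum>\<sigma>\<in>(\<lambda>X. restr X (r n)) ` P. card {\<rho>. length \<rho> = t \<and> fcomp t e \<rho> \<sigma>}) / 2 ^ t"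
        by (intro divide_right_mono) (simp_all only: of_nat_le_iff zero_le_power zero_le_numeral card_UN_le finite_restr_image)
      also have "\<dots> \<le> (\<Sum>\<sigma>\<in>(\<lambda>X. restr X (r n)) ` P. real c * M \<sigma>)"
        unfolding of_nat_sum sum_divide_distrib by (intro sum_mono c)
      also have "\<dots> = real c * mass P (r n)" by (simp add: mass_def sum_distrib_left)
      also have "\<dots> \<le> real c * (1/2) ^ n" by (intro mult_left_mono r) simp
      finally show ?thesis .
    qed
    have inc: "incseq (C n)" for n
    proof (rule incseq_SucI, rule subsetI)
      fix t Z assume "Z \<in> C n t"
      then obtain X where "X \<in> P" "fcomp t e (restr Z t) (restr X (r n))" unfolding C_def by blast
      moreover from this(2) have "fcomp (Suc t) e (restr Z (Suc t)) (restr X (r n))" by (rule fcomp_restr_mono) auto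
      ultimately show "Z \<in> C n (Suc t)" unfolding C_def by blast
    qed
    show ?thesis
    proof (rule null_if_small[where U = "\<lambda>n. \<Union>t. C n t" and c = c])
      show "B e \<subseteq> (\<Union>t. C n t)" for n
      proof
        fix Z assume "Z \<in> B e"
        then obtain X where X: "X \<in> P" "\<And>n. run (inv prog_encode e) (seq_of Z) n = Some (seq_of X n)" unfolding B_def by blast
        have "prog_encode (inv prog_encode e) = e" using bij_prog_encode by (simp add: bij_is_surj surj_f_inv_f)
        then show "Z \<in> (\<Union>t. C n t)" using fcomp_complete[of "r n" "inv prog_encode e" Z X] X unfolding C_def by auto
      qed
      show "(\<Union>t. C n t) \<in> sets coin_measure" for n using sets by blast
      show "measure coin_measure (\<Union>t. C n t) \<le> real c * (1/2) ^ n" for n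
      proof (rule LIMSEQ_le_const2)
        show "(\<lambda>t. measure coin_measure (C n t)) \<longlonglongrightarrow> measure coin_measure (\<Union>t. C n t)"
          by (rule coin.finite_Lim_measure_incseq) (use sets inc in auto)
      qed (use C_small in blast)
    qed
  qed
  then have "AE Z in coin_measure. \<forall>e. Z \<notin> B e" unfolding AE_all_countable by blast
  then show ?thesis
  proof eventually_elim
    fix Z assume Z: "\<forall>e. Z \<notin> B e"
    show "\<not> (\<exists>X\<in>P. seq_of X \<le>\<^sub>T seq_of Z)"
    proof
      assume "\<exists>X\<in>P. seq_of X \<le>\<^sub>T seq_of Z"
      then obtain X p where X: "X \<in> P" "\<And>n. run p (seq_of Z) n = Some (seq_of X n)" unfolding turing_le_def by blast
      moreover have "inv prog_encode (prog_encode p) = p" using bij_prog_encode by (simp add: bij_is_inj)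
      ultimately have "Z \<in> B (prog_encode p)" unfolding B_def by auto
      then show False using Z by blast
    qed
  qed
qed

text \<open>Otherwise almost every sequence would compute the halting problem and with it, by
  \<open>halting_basis\<close>, a member of a deep class.\<close>

lemma incomplete_MLR: "\<exists>X\<in>MLR. \<not> seq_of halting_problem \<le>\<^sub>T seq_of X"
proof (rule ccontr)
  assume n: "\<not> ?thesis"
  obtain P where P: "P \<noteq> {}" "Pi01 P" "deep M P" using F_deep_nonempty F_deep_iff by (metis all_not_in_conv)
  obtain X where X: "X \<in> P" "seq_of X \<le>\<^sub>T seq_of halting_problem" using halting_basis P by blast
  have "AE Z in coin_measure. False"
    using AE_MLR AE_not_above_deep[OF P(3)]
  proof eventually_elim
    fix Z assume "Z \<in> MLR" "\<not> (\<exists>X\<in>P. seq_of X \<le>\<^sub>T seq_of Z)"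
    then show False using n X turing_le_trans by blast
  qed
  then show False by (simp add: coin.AE_False)
qed

end

section \<open>Embedding effectively closed sets of Baire space\<close>

definition bpaths :: "(nat list \<Rightarrow> bool) \<Rightarrow> (nat \<Rightarrow> nat) set" where
  "bpaths V = {f. \<forall>n. V (map f [0..<n])}"

text \<open>
  A point of the target class is read in pairs of bits; a pair with second bit 1 closes the
  current block and records its length. Infinitely many closed blocks spell out an element of
  \<open>bpaths V\<close>, otherwise the last block is an infinite path through \<open>T\<close> (Simpson's embedding).
\<close>

definition bscan :: "(nat \<Rightarrow> bool) \<Rightarrow> nat \<Rightarrow> bool list \<times> nat list" where
  "bscan X n = rec_nat ([], []) (\<lambda>n p. if X (Suc (2 * n)) then ([], snd p @ [length (fst p)])
     else (fst p @ [X (2 * n)], snd p)) n"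

lemma bscan_simps: "bscan X 0 = ([], [])"
  "bscan X (Suc n) = (if X (Suc (2 * n)) then ([], snd (bscan X n) @ [length (fst (bscan X n))])
     else (fst (bscan X n) @ [X (2 * n)], snd (bscan X n)))"
  by (simp_all add: bscan_def)

lemma bscan_cong: "(\<And>i. i < 2 * n \<Longrightarrow> X i = Y i) \<Longrightarrow> bscan X n = bscan Y n"
  by (induction n) (simp_all add: bscan_simps)

lemma cmp_bscan: "cmp A X \<Longrightarrow> cmp A f \<Longrightarrow> cmp A (\<lambda>x. bscan X (f x))"
proof -
  assume *: "cmp A X" "cmp A f"
  show ?thesis unfolding bscan_def by (intro cmp_intros cmp_comp[OF *(1)] cmp_comp[OF *(2)])
qed

locale embedding =
  fixes V :: "nat list \<Rightarrow> bool" and T :: "bool list \<Rightarrow> bool"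
  assumes cmp_V: "cmp (\<lambda>_. 0) V" and V_Nil: "V []" and V_take: "\<And>\<tau> n. V \<tau> \<Longrightarrow> V (take n \<tau>)"
    and T: "dtree T" and T_nonempty: "paths T \<noteq> {}"
begin

definition emb :: "(nat \<Rightarrow> bool) set" where
  "emb = {X. \<forall>n. T (fst (bscan X n)) \<and> V (snd (bscan X n))}"

lemma Pi01_emb: "Pi01 emb"
proof (rule Pi01I[where R = "\<lambda>(s::nat) \<sigma>. T (fst (bscan (nthd False \<sigma>) (length \<sigma> div 2))) \<and> V (snd (bscan (nthd False \<sigma>) (length \<sigma> div 2)))"])
  have b: "cmp (\<lambda>_. 0) (\<lambda>p::nat \<times> bool list. bscan (nthd False (snd p)) (length (snd p) div 2))"
    unfolding bscan_def by (intro cmp_intros)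
  show "cmp (\<lambda>_. 0) (\<lambda>p::nat \<times> bool list. T (fst (bscan (nthd False (snd p)) (length (snd p) div 2))) \<and>
     V (snd (bscan (nthd False (snd p)) (length (snd p) div 2))))"
    by (intro cmp_conj dtree_cmp[OF T] cmp_comp[OF cmp_V] cmp_fst cmp_snd b)
  have eq: "bscan (nthd False (restr X n)) (length (restr X n) div 2) = bscan X (n div 2)" for X n
    unfolding length_restr by (rule bscan_cong) simp
  have "(\<forall>n. T (fst (bscan X (n div 2))) \<and> V (snd (bscan X (n div 2)))) \<longleftrightarrow> X \<in> emb" for X
  proof
    assume *: "\<forall>n. T (fst (bscan X (n div 2))) \<and> V (snd (bscan X (n div 2)))"
    have "T (fst (bscan X n)) \<and> V (snd (bscan X n))" for n using *[rule_format, of "2 * n"] by simp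
    then show "X \<in> emb" by (simp add: emb_def)
  qed (simp add: emb_def)
  then show "(X \<in> emb) = (\<forall>(s::nat) n. T (fst (bscan (nthd False (restr X n)) (length (restr X n) div 2))) \<and>
     V (snd (bscan (nthd False (restr X n)) (length (restr X n) div 2))))" for X
    unfolding eq by blast
qed

lemma bscan_snd_mono: "\<exists>\<rho>. snd (bscan X (n + d)) = snd (bscan X n) @ \<rho>"
proof (induction d)
  case (Suc d)
  then show ?case by (auto simp: bscan_simps)
qed simp

lemma emb_infinite:
  assumes X: "X \<in> emb" and inf: "\<And>n. \<exists>m. length (snd (bscan X m)) > n"
  shows "\<exists>f\<in>bpaths V. f \<le>\<^sub>T seq_of X"
proof -
  define f where "f n = nthd 0 (snd (bscan X (LEAST m. length (snd (bscan X m)) > n))) n" for n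
  have f: "f i = snd (bscan X m) ! i" if "i < length (snd (bscan X m))" for i m
  proof -
    let ?m = "LEAST m. length (snd (bscan X m)) > i"
    have 1: "length (snd (bscan X ?m)) > i" by (rule LeastI_ex[OF inf])
    have "?m \<le> m" by (rule Least_le) (rule that)
    then obtain \<rho> where "snd (bscan X m) = snd (bscan X ?m) @ \<rho>" using bscan_snd_mono[of X ?m "m - ?m"] by auto
    then show ?thesis using 1 by (simp add: f_def nth_append)
  qed
  have "V (map f [0..<n])" for n
  proof -
    obtain m where m: "length (snd (bscan X m)) > n" using inf by blast
    then have "map f [0..<n] = take n (snd (bscan X m))" by (intro nth_equalityI) (auto simp: f)
    moreover have "V (snd (bscan X m))" using X unfolding emb_def by blast
    ultimately show ?thesis using V_take by simp
  qed
  moreover have "cmp (seq_of X) f" unfolding f_def[abs_def]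
    by (intro cmp_intros cmp_bscan cmp_seq_of inf)
  ultimately show ?thesis unfolding cmp_nat_iff bpaths_def by blast
qed

lemma emb_finite:
  assumes X: "X \<in> emb" and fin: "\<And>m. length (snd (bscan X m)) \<le> n"
  shows "\<exists>Y\<in>paths T. seq_of Y \<le>\<^sub>T seq_of X"
proof -
  define l where "l = Max (range (\<lambda>m. length (snd (bscan X m))))"
  have fr: "finite (range (\<lambda>m. length (snd (bscan X m))))"
    by (rule finite_subset[of _ "{..n}"]) (use fin in auto)
  have "l \<in> range (\<lambda>m. length (snd (bscan X m)))" unfolding l_def by (rule Max_in[OF fr]) auto
  then obtain N where N: "length (snd (bscan X N)) = l" by auto
  have le: "length (snd (bscan X m)) \<le> l" for m unfolding l_def using fr by simp
  have const: "length (snd (bscan X (N + d))) = l" for d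
    using bscan_snd_mono[of X N d] N le[of "N + d"] by auto
  \<comment> \<open>Once the number of closed blocks is maximal, no second bit is 1 any more and the
    current block grows forever.\<close>
  have nomark: "\<not> X (Suc (2 * (N + d)))" for d
    using const[of d] const[of "Suc d"] by (auto simp: bscan_simps)
  have fst: "fst (bscan X (N + d)) = fst (bscan X N) @ map (\<lambda>i. X (2 * (N + i))) [0..<d]" for d
    by (induction d) (use nomark in \<open>simp_all add: bscan_simps\<close>)
  define Y where "Y i = nthd False (fst (bscan X (N + Suc i))) i" for i
  have "restr Y k = take k (fst (bscan X (N + k)))" for k
  proof (rule nth_equalityI)
    fix i assume "i < length (restr Y k)"
    then have i: "i < k" by simp
    have "i - length (fst (bscan X N)) < Suc i" "i - length (fst (bscan X N)) < k" using i by simp_all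
    then show "restr Y k ! i = take k (fst (bscan X (N + k))) ! i"
      using i unfolding Y_def fst by (simp add: nthd_def nth_append del: upt_Suc)
  qed (simp add: fst)
  then have "T (restr Y k)" for k using X dtree_take[OF T] unfolding emb_def by simp
  then have "Y \<in> paths T" by (simp add: paths_def)
  moreover have "cmp (seq_of X) Y" unfolding Y_def[abs_def] by (intro cmp_intros cmp_bscan cmp_seq_of)
  ultimately show ?thesis unfolding seq_of_tle_iff by blast
qed

lemma emb_ge: "bpaths V \<union> seq_of ` paths T \<le>\<^sub>w seq_of ` emb"
  unfolding weak_le_def
proof
  fix Z assume "Z \<in> seq_of ` emb"
  then obtain X where X: "X \<in> emb" "Z = seq_of X" by blast
  show "\<exists>Y\<in>bpaths V \<union> seq_of ` paths T. Y \<le>\<^sub>T Z"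
  proof (cases "\<forall>n. \<exists>m. length (snd (bscan X m)) > n")
    case True
    then show ?thesis using emb_infinite[OF X(1)] X(2) by blast
  next
    case False
    then obtain n where "\<And>m. length (snd (bscan X m)) \<le> n" by (auto simp: not_less)
    then show ?thesis using emb_finite[OF X(1)] X(2) by blast
  qed
qed

text \<open>A value \<open>m\<close> is spelled by closing a block of length \<open>m\<close>, whose
  bits must form a string on \<open>T\<close>; this one is computable from \<open>m\<close>.\<close>

definition tstr :: "nat \<Rightarrow> bool list" where "tstr m = bits m (LEAST i. T (bits m i))"

lemma tstr: "length (tstr m) = m" "T (tstr m)"
proof -
  obtain X where "X \<in> paths T" using T_nonempty by blast
  then have "\<exists>\<sigma>. length \<sigma> = m \<and> T \<sigma>" unfolding paths_def by (intro exI[of _ "restr X m"]) simp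
  then have "\<exists>i. T (bits m i)" unfolding ex_strings by blast
  then show "T (tstr m)" unfolding tstr_def by (rule LeastI_ex)
qed (simp add: tstr_def)

lemma cmp_tstr: "cmp A f \<Longrightarrow> cmp A (\<lambda>x. tstr (f x))"
proof -
  assume f: "cmp A f"
  have ex: "\<exists>i. T (bits m i)" for m
  proof -
    have "\<exists>\<sigma>. length \<sigma> = m \<and> T \<sigma>" using tstr by blast
    then show ?thesis unfolding ex_strings by blast
  qed
  have "cmp A tstr" unfolding tstr_def[abs_def] by (intro cmp_intros dtree_cmp[OF T] ex)
  then show ?thesis using f by (rule cmp_comp)
qed

lemma emb_le_bpaths:
  assumes f: "f \<in> bpaths V" shows "\<exists>X\<in>emb. seq_of X \<le>\<^sub>T f"
proof -
  \<comment> \<open>The state consists of the index of the value being spelled and the number of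
    bits already written in its block.\<close>
  define kst where "kst n = rec_nat (0, 0) (\<lambda>_ p. if snd p < f (fst p) then (fst p, Suc (snd p)) else (Suc (fst p), 0)) n" for n :: nat
  have kst: "kst 0 = (0, 0)" "kst (Suc n) = (if snd (kst n) < f (fst (kst n)) then (fst (kst n), Suc (snd (kst n))) else (Suc (fst (kst n)), 0))" for n
    by (simp_all add: kst_def)
  define X where "X i = (let p = kst (i div 2) in if even i then snd p < f (fst p) \<and> nthd False (tstr (f (fst p))) (snd p)
     else \<not> snd p < f (fst p))" for i
  have X: "X (2 * n) = (snd (kst n) < f (fst (kst n)) \<and> nthd False (tstr (f (fst (kst n)))) (snd (kst n)))"
    "X (Suc (2 * n)) = (\<not> snd (kst n) < f (fst (kst n)))" for n by (simp_all add: X_def Let_def)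
  have inv: "snd (kst n) \<le> f (fst (kst n))" for n by (induction n) (simp_all add: kst)
  have bs: "bscan X n = (take (snd (kst n)) (tstr (f (fst (kst n)))), map f [0..<fst (kst n)])" for n
  proof (induction n)
    case (Suc n)
    show ?case
    proof (cases "snd (kst n) < f (fst (kst n))")
      case True
      then show ?thesis using Suc tstr(1)[of "f (fst (kst n))"]
        by (simp add: bscan_simps X kst take_Suc_conv_app_nth)
    next
      case False
      then have "snd (kst n) = f (fst (kst n))" using inv[of n] by simp
      then show ?thesis using Suc False tstr(1)[of "f (fst (kst n))"] by (simp add: bscan_simps X kst)
    qed
  qed (simp add: bscan_simps kst)
  have "X \<in> emb" unfolding emb_def mem_Collect_eq bs using f dtree_take[OF T tstr(2)] by (auto simp: bpaths_def)
  moreover have "cmp f X"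
  proof -
    have "cmp f kst" unfolding kst_def[abs_def] by (intro cmp_intros cmp_comp[OF cmp_oracle])
    then show ?thesis unfolding X_def[abs_def]
      by (intro cmp_intros cmp_tstr cmp_comp[OF cmp_oracle] cmp_comp[OF \<open>cmp f kst\<close>])
  qed
  ultimately show ?thesis unfolding seq_of_tle_iff by blast
qed

lemma emb_le_paths:
  assumes Y: "Y \<in> paths T" shows "\<exists>X\<in>emb. seq_of X \<le>\<^sub>T seq_of Y"
proof -
  define X where "X i = (even i \<and> Y (i div 2))" for i :: nat
  have "bscan X n = (restr Y n, [])" for n
    by (induction n) (simp_all add: bscan_simps X_def restr_Suc, simp add: restr_def)
  then have "X \<in> emb" unfolding emb_def using Y V_Nil by (simp add: paths_def)
  moreover have "cmp (seq_of Y) X" unfolding X_def[abs_def] by (intro cmp_intros cmp_comp[OF cmp_seq_of])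
  ultimately show ?thesis unfolding seq_of_tle_iff by blast
qed

lemma emb_equiv: "seq_of ` emb \<equiv>\<^sub>w bpaths V \<union> seq_of ` paths T"
proof -
  have "seq_of ` emb \<le>\<^sub>w bpaths V \<union> seq_of ` paths T"
    unfolding weak_le_def using emb_le_bpaths emb_le_paths by blast
  then show ?thesis using emb_ge unfolding weak_equiv_def by blast
qed

lemma emb_nonempty: "emb \<noteq> {}"
  using emb_le_paths T_nonempty by blast

end

section \<open>The infimum of all deep degrees\<close>

text \<open>The tree of \<open>Pi01_iff_tree\<close>, uniformly in an index \<open>e\<close> of the
  enumeration, since the infimum ranges over all classes at once.\<close>

definition trE :: "nat \<Rightarrow> bool list \<Rightarrow> bool" where
  "trE e \<sigma> \<longleftrightarrow> (\<forall>n\<le>length \<sigma>. \<forall>s\<le>length \<sigma>. \<not> (\<exists>y<s. evb s (replicate s False) e (enc (take n \<sigma>)) y))"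

lemma cmp_trE [cmp_intros]: "cmp A e \<Longrightarrow> cmp A \<sigma> \<Longrightarrow> cmp A (\<lambda>x. trE (e x) (\<sigma> x))"
proof -
  assume *: "cmp A e" "cmp A \<sigma>"
  show ?thesis unfolding trE_def by (intro cmp_intros cmp_comp[OF *(1)] cmp_comp[OF *(2)])
qed

lemma trE_take: "trE e \<sigma> \<Longrightarrow> trE e (take n \<sigma>)"
  by (auto simp: trE_def min_def)

lemma dtree_trE: "dtree (trE e)"
  unfolding dtree_def using trE_take by (auto intro!: cmp_intros)

lemma Pi01_trE: assumes "Pi01 P" shows "\<exists>e. P = paths (trE e)"
proof -
  obtain p where p: "P = {X. \<forall>n. run0 p (enc (restr X n)) = None}"
    using assms unfolding Pi01_def ce_def str_encode_eq by auto
  let ?e = "prog_encode p"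
  have conv: "run0 p x \<noteq> None \<longleftrightarrow> (\<exists>s. \<exists>y<s. evb s (replicate s False) ?e x y)" for x
  proof
    assume "run0 p x \<noteq> None"
    then obtain y where "run p (seq_of (\<lambda>_. False)) x = Some y" unfolding seq_of_False by blast
    from evb_complete[OF this] obtain m where "\<forall>s\<ge>m. evb s (restr (\<lambda>_. False) s) ?e x y" by blast
    then have "evb (max m (Suc y)) (replicate (max m (Suc y)) False) ?e x y \<and> y < max m (Suc y)"
      unfolding restr_False by auto
    then show "\<exists>s. \<exists>y<s. evb s (replicate s False) ?e x y" by blast
  next
    assume "\<exists>s. \<exists>y<s. evb s (replicate s False) ?e x y"
    then show "run0 p x \<noteq> None"
      unfolding restr_False[symmetric] seq_of_False[symmetric] using evb_sound by (metis option.discI)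
  qed
  have "X \<in> P \<longleftrightarrow> X \<in> paths (trE ?e)" for X
  proof
    assume "X \<in> P"
    then have "\<not> (\<exists>s. \<exists>y<s. evb s (replicate s False) ?e (enc (restr X n)) y)" for n
      unfolding conv[symmetric] p by simp
    then show "X \<in> paths (trE ?e)" unfolding paths_def trE_def by (auto simp: min_def)
  next
    assume X: "X \<in> paths (trE ?e)"
    have "\<not> (\<exists>y<s. evb s (replicate s False) ?e (enc (restr X n)) y)" for n s
    proof -
      have "trE ?e (restr X (max n s))" using X by (simp add: paths_def)
      moreover have "n \<le> length (restr X (max n s))" "s \<le> length (restr X (max n s))" by simp_all
      ultimately have "\<not> (\<exists>y<s. evb s (replicate s False) ?e (enc (take n (restr X (max n s)))) y)" unfolding trE_def by blast
      moreover have "min n (max n s) = n" by simp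
      ultimately show ?thesis by (metis take_restr)
    qed
    then show "X \<in> P" unfolding p using conv by blast
  qed
  then show ?thesis by blast
qed

text \<open>
  The codes \<open>f (Suc n)\<close> of a witness list the bit \<open>X n\<close>, the value \<open>r n\<close> of the rate with a stage
  \<open>h n\<close> confirming it, and for \<open>n = (k, t)\<close> a level \<open>u n\<close> of the tree at which the \<open>t\<close>-th
  approximation to the mass at length \<open>r k\<close> is at most \<open>2 ^ (- k)\<close>.
\<close>

definition wX :: "nat \<Rightarrow> bool" where "wX c = fst (dec c :: bool \<times> nat \<times> nat \<times> nat)"
definition wh :: "nat \<Rightarrow> nat" where "wh c = fst (snd (dec c :: bool \<times> nat \<times> nat \<times> nat))"
definition wv :: "nat \<Rightarrow> nat" where "wv c = fst (snd (snd (dec c :: bool \<times> nat \<times> nat \<times> nat)))"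
definition wu :: "nat \<Rightarrow> nat" where "wu c = snd (snd (snd (dec c :: bool \<times> nat \<times> nat \<times> nat)))"

lemma w_enc [simp]: "wX (enc (x :: bool, h :: nat, v :: nat, u :: nat)) = x" "wh (enc (x :: bool, h :: nat, v :: nat, u :: nat)) = h"
  "wv (enc (x :: bool, h :: nat, v :: nat, u :: nat)) = v" "wu (enc (x :: bool, h :: nat, v :: nat, u :: nat)) = u"
  by (simp_all add: wX_def wh_def wv_def wu_def)

context universal
begin

definition amass :: "nat \<Rightarrow> nat \<Rightarrow> nat \<Rightarrow> nat \<Rightarrow> nat" where
  "amass e t v u = (\<Sum>\<sigma> | length \<sigma> = v. if \<exists>\<tau>. length \<tau> = u \<and> (take v \<tau> = \<sigma> \<and> trE e \<tau>) then Ms t \<sigma> else 0)"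

definition wcond :: "nat \<Rightarrow> nat \<Rightarrow> (nat \<Rightarrow> nat) \<Rightarrow> nat \<Rightarrow> bool" where
  "wcond e d g n \<longleftrightarrow> evb (wh (g n)) (replicate (wh (g n)) False) d n (wv (g n)) \<and>
     (let k = fst (prod_decode n); t = snd (prod_decode n); v = wv (g k) in
        v \<le> wu (g n) \<and> amass e t v (wu (g n)) * 2 ^ k \<le> 2 ^ t)"

text \<open>The entry at 0 codes the index \<open>e\<close> of a class and the program code
  \<open>d\<close> of its rate. Condition \<open>n\<close> refers back only to the entry for
  \<open>fst (prod_decode n)\<close>, which is at most \<open>n\<close>, so it can be checked on a
  finite list.\<close>

definition WV :: "nat list \<Rightarrow> bool" where
  "WV \<tau> \<longleftrightarrow> (let e = fst (prod_decode (nthd 0 \<tau> 0)); d = snd (prod_decode (nthd 0 \<tau> 0)) in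
     (\<forall>n<length \<tau> - 1. wcond e d (\<lambda>i. nthd 0 \<tau> (Suc i)) n) \<and>
     trE e (map (\<lambda>i. wX (nthd 0 \<tau> (Suc i))) [0..<length \<tau> - 1]))"

lemma cmp_WV: "cmp (\<lambda>_. 0) WV"
  unfolding WV_def[abs_def] wcond_def amass_def wX_def wh_def wv_def wu_def
  by (intro cmp_intros cmp_pdecode)

lemma trE_Nil: "trE e []" by (simp add: trE_def)

lemma WV_Nil: "WV []" by (simp add: WV_def Let_def trE_Nil)

lemma fst_prod_decode_le: "fst (prod_decode n) \<le> n"
  by (metis le_prod_encode_1 prod.collapse prod_decode_inverse)

lemma wcond_cong:
  assumes "\<And>i. i \<le> n \<Longrightarrow> g i = g' i" shows "wcond e d g n = wcond e d g' n"
  using assms[of n] assms[OF fst_prod_decode_le] unfolding wcond_def by simp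

lemma WV_map: "WV (map f [0..<Suc m]) \<longleftrightarrow>
    (\<forall>n<m. wcond (fst (prod_decode (f 0))) (snd (prod_decode (f 0))) (\<lambda>i. f (Suc i)) n) \<and>
    trE (fst (prod_decode (f 0))) (restr (\<lambda>i. wX (f (Suc i))) m)"
proof -
  have h: "nthd 0 (map f [0..<Suc m]) i = f i" if "i < Suc m" for i using that by (simp del: upt_Suc)
  have "(\<forall>n<m. wcond e d (\<lambda>i. nthd 0 (map f [0..<Suc m]) (Suc i)) n) \<longleftrightarrow> (\<forall>n<m. wcond e d (\<lambda>i. f (Suc i)) n)" for e d
    using wcond_cong[of _ "\<lambda>i. nthd 0 (map f [0..<Suc m]) (Suc i)" "\<lambda>i. f (Suc i)" e d] h by (metis Suc_less_eq le_less_trans)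
  moreover have "map (\<lambda>i. wX (nthd 0 (map f [0..<Suc m]) (Suc i))) [0..<m] = restr (\<lambda>i. wX (f (Suc i))) m"
    unfolding restr_def using h by (intro map_cong) auto
  ultimately show ?thesis unfolding WV_def Let_def h[OF zero_less_Suc] by (simp del: upt_Suc)
qed

lemma WV_take: "WV \<tau> \<Longrightarrow> WV (take n \<tau>)"
proof -
  assume *: "WV \<tau>"
  show ?thesis
  proof (cases "n = 0 \<or> \<tau> = []")
    case True
    then show ?thesis using WV_Nil by auto
  next
    case False
    define f where "f = nthd 0 \<tau>"
    obtain m where m: "length \<tau> = Suc m" using False by (cases \<tau>) auto
    obtain k where k: "min n (length \<tau>) = Suc k" "k \<le> m" using False m by (cases n) auto
    have t: "\<tau> = map f [0..<Suc m]" by (rule nth_equalityI) (simp_all add: m f_def del: upt_Suc)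
    have len: "length (take n \<tau>) = Suc k" using k(1) by (simp add: min.commute)
    have "take n \<tau> = map f [0..<Suc k]"
    proof (rule nth_equalityI)
      fix i assume "i < length (take n \<tau>)"
      then have "i < Suc k" "i < n" "i < length \<tau>" unfolding len using len by simp_all
      then show "take n \<tau> ! i = map f [0..<Suc k] ! i" by (simp add: f_def del: upt_Suc)
    qed (simp only: len length_map length_upt diff_zero)
    moreover have "WV (map f [0..<Suc k])"
      using * k(2) trE_take[of "fst (prod_decode (f 0))" "restr (\<lambda>i. wX (f (Suc i))) m" k]
      unfolding t WV_map by (auto simp: min_def)
    ultimately show ?thesis by simp
  qed
qed

lemma amass_real: "real (amass e t v u) / 2 ^ t =
    (\<Sum>\<sigma> | length \<sigma> = v. if \<exists>\<tau>. length \<tau> = u \<and> (take v \<tau> = \<sigma> \<and> trE e \<tau>) then real (Ms t \<sigma>) / 2 ^ t else 0)"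
  unfolding amass_def of_nat_sum sum_divide_distrib by (rule sum.cong) auto

text \<open>The confirming stages show that \<open>d\<close> computes the rate without an oracle,
  whatever the complexity of \<open>f\<close>. The mass bound holds at every stage \<open>t\<close>,
  because prefixes of members survive to all levels, and it passes to the limit.\<close>

lemma bpaths_WV_deep:
  assumes f: "f \<in> bpaths WV"
  shows "\<exists>P. Pi01 P \<and> deep M P \<and> (\<exists>X\<in>P. seq_of X \<le>\<^sub>T f)"
proof -
  define e d where "e = fst (prod_decode (f 0))" and "d = snd (prod_decode (f 0))"
  define g where "g i = f (Suc i)" for i
  define X where "X i = wX (g i)" for i
  have "WV (map f [0..<Suc m])" for m using f unfolding bpaths_def by blast
  then have wc: "wcond e d g n" and tr: "trE e (restr X m)" for n m
    unfolding WV_map e_def[symmetric] d_def[symmetric] g_def[abs_def] X_def[abs_def] by blast+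
  have X: "X \<in> paths (trE e)" using tr by (simp add: paths_def)
  obtain p where p: "d = prog_encode p" using bij_prog_encode by (metis bij_pointE)
  define r where "r n = wv (g n)" for n
  have "run0 p n = Some (r n)" for n
    using wc[of n] evb_sound[of _ "\<lambda>_. False" _ p n "r n"] unfolding wcond_def r_def p restr_False[symmetric] seq_of_False[symmetric] by blast
  then have r: "cmp (\<lambda>_. 0) r" unfolding cmp_def enc_nat_def by blast
  have "deep M (paths (trE e))"
  proof (rule deepI[OF r, of _ 1])
    fix k
    have le: "(\<Sum>\<sigma>\<in>(\<lambda>X. restr X (r k)) ` paths (trE e). real (Ms t \<sigma>) / 2 ^ t) \<le> (1/2) ^ k" for t
    proof -
      define n where "n = prod_encode (k, t)"
      have n: "r k \<le> wu (g n)" "amass e t (r k) (wu (g n)) * 2 ^ k \<le> 2 ^ t"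
        using wc[of n] unfolding wcond_def n_def r_def by (simp_all add: Let_def)
      have "(\<Sum>\<sigma>\<in>(\<lambda>X. restr X (r k)) ` paths (trE e). real (Ms t \<sigma>) / 2 ^ t) \<le> real (amass e t (r k) (wu (g n))) / 2 ^ t"
        unfolding amass_real
      proof (rule sum_le_included[where i = "\<lambda>\<sigma>. \<sigma>"])
        show "\<forall>\<sigma>\<in>(\<lambda>X. restr X (r k)) ` paths (trE e). \<exists>y\<in>{\<sigma>. length \<sigma> = r k}. y = \<sigma> \<and>
          real (Ms t \<sigma>) / 2 ^ t \<le> (if \<exists>\<tau>. length \<tau> = wu (g n) \<and> (take (r k) \<tau> = y \<and> trE e \<tau>) then real (Ms t y) / 2 ^ t else 0)"
        proof
          fix \<sigma> assume "\<sigma> \<in> (\<lambda>X. restr X (r k)) ` paths (trE e)"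
          then obtain Z where Z: "Z \<in> paths (trE e)" "\<sigma> = restr Z (r k)" by blast
          have "\<exists>\<tau>. length \<tau> = wu (g n) \<and> (take (r k) \<tau> = \<sigma> \<and> trE e \<tau>)"
            using Z n(1) by (intro exI[of _ "restr Z (wu (g n))"]) (simp add: paths_def min_def)
          then show "\<exists>y\<in>{\<sigma>. length \<sigma> = r k}. y = \<sigma> \<and> real (Ms t \<sigma>) / 2 ^ t \<le>
             (if \<exists>\<tau>. length \<tau> = wu (g n) \<and> (take (r k) \<tau> = y \<and> trE e \<tau>) then real (Ms t y) / 2 ^ t else 0)"
            using Z(2) by (intro bexI[of _ \<sigma>]) auto
        qed
      qed auto
      also have "real (amass e t (r k) (wu (g n)) * 2 ^ k) \<le> real (2 ^ t)" using n(2) unfolding of_nat_le_iff .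
      then have "real (amass e t (r k) (wu (g n))) / 2 ^ t \<le> (1/2) ^ k" by (simp add: power_one_over field_simps)
      finally show ?thesis .
    qed
    have "mass (paths (trE e)) (r k) \<le> (1/2) ^ k"
      unfolding mass_def
    proof (rule LIMSEQ_le_const2)
      show "(\<lambda>t. \<Sum>\<sigma>\<in>(\<lambda>X. restr X (r k)) ` paths (trE e). real (Ms t \<sigma>) / 2 ^ t) \<longlonglongrightarrow>
          (\<Sum>\<sigma>\<in>(\<lambda>X. restr X (r k)) ` paths (trE e). M \<sigma>)" by (intro tendsto_sum Ms(3))
    qed (use le in blast)
    then show "mass (paths (trE e)) (r k) \<le> real 1 * (1/2) ^ k" by simp
  qed
  moreover have "Pi01 (paths (trE e))" unfolding Pi01_iff_tree using dtree_trE by blast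
  moreover have "cmp f X" unfolding X_def[abs_def] g_def wX_def by (intro cmp_intros cmp_comp[OF cmp_oracle])
  ultimately show ?thesis using X unfolding seq_of_tle_iff by blast
qed

text \<open>Besides the bits of \<open>X\<close>, a witness consists of fixed indices, the
  computable rate, and stages and levels found by search; for the levels the search succeeds by
  compactness.\<close>

lemma deep_bpaths_WV:
  assumes P: "Pi01 P" "deep M P" and X: "X \<in> P"
  shows "\<exists>f\<in>bpaths WV. f \<le>\<^sub>T seq_of X"
proof -
  obtain e where e: "P = paths (trE e)" using Pi01_trE[OF P(1)] by blast
  obtain r where r: "cmp (\<lambda>_. 0) r" "\<And>n. mass P (r n) \<le> (1/2) ^ n" using P(2) unfolding deep_iff by blast
  obtain p where p: "\<And>n. run0 p n = Some (r n)" using r(1) unfolding cmp_def enc_nat_def by blast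
  define d where "d = prog_encode p"
  have hex: "\<exists>h. evb h (replicate h False) d n (r n)" for n
    using evb_complete[of p "\<lambda>_. False" n "r n"] p unfolding seq_of_False restr_False d_def by blast
  have uex: "\<exists>u. r k \<le> u \<and> amass e t (r k) u * 2 ^ k \<le> 2 ^ t" for k t
  proof -
    obtain u where u: "u \<ge> r k" "\<And>\<sigma>. length \<sigma> = r k \<Longrightarrow> \<exists>\<tau>. length \<tau> = u \<and> take (r k) \<tau> = \<sigma> \<and> trE e \<tau> \<Longrightarrow> \<sigma> \<in> (\<lambda>X. restr X (r k)) ` P"
      using tree_settle[OF dtree_trE, of "r k" e] unfolding e by blast
    have "real (amass e t (r k) u) / 2 ^ t \<le> (\<Sum>\<sigma> | length \<sigma> = r k. if \<sigma> \<in> (\<lambda>X. restr X (r k)) ` P then M \<sigma> else 0)"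
      unfolding amass_real by (intro sum_mono) (use u(2) in \<open>auto intro: Ms_le_M\<close>)
    also have "\<dots> = mass P (r k)"
      unfolding mass_def by (rule sum.mono_neutral_cong_right) auto
    also have "\<dots> \<le> (1/2) ^ k" by (rule r)
    finally have "real (amass e t (r k) u * 2 ^ k) \<le> real (2 ^ t)" by (simp add: power_one_over field_simps)
    then have "amass e t (r k) u * 2 ^ k \<le> 2 ^ t" unfolding of_nat_le_iff .
    then show ?thesis using u(1) by blast
  qed
  define h where "h n = (LEAST h. evb h (replicate h False) d n (r n))" for n
  define u where "u n = (LEAST u. r (fst (prod_decode n)) \<le> u \<and>
     amass e (snd (prod_decode n)) (r (fst (prod_decode n))) u * 2 ^ fst (prod_decode n) \<le> 2 ^ snd (prod_decode n))" for n
  have h: "evb (h n) (replicate (h n) False) d n (r n)" for n unfolding h_def by (rule LeastI_ex[OF hex])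
  have u: "r (fst (prod_decode n)) \<le> u n \<and>
     amass e (snd (prod_decode n)) (r (fst (prod_decode n))) (u n) * 2 ^ fst (prod_decode n) \<le> 2 ^ snd (prod_decode n)" for n
    unfolding u_def by (rule LeastI_ex[OF uex])
  define f where "f n = (if n = 0 then prod_encode (e, d) else enc (X (n - 1), h (n - 1), r (n - 1), u (n - 1)))" for n
  have f0: "f 0 = prod_encode (e, d)" and fS: "f (Suc n) = enc (X n, h n, r n, u n)" for n by (simp_all add: f_def)
  have "wcond e d (\<lambda>i. f (Suc i)) n" for n unfolding wcond_def fS using h u by (simp add: Let_def)
  moreover have "trE e (restr (\<lambda>i. wX (f (Suc i))) m)" for m using X unfolding fS e paths_def by simp
  ultimately have "WV (map f [0..<Suc m])" for m unfolding WV_map f0 by simp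
  then have "WV (map f [0..<m])" for m using WV_Nil by (cases m) (simp_all del: upt_Suc)
  moreover have "cmp (seq_of X) f"
  proof -
    have am: "cmp (\<lambda>_. 0) (\<lambda>p. amass (fst p) (fst (snd p)) (fst (snd (snd p))) (snd (snd (snd p))))"
      unfolding amass_def by (intro cmp_intros)
    have "cmp (\<lambda>_. 0) h" unfolding h_def[abs_def] by (intro cmp_intros cmp_comp[OF r(1)] hex)
    moreover have "cmp (\<lambda>_. 0) u" unfolding u_def[abs_def]
      by (intro cmp_intros cmp_pdecode cmp_comp[OF r(1)] cmp_app4[OF am] uex)
    ultimately show ?thesis unfolding f_def[abs_def]
      by (intro cmp_intros cmp_comp[OF cmp0[OF r(1)]] cmp_comp[OF cmp0[OF \<open>cmp (\<lambda>_. 0) h\<close>]]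
        cmp_comp[OF cmp0[OF \<open>cmp (\<lambda>_. 0) u\<close>]] cmp_comp[OF cmp_seq_of])
  qed
  ultimately show ?thesis unfolding bpaths_def cmp_nat_iff by blast
qed

definition deep_classes :: "(nat \<Rightarrow> bool) set set" where
  "deep_classes = {P. P \<noteq> {} \<and> Pi01 P \<and> deep M P}"

lemma F_deep_image: "F_deep M = wd ` deep_classes"
  using F_deep_iff by (auto simp: deep_classes_def)

text \<open>The embedding takes a nonempty class of paths next to \<open>bpaths WV\<close>. One deep
  class serves, since its members already belong to the union.\<close>

lemma deep_infimum:
  obtains R where "R \<noteq> {}" "Pi01 R" "seq_of ` R \<equiv>\<^sub>w (\<Union>P\<in>deep_classes. seq_of ` P)"
proof -
  obtain P0 where P0: "P0 \<in> deep_classes" using F_deep_nonempty unfolding F_deep_image by blast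
  then obtain T' where T': "dtree T'" "P0 = paths T'" unfolding deep_classes_def Pi01_iff_tree by blast
  interpret embedding WV T'
    using cmp_WV WV_Nil WV_take T' P0 by unfold_locales (auto simp: deep_classes_def)
  let ?D = "\<Union>P\<in>deep_classes. seq_of ` P"
  have "bpaths WV \<union> seq_of ` paths T' \<le>\<^sub>w ?D"
    unfolding weak_le_def deep_classes_def using deep_bpaths_WV by blast
  moreover have "?D \<le>\<^sub>w bpaths WV \<union> seq_of ` paths T'"
    unfolding weak_le_def
  proof
    fix Y assume "Y \<in> bpaths WV \<union> seq_of ` paths T'"
    then show "\<exists>X\<in>?D. X \<le>\<^sub>T Y"
    proof
      assume "Y \<in> bpaths WV"
      then obtain P X where "Pi01 P" "deep M P" "X \<in> P" "seq_of X \<le>\<^sub>T Y" using bpaths_WV_deep by blast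
      moreover then have "P \<in> deep_classes" unfolding deep_classes_def by blast
      ultimately show ?thesis by blast
    next
      assume "Y \<in> seq_of ` paths T'"
      then show ?thesis using P0 T'(2) turing_le_refl by blast
    qed
  qed
  ultimately have "seq_of ` emb \<equiv>\<^sub>w ?D" using emb_equiv unfolding weak_equiv_def using weak_le_trans by blast
  then show thesis using that emb_nonempty Pi01_emb by blast
qed

end

section \<open>The three filters\<close>

lemma wd_in_deg: "A \<in> deg\<^sub>w A" "B \<in> deg\<^sub>w A \<longleftrightarrow> A \<equiv>\<^sub>w B"
  by (simp_all add: deg\<^sub>w_def weak_equiv_def weak_le_refl)

text \<open>The condition of \<open>F_diff\<close> on a single representative. It is inherited
  upwards in the weak order and is thus the same for all members of a degree.\<close>

definition above_diff :: "(nat \<Rightarrow> nat) set \<Rightarrow> bool" where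
  "above_diff A \<longleftrightarrow> (\<forall>X\<in>MLR. (\<exists>Y\<in>A. Y \<le>\<^sub>T seq_of X) \<longrightarrow> seq_of halting_problem \<le>\<^sub>T seq_of X)"

lemma above_diff_mono: "A \<le>\<^sub>w B \<Longrightarrow> above_diff A \<Longrightarrow> above_diff B"
  unfolding above_diff_def weak_le_def using turing_le_trans by blast

lemma above_diff_Un: "above_diff A \<Longrightarrow> above_diff B \<Longrightarrow> above_diff (A \<union> B)"
  unfolding above_diff_def by blast

lemma F_diff_deg: "deg\<^sub>w A \<in> F_diff \<longleftrightarrow> deg\<^sub>w A \<in> carrier E\<^sub>w \<and> above_diff A"
proof -
  have "(\<forall>P\<in>deg\<^sub>w A. above_diff P) \<longleftrightarrow> above_diff A"
    using above_diff_mono wd_in_deg unfolding weak_equiv_def by metis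
  then show ?thesis unfolding F_diff_def above_diff_def[symmetric] by simp
qed

lemma F_diff_iff: "p \<in> F_diff \<longleftrightarrow> (\<exists>P. P \<noteq> {} \<and> Pi01 P \<and> p = wd P \<and> above_diff (seq_of ` P))"
proof
  assume p: "p \<in> F_diff"
  then obtain P where "P \<noteq> {}" "Pi01 P" "p = wd P" unfolding F_diff_def carrier_E_iff by blast
  then show "\<exists>P. P \<noteq> {} \<and> Pi01 P \<and> p = wd P \<and> above_diff (seq_of ` P)" using p F_diff_deg by metis
next
  assume "\<exists>P. P \<noteq> {} \<and> Pi01 P \<and> p = wd P \<and> above_diff (seq_of ` P)"
  then show "p \<in> F_diff" using F_diff_deg carrier_E_iff by metis
qed

lemma F_diff_filter:
  assumes "F_diff \<noteq> {}" shows "order_filter E\<^sub>w F_diff"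
  unfolding order_filter_def le_E
proof (intro conjI ballI impI)
  show "F_diff \<subseteq> carrier E\<^sub>w" by (auto simp: F_diff_def)
  show "F_diff \<noteq> {}" by fact
next
  fix p q assume "p \<in> F_diff" "q \<in> carrier E\<^sub>w" "wdeg_le p q"
  then obtain P Q where "p = wd P" "above_diff (seq_of ` P)" "Q \<noteq> {}" "Pi01 Q" "q = wd Q"
    unfolding F_diff_iff carrier_E_iff by blast
  then show "q \<in> F_diff" unfolding F_diff_iff using \<open>wdeg_le p q\<close> above_diff_mono by (auto simp: wdeg_le_deg)
next
  fix p q assume "p \<in> F_diff" "q \<in> F_diff"
  then obtain P Q where *: "P \<noteq> {}" "Pi01 P" "p = wd P" "above_diff (seq_of ` P)"
      "Q \<noteq> {}" "Pi01 Q" "q = wd Q" "above_diff (seq_of ` Q)"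
    unfolding F_diff_iff by blast
  show "p \<sqinter>\<^bsub>E\<^sub>w\<^esub> q \<in> F_diff"
    unfolding F_diff_iff
    by (rule exI[of _ "P \<union> Q"]) (use * meet_E Pi01_Un above_diff_Un in \<open>auto simp: image_Un\<close>)
qed

subsection \<open>Difference randomness: no least element\<close>

text \<open>
  An element of \<open>bpaths V\<close> maps \<open>n\<close> to 0 if \<open>n\<close> is not in the set, and otherwise to one plus a stage
  at which \<open>n\<close> has been enumerated.
\<close>

lemma ce_bpaths:
  assumes g: "cmp (\<lambda>_. 0) (\<lambda>p. g (fst p) (snd p) :: bool)" and A: "\<And>x. A x \<longleftrightarrow> (\<exists>s::nat. g s x)"
  obtains V where "cmp (\<lambda>_. 0) V" "V []" "\<And>\<tau> n. V \<tau> \<Longrightarrow> V (take n \<tau>)"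
    "bpaths V \<equiv>\<^sub>w {seq_of A}"
proof -
  define V where "V \<tau> \<longleftrightarrow> (\<forall>n<length \<tau>. (nthd 0 \<tau> n = 0 \<longrightarrow> (\<forall>s<length \<tau>. \<not> g s n)) \<and>
     (nthd 0 \<tau> n \<noteq> 0 \<longrightarrow> g (nthd 0 \<tau> n - 1) n))" for \<tau> :: "nat list"
  have paths: "f \<in> bpaths V \<longleftrightarrow> (\<forall>n. (f n = 0 \<longrightarrow> \<not> A n) \<and> (f n \<noteq> 0 \<longrightarrow> g (f n - 1) n))" for f
  proof
    assume f: "f \<in> bpaths V"
    show "\<forall>n. (f n = 0 \<longrightarrow> \<not> A n) \<and> (f n \<noteq> 0 \<longrightarrow> g (f n - 1) n)"
    proof
      fix n
      have *: "(f n = 0 \<longrightarrow> \<not> g s n) \<and> (f n \<noteq> 0 \<longrightarrow> g (f n - 1) n)" for s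
      proof -
        have "V (map f [0..<Suc (max n s)])" using f unfolding bpaths_def by blast
        moreover have "n < length (map f [0..<Suc (max n s)])" "s < length (map f [0..<Suc (max n s)])"
          by (simp_all del: upt_Suc)
        moreover have "nthd 0 (map f [0..<Suc (max n s)]) n = f n" by (simp del: upt_Suc)
        ultimately show ?thesis unfolding V_def by metis
      qed
      then show "(f n = 0 \<longrightarrow> \<not> A n) \<and> (f n \<noteq> 0 \<longrightarrow> g (f n - 1) n)" unfolding A by blast
    qed
  qed (auto simp: bpaths_def V_def A)
  show thesis
  proof (rule that)
    show "cmp (\<lambda>_. 0) V" unfolding V_def[abs_def] by (intro cmp_intros cmp_app2[OF g])
    show "V []" by (simp add: V_def)
    show "V (take n \<tau>)" if "V \<tau>" for \<tau> n using that by (simp add: V_def)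
    have "cmp f A" if "f \<in> bpaths V" for f
    proof -
      have "A = (\<lambda>n. f n \<noteq> 0)" using that A unfolding paths by blast
      moreover have "cmp f (\<lambda>n. f n \<noteq> 0)" by (intro cmp_intros cmp_oracle)
      ultimately show ?thesis by simp
    qed
    then have "{seq_of A} \<le>\<^sub>w bpaths V" unfolding weak_le_def seq_of_tle_iff[symmetric] by blast
    moreover have "bpaths V \<le>\<^sub>w {seq_of A}"
    proof -
      have ex: "\<exists>s. A n \<longrightarrow> g s n" for n using A by blast
      define f where "f n = (if A n then Suc (LEAST s. A n \<longrightarrow> g s n) else 0)" for n
      have "A n \<longrightarrow> g (LEAST s. A n \<longrightarrow> g s n) n" for n by (rule LeastI_ex[OF ex])
      then have "f \<in> bpaths V" unfolding paths by (auto simp: f_def)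
      moreover have "cmp (seq_of A) f" unfolding f_def[abs_def]
        by (intro cmp_intros cmp_comp[OF cmp_seq_of] cmp_app2[OF cmp0[OF g]] ex)
      ultimately show ?thesis unfolding weak_le_def cmp_nat_iff by blast
    qed
    ultimately show "bpaths V \<equiv>\<^sub>w {seq_of A}" unfolding weak_equiv_def by blast
  qed
qed

context universal
begin

lemma F_diff_no_least: "\<not> (\<exists>l. least E\<^sub>w l F_diff)"
proof
  assume "\<exists>l. least E\<^sub>w l F_diff"
  then obtain l where l: "l \<in> F_diff" "\<And>q. q \<in> F_diff \<Longrightarrow> wdeg_le l q" unfolding least_def le_E by blast
  then obtain P where P: "P \<noteq> {}" "Pi01 P" "l = wd P" "above_diff (seq_of ` P)" unfolding F_diff_iff by blast
  obtain S where tree: "dtree S" "P = paths S" using P(2) unfolding Pi01_iff_tree by blast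
  interpret sacks S
  proof
    show "dtree S" by (rule tree(1))
    fix X assume X: "X \<in> paths S"
    show "\<not> cmp (\<lambda>_. 0) X"
    proof
      assume "cmp (\<lambda>_. 0) X"
      \<comment> \<open>A computable member of \<open>P\<close> would be computed by every sequence,
        in particular by an incomplete random one.\<close>
      then have "seq_of X \<le>\<^sub>T seq_of Z" for Z unfolding seq_of_tle_iff by (rule cmp0)
      then show False using incomplete_MLR P(4) X unfolding above_diff_def tree(2) by blast
    qed
  qed
  obtain i where i: "\<forall>X\<in>MLR. seq_of (Aset i) \<le>\<^sub>T seq_of X \<longrightarrow> seq_of halting_problem \<le>\<^sub>T seq_of X"
    using ce_not_below_incomplete by blast
  obtain V where V: "cmp (\<lambda>_. 0) V" "V []" "\<And>\<tau> n. V \<tau> \<Longrightarrow> V (take n \<tau>)" "bpaths V \<equiv>\<^sub>w {seq_of (Aset i)}"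
  proof (rule ce_bpaths[of "As i" "Aset i"])
    show "cmp (\<lambda>_. 0) (\<lambda>p. As i (fst p) (snd p))" by (intro cmp_intros)
  qed (simp_all add: Aset_def)
  interpret embedding V S using V(1-3) tree(1) P(1)[unfolded tree(2)] by unfold_locales
  \<comment> \<open>The class \<open>emb\<close> has the degree of \<open>P\<close> with the single
    sequence \<open>Aset i\<close> adjoined, so it satisfies \<open>above_diff\<close> and yet lies
    below that sequence.\<close>
  have "bpaths V \<union> seq_of ` P \<le>\<^sub>w seq_of ` emb" using emb_equiv unfolding weak_equiv_def tree(2) by blast
  moreover have "{seq_of (Aset i)} \<union> seq_of ` P \<le>\<^sub>w bpaths V \<union> seq_of ` P"
    using V(4) unfolding weak_equiv_def weak_le_def using turing_le_refl by blast
  moreover have "above_diff ({seq_of (Aset i)} \<union> seq_of ` P)"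
    by (rule above_diff_Un[OF _ P(4)]) (use i in \<open>auto simp: above_diff_def\<close>)
  ultimately have "above_diff (seq_of ` emb)" using above_diff_mono weak_le_trans by blast
  then have "wd emb \<in> F_diff" unfolding F_diff_iff using emb_nonempty Pi01_emb by blast
  then have "seq_of ` P \<le>\<^sub>w seq_of ` emb" using l(2) unfolding P(3) wdeg_le_deg[symmetric] by blast
  moreover have "seq_of ` emb \<le>\<^sub>w bpaths V"
    using emb_equiv unfolding weak_equiv_def weak_le_def by blast
  moreover have "bpaths V \<le>\<^sub>w {seq_of (Aset i)}" using V(4) unfolding weak_equiv_def by blast
  ultimately have "seq_of ` P \<le>\<^sub>w {seq_of (Aset i)}" using weak_le_trans by blast
  then show False using Aset_not_above unfolding weak_le_def tree(2) by blast
qed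

section \<open>Infima of deep degrees\<close>

lemma F_pseudo_deg:
  assumes "p \<in> F_pseudo M"
  obtains \<Q> where "\<Q> \<subseteq> deep_classes" "p = deg\<^sub>w (\<Union>P\<in>\<Q>. seq_of ` P)"
proof -
  obtain C where C: "C \<subseteq> wd ` deep_classes" "p = \<Sqinter>\<^bsub>D\<^sub>w\<^esub> C"
    using assms unfolding F_pseudo_def F_deep_image by blast
  then obtain \<Q> where Q: "\<Q> \<subseteq> deep_classes" "C = wd ` \<Q>" by (meson subset_imageE)
  have "wd ` \<Q> = deg\<^sub>w ` ((\<lambda>P. seq_of ` P) ` \<Q>)" by (simp add: image_image)
  then have "p = deg\<^sub>w (\<Union>P\<in>\<Q>. seq_of ` P)" unfolding C(2) Q(2) by (simp only: inf_D)
  then show thesis using that Q(1) by blast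
qed

lemma F_pseudoI:
  assumes "p \<in> carrier E\<^sub>w" "\<Q> \<subseteq> deep_classes" "p = deg\<^sub>w (\<Union>P\<in>\<Q>. seq_of ` P)"
  shows "p \<in> F_pseudo M"
proof -
  have "\<Sqinter>\<^bsub>D\<^sub>w\<^esub> (wd ` \<Q>) = p"
    using inf_D[of "(\<lambda>P. seq_of ` P) ` \<Q>"] unfolding assms(3) by (simp add: image_image)
  moreover have "wd ` \<Q> \<subseteq> F_deep M" unfolding F_deep_image using assms(2) by blast
  ultimately show ?thesis unfolding F_pseudo_def using assms(1) by blast
qed

lemma F_pseudo_principal:
  obtains R where "R \<noteq> {}" "Pi01 R" "wd R \<in> F_pseudo M" "F_pseudo M = {q \<in> carrier E\<^sub>w. wdeg_le (wd R) q}"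
proof -
  let ?D = "\<Union>P\<in>deep_classes. seq_of ` P"
  obtain R where R: "R \<noteq> {}" "Pi01 R" "seq_of ` R \<equiv>\<^sub>w ?D" by (rule deep_infimum)
  have wdR: "wd R = deg\<^sub>w ?D" unfolding deg_eq_iff by (rule R)
  have RE: "wd R \<in> carrier E\<^sub>w" using R unfolding carrier_E_iff by blast
  have "q \<in> F_pseudo M \<longleftrightarrow> wdeg_le (wd R) q" if q: "q \<in> carrier E\<^sub>w" for q
  proof
    assume "q \<in> F_pseudo M"
    then obtain \<Q> where Q: "\<Q> \<subseteq> deep_classes" "q = deg\<^sub>w (\<Union>P\<in>\<Q>. seq_of ` P)" by (rule F_pseudo_deg)
    have "?D \<le>\<^sub>w (\<Union>P\<in>\<Q>. seq_of ` P)" unfolding weak_le_def using Q(1) turing_le_refl by blast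
    then show "wdeg_le (wd R) q" unfolding Q(2) wdR wdeg_le_deg .
  next
    assume le: "wdeg_le (wd R) q"
    obtain Q where Q: "Q \<noteq> {}" "Pi01 Q" "q = wd Q" using q unfolding carrier_E_iff by blast
    define \<Q> where "\<Q> = (\<lambda>P. wjoin P Q) ` deep_classes"
    have sub: "\<Q> \<subseteq> deep_classes"
    proof
      fix J assume "J \<in> \<Q>"
      then obtain P where P: "J = wjoin P Q" "P \<noteq> {}" "Pi01 P" "deep M P" unfolding \<Q>_def deep_classes_def by blast
      then have "J \<noteq> {}" using Q(1) seq_join_in_wjoin by (metis all_not_in_conv)
      then show "J \<in> deep_classes" unfolding deep_classes_def using P Pi01_wjoin Q(2) deep_wjoin by blast
    qed
    have "seq_of ` Q \<le>\<^sub>w (\<Union>P\<in>\<Q>. seq_of ` P)"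
      using wjoin_ge(2)[of Q] unfolding weak_le_def \<Q>_def by blast
    moreover have "(\<Union>P\<in>\<Q>. seq_of ` P) \<le>\<^sub>w seq_of ` Q"
      unfolding weak_le_def
    proof
      fix Z assume "Z \<in> seq_of ` Q"
      then obtain Y where Y: "Y \<in> Q" "Z = seq_of Y" by blast
      have "?D \<le>\<^sub>w seq_of ` Q" using le unfolding wdR Q(3) wdeg_le_deg .
      then obtain P X where X: "P \<in> deep_classes" "X \<in> P" "cmp (seq_of Y) X"
        using Y unfolding weak_le_def seq_of_tle_iff[symmetric] by blast
      \<comment> \<open>\<open>Y\<close> computes the member \<open>X\<close> of \<open>P\<close>
        and is itself a member of \<open>Q\<close>, so it computes a member of the join.\<close>
      have "seq_of ` P \<le>\<^sub>w seq_of ` {Y}" "seq_of ` Q \<le>\<^sub>w seq_of ` {Y}"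
        unfolding seq_of_image_le using X Y cmp_seq_of by blast+
      then have "seq_of ` wjoin P Q \<le>\<^sub>w seq_of ` {Y}" by (rule wjoin_le)
      then show "\<exists>X\<in>(\<Union>P\<in>\<Q>. seq_of ` P). X \<le>\<^sub>T Z" unfolding weak_le_def \<Q>_def using X(1) Y(2) by blast
    qed
    ultimately have "q = deg\<^sub>w (\<Union>P\<in>\<Q>. seq_of ` P)" unfolding Q(3) by (intro deg_antisym)
    then show "q \<in> F_pseudo M" using F_pseudoI[OF q sub] by blast
  qed
  then have "F_pseudo M = {q \<in> carrier E\<^sub>w. wdeg_le (wd R) q}" unfolding F_pseudo_def by blast
  moreover have "wd R \<in> F_pseudo M" using F_pseudoI[OF RE order_refl wdR] .
  ultimately show thesis using that R by blast
qed

lemma F_pseudo_filter: "principal_filter E\<^sub>w (F_pseudo M)"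
proof -
  obtain R where R: "R \<noteq> {}" "Pi01 R" "wd R \<in> F_pseudo M" "F_pseudo M = {q \<in> carrier E\<^sub>w. wdeg_le (wd R) q}"
    by (rule F_pseudo_principal)
  have "order_filter E\<^sub>w (F_pseudo M)"
    unfolding order_filter_def le_E
  proof (intro conjI ballI impI)
    show "F_pseudo M \<subseteq> carrier E\<^sub>w" by (auto simp: F_pseudo_def)
    show "F_pseudo M \<noteq> {}" using R(3) by blast
  next
    fix p q assume "p \<in> F_pseudo M" "q \<in> carrier E\<^sub>w" "wdeg_le p q"
    then show "q \<in> F_pseudo M" unfolding R(4) carrier_E_iff using wdeg_le_trans by blast
  next
    fix p q assume "p \<in> F_pseudo M" "q \<in> F_pseudo M"
    then obtain P Q where *: "P \<noteq> {}" "Pi01 P" "p = wd P" "wdeg_le (wd R) p" "Q \<noteq> {}" "Pi01 Q" "q = wd Q" "wdeg_le (wd R) q"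
      unfolding R(4) carrier_E_iff by blast
    then have "p \<sqinter>\<^bsub>E\<^sub>w\<^esub> q = wd (P \<union> Q)" by (simp add: meet_E)
    moreover have "wd (P \<union> Q) \<in> carrier E\<^sub>w" unfolding carrier_E_iff using * Pi01_Un by blast
    moreover have "wdeg_le (wd R) (wd (P \<union> Q))" using * by (intro wd_le_Un) simp_all
    ultimately show "p \<sqinter>\<^bsub>E\<^sub>w\<^esub> q \<in> F_pseudo M" unfolding R(4) by simp
  qed
  moreover have "least E\<^sub>w (wd R) (F_pseudo M)"
    unfolding least_def le_E using R(3,4) by (auto simp: F_pseudo_def)
  ultimately show ?thesis unfolding principal_filter_def by blast
qed

lemma F_deep_subset_F_pseudo: "F_deep M \<subseteq> F_pseudo M"
proof
  fix p assume p: "p \<in> F_deep M"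
  then obtain P where P: "P \<in> deep_classes" "p = wd P" unfolding F_deep_image by blast
  then show "p \<in> F_pseudo M" using p by (intro F_pseudoI[of _ "{P}"]) (auto simp: F_deep_def)
qed

lemma F_pseudo_subset_F_diff: "F_pseudo M \<subseteq> F_diff"
proof
  fix p assume p: "p \<in> F_pseudo M"
  then obtain \<Q> where Q: "\<Q> \<subseteq> deep_classes" "p = deg\<^sub>w (\<Union>P\<in>\<Q>. seq_of ` P)" by (rule F_pseudo_deg)
  have "above_diff (\<Union>P\<in>\<Q>. seq_of ` P)"
    unfolding above_diff_def using Q(1) deep_diff unfolding deep_classes_def by blast
  then show "p \<in> F_diff" using p unfolding Q(2) F_diff_deg F_pseudo_def by blast
qed

end

theorem mainTheorem10:
  fixes M :: "bool list \<Rightarrow> real"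
  assumes "universal_semimeasure M"
  shows "principal_filter E\<^sub>w (F_pseudo M) \<and>
    nonprincipal_filter E\<^sub>w (F_deep M) \<and>
    nonprincipal_filter E\<^sub>w F_diff \<and>
    F_deep M \<subset> F_pseudo M \<and> F_pseudo M \<subset> F_diff"
proof -
  interpret universal M using assms by unfold_locales
  have pseudo: "principal_filter E\<^sub>w (F_pseudo M)" by (rule F_pseudo_filter)
  have deep: "nonprincipal_filter E\<^sub>w (F_deep M)"
    unfolding nonprincipal_filter_def using F_deep_filter[OF F_deep_nonempty] F_deep_no_least by blast
  have "F_diff \<noteq> {}" using F_deep_nonempty F_deep_subset_F_pseudo F_pseudo_subset_F_diff by blast
  then have diff: "nonprincipal_filter E\<^sub>w F_diff"
    unfolding nonprincipal_filter_def using F_diff_filter F_diff_no_least by blast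
  \<comment> \<open>Of two neighbouring filters one has a least element and the other has none, so
    they differ.\<close>
  have "F_deep M \<noteq> F_pseudo M" "F_pseudo M \<noteq> F_diff"
    using pseudo deep diff unfolding principal_filter_def nonprincipal_filter_def by metis+
  then show ?thesis using pseudo deep diff F_deep_subset_F_pseudo F_pseudo_subset_F_diff by blast
qed

end
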